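(* The following counting problem is \textup{\#P}-complete: given a finite region $\Gamma\subset\mathbb{Z}^3$, compute the number of tilings of $\Gamma$ by slabs, i.e.\ by copies of the $2\times2\times1$ brick (rotations and reflections allowed). Moreover, this problem remains \textup{\#P}-complete when the input is restricted to contractible regions.
   Context: Identify $\mathbb{Z}^3$ with the set of closed unit cubes in $\mathbb{R}^3$ centered at integer lattice points. A region is a finite subset $\Gamma\subset\mathbb{Z}^3$, identified with $\overline\Gamma\subset\mathbb{R}^3$, the union of the corresponding closed unit cubes. $\Gamma$ is contractible if $\overline\Gamma$ is contractible and its interior is also contractible. A tiling of $\Gamma$ by a tile $T$ is a partition of $\Gamma$ into pairwise disjoint subsets, each an image of $T$ under an isometry of $\mathbb{Z}^3$. *)

theory Defs
  imports
    "HOL-Analysis.Analysis"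
    "HOL-Computational_Algebra.Polynomial"
    "HOL-Library.Disjoint_Sets"
begin

section \<open>Deterministic multi-tape oracle Turing machines\<close>

text \<open>
  States and tape symbols are natural numbers below the bounds given in the machine. Tapes are
  infinite in both directions. Tape 0 carries the input and, on halting, the output; tape 1 is the
  oracle tape; both words start at cell 0. The oracle is partial: it answers a query in one step,
  and a query on which it is undefined leaves the machine without a successor configuration, so
  that it never halts. An ordinary Turing machine is one run with the nowhere defined oracle.
\<close>

datatype move = MLeft | MStay | MRight

record machine =
  num_tapes :: nat
  num_states :: nat
  num_symbols :: nat
  trans :: "nat \<Rightarrow> nat list \<Rightarrow> nat \<times> (nat \<times> move) list"

type_synonym tape = "(int \<Rightarrow> nat) \<times> int"
type_synonym config = "nat \<times> tape list"
type_synonym oracle_map = "bool list \<Rightarrow> bool list option"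

abbreviation start_state :: nat where "start_state \<equiv> 0"
abbreviation halt_state :: nat where "halt_state \<equiv> 1"
abbreviation query_state :: nat where "query_state \<equiv> 2"
abbreviation answer_state :: nat where "answer_state \<equiv> 3"

abbreviation blank :: nat where "blank \<equiv> 0"

definition bit_symbol :: "bool \<Rightarrow> nat" where
  "bit_symbol b = (if b then 2 else 1)"

definition wf_machine :: "machine \<Rightarrow> bool" where
  "wf_machine M \<longleftrightarrow>
     2 \<le> num_tapes M \<and> 4 \<le> num_states M \<and> 3 \<le> num_symbols M \<and>
     (\<forall>q < num_states M. \<forall>ss. length ss = num_tapes M \<and> (\<forall>s\<in>set ss. s < num_symbols M) \<longrightarrow>
        fst (trans M q ss) < num_states M \<and>
        length (snd (trans M q ss)) = num_tapes M \<and>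
        (\<forall>a\<in>set (snd (trans M q ss)). fst a < num_symbols M))"

definition read_tape :: "tape \<Rightarrow> nat" where
  "read_tape T = fst T (snd T)"

fun move_offset :: "move \<Rightarrow> int" where
  "move_offset MLeft = -1"
| "move_offset MStay = 0"
| "move_offset MRight = 1"

definition act_tape :: "nat \<times> move \<Rightarrow> tape \<Rightarrow> tape" where
  "act_tape a T = ((fst T)(snd T := fst a), snd T + move_offset (snd a))"

definition word_tape :: "bool list \<Rightarrow> tape" where
  "word_tape w =
     ((\<lambda>i. if 0 \<le> i \<and> i < int (length w) then bit_symbol (w ! nat i) else blank), 0)"

definition tape_holds :: "tape \<Rightarrow> bool list \<Rightarrow> bool" where
  "tape_holds T w \<longleftrightarrow>
     (\<forall>i < length w. fst T (int i) = bit_symbol (w ! i)) \<and> fst T (int (length w)) = blank"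

definition init_config :: "machine \<Rightarrow> bool list \<Rightarrow> config" where
  "init_config M x = (start_state, word_tape x # replicate (num_tapes M - 1) (word_tape []))"

inductive step :: "machine \<Rightarrow> oracle_map \<Rightarrow> config \<Rightarrow> config \<Rightarrow> bool" for M Or where
  ordinary: "q \<noteq> halt_state \<Longrightarrow> q \<noteq> query_state \<Longrightarrow> trans M q (map read_tape ts) = (q', as) \<Longrightarrow>
     step M Or (q, ts) (q', map2 act_tape as ts)"
| oracle_call: "tape_holds (ts ! 1) w \<Longrightarrow> Or w = Some a \<Longrightarrow>
     step M Or (query_state, ts) (answer_state, ts[1 := word_tape a])"

definition computes_within ::
  "machine \<Rightarrow> oracle_map \<Rightarrow> bool list \<Rightarrow> bool list \<Rightarrow> nat \<Rightarrow> bool" where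
  "computes_within M Or x y t \<longleftrightarrow>
     (\<exists>n\<le>t. \<exists>ts. (step M Or ^^ n) (init_config M x) (halt_state, ts) \<and> tape_holds (ts ! 0) y)"

definition poly_time :: "oracle_map \<Rightarrow> (bool list \<Rightarrow> bool list) \<Rightarrow> bool" where
  "poly_time Or F \<longleftrightarrow>
     (\<exists>M (p :: nat poly). wf_machine M \<and>
        (\<forall>x. computes_within M Or x (F x) (poly p (length x))))"

lemma tape_holds_unique:
  assumes "tape_holds T v" "tape_holds T w"
  shows "v = w"
proof -
  have len: "length w \<le> length v" if "tape_holds T v" "tape_holds T w" for v w
  proof (rule ccontr)
    assume "\<not> length w \<le> length v"
    with that show False
      by (auto simp: tape_holds_def bit_symbol_def split: if_splits dest!: spec[of _ "length v"])
  qed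
  have "length v = length w"
    using len assms by (meson le_antisym)
  moreover have "v ! i = w ! i" if "i < length v" for i
    using assms that \<open>length v = length w\<close>
    by (auto simp: tape_holds_def bit_symbol_def split: if_splits dest!: spec[of _ i])
  ultimately show ?thesis
    by (simp add: list_eq_iff_nth_eq)
qed

lemma step_deterministic: "step M Or c d \<Longrightarrow> step M Or c d' \<Longrightarrow> d = d'"
  by (auto elim!: step.cases dest: tape_holds_unique)

section \<open>The class \#P and \#P-completeness\<close>

text \<open>Every bit of \<open>w\<close> is doubled and the pair 01 marks the end.\<close>

definition delimit :: "bool list \<Rightarrow> bool list" where
  "delimit w = concat (map (\<lambda>b. [b, b]) w) @ [False, True]"

definition pair_word :: "bool list \<Rightarrow> bool list \<Rightarrow> bool list" where
  "pair_word x y = delimit x @ y"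

text \<open>Binary representation, least significant bit first; \<open>0\<close> is the empty word.\<close>

fun binary :: "nat \<Rightarrow> bool list" where
  "binary n = (if n = 0 then [] else odd n # binary (n div 2))"

declare binary.simps [simp del]

definition sharp_P :: "(bool list \<Rightarrow> nat) set" where
  "sharp_P =
     {f. \<exists>(p :: nat poly) V. poly_time (\<lambda>_. None) (\<lambda>z. [V z]) \<and>
        (\<forall>x. f x = card {y. length y = poly p (length x) \<and> V (pair_word x y)})}"

text \<open>
  A counting problem consists of a set \<open>I\<close> of instances, an encoding \<open>e\<close> of instances as words,
  injective on \<open>I\<close>, and the number \<open>f a\<close> to be computed for each instance \<open>a\<close>. Words that encode
  no instance are not valid inputs: membership in \#P puts no condition on them, and the oracle for
  the problem is undefined on them, so a reduction may query genuine instances only.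
  Completeness is with respect to polynomial-time Turing reductions (Valiant).
\<close>

definition problem_oracle ::
  "'a set \<Rightarrow> ('a \<Rightarrow> bool list) \<Rightarrow> ('a \<Rightarrow> nat) \<Rightarrow> oracle_map" where
  "problem_oracle I e f w =
     (if w \<in> e ` I then Some (binary (f (inv_into I e w))) else None)"

definition sharp_P_member :: "'a set \<Rightarrow> ('a \<Rightarrow> bool list) \<Rightarrow> ('a \<Rightarrow> nat) \<Rightarrow> bool" where
  "sharp_P_member I e f \<longleftrightarrow> (\<exists>g\<in>sharp_P. \<forall>a\<in>I. g (e a) = f a)"

definition sharp_P_hard :: "'a set \<Rightarrow> ('a \<Rightarrow> bool list) \<Rightarrow> ('a \<Rightarrow> nat) \<Rightarrow> bool" where
  "sharp_P_hard I e f \<longleftrightarrow>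
     (\<forall>h\<in>sharp_P. poly_time (problem_oracle I e f) (\<lambda>x. binary (h x)))"

definition sharp_P_complete :: "'a set \<Rightarrow> ('a \<Rightarrow> bool list) \<Rightarrow> ('a \<Rightarrow> nat) \<Rightarrow> bool" where
  "sharp_P_complete I e f \<longleftrightarrow>
     inj_on e I \<and> sharp_P_member I e f \<and> sharp_P_hard I e f"

section \<open>Regions, tilings and slabs\<close>

definition lattice_point :: "int ^ 3 \<Rightarrow> real ^ 3" where
  "lattice_point c = (\<chi> i. of_int (c $ i))"

definition unit_cube :: "int ^ 3 \<Rightarrow> (real ^ 3) set" where
  "unit_cube c = {x. \<forall>i. \<bar>x $ i - lattice_point c $ i\<bar> \<le> 1 / 2}"

definition realization :: "(int ^ 3) set \<Rightarrow> (real ^ 3) set" where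
  "realization \<Gamma> = (\<Union>c\<in>\<Gamma>. unit_cube c)"

text \<open>The library predicate \<^const>\<open>contractible\<close> holds of the empty set, hence the first conjunct.\<close>

definition contractible_region :: "(int ^ 3) set \<Rightarrow> bool" where
  "contractible_region \<Gamma> \<longleftrightarrow>
     \<Gamma> \<noteq> {} \<and> contractible (realization \<Gamma>) \<and> contractible (interior (realization \<Gamma>))"

definition lattice_isometry :: "(int ^ 3 \<Rightarrow> int ^ 3) \<Rightarrow> bool" where
  "lattice_isometry \<phi> \<longleftrightarrow> bij \<phi> \<and>
     (\<forall>x y. dist (lattice_point (\<phi> x)) (lattice_point (\<phi> y)) =
            dist (lattice_point x) (lattice_point y))"

definition is_tiling :: "(int ^ 3) set \<Rightarrow> (int ^ 3) set \<Rightarrow> (int ^ 3) set set \<Rightarrow> bool" where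
  "is_tiling T \<Gamma> P \<longleftrightarrow>
     partition_on \<Gamma> P \<and> (\<forall>S\<in>P. \<exists>\<phi>. lattice_isometry \<phi> \<and> S = \<phi> ` T)"

definition num_tilings :: "(int ^ 3) set \<Rightarrow> (int ^ 3) set \<Rightarrow> nat" where
  "num_tilings T \<Gamma> = card {P. is_tiling T \<Gamma> P}"

definition slab :: "(int ^ 3) set" where
  "slab = {x. x $ 1 \<in> {0, 1} \<and> x $ 2 \<in> {0, 1} \<and> x $ 3 = 0}"

lemma finite_tilings: "finite \<Gamma> \<Longrightarrow> finite {P. is_tiling T \<Gamma> P}"
  by (rule finite_subset[of _ "Pow (Pow \<Gamma>)"]) (auto simp: is_tiling_def partition_on_def)

text \<open>
  A region is presented as a list of its cubes without repetition, each cube by its three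
  coordinates in sign-and-magnitude binary.
\<close>

definition encode_int :: "int \<Rightarrow> bool list" where
  "encode_int x = (x < 0) # binary (nat \<bar>x\<bar>)"

definition encode_cube :: "int ^ 3 \<Rightarrow> bool list" where
  "encode_cube c =
     delimit (encode_int (c $ 1)) @ delimit (encode_int (c $ 2)) @ delimit (encode_int (c $ 3))"

definition encode_region :: "(int ^ 3) list \<Rightarrow> bool list" where
  "encode_region cs = concat (map encode_cube cs)"

lemma delimit_append_inject: "delimit v @ x = delimit w @ y \<longleftrightarrow> v = w \<and> x = y"
proof (induction v arbitrary: w)
  case Nil
  then show ?case by (cases w) (auto simp: delimit_def)
next
  case (Cons b v)
  then show ?case by (cases w) (auto simp: delimit_def)
qed

lemma binary_inject: "binary m = binary n \<longleftrightarrow> m = n"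
proof
  show "binary m = binary n \<Longrightarrow> m = n"
  proof (induction m arbitrary: n rule: binary.induct)
    case (1 m)
    show ?case
    proof (cases "m = 0 \<or> n = 0")
      case True
      with "1.prems" show ?thesis
        by (auto simp: binary.simps[of m] binary.simps[of n] split: if_splits)
    next
      case False
      with "1.prems" have "odd m = odd n" "binary (m div 2) = binary (n div 2)"
        by (simp_all add: binary.simps[of m] binary.simps[of n])
      with "1.IH" False have "m div 2 = n div 2" "odd m = odd n" by auto
      then show ?thesis by presburger
    qed
  qed
qed simp

lemma encode_int_inject: "encode_int x = encode_int y \<longleftrightarrow> x = y"
  by (auto simp: encode_int_def binary_inject)

lemma encode_cube_append_inject: "encode_cube c @ x = encode_cube d @ y \<longleftrightarrow> c = d \<and> x = y"
  by (auto simp: encode_cube_def delimit_append_inject encode_int_inject vec_eq_iff forall_3)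

lemma inj_encode_region: "inj encode_region"
proof (rule injI)
  fix cs ds show "encode_region cs = encode_region ds \<Longrightarrow> cs = ds"
  proof (induction cs arbitrary: ds)
    case Nil
    then show ?case
      by (cases ds) (auto simp: encode_region_def encode_cube_def delimit_def)
  next
    case (Cons c cs)
    then show ?case
      by (cases ds)
        (auto simp: encode_region_def encode_cube_append_inject,
         auto simp: encode_cube_def delimit_def)
  qed
qed

end

theory Submission imports Defs begin

text \<open>
  Membership in \#P: a tiling is certified by the relation ``in the same tile'' on the cubes, which
  can be checked locally.

  Hardness: the runs of a verifier on certificates correspond bijectively to the solutions of a binary
  constraint problem whose variables are the local views of the run. The problem is laid out as a
  square grid of blocks on a plate of thickness one. Every pair of a variable and a value owns one row
  and one column of the grid, whose wire carries a bit. Buses along the four sides force exactly one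
  selected value per variable, and a filter block at a crossing excludes two conflicting selected
  values. The bits are the slabs straddling two blocks; all remaining slabs are determined by them, so
  that tilings correspond bijectively to solutions. The region is a height field over a square, hence
  contractible.
\<close>

text \<open>A wire is a wall one cell thick and two cells high on the plate. Slabs standing in it
  behave like dominoes in a strip, and the bit is the phase of this row of dominoes, which a strip
  of even length passes on. Plain crossings do not interact because one wire lies above the plate
  and the other below. The obstacle is a slab that leaves a block elsewhere. So bumps line two sides
  of every block; their tips force the slabs there, and these slabs cut the plate along the block
  boundaries, leaving only the walls to pass. Each block thereby becomes a finite problem, and the
  fifteen types of blocks are settled by evaluating a counting procedure that is itself proved
  correct. As the number of tilings equals the number of certificates, a single oracle query
  suffices. The other obstacle is to exhibit concrete machines: all programs come from expressions
  with bounded sums, compiled to machines whose tapes serve as unary counters; polynomial time then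
  holds by construction.\<close>

section \<open>Tilings by an arbitrary class of tiles\<close>

definition tilings :: "('a set \<Rightarrow> bool) \<Rightarrow> 'a set \<Rightarrow> 'a set set set" where
  "tilings R A = {P. partition_on A P \<and> (\<forall>S\<in>P. R S)}"

lemma tilingsI:
  assumes "\<Union>P = A" "\<And>S T. S \<in> P \<Longrightarrow> T \<in> P \<Longrightarrow> S \<noteq> T \<Longrightarrow> S \<inter> T = {}" "{} \<notin> P" "\<And>S. S \<in> P \<Longrightarrow> R S"
  shows "P \<in> tilings R A"
  using assms by (simp add: tilings_def partition_on_def disjoint_def)

lemma tilingsD:
  assumes "P \<in> tilings R A"
  shows "\<Union>P = A" "\<And>S T. S \<in> P \<Longrightarrow> T \<in> P \<Longrightarrow> S \<noteq> T \<Longrightarrow> S \<inter> T = {}" "{} \<notin> P" "\<And>S. S \<in> P \<Longrightarrow> R S"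
  using assms by (simp_all add: tilings_def partition_on_def disjoint_def)

lemma finite_tilings_set: "finite A \<Longrightarrow> finite (tilings R A)"
  by (rule finite_subset[of _ "Pow (Pow A)"]) (auto simp: tilings_def partition_on_def)

lemma partition_on_image_iff:
  assumes "inj f"
  shows "partition_on (f ` A) ((`) f ` P) \<longleftrightarrow> partition_on A P"
proof -
  have "\<Union> ((`) f ` P) = f ` \<Union> P" by auto
  then have "\<Union> ((`) f ` P) = f ` A \<longleftrightarrow> \<Union> P = A" using inj_image_eq_iff[OF assms] by simp
  moreover have "disjoint ((`) f ` P) \<longleftrightarrow> disjoint P"
    by (simp add: disjoint_def inj_image_eq_iff[OF assms] image_Int[OF assms, symmetric])
  moreover have "{} \<notin> (`) f ` P \<longleftrightarrow> {} \<notin> P" by auto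
  ultimately show ?thesis by (simp add: partition_on_def)
qed

lemma card_tilings_image:
  assumes f: "inj f" and R: "\<And>S. R' (f ` S) \<longleftrightarrow> R S"
  shows "card (tilings R' (f ` A)) = card (tilings R A)"
proof -
  have "inj ((`) f)" by (rule injI) (simp add: inj_image_eq_iff[OF f])
  then have inj: "inj ((`) ((`) f))" by (intro injI) (simp add: inj_image_eq_iff)
  have "tilings R' (f ` A) = (`) ((`) f) ` tilings R A"
  proof (intro set_eqI iffI)
    fix P assume P: "P \<in> tilings R' (f ` A)"
    define Q where "Q = {S. f ` S \<in> P}"
    have "S \<in> (`) f ` Q" if "S \<in> P" for S
    proof -
      have "S \<subseteq> f ` A" using P that by (auto simp: tilings_def partition_on_def)
      then obtain T where "S = f ` T" by (auto simp: subset_image_iff)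
      then show ?thesis using that by (auto simp: Q_def)
    qed
    then have PQ: "P = (`) f ` Q" by (auto simp: Q_def)
    then have "Q \<in> tilings R A"
      using P partition_on_image_iff[OF f] R by (auto simp: tilings_def)
    then show "P \<in> (`) ((`) f) ` tilings R A" using PQ by blast
  next
    fix P assume "P \<in> (`) ((`) f) ` tilings R A"
    then show "P \<in> tilings R' (f ` A)"
      using partition_on_image_iff[OF f] R by (auto simp: tilings_def)
  qed
  then show ?thesis using card_image[OF inj_on_subset[OF inj subset_UNIV]] by metis
qed

section \<open>Slabs as isometric copies of the brick\<close>

type_synonym cell = "int \<times> int \<times> int"

text \<open>\<open>k\<close> selects the plane of the slab (xy, xz or yz), and the given cell is the
  corner with the smallest coordinates.\<close>

fun slab_cells :: "nat \<Rightarrow> cell \<Rightarrow> cell list" where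
  "slab_cells k (x, y, z) =
    (if k = 0 then [(x, y, z), (x + 1, y, z), (x, y + 1, z), (x + 1, y + 1, z)]
     else if k = 1 then [(x, y, z), (x + 1, y, z), (x, y, z + 1), (x + 1, y, z + 1)]
     else [(x, y, z), (x, y + 1, z), (x, y, z + 1), (x, y + 1, z + 1)])"

definition is_slab :: "cell set \<Rightarrow> bool" where
  "is_slab S \<longleftrightarrow> (\<exists>k c. S = set (slab_cells k c))"

fun cube :: "cell \<Rightarrow> int ^ 3" where
  "cube (x, y, z) = vector [x, y, z]"

lemma cube_nth [simp]: "cube (x, y, z) $ 1 = x" "cube (x, y, z) $ 2 = y" "cube (x, y, z) $ 3 = z"
  by simp_all

lemma cube_surj: "cube (c $ 1, c $ 2, c $ 3) = c"
  by (simp add: vec_eq_iff forall_3)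

lemma cube_eq_iff: "cube p = cube q \<longleftrightarrow> p = q"
  by (cases p; cases q) (auto simp: vec_eq_iff forall_3)

lemma inj_cube: "inj cube"
  by (simp add: inj_def cube_eq_iff)

lemma cube_add: "cube (x, y, z) + cube (x', y', z') = cube (x + x', y + y', z + z')"
  by (simp add: vec_eq_iff forall_3)

lemma cube_0: "cube (0, 0, 0) = 0"
  by (simp add: vec_eq_iff forall_3)

text \<open>Squared distances keep the study of isometries inside the integers.\<close>

definition sqdist :: "int ^ 3 \<Rightarrow> int ^ 3 \<Rightarrow> int" where
  "sqdist p q = (p $ 1 - q $ 1)\<^sup>2 + (p $ 2 - q $ 2)\<^sup>2 + (p $ 3 - q $ 3)\<^sup>2"

lemma dist_lattice_point: "dist (lattice_point p) (lattice_point q) = sqrt (of_int (sqdist p q))"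
  by (simp add: dist_vec_def L2_set_def sum_3 lattice_point_def sqdist_def dist_real_def)

lemma lattice_isometry_iff:
  "lattice_isometry \<phi> \<longleftrightarrow> bij \<phi> \<and> (\<forall>p q. sqdist (\<phi> p) (\<phi> q) = sqdist p q)"
  by (simp add: lattice_isometry_def dist_lattice_point)

definition parallelogram :: "int ^ 3 \<Rightarrow> int ^ 3 \<Rightarrow> int ^ 3 \<Rightarrow> (int ^ 3) set" where
  "parallelogram p u v = {p, p + u, p + v, p + u + v}"

lemma parallelogram_swap: "parallelogram p u v = parallelogram p v u"
  by (auto simp: parallelogram_def add_ac)

lemma slab_parallelogram: "slab = parallelogram 0 (cube (1, 0, 0)) (cube (0, 1, 0))"
proof -
  have "c \<in> slab \<longleftrightarrow> c \<in> parallelogram 0 (cube (1, 0, 0)) (cube (0, 1, 0))" for c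
    by (auto simp: slab_def parallelogram_def vec_eq_iff forall_3)
  then show ?thesis by blast
qed

lemma cube_slab_cells: "cube ` set (slab_cells k c) = parallelogram (cube c)
    (if k \<in> {0, 1} then cube (1, 0, 0) else cube (0, 1, 0)) (if k = 0 then cube (0, 1, 0) else cube (0, 0, 1))"
  by (cases c) (auto simp: parallelogram_def cube_add simp del: cube.simps)

definition axes :: "(int ^ 3) set" where
  "axes = {cube (1, 0, 0), cube (0, 1, 0), cube (0, 0, 1)}"

lemma sum_squares_zero_int: "a\<^sup>2 + b\<^sup>2 + c\<^sup>2 = (0::int) \<Longrightarrow> a = 0 \<and> b = 0 \<and> c = 0"
  using zero_le_power2[of a] zero_le_power2[of b] zero_le_power2[of c]
  by (metis add_nonneg_eq_0_iff add_nonneg_nonneg zero_eq_power2)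

lemma unit_square_int: "a\<^sup>2 + b\<^sup>2 + c\<^sup>2 = (1::int) \<Longrightarrow>
   (\<bar>a\<bar> = 1 \<and> b = 0 \<and> c = 0) \<or> (a = 0 \<and> \<bar>b\<bar> = 1 \<and> c = 0) \<or> (a = 0 \<and> b = 0 \<and> \<bar>c\<bar> = 1)"
proof -
  assume e: "a\<^sup>2 + b\<^sup>2 + c\<^sup>2 = 1"
  have sq: "x = 0 \<or> \<bar>x\<bar> = 1" if "x\<^sup>2 \<le> 1" for x :: int
    using that abs_le_square_iff[of x 1] by auto
  have "a\<^sup>2 \<ge> 0" "b\<^sup>2 \<ge> 0" "c\<^sup>2 \<ge> 0" by auto
  with e have "a\<^sup>2 \<le> 1" "b\<^sup>2 \<le> 1" "c\<^sup>2 \<le> 1" by linarith+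
  then have "a = 0 \<or> \<bar>a\<bar> = 1" "b = 0 \<or> \<bar>b\<bar> = 1" "c = 0 \<or> \<bar>c\<bar> = 1" by (simp_all only: sq)
  then show ?thesis using e by (elim disjE) (auto simp: abs_if split: if_splits)
qed

lemma unit_vector_axes:
  assumes "(u $ 1)\<^sup>2 + (u $ 2)\<^sup>2 + (u $ 3)\<^sup>2 = (1::int)"
  shows "u \<in> axes \<or> - u \<in> axes"
  using unit_square_int[OF assms] by (auto simp: axes_def vec_eq_iff forall_3 abs_if split: if_splits)

lemma parallelogram_axes:
  assumes "u \<in> axes" "v \<in> axes" "u \<noteq> v"
  shows "\<exists>S. is_slab S \<and> parallelogram p u v = cube ` S"
proof -
  obtain c where c: "p = cube c" by (metis cube_surj)
  have "is_slab (set (slab_cells k c))" for k unfolding is_slab_def by blast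
  moreover have f: "parallelogram p (cube (1, 0, 0)) (cube (0, 1, 0)) = cube ` set (slab_cells 0 c)"
    "parallelogram p (cube (1, 0, 0)) (cube (0, 0, 1)) = cube ` set (slab_cells 1 c)"
    "parallelogram p (cube (0, 1, 0)) (cube (0, 0, 1)) = cube ` set (slab_cells 2 c)"
    unfolding cube_slab_cells c by simp_all
  moreover have "\<exists>k. parallelogram p u v = cube ` set (slab_cells k c)"
  proof -
    have "\<exists>k. parallelogram p (cube (1, 0, 0)) (cube (0, 1, 0)) = cube ` set (slab_cells k c)"
      "\<exists>k. parallelogram p (cube (1, 0, 0)) (cube (0, 0, 1)) = cube ` set (slab_cells k c)"
      "\<exists>k. parallelogram p (cube (0, 1, 0)) (cube (0, 0, 1)) = cube ` set (slab_cells k c)"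
      using f by blast+
    note g = this this[unfolded parallelogram_swap[of p "cube (1, 0, 0)"] parallelogram_swap[of p "cube (0, 1, 0)" "cube (0, 0, 1)"]]
    have "\<forall>u\<in>axes. \<forall>v\<in>axes. u \<noteq> v \<longrightarrow> (\<exists>k. parallelogram p u v = cube ` set (slab_cells k c))"
      unfolding axes_def by (simp only: ball_simps insert_iff g simp_thms)
    then show ?thesis using assms by blast
  qed
  ultimately show ?thesis by blast
qed

text \<open>The six distances between the corners survive the isometry. They make the two image
  edges orthogonal unit vectors and the image of the fourth corner their sum. An integer unit vector
  is an axis up to sign, and signs disappear when another corner is taken as base point.\<close>

lemma isometric_slab:
  "(\<exists>\<phi>. lattice_isometry \<phi> \<and> T = \<phi> ` slab) \<longleftrightarrow> (\<exists>S. is_slab S \<and> T = cube ` S)"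
proof
  assume "\<exists>\<phi>. lattice_isometry \<phi> \<and> T = \<phi> ` slab"
  then obtain \<phi> where \<phi>: "\<And>p q. sqdist (\<phi> p) (\<phi> q) = sqdist p q" and T: "T = \<phi> ` slab"
    by (auto simp: lattice_isometry_iff)
  define p u v w where "p = \<phi> 0" and "u = \<phi> (cube (1, 0, 0)) - p" and "v = \<phi> (cube (0, 1, 0)) - p"
    and "w = \<phi> (cube (1, 1, 0)) - p"
  have nu: "(u $ 1)\<^sup>2 + (u $ 2)\<^sup>2 + (u $ 3)\<^sup>2 = 1"
    using \<phi>[of "cube (1, 0, 0)" 0] by (simp add: sqdist_def u_def p_def)
  have nv: "(v $ 1)\<^sup>2 + (v $ 2)\<^sup>2 + (v $ 3)\<^sup>2 = 1"
    using \<phi>[of "cube (0, 1, 0)" 0] by (simp add: sqdist_def v_def p_def)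
  have nw: "(w $ 1)\<^sup>2 + (w $ 2)\<^sup>2 + (w $ 3)\<^sup>2 = 2"
    using \<phi>[of "cube (1, 1, 0)" 0] by (simp add: sqdist_def w_def p_def)
  have uv: "(u $ 1 - v $ 1)\<^sup>2 + (u $ 2 - v $ 2)\<^sup>2 + (u $ 3 - v $ 3)\<^sup>2 = 2"
    using \<phi>[of "cube (1, 0, 0)" "cube (0, 1, 0)"] by (simp add: sqdist_def u_def v_def p_def)
  have wu: "(w $ 1 - u $ 1)\<^sup>2 + (w $ 2 - u $ 2)\<^sup>2 + (w $ 3 - u $ 3)\<^sup>2 = 1"
    using \<phi>[of "cube (1, 1, 0)" "cube (1, 0, 0)"] by (simp add: sqdist_def u_def w_def p_def)
  have wv: "(w $ 1 - v $ 1)\<^sup>2 + (w $ 2 - v $ 2)\<^sup>2 + (w $ 3 - v $ 3)\<^sup>2 = 1"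
    using \<phi>[of "cube (1, 1, 0)" "cube (0, 1, 0)"] by (simp add: sqdist_def v_def w_def p_def)
  \<comment> \<open>Expanding the square of \<open>w - u - v\<close> leaves squared lengths and
    inner products, all of which are determined by the six distances.\<close>
  have "(w $ 1 - u $ 1 - v $ 1)\<^sup>2 + (w $ 2 - u $ 2 - v $ 2)\<^sup>2 + (w $ 3 - u $ 3 - v $ 3)\<^sup>2 = 0"
    using nu nv nw uv wu wv by (simp add: power2_eq_square algebra_simps)
  then have "w $ 1 - u $ 1 - v $ 1 = 0 \<and> w $ 2 - u $ 2 - v $ 2 = 0 \<and> w $ 3 - u $ 3 - v $ 3 = 0"
    by (rule sum_squares_zero_int)
  then have w: "w = u + v" by (simp add: vec_eq_iff forall_3)
  have pts: "\<phi> 0 = p" "\<phi> (cube (1, 0, 0)) = p + u" "\<phi> (cube (0, 1, 0)) = p + v" "\<phi> (cube (1, 1, 0)) = p + u + v"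
    using w by (simp_all add: u_def v_def w_def p_def algebra_simps del: cube.simps)
  have "T = parallelogram p u v"
    unfolding T slab_parallelogram parallelogram_def
    using pts by (simp add: cube_add del: cube.simps)
  moreover have "u \<noteq> v" "u \<noteq> - v" using uv nu nv by (auto simp: power2_eq_square)
  moreover note unit_vector_axes[OF nu] unit_vector_axes[OF nv]
  moreover have "parallelogram p u v = parallelogram (p + u) (- u) v"
    "parallelogram p u v = parallelogram (p + v) u (- v)"
    "parallelogram p u v = parallelogram (p + u + v) (- u) (- v)"
    by (auto simp: parallelogram_def algebra_simps)
  ultimately show "\<exists>S. is_slab S \<and> T = cube ` S"
    using parallelogram_axes[of u v p] parallelogram_axes[of "- u" v "p + u"]
      parallelogram_axes[of u "- v" "p + v"] parallelogram_axes[of "- u" "- v" "p + u + v"]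
    by (metis minus_minus)
next
  assume "\<exists>S. is_slab S \<and> T = cube ` S"
  then obtain k c where T: "T = cube ` set (slab_cells k c)" unfolding is_slab_def by blast
  \<comment> \<open>A permutation of the coordinates, which turns the brick into the required plane,
    followed by a translation.\<close>
  define \<phi> :: "int ^ 3 \<Rightarrow> int ^ 3" where "\<phi> = (\<lambda>p. cube c +
     (if k = 0 then p else if k = 1 then cube (p $ 1, p $ 3, p $ 2) else cube (p $ 3, p $ 1, p $ 2)))"
  have "\<phi> ` slab = T"
    unfolding T cube_slab_cells slab_parallelogram parallelogram_def \<phi>_def
    by (simp add: cube_add cube_0 add.assoc del: cube.simps)
  moreover have "bij \<phi>"
  proof (rule o_bij)
    define \<psi> :: "int ^ 3 \<Rightarrow> int ^ 3" where "\<psi> = (\<lambda>q. let r = q - cube c in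
       if k = 0 then r else if k = 1 then cube (r $ 1, r $ 3, r $ 2) else cube (r $ 2, r $ 3, r $ 1))"
    show "\<psi> \<circ> \<phi> = id" "\<phi> \<circ> \<psi> = id"
      by (auto simp: \<psi>_def \<phi>_def fun_eq_iff vec_eq_iff forall_3 Let_def)
  qed
  moreover have "sqdist (\<phi> p) (\<phi> q) = sqdist p q" for p q
    by (auto simp: sqdist_def \<phi>_def)
  ultimately show "\<exists>\<phi>. lattice_isometry \<phi> \<and> T = \<phi> ` slab" by (auto simp: lattice_isometry_iff)
qed

lemma num_tilings_cube: "num_tilings slab (cube ` A) = card (tilings is_slab A)"
proof -
  have "{P. is_tiling slab (cube ` A) P} = tilings (\<lambda>T. \<exists>\<phi>. lattice_isometry \<phi> \<and> T = \<phi> ` slab) (cube ` A)"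
    by (simp add: is_tiling_def tilings_def)
  moreover have "(\<exists>\<phi>. lattice_isometry \<phi> \<and> cube ` S = \<phi> ` slab) \<longleftrightarrow> is_slab S" for S
    unfolding isometric_slab inj_image_eq_iff[OF inj_cube] by blast
  ultimately show ?thesis
    unfolding num_tilings_def using card_tilings_image[OF inj_cube] by simp
qed

lemma is_slab_translate: "is_slab ((\<lambda>(x, y, z). (x + a, y + b, z)) ` S) \<longleftrightarrow> is_slab S"
proof -
  have *: "is_slab ((\<lambda>(x, y, z). (x + a, y + b, z)) ` S)" if "is_slab S" for S a b
  proof -
    obtain k x y z where "S = set (slab_cells k (x, y, z))" using \<open>is_slab S\<close> unfolding is_slab_def by (metis prod_cases3)
    then have "(\<lambda>(x, y, z). (x + a, y + b, z)) ` S = set (slab_cells k (x + a, y + b, z))"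
      by (simp add: add.commute add.left_commute)
    then show ?thesis unfolding is_slab_def by blast
  qed
  have "(\<lambda>(x, y, z). (x + - a, y + - b, z)) ` (\<lambda>(x, y, z). (x + a, y + b, z)) ` S = S"
    by (simp add: image_image case_prod_beta)
  then show ?thesis using *[of S a b] *[of "(\<lambda>(x, y, z). (x + a, y + b, z)) ` S" "- a" "- b"] by metis
qed

section \<open>Decomposing a count of tilings\<close>

text \<open>Exactly one tile of a tiling contains \<open>c\<close>; removing it leaves a tiling of
  the rest. This is the branching rule of the counting procedure below.\<close>

lemma tilings_insert:
  assumes "finite A" "c \<in> A"
  shows "card (tilings R A) = (\<Sum>S | R S \<and> S \<subseteq> A \<and> c \<in> S. card (tilings R (A - S)))"
proof -
  let ?F = "{S. R S \<and> S \<subseteq> A \<and> c \<in> S}"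
  have fin: "finite ?F" by (rule finite_subset[of _ "Pow A"]) (use assms in auto)
  have "tilings R A = (\<Union>S\<in>?F. insert S ` tilings R (A - S))"
  proof (intro set_eqI iffI)
    fix P assume P: "P \<in> tilings R A"
    then obtain S where S: "S \<in> P" "c \<in> S" using assms by (auto simp: tilings_def partition_on_def)
    have d: "T \<inter> S = {}" if "T \<in> P" "T \<noteq> S" for T
      using P S that by (auto simp: tilings_def partition_on_def disjoint_def)
    have "P - {S} \<in> tilings R (A - S)"
    proof (rule tilingsI)
      show "\<Union>(P - {S}) = A - S" using tilingsD(1)[OF P] d S by blast
      show "T \<inter> T' = {}" if "T \<in> P - {S}" "T' \<in> P - {S}" "T \<noteq> T'" for T T'
        using tilingsD(2)[OF P] that by simp
      show "{} \<notin> P - {S}" "\<And>T. T \<in> P - {S} \<Longrightarrow> R T" using tilingsD(3,4)[OF P] by simp_all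
    qed
    moreover have "P = insert S (P - {S})" using S by blast
    moreover have "S \<in> ?F" using P S by (auto simp: tilings_def partition_on_def)
    ultimately show "P \<in> (\<Union>S\<in>?F. insert S ` tilings R (A - S))" by blast
  next
    fix P assume "P \<in> (\<Union>S\<in>?F. insert S ` tilings R (A - S))"
    then obtain S Q where S: "S \<in> ?F" "Q \<in> tilings R (A - S)" "P = insert S Q" by blast
    then have "T \<inter> S = {}" if "T \<in> Q" for T using that by (auto simp: tilings_def partition_on_def)
    note d = this
    show "P \<in> tilings R A"
    proof (rule tilingsI)
      show "\<Union>P = A" using S tilingsD(1)[OF S(2)] by auto
      show "{} \<notin> P" using S tilingsD(3)[OF S(2)] by auto
      show "R T" if "T \<in> P" for T using S that tilingsD(4)[OF S(2)] by auto
      show "T \<inter> T' = {}" if TT: "T \<in> P" "T' \<in> P" "T \<noteq> T'" for T T'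
      proof -
        consider "T = S" "T' \<in> Q" | "T' = S" "T \<in> Q" | "T \<in> Q" "T' \<in> Q" using TT S(3) by blast
        then show ?thesis
        proof cases
          case 1 then show ?thesis using d[of T'] by blast
        next
          case 2 then show ?thesis using d[of T] by blast
        next
          case 3 then show ?thesis by (rule tilingsD(2)[OF S(2) _ _ TT(3)])
        qed
      qed
    qed
  qed
  moreover have "inj_on (insert S) (tilings R (A - S))" if "S \<in> ?F" for S
  proof (rule inj_onI)
    fix Q Q' assume Q: "Q \<in> tilings R (A - S)" "Q' \<in> tilings R (A - S)" "insert S Q = insert S Q'"
    have "\<not> S \<subseteq> A - S" using that by blast
    then have "S \<notin> Q" "S \<notin> Q'" using tilingsD(1)[OF Q(1)] tilingsD(1)[OF Q(2)] by blast+
    then show "Q = Q'" using Q(3) by (metis insert_ident)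
  qed
  moreover have "insert S ` tilings R (A - S) \<inter> insert T ` tilings R (A - T) = {}"
    if "S \<in> ?F" "T \<in> ?F" "S \<noteq> T" for S T
  proof (rule ccontr)
    assume "insert S ` tilings R (A - S) \<inter> insert T ` tilings R (A - T) \<noteq> {}"
    then obtain Q Q' where Q: "Q \<in> tilings R (A - S)" "insert S Q = insert T Q'" by blast
    then have "T \<in> Q" using that(3) by blast
    then have "T \<subseteq> A - S" using Q by (auto simp: tilings_def partition_on_def)
    then show False using that by blast
  qed
  ultimately show ?thesis
    using fin finite_tilings_set[of "A - _" R] assms(1)
    by (simp add: card_UN_disjoint card_image)
qed

text \<open>A slab is forced as soon as one of its cells lies in no other slab of the region.\<close>

lemma card_tilings_forced:
  assumes F: "\<And>S. S \<in> F \<Longrightarrow> \<exists>c\<in>S. c \<in> A \<and> (\<forall>T. R T \<longrightarrow> T \<subseteq> A \<longrightarrow> c \<in> T \<longrightarrow> T = S)"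
    and RF: "\<And>S. S \<in> F \<Longrightarrow> R S \<and> S \<subseteq> A" and dis: "disjoint F"
  shows "card (tilings R A) = card (tilings R (A - \<Union>F))"
proof -
  have ne: "{} \<notin> F" using F by blast
  \<comment> \<open>Every tiling contains \<open>F\<close>, because the tile at the distinguished
    cell of a member of \<open>F\<close> has no alternative. Hence deleting \<open>F\<close> and
    adding it are inverse to each other.\<close>
  have "bij_betw (\<lambda>P. P - F) (tilings R A) (tilings R (A - \<Union>F))"
  proof (rule bij_betw_byWitness[where f' = "\<lambda>Q. Q \<union> F"])
    have sub: "F \<subseteq> P" if P: "P \<in> tilings R A" for P
    proof
      fix S assume "S \<in> F"
      then obtain c where c: "c \<in> S" "c \<in> A" "\<And>T. R T \<Longrightarrow> T \<subseteq> A \<Longrightarrow> c \<in> T \<Longrightarrow> T = S" using F by metis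
      then obtain T where "T \<in> P" "c \<in> T" using tilingsD(1)[OF P] by blast
      moreover have "R T" "T \<subseteq> A" using P \<open>T \<in> P\<close> by (auto simp: tilings_def partition_on_def)
      ultimately show "S \<in> P" using c(3) by metis
    qed
    then show "\<forall>P\<in>tilings R A. P - F \<union> F = P" by blast
    have notin: "S \<notin> F" if "Q \<in> tilings R (A - \<Union>F)" "S \<in> Q" for Q S
    proof
      assume "S \<in> F"
      moreover have "S \<subseteq> A - \<Union>F" "S \<noteq> {}" using that by (auto simp: tilings_def partition_on_def)
      ultimately show False by blast
    qed
    then show "\<forall>Q\<in>tilings R (A - \<Union>F). Q \<union> F - F = Q" by blast
    show "(\<lambda>P. P - F) ` tilings R A \<subseteq> tilings R (A - \<Union>F)"
    proof (rule image_subsetI)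
      fix P assume P: "P \<in> tilings R A"
      have d: "S \<inter> T = {}" if "S \<in> P" "S \<notin> F" "T \<in> F" for S T
      proof -
        have "T \<in> P" "S \<noteq> T" using sub[OF P] that by blast+
        then show ?thesis using P that unfolding tilings_def partition_on_def disjoint_def by blast
      qed
      have "\<Union> (P - F) = A - \<Union>F"
        using tilingsD(1)[OF P] d by blast
      then show "P - F \<in> tilings R (A - \<Union>F)"
        by (rule tilingsI) (use tilingsD(2-4)[OF P] in simp_all)
    qed
    show "(\<lambda>Q. Q \<union> F) ` tilings R (A - \<Union>F) \<subseteq> tilings R A"
    proof (rule image_subsetI)
      fix Q assume Q: "Q \<in> tilings R (A - \<Union>F)"
      have U: "\<Union> (Q \<union> F) = A" using Q RF by (auto simp: tilings_def partition_on_def)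
      have d: "S \<inter> T = {}" if "S \<in> Q" "T \<in> F" for S T
        using that Q by (auto simp: tilings_def partition_on_def)
      have "S \<inter> T = {}" if "S \<in> Q \<union> F" "T \<in> Q \<union> F" "S \<noteq> T" for S T
        using that d[of S T] d[of T S] tilingsD(2)[OF Q, of S T] disjointD[OF dis, of S T] by auto
      then have "disjoint (Q \<union> F)" by (simp add: disjoint_def)
      moreover have "{} \<notin> Q \<union> F" "\<forall>S\<in>Q \<union> F. R S" using Q RF ne by (auto simp: tilings_def partition_on_def)
      ultimately show "Q \<union> F \<in> tilings R A" using U by (simp add: tilings_def partition_on_def)
    qed
  qed
  then show ?thesis by (rule bij_betw_same_card)
qed

text \<open>The pieces \<open>B k\<close> of the region interact only through the slabs in \<open>X\<close>; when each piece has at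
  most one tiling after removal of the chosen slabs, a tiling is determined by its trace on \<open>X\<close>.\<close>

lemma card_tilings_pieces:
  assumes A: "A = (\<Union>k\<in>K. B k)" and dB: "\<And>k l. k \<in> K \<Longrightarrow> l \<in> K \<Longrightarrow> k \<noteq> l \<Longrightarrow> B k \<inter> B l = {}"
    and X: "\<And>S. R S \<Longrightarrow> S \<subseteq> A \<Longrightarrow> S \<in> X \<or> (\<exists>k\<in>K. S \<subseteq> B k)"
    and XR: "\<And>S. S \<in> X \<Longrightarrow> R S" and notin: "\<And>S k. S \<in> X \<Longrightarrow> k \<in> K \<Longrightarrow> \<not> S \<subseteq> B k"
    and dX: "disjoint X" and R0: "\<not> R {}"
    and uniq: "\<And>Y k P Q. Y \<subseteq> X \<Longrightarrow> \<Union>Y \<subseteq> A \<Longrightarrow> k \<in> K \<Longrightarrow>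
       P \<in> tilings R (B k - \<Union>Y) \<Longrightarrow> Q \<in> tilings R (B k - \<Union>Y) \<Longrightarrow> P = Q"
  shows "card (tilings R A) = card {Y. Y \<subseteq> X \<and> \<Union>Y \<subseteq> A \<and> (\<forall>k\<in>K. tilings R (B k - \<Union>Y) \<noteq> {})}"
proof -
  \<comment> \<open>A tile outside \<open>X\<close> lies in a single piece. So the tiles inside
    \<open>B k\<close> cover exactly what the chosen members of \<open>X\<close> leave of
    it.\<close>
  have piece: "{S\<in>P. S \<subseteq> B k} \<in> tilings R (B k - \<Union>(P \<inter> X))" if P: "P \<in> tilings R A" and k: "k \<in> K" for P k
  proof -
    have dP: "S \<inter> T = {}" if "S \<in> P" "T \<in> P" "S \<noteq> T" for S T
      using P that unfolding tilings_def partition_on_def disjoint_def by blast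
    have "\<Union>{S\<in>P. S \<subseteq> B k} = B k - \<Union>(P \<inter> X)"
    proof (intro equalityI subsetI)
      fix c assume "c \<in> \<Union>{S\<in>P. S \<subseteq> B k}"
      then obtain S where S: "S \<in> P" "S \<subseteq> B k" "c \<in> S" by blast
      then have "S \<notin> X" using notin k by blast
      then have "c \<notin> T" if "T \<in> P \<inter> X" for T using dP[of S T] S that by blast
      then show "c \<in> B k - \<Union>(P \<inter> X)" using S by blast
    next
      fix c assume c: "c \<in> B k - \<Union>(P \<inter> X)"
      then have "c \<in> A" using A k by blast
      then obtain S where S: "S \<in> P" "c \<in> S" using P by (auto simp: tilings_def partition_on_def)
      moreover have "R S" "S \<subseteq> A" using P S by (auto simp: tilings_def partition_on_def)
      ultimately obtain l where "l \<in> K" "S \<subseteq> B l" using X c by blast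
      then have "l = k" using dB k S c by blast
      then show "c \<in> \<Union>{S\<in>P. S \<subseteq> B k}" using S \<open>S \<subseteq> B l\<close> by blast
    qed
    then show ?thesis by (rule tilingsI) (use tilingsD(2-4)[OF P] in simp_all)
  qed
  have split: "P = (P \<inter> X) \<union> (\<Union>k\<in>K. {S\<in>P. S \<subseteq> B k})" if P: "P \<in> tilings R A" for P
    using P X by (auto simp: tilings_def partition_on_def)
  let ?G = "{Y. Y \<subseteq> X \<and> \<Union>Y \<subseteq> A \<and> (\<forall>k\<in>K. tilings R (B k - \<Union>Y) \<noteq> {})}"
  have "bij_betw (\<lambda>P. P \<inter> X) (tilings R A) ?G"
  proof (rule bij_betwI')
    fix P Q assume PQ: "P \<in> tilings R A" "Q \<in> tilings R A"
    show "P \<inter> X = Q \<inter> X \<longleftrightarrow> P = Q"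
    proof
      assume e: "P \<inter> X = Q \<inter> X"
      have sub: "P \<inter> X \<subseteq> X" "\<Union>(P \<inter> X) \<subseteq> A" using PQ by (auto simp: tilings_def partition_on_def)
      have "{S\<in>P. S \<subseteq> B k} = {S\<in>Q. S \<subseteq> B k}" if "k \<in> K" for k
        using uniq[OF sub that] piece[OF PQ(1) that] piece[OF PQ(2) that] e by metis
      then have "(P \<inter> X) \<union> (\<Union>k\<in>K. {S\<in>P. S \<subseteq> B k}) = (Q \<inter> X) \<union> (\<Union>k\<in>K. {S\<in>Q. S \<subseteq> B k})"
        using e by simp
      then show "P = Q" using split[OF PQ(1)] split[OF PQ(2)] by simp
    qed simp
  next
    fix P assume P: "P \<in> tilings R A"
    have "tilings R (B k - \<Union>(P \<inter> X)) \<noteq> {}" if "k \<in> K" for k using piece[OF P that] by blast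
    moreover have "\<Union>(P \<inter> X) \<subseteq> A" using P by (auto simp: tilings_def partition_on_def)
    ultimately show "P \<inter> X \<in> ?G" by blast
  next
    fix Y assume Y: "Y \<in> ?G"
    then have "\<forall>k\<in>K. \<exists>Q. Q \<in> tilings R (B k - \<Union>Y)" by (simp add: ex_in_conv)
    then obtain Q where Q: "\<And>k. k \<in> K \<Longrightarrow> Q k \<in> tilings R (B k - \<Union>Y)" by metis
    \<comment> \<open>The converse direction glues one tiling of each remainder to the chosen
      slabs.\<close>
    define P where "P = Y \<union> (\<Union>k\<in>K. Q k)"
    have Qs: "S \<subseteq> B k - \<Union>Y" "R S" "S \<noteq> {}" if "k \<in> K" "S \<in> Q k" for k S
      using Q[OF that(1)] that(2) by (auto simp: tilings_def partition_on_def)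
    have Qd: "S \<inter> T = {}" if "k \<in> K" "S \<in> Q k" "T \<in> Q k" "S \<noteq> T" for k S T
      using Q[OF that(1)] that unfolding tilings_def partition_on_def disjoint_def by blast
    have QU: "\<Union>(Q k) = B k - \<Union>Y" if "k \<in> K" for k
      using Q[OF that] by (auto simp: tilings_def partition_on_def)
    have "\<Union>P = \<Union>Y \<union> (\<Union>k\<in>K. B k - \<Union>Y)" 
    proof -
      have "\<Union>(\<Union>k\<in>K. Q k) = (\<Union>k\<in>K. \<Union>(Q k))" by blast
      also have "\<dots> = (\<Union>k\<in>K. B k - \<Union>Y)" using QU by simp
      finally show ?thesis unfolding P_def by (simp only: Union_Un_distrib)
    qed
    also have "\<dots> = A" using Y unfolding A by blast
    finally have "\<Union>P = A" .
    moreover have "S \<inter> T = {}" if ST: "S \<in> P" "T \<in> P" "S \<noteq> T" for S T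
    proof -
      consider "S \<in> Y" "T \<in> Y" | k where "k \<in> K" "S \<in> Q k" "T \<in> Y" | k where "k \<in> K" "T \<in> Q k" "S \<in> Y"
        | k l where "k \<in> K" "l \<in> K" "S \<in> Q k" "T \<in> Q l" using ST(1,2) unfolding P_def by blast
      then show ?thesis
      proof cases
        case 1
        then show ?thesis using Y dX ST(3) unfolding disjoint_def by blast
      next
        case (2 k)
        then show ?thesis using Qs(1)[of k S] by blast
      next
        case (3 k)
        then show ?thesis using Qs(1)[of k T] by blast
      next
        case (4 k l)
        show ?thesis
        proof (cases "k = l")
          case True
          then show ?thesis using Qd[OF 4(1,3) _ ST(3)] 4(4) by simp
        next
          case False
          then show ?thesis using Qs(1)[OF 4(1,3)] Qs(1)[OF 4(2,4)] dB[OF 4(1,2)] by blast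
        qed
      qed
    qed
    moreover have RP: "R S" if SP: "S \<in> P" for S
    proof (cases "S \<in> Y")
      case True
      then show ?thesis using Y XR by blast
    next
      case False
      then obtain k where "k \<in> K" "S \<in> Q k" using SP unfolding P_def by blast
      then show ?thesis by (rule Qs(2))
    qed
    moreover have "{} \<notin> P" using RP R0 by blast
    ultimately have "P \<in> tilings R A" by (simp add: tilings_def partition_on_def disjoint_def)
    moreover have "P \<inter> X = Y"
    proof -
      have "S \<notin> X" if "k \<in> K" "S \<in> Q k" for k S using Qs(1)[OF that] notin[OF _ that(1)] by blast
      then have "(\<Union>k\<in>K. Q k) \<inter> X = {}" by blast
      moreover have "Y \<subseteq> X" using Y by blast
      ultimately show ?thesis unfolding P_def Int_Un_distrib2 by (simp add: Int_absorb2)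
    qed
    ultimately show "\<exists>P\<in>tilings R A. Y = P \<inter> X" by blast
  qed
  then show ?thesis by (rule bij_betw_same_card)
qed

section \<open>A verified procedure that counts slab tilings\<close>

text \<open>The list is meant to be sorted, so the search ends at the first larger entry;
  \<open>None\<close> reports a missing cell.\<close>

fun rm :: "int \<Rightarrow> int list \<Rightarrow> int list option" where
  "rm a [] = None"
| "rm a (b # bs) = (if a = b then Some bs else if b < a then map_option ((#) b) (rm a bs) else None)"

fun rms :: "int list \<Rightarrow> int list \<Rightarrow> int list option" where
  "rms [] cs = Some cs"
| "rms (a # as) cs = (case rm a cs of None \<Rightarrow> None | Some ds \<Rightarrow> rms as ds)"

lemma length_rm: "rm a cs = Some ds \<Longrightarrow> length ds < length cs"
  by (induction a cs arbitrary: ds rule: rm.induct) (auto split: if_splits)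

lemma length_rms: "rms as cs = Some ds \<Longrightarrow> length ds \<le> length cs"
  by (induction as cs arbitrary: ds rule: rms.induct)
     (auto split: option.splits dest!: length_rm, fastforce)


text \<open>\<open>cs\<close> is what remains of slice \<open>x\<close>, \<open>ns\<close> what
  remains of slice \<open>x + 1\<close>, and \<open>pl\<close> supplies the untouched slices from
  \<open>x + 2\<close> on. A cell (y, z) has the key 16 z + y, so steps in y and z add 1 and 16. The
  smallest key is a corner of its slab, which leaves three cases: the slab inside the slice, the
  flat one, and the upright one that reaches into the next slice.\<close>

function solve :: "(int \<Rightarrow> int list) \<Rightarrow> int \<Rightarrow> int list \<Rightarrow> int list \<Rightarrow> nat" where
  "solve pl x [] ns = (if x < 14 then solve pl (x + 1) ns (pl (x + 2)) else 1)"
| "solve pl x (c # cs) ns =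
    (case rms [c + 1, c + 16, c + 17] cs of None \<Rightarrow> 0 | Some ds \<Rightarrow> solve pl x ds ns) +
    (case rm (c + 1) cs of None \<Rightarrow> 0 | Some ds \<Rightarrow> (case rms [c, c + 1] ns of None \<Rightarrow> 0 | Some ms \<Rightarrow> solve pl x ds ms)) +
    (case rm (c + 16) cs of None \<Rightarrow> 0 | Some ds \<Rightarrow> (case rms [c, c + 16] ns of None \<Rightarrow> 0 | Some ms \<Rightarrow> solve pl x ds ms))"
  by pat_completeness auto
termination
  by (relation "measures [\<lambda>(t, x, cs, ns). nat (14 - x), \<lambda>(t, x, cs, ns). length cs]")
    (auto simp: less_Suc_eq_le less_Suc_eq dest!: length_rms length_rm simp del: rms.simps)

lemma rm_Some:
  "sorted_wrt (<) cs \<Longrightarrow> rm a cs = Some ds \<Longrightarrow> a \<in> set cs \<and> set ds = set cs - {a} \<and> sorted_wrt (<) ds"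
proof (induction a cs arbitrary: ds rule: rm.induct)
  case (2 a b bs)
  consider "a = b" | "b < a" "\<exists>es. rm a bs = Some es \<and> ds = b # es"
    using 2(3) by (auto split: if_splits)
  then show ?case
  proof cases
    case 1
    then show ?thesis using 2(2,3) by auto
  next
    case 2
    then obtain es where es: "rm a bs = Some es" "ds = b # es" by blast
    have "a \<in> set bs \<and> set es = set bs - {a} \<and> sorted_wrt (<) es"
      using 2 "2.IH"[of es] "2.prems" es by auto
    then show ?thesis using es 2 "2.prems" by auto
  qed
qed simp

lemma rm_None: "sorted_wrt (<) cs \<Longrightarrow> rm a cs = None \<Longrightarrow> a \<notin> set cs"
  by (induction a cs rule: rm.induct) (auto split: if_splits)

lemma rms_Some:
  "sorted_wrt (<) cs \<Longrightarrow> rms as cs = Some ds \<Longrightarrow> set as \<subseteq> set cs \<and> set ds = set cs - set as \<and> sorted_wrt (<) ds"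
proof (induction as cs arbitrary: ds rule: rms.induct)
  case (2 a as cs)
  then obtain es where es: "rm a cs = Some es" "rms as es = Some ds" by (auto split: option.splits)
  note s = rm_Some[OF 2(2) es(1)]
  then have "set as \<subseteq> set es \<and> set ds = set es - set as \<and> sorted_wrt (<) ds" using 2(1)[OF es(1) _ es(2)] by simp
  then show ?case using s by auto
qed simp

lemma rms_None: "sorted_wrt (<) cs \<Longrightarrow> distinct as \<Longrightarrow> rms as cs = None \<Longrightarrow> \<not> set as \<subseteq> set cs"
proof (induction as cs rule: rms.induct)
  case (2 a as cs)
  show ?case
  proof (cases "rm a cs")
    case None
    then show ?thesis using rm_None[OF 2(2)] by simp
  next
    case (Some es)
    note s = rm_Some[OF 2(2) Some]
    then have "\<not> set as \<subseteq> set es" using 2 Some by simp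
    then show ?thesis using s 2(3) by auto
  qed
qed simp

definition layer :: "int \<Rightarrow> int list \<Rightarrow> cell set" where
  "layer x ks = {c. fst c = x \<and> 0 \<le> fst (snd c) \<and> fst (snd c) < 16 \<and> 16 * snd (snd c) + fst (snd c) \<in> set ks}"

lemma in_layer: "(x, y, z) \<in> layer x' ks \<longleftrightarrow> x = x' \<and> 0 \<le> y \<and> y < 16 \<and> 16 * z + y \<in> set ks"
  by (simp add: layer_def)

lemma finite_layer: "finite (layer x ks)"
proof (rule finite_subset)
  show "layer x ks \<subseteq> (\<lambda>k. (x, k mod 16, k div 16)) ` set ks"
  proof
    fix c assume "c \<in> layer x ks"
    then show "c \<in> (\<lambda>k. (x, k mod 16, k div 16)) ` set ks"
      by (cases c) (auto simp: in_layer intro!: image_eqI[where x = "16 * snd (snd c) + fst (snd c)"])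
  qed
qed simp

definition slices :: "(int \<Rightarrow> int list) \<Rightarrow> int \<Rightarrow> int list \<Rightarrow> int list \<Rightarrow> cell set" where
  "slices pl x cs ns = layer x cs \<union> layer (x + 1) ns \<union> (\<Union>x'\<in>{x + 2..13}. layer x' (pl x'))"

lemma in_slices: "(a, y, z) \<in> slices pl x cs ns \<longleftrightarrow> 0 \<le> y \<and> y < 16 \<and>
   (a = x \<and> 16 * z + y \<in> set cs \<or> a = x + 1 \<and> 16 * z + y \<in> set ns \<or>
    x + 2 \<le> a \<and> a \<le> 13 \<and> 16 * z + y \<in> set (pl a))"
  by (auto simp: slices_def in_layer)

text \<open>The bound 14 below the base 16 keeps \<open>y + 1\<close> a proper digit, so that adding
  1 never reaches the next layer.\<close>

definition valid_keys :: "int list \<Rightarrow> bool" where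
  "valid_keys cs \<longleftrightarrow> sorted_wrt (<) cs \<and> (\<forall>k\<in>set cs. k mod 16 < 14)"

lemma slab_min_corner:
  assumes "is_slab S" "(x, y, z) \<in> S" "S \<subseteq> A" "\<And>a b c. (a, b, c) \<in> A \<Longrightarrow> a \<le> x \<Longrightarrow> b \<le> y \<Longrightarrow> c \<le> z \<Longrightarrow> (a, b, c) = (x, y, z)"
  shows "\<exists>k. S = set (slab_cells k (x, y, z))"
proof -
  obtain k a b c where S: "S = set (slab_cells k (a, b, c))" using assms(1) unfolding is_slab_def by (metis prod_cases3)
  have "(a, b, c) \<in> S" "a \<le> x" "b \<le> y" "c \<le> z" using assms(2) unfolding S by (auto split: if_splits)
  then have "(a, b, c) = (x, y, z)" using assms(3,4) by blast
  then show ?thesis using S by blast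
qed

text \<open>If no other cell lies weakly below (x, y, z) in all coordinates, a slab through this
  cell must have it as its smallest corner, and only the orientation is left to choose.\<close>

lemma card_tilings_min_corner:
  assumes fin: "finite A" and c: "(x, y, z) \<in> A"
    and min: "\<And>a b c. (a, b, c) \<in> A \<Longrightarrow> a \<le> x \<Longrightarrow> b \<le> y \<Longrightarrow> c \<le> z \<Longrightarrow> (a, b, c) = (x, y, z)"
  shows "card (tilings is_slab A) = (\<Sum>k<3. if set (slab_cells k (x, y, z)) \<subseteq> A
    then card (tilings is_slab (A - set (slab_cells k (x, y, z)))) else 0)"
proof -
  let ?S = "\<lambda>k. set (slab_cells k (x, y, z))"
  have S2: "?S k = ?S 2" if "\<not> k < 3" for k using that by auto
  have "{S. is_slab S \<and> S \<subseteq> A \<and> (x, y, z) \<in> S} = ?S ` {k. k < 3 \<and> ?S k \<subseteq> A}"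
  proof (intro set_eqI iffI)
    fix S assume S: "S \<in> {S. is_slab S \<and> S \<subseteq> A \<and> (x, y, z) \<in> S}"
    then obtain k where k: "S = ?S k" using slab_min_corner[OF _ _ _ min] by blast
    show "S \<in> ?S ` {k. k < 3 \<and> ?S k \<subseteq> A}"
    proof (cases "k < 3")
      case True then show ?thesis using S k by blast
    next
      case False
      then have "S = ?S 2" using S2 k by metis
      then show ?thesis using S by (intro image_eqI[of _ _ 2]) auto
    qed
  next
    fix S assume "S \<in> ?S ` {k. k < 3 \<and> ?S k \<subseteq> A}"
    moreover have "(x, y, z) \<in> ?S k" for k by simp
    ultimately show "S \<in> {S. is_slab S \<and> S \<subseteq> A \<and> (x, y, z) \<in> S}" unfolding is_slab_def by blast
  qed
  moreover have "inj_on ?S {k. k < 3 \<and> ?S k \<subseteq> A}"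
  proof -
    have "?S 0 \<noteq> ?S 1" "?S 0 \<noteq> ?S 2" "?S 1 \<noteq> ?S 2"
    proof -
      have "(x, y + 1, z) \<in> ?S 0" "(x, y + 1, z) \<notin> ?S 1" "(x + 1, y, z) \<in> ?S 0" "(x + 1, y, z) \<notin> ?S 2"
        "(x + 1, y, z) \<in> ?S 1" by simp_all
      then show "?S 0 \<noteq> ?S 1" "?S 0 \<noteq> ?S 2" "?S 1 \<noteq> ?S 2" by metis+
    qed
    note ne = this
    have three: "k = 0 \<or> k = 1 \<or> k = 2" if "k < 3" for k :: nat using that by linarith
    show ?thesis
    proof (rule inj_onI)
      fix k l assume kl: "k \<in> {k. k < 3 \<and> ?S k \<subseteq> A}" "l \<in> {k. k < 3 \<and> ?S k \<subseteq> A}" "?S k = ?S l"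
      then have "k = 0 \<or> k = 1 \<or> k = 2" "l = 0 \<or> l = 1 \<or> l = 2" using three by blast+
      then show "k = l" using ne kl(3) by (elim disjE; hypsubst; (rule refl | metis))
    qed
  qed
  ultimately have "card (tilings is_slab A) = (\<Sum>k | k < 3 \<and> ?S k \<subseteq> A. card (tilings is_slab (A - ?S k)))"
    unfolding tilings_insert[OF fin c] by (simp add: sum.reindex del: slab_cells.simps)
  also have "{k. k < 3 \<and> ?S k \<subseteq> A} = {k \<in> {..<3}. ?S k \<subseteq> A}" by auto
  also have "(\<Sum>k\<in>\<dots>. card (tilings is_slab (A - ?S k))) = (\<Sum>k<3. if ?S k \<subseteq> A then card (tilings is_slab (A - ?S k)) else 0)"
    by (rule sum.inter_filter) simp
  finally show ?thesis .
qed

lemma finite_slices: "finite (slices pl x cs ns)"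
  by (simp add: slices_def finite_layer)

lemma decompose_16:
  fixes b b' e e' :: int
  assumes "0 \<le> b" "b < 16" "0 \<le> b'" "b' < 16"
  shows "16 * e + b = 16 * e' + b' \<longleftrightarrow> e = e' \<and> b = b'"
  using assms by (cases e e' rule: linorder_cases) simp_all

text \<open>The first key of the current slice is such a minimal corner: earlier slices are used up,
  and a cell of the slice below it in y and z would have a smaller key.\<close>

lemma solve_correct:
  assumes "\<And>a. valid_keys (pl a)" "\<And>a. 14 \<le> a \<Longrightarrow> pl a = []"
    "valid_keys cs" "valid_keys ns" "13 \<le> x \<Longrightarrow> ns = []" "14 \<le> x \<Longrightarrow> cs = []"
  shows "solve pl x cs ns = card (tilings is_slab (slices pl x cs ns))"
  using assms
proof (induction pl x cs ns rule: solve.induct)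
  case (1 pl x ns)
  show ?case
  proof (cases "x < 14")
    case True
    have "slices pl x [] ns = slices pl (x + 1) ns (pl (x + 2))"
    proof (intro set_eqI)
      fix c :: cell obtain a y z where c: "c = (a, y, z)" by (metis prod_cases3)
      have "pl a = []" if "a = x + 2" "\<not> a \<le> 13" using 1 that by simp
      then show "c \<in> slices pl x [] ns \<longleftrightarrow> c \<in> slices pl (x + 1) ns (pl (x + 2))"
        unfolding c in_slices by (cases "a = x + 2"; cases "a \<le> 13") auto
    qed
    then show ?thesis using 1 True by simp
  next
    case False
    then have "slices pl x [] ns = {}" using 1 by (auto simp: slices_def layer_def)
    moreover have "tilings is_slab {} = {{}}" by (auto simp: tilings_def partition_on_def)
    ultimately show ?thesis using False by simp
  qed
next
  case (2 pl x c cs ns)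
  let ?A = "slices pl x (c # cs) ns"
  define y z where "y = c mod 16" and "z = c div 16"
  have c: "c = 16 * z + y" "0 \<le> y" "y < 14" using "2.prems"(3) by (auto simp: y_def z_def valid_keys_def)
  have sc: "sorted_wrt (<) cs" "sorted_wrt (<) ns" and gt: "\<And>k. k \<in> set cs \<Longrightarrow> c < k"
    and m: "\<And>k. k \<in> set cs \<union> set ns \<Longrightarrow> k mod 16 < 14"
    using "2.prems"(3,4) by (auto simp: valid_keys_def)
  have vd: "valid_keys ds" if "sorted_wrt (<) ds" "set ds \<subseteq> set cs \<union> set ns" for ds
    using that m by (auto simp: valid_keys_def)
  have mem: "(a, b, e) \<in> ?A \<longleftrightarrow> 0 \<le> b \<and> b < 16 \<and>
     (a = x \<and> (16 * e + b = c \<or> 16 * e + b \<in> set cs) \<or> a = x + 1 \<and> 16 * e + b \<in> set ns \<or>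
      x + 2 \<le> a \<and> a \<le> 13 \<and> 16 * e + b \<in> set (pl a))" for a b e
    unfolding in_slices by auto
  note dec = decompose_16
  have nc: "c \<notin> set cs" using gt by blast
  have e: "16 * z + y = c" "16 * z + (y + 1) = c + 1" "16 * (z + 1) + y = c + 16" "16 * (z + 1) + (y + 1) = c + 17"
    "16 * z + 16 + y = c + 16" "17 + c = c + 17"
    and bd: "0 \<le> y" "y < 16" "0 \<le> y + 1" "y + 1 < 16" using c by simp_all
  have k: "16 * e + b = c \<longleftrightarrow> b = y \<and> e = z" "16 * e + b = c + 1 \<longleftrightarrow> b = y + 1 \<and> e = z"
    "16 * e + b = c + 16 \<longleftrightarrow> b = y \<and> e = z + 1" "16 * e + b = c + 17 \<longleftrightarrow> b = y + 1 \<and> e = z + 1"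
    if "0 \<le> b" "b < 16" for e b :: int
    using decompose_16[OF that bd(1,2), of e z] decompose_16[OF that bd(3,4), of e z]
      decompose_16[OF that bd(1,2), of e "z + 1"] decompose_16[OF that bd(3,4), of e "z + 1"] unfolding e by blast+
  have x: "x < 14" using "2.prems"(6) by force
  have "card (tilings is_slab ?A) = (\<Sum>k<3. if set (slab_cells k (x, y, z)) \<subseteq> ?A
    then card (tilings is_slab (?A - set (slab_cells k (x, y, z)))) else 0)"
  proof (rule card_tilings_min_corner[OF finite_slices])
    show "(x, y, z) \<in> ?A" unfolding mem using c by auto
    fix a b e assume "(a, b, e) \<in> ?A" and le: "a \<le> x" "b \<le> y" "e \<le> z"
    then have *: "0 \<le> b" "b < 16" "a = x" "16 * e + b = c \<or> 16 * e + b \<in> set cs" unfolding mem by auto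
    moreover have "16 * e + b \<le> c" using le c by linarith
    ultimately have "16 * e + b = c" using gt by force
    then show "(a, b, e) = (x, y, z)" using * c dec by auto
  qed
  moreover have "(case rms [c + 1, c + 16, c + 17] cs of None \<Rightarrow> 0 | Some ds \<Rightarrow> solve pl x ds ns) =
    (if set (slab_cells 2 (x, y, z)) \<subseteq> ?A then card (tilings is_slab (?A - set (slab_cells 2 (x, y, z)))) else 0)"
  proof -
    have sub: "set (slab_cells 2 (x, y, z)) \<subseteq> ?A \<longleftrightarrow> set [c + 1, c + 16, c + 17] \<subseteq> set cs"
      by (auto simp: mem e bd nc)
    show ?thesis
    proof (cases "rms [c + 1, c + 16, c + 17] cs")
      case None
      have "\<not> set (slab_cells 2 (x, y, z)) \<subseteq> ?A" unfolding sub using rms_None[OF sc(1) _ None] by simp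
      then show ?thesis using None by (simp del: slab_cells.simps rms.simps)
    next
      case (Some ds)
      note r = rms_Some[OF sc(1) Some]
      have "slices pl x ds ns = ?A - set (slab_cells 2 (x, y, z))"
      proof (intro set_eqI)
        fix p :: cell obtain a b e where p: "p = (a, b, e)" by (metis prod_cases3)
        show "p \<in> slices pl x ds ns \<longleftrightarrow> p \<in> ?A - set (slab_cells 2 (x, y, z))"
          proof (cases "0 \<le> b \<and> b < 16")
            case True
            then have "p \<in> set (slab_cells 2 (x, y, z)) \<longleftrightarrow> a = x \<and> 16 * e + b \<in> {c, c + 1, c + 16, c + 17}"
              unfolding p using k[of b e] by auto
            note q = this
            define K where "K = 16 * e + b"
            have rs: "set ds = set cs - {c + 1, c + 16, c + 17}" using r by simp
            show ?thesis unfolding Diff_iff q unfolding p in_slices rs K_def[symmetric] using nc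
              by (cases "a = x"; cases "K = c"; cases "K \<in> {c + 1, c + 16, c + 17}") simp_all
          next
            case False
            then show ?thesis unfolding p by (auto simp: in_slices)
          qed
      qed
      moreover have "solve pl x ds ns = card (tilings is_slab (slices pl x ds ns))"
      proof (rule "2.IH"(1)[OF Some])
        have "set ds \<subseteq> set cs \<union> set ns" using r by blast
        then show "valid_keys ds" using vd r by blast
        show "14 \<le> x \<Longrightarrow> ds = []" using x by simp
      qed (use "2.prems"(1,2,4,5) in simp_all)
      moreover have "set (slab_cells 2 (x, y, z)) \<subseteq> ?A" unfolding sub using r by simp
      ultimately show ?thesis using Some by (simp del: slab_cells.simps rms.simps)
    qed
  qed
  moreover have "(case rm (c + 1) cs of None \<Rightarrow> 0 | Some ds \<Rightarrow> (case rms [c, c + 1] ns of None \<Rightarrow> 0 | Some ms \<Rightarrow> solve pl x ds ms)) =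
    (if set (slab_cells 0 (x, y, z)) \<subseteq> ?A then card (tilings is_slab (?A - set (slab_cells 0 (x, y, z)))) else 0)"
  proof -
    have sub: "set (slab_cells 0 (x, y, z)) \<subseteq> ?A \<longleftrightarrow> c + 1 \<in> set cs \<and> set [c, c + 1] \<subseteq> set ns"
      by (auto simp: mem e bd nc)
    show ?thesis
    proof (cases "rm (c + 1) cs")
      case None
      have "\<not> set (slab_cells 0 (x, y, z)) \<subseteq> ?A" unfolding sub using rm_None[OF sc(1) None] by simp
      then show ?thesis using None by (simp del: slab_cells.simps rms.simps)
    next
      case (Some ds)
      note r = rm_Some[OF sc(1) Some]
      show ?thesis
      proof (cases "rms [c, c + 1] ns")
        case None
        have "\<not> set (slab_cells 0 (x, y, z)) \<subseteq> ?A" unfolding sub using rms_None[OF sc(2) _ None] by simp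
      then show ?thesis using Some None by (simp del: slab_cells.simps rms.simps)
      next
        case (Some ms)
        note r' = rms_Some[OF sc(2) Some]
        have "slices pl x ds ms = ?A - set (slab_cells 0 (x, y, z))"
        proof (intro set_eqI)
          fix p :: cell obtain a b e where p: "p = (a, b, e)" by (metis prod_cases3)
          show "p \<in> slices pl x ds ms \<longleftrightarrow> p \<in> ?A - set (slab_cells 0 (x, y, z))"
            proof (cases "0 \<le> b \<and> b < 16")
            case True
            then have "p \<in> set (slab_cells 0 (x, y, z)) \<longleftrightarrow> (a = x \<or> a = x + 1) \<and> 16 * e + b \<in> {c, c + 1}"
              unfolding p using k[of b e] by auto
            note q = this
            define K where "K = 16 * e + b"
            have rs: "set ds = set cs - {c + 1}" "set ms = set ns - {c, c + 1}" using r r' by simp_all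
            show ?thesis unfolding Diff_iff q unfolding p in_slices rs K_def[symmetric] using nc
              by (cases "a = x"; cases "a = x + 1"; cases "K = c"; cases "K = c + 1") simp_all
          next
            case False
            then show ?thesis unfolding p by (auto simp: in_slices)
          qed
        qed
        moreover have "solve pl x ds ms = card (tilings is_slab (slices pl x ds ms))"
        proof (rule "2.IH"(2)[OF \<open>rm (c + 1) cs = Some ds\<close> Some])
          have "set ds \<subseteq> set cs \<union> set ns" "set ms \<subseteq> set cs \<union> set ns" using r r' by blast+
          then show "valid_keys ds" "valid_keys ms" using vd r r' by blast+
          show "13 \<le> x \<Longrightarrow> ms = []" using r' "2.prems"(5) by simp
          show "14 \<le> x \<Longrightarrow> ds = []" using x by simp
        qed (use "2.prems"(1,2) in simp_all)
        moreover have "set (slab_cells 0 (x, y, z)) \<subseteq> ?A" unfolding sub using r r' by simp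
      ultimately show ?thesis using Some \<open>rm (c + 1) cs = Some ds\<close> by (simp del: slab_cells.simps rms.simps)
      qed
    qed
  qed
  moreover have "(case rm (c + 16) cs of None \<Rightarrow> 0 | Some ds \<Rightarrow> (case rms [c, c + 16] ns of None \<Rightarrow> 0 | Some ms \<Rightarrow> solve pl x ds ms)) =
    (if set (slab_cells 1 (x, y, z)) \<subseteq> ?A then card (tilings is_slab (?A - set (slab_cells 1 (x, y, z)))) else 0)"
  proof -
    have sub: "set (slab_cells 1 (x, y, z)) \<subseteq> ?A \<longleftrightarrow> c + 16 \<in> set cs \<and> set [c, c + 16] \<subseteq> set ns"
      by (auto simp: mem e bd nc)
    show ?thesis
    proof (cases "rm (c + 16) cs")
      case None
      have "\<not> set (slab_cells 1 (x, y, z)) \<subseteq> ?A" unfolding sub using rm_None[OF sc(1) None] by simp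
      then show ?thesis using None by (simp del: slab_cells.simps rms.simps)
    next
      case (Some ds)
      note r = rm_Some[OF sc(1) Some]
      show ?thesis
      proof (cases "rms [c, c + 16] ns")
        case None
        have "\<not> set (slab_cells 1 (x, y, z)) \<subseteq> ?A" unfolding sub using rms_None[OF sc(2) _ None] by simp
      then show ?thesis using Some None by (simp del: slab_cells.simps rms.simps)
      next
        case (Some ms)
        note r' = rms_Some[OF sc(2) Some]
        have "slices pl x ds ms = ?A - set (slab_cells 1 (x, y, z))"
        proof (intro set_eqI)
          fix p :: cell obtain a b e where p: "p = (a, b, e)" by (metis prod_cases3)
          show "p \<in> slices pl x ds ms \<longleftrightarrow> p \<in> ?A - set (slab_cells 1 (x, y, z))"
            proof (cases "0 \<le> b \<and> b < 16")
            case True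
            then have "p \<in> set (slab_cells 1 (x, y, z)) \<longleftrightarrow> (a = x \<or> a = x + 1) \<and> 16 * e + b \<in> {c, c + 16}"
              unfolding p using k[of b e] by auto
            note q = this
            define K where "K = 16 * e + b"
            have rs: "set ds = set cs - {c + 16}" "set ms = set ns - {c, c + 16}" using r r' by simp_all
            show ?thesis unfolding Diff_iff q unfolding p in_slices rs K_def[symmetric] using nc
              by (cases "a = x"; cases "a = x + 1"; cases "K = c"; cases "K = c + 16") simp_all
          next
            case False
            then show ?thesis unfolding p by (auto simp: in_slices)
          qed
        qed
        moreover have "solve pl x ds ms = card (tilings is_slab (slices pl x ds ms))"
        proof (rule "2.IH"(3)[OF \<open>rm (c + 16) cs = Some ds\<close> Some])
          have "set ds \<subseteq> set cs \<union> set ns" "set ms \<subseteq> set cs \<union> set ns" using r r' by blast+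
          then show "valid_keys ds" "valid_keys ms" using vd r r' by blast+
          show "13 \<le> x \<Longrightarrow> ms = []" using r' "2.prems"(5) by simp
          show "14 \<le> x \<Longrightarrow> ds = []" using x by simp
        qed (use "2.prems"(1,2) in simp_all)
        moreover have "set (slab_cells 1 (x, y, z)) \<subseteq> ?A" unfolding sub using r r' by simp
      ultimately show ?thesis using Some \<open>rm (c + 16) cs = Some ds\<close> by (simp del: slab_cells.simps rms.simps)
      qed
    qed
  qed
  moreover have "(\<Sum>k<3. f k) = f 2 + f 0 + f (1::nat)" for f :: "nat \<Rightarrow> nat"
    by (simp add: numeral_3_eq_3 numeral_2_eq_2)
  ultimately show ?case by (simp del: rms.simps slab_cells.simps)
qed

section \<open>The shape of the blocks\<close>

text \<open>Rows are indexed by x. An entry 1 adds a cell above the plate, which is the layer z = 3,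
  and -1 adds one below. The first row and the first column contain no 0, so that fences can close
  off the whole boundary. Wherever a wall passes a bump, the bump is on the other side of the plate
  and does not alter the wall.\<close>

definition bumps :: "int list list" where
  "bumps =
    [[-1, 1, 1, 1, -1, -1, 1, 1, -1, -1, 1, 1, -1, -1],
     [-1, 1, 0, 0, 1, 1, -1, -1, 0, 0, -1, -1, 1, 1],
     [1, -1, 0, 0, 0, 0, 0, 0, 0, 0, 0, 0, 0, 0],
     [1, -1, 1, 1, 0, 0, 0, 0, -1, -1, 0, 0, 0, 0],
     [1, -1, 0, 0, 0, 0, 0, 0, 0, 0, 0, 0, 0, 0],
     [1, -1, 0, 0, 0, 0, 0, 0, 0, 0, 0, 0, 0, 0],
     [-1, 0, 0, 0, 0, 0, 0, 0, 0, 0, 0, -1, 0, 0],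
     [-1, 0, 0, 0, 0, 0, 0, 0, 0, 0, 0, -1, 0, 0],
     [1, 0, 0, 0, 0, 0, 0, 0, 0, 0, 0, 1, 0, 0],
     [1, 0, 0, 0, 0, 0, 0, 0, 0, 0, 0, 1, 0, 0],
     [-1, 1, 0, 0, 0, 0, 0, 0, 0, 0, 0, 0, 0, 0],
     [-1, 1, 0, 0, 0, 0, 0, 0, 0, 0, 0, 0, 0, 0],
     [1, -1, 0, 0, 0, 0, 0, 0, 0, 0, 0, 0, 0, 0],
     [1, -1, 0, 0, 0, 0, 0, 0, 0, 0, 0, 0, 0, 0]]"

text \<open>Type 0 is a corner of the grid, 1 a plain crossing and 2 a filter. The triples from 3,
  6, 9 and 12 are the top, bottom, left and right side, each for the first, a middle and the last
  value of a group. A wall has height 2. The bus of a side lies at 8 or 9 for reasons of parity: the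
  bent wall of a first value then has an even number of cells, the one of a last value and the
  branching one of a middle value an odd number.\<close>

definition wall_up :: "nat \<Rightarrow> int \<Rightarrow> int \<Rightarrow> int" where
  "wall_up \<tau> x y =
    (if \<tau> = 1 then if x = 7 then 2 else 0
     else if \<tau> = 2 then
       if 5 \<le> x \<and> x \<le> 7 \<and> 6 \<le> y \<and> y \<le> 8 then if x = 5 then 2 else 3 else if x = 7 then 2 else 0
     else if 3 \<le> \<tau> \<and> \<tau> \<le> 5 then
       if x = 7 \<and> y \<le> 9 \<or> y = 9 \<and> (\<tau> = 3 \<longrightarrow> 7 \<le> x) \<and> (\<tau> = 5 \<longrightarrow> x \<le> 7) then 2 else 0
     else if 6 \<le> \<tau> \<and> \<tau> \<le> 8 then
       if x = 7 \<and> 8 \<le> y \<or> y = 8 \<and> (\<tau> = 6 \<longrightarrow> 7 \<le> x) \<and> (\<tau> = 8 \<longrightarrow> x \<le> 7) then 2 else 0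
     else 0)"

text \<open>In the filter the lower wire makes a detour that takes it below the upper wire at x = 7,
  where both sides of the plate carry a patch of 3 by 3 columns. There the two wires interact, and
  the combination of two bits 0 is excluded.\<close>

definition wall_down :: "nat \<Rightarrow> int \<Rightarrow> int \<Rightarrow> int" where
  "wall_down \<tau> x y =
    (if \<tau> = 1 then if y = 3 then 2 else 0
     else if \<tau> = 2 then
       if 5 \<le> x \<and> x \<le> 7 \<and> 5 \<le> y \<and> y \<le> 7 then if x = 5 then 2 else 3
       else if y = 3 \<and> (x \<le> 7 \<or> 10 \<le> x) \<or> 3 \<le> y \<and> y \<le> 9 \<and> (x = 7 \<or> x = 10) \<or> y = 9 \<and> 7 \<le> x \<and> x \<le> 10
         then 2 else 0
     else if 9 \<le> \<tau> \<and> \<tau> \<le> 11 then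
       if y = 3 \<and> 8 \<le> x \<or> x = 8 \<and> (\<tau> = 9 \<longrightarrow> 3 \<le> y) \<and> (\<tau> = 11 \<longrightarrow> y \<le> 3) then 2 else 0
     else if 12 \<le> \<tau> \<and> \<tau> \<le> 14 then
       if y = 3 \<and> x \<le> 9 \<or> x = 9 \<and> (\<tau> = 12 \<longrightarrow> 3 \<le> y) \<and> (\<tau> = 14 \<longrightarrow> y \<le> 3) then 2 else 0
     else 0)"


definition bump :: "int \<Rightarrow> int \<Rightarrow> int" where
  "bump x y = bumps ! nat x ! nat y"

definition occupied :: "nat \<Rightarrow> int \<Rightarrow> int \<Rightarrow> int \<Rightarrow> int \<Rightarrow> bool" where
  "occupied \<tau> b x y z \<longleftrightarrow> 3 - max (- b) (wall_down \<tau> x y) \<le> z \<and> z \<le> 3 + max b (wall_up \<tau> x y)"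

text \<open>Exactly the cells taken by the forced slabs in \<open>fence_slabs\<close>. Among the
  columns with x = 0 or y = 0 this removes the entire plate layer.\<close>

definition fence :: "int \<Rightarrow> int \<Rightarrow> int \<Rightarrow> int \<Rightarrow> bool" where
  "fence b x y z \<longleftrightarrow> b \<noteq> 0 \<and> (x \<le> 1 \<or> y \<le> 1) \<and> (z = 3 \<or> z = 3 + b)"

definition in_block :: "int \<Rightarrow> int \<Rightarrow> bool" where
  "in_block x y \<longleftrightarrow> 0 \<le> x \<and> x < 14 \<and> 0 \<le> y \<and> y < 14"

definition inner :: "nat \<Rightarrow> cell set" where
  "inner \<tau> = {(x, y, z). in_block x y \<and> occupied \<tau> (bump x y) x y z \<and> \<not> fence (bump x y) x y z}"

text \<open>The stored row is traversed together with its indices instead of calling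
  \<open>bump\<close>, for the sake of evaluation; running through z outside and y inside yields the
  keys in increasing order.\<close>

definition plane :: "nat \<Rightarrow> cell list \<Rightarrow> int \<Rightarrow> int list" where
  "plane \<tau> rem x = (if 0 \<le> x \<and> x < 14 then
     map (\<lambda>(z, y, b). 16 * z + y) (filter (\<lambda>(z, y, b). occupied \<tau> b x y z \<and> \<not> fence b x y z \<and> (x, y, z) \<notin> set rem)
       (List.product [0..6] (zip [0..13] (bumps ! nat x)))) else [])"

lemma bumps_shape: "length bumps = 14" "\<forall>r\<in>set bumps. length r = 14 \<and> (\<forall>b\<in>set r. -1 \<le> b \<and> b \<le> 1)"
  by code_simp+

lemma bump_bound: "in_block x y \<Longrightarrow> -1 \<le> bump x y \<and> bump x y \<le> 1"
proof -
  assume xy: "in_block x y"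
  then have "bumps ! nat x \<in> set bumps" using bumps_shape(1) by (simp add: in_block_def nat_less_iff)
  then have r: "length (bumps ! nat x) = 14" "\<forall>b\<in>set (bumps ! nat x). -1 \<le> b \<and> b \<le> 1" using bumps_shape(2) by blast+
  have "bumps ! nat x ! nat y \<in> set (bumps ! nat x)" using r(1) xy by (simp add: in_block_def nat_less_iff)
  then show ?thesis using r(2) unfolding bump_def by blast
qed

lemma wall_bound: "0 \<le> wall_up \<tau> x y \<and> wall_up \<tau> x y \<le> 3" "0 \<le> wall_down \<tau> x y \<and> wall_down \<tau> x y \<le> 3"
  by (simp_all add: wall_up_def wall_down_def)

lemma occupied_bound: "in_block x y \<Longrightarrow> occupied \<tau> (bump x y) x y z \<Longrightarrow> 0 \<le> z \<and> z \<le> 6"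
  using bump_bound[of x y] wall_bound[of \<tau> x y] unfolding occupied_def by linarith

lemma zip_bumps: "0 \<le> x \<Longrightarrow> x < 14 \<Longrightarrow> (y, b) \<in> set (zip [0..13] (bumps ! nat x)) \<longleftrightarrow> 0 \<le> y \<and> y < 14 \<and> b = bump x y"
proof -
  assume x: "0 \<le> x" "x < 14"
  then have len: "length (bumps ! nat x) = 14" using bumps_shape by (simp add: nat_less_iff)
  have "(y, b) \<in> set (zip [0..13] (bumps ! nat x)) \<longleftrightarrow> (\<exists>i<14. y = int i \<and> b = bumps ! nat x ! i)"
  proof
    assume "(y, b) \<in> set (zip [0..13] (bumps ! nat x))"
    then obtain i where "[0..13] ! i = y" "bumps ! nat x ! i = b" "i < 14" unfolding in_set_zip using len by auto
    then show "\<exists>i<14. y = int i \<and> b = bumps ! nat x ! i" by (intro exI[of _ i]) (simp add: nth_upto)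
  next
    assume "\<exists>i<14. y = int i \<and> b = bumps ! nat x ! i"
    then obtain i where "i < 14" "y = int i" "b = bumps ! nat x ! i" by blast
    then show "(y, b) \<in> set (zip [0..13] (bumps ! nat x))" unfolding in_set_zip using len by (intro exI[of _ i]) (simp add: nth_upto)
  qed
  also have "\<dots> \<longleftrightarrow> 0 \<le> y \<and> y < 14 \<and> b = bump x y"
    unfolding bump_def by (auto intro!: exI[of _ "nat y"])
  finally show ?thesis .
qed

lemma plane_outside: "\<not> (0 \<le> x \<and> x < 14) \<Longrightarrow> plane \<tau> rem x = []"
  unfolding plane_def by (rule if_not_P)

lemma set_plane: "16 * z + y \<in> set (plane \<tau> rem x) \<longleftrightarrow> (x, y, z) \<in> inner \<tau> - set rem" if y: "0 \<le> y" "y < 16"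
proof (cases "0 \<le> x \<and> x < 14")
  case True
  have dec: "16 * z' + y' = 16 * z + y \<longleftrightarrow> z' = z \<and> y' = y" if "0 \<le> y'" "y' < 14" for z' y' :: int
    using decompose_16[of y' y z' z] that y by simp
  have "16 * z + y \<in> set (plane \<tau> rem x) \<longleftrightarrow> (\<exists>z' y' b. 0 \<le> z' \<and> z' \<le> 6 \<and> (y', b) \<in> set (zip [0..13] (bumps ! nat x)) \<and>
      occupied \<tau> b x y' z' \<and> \<not> fence b x y' z' \<and> (x, y', z') \<notin> set rem \<and> 16 * z + y = 16 * z' + y')"
    unfolding plane_def if_P[OF True] set_map set_filter set_product image_iff Bex_def mem_Collect_eq split_paired_Ex
      prod.case mem_Sigma_iff set_upto atLeastAtMost_iff by blast
  also have "\<dots> \<longleftrightarrow> 0 \<le> z \<and> z \<le> 6 \<and> y < 14 \<and> occupied \<tau> (bump x y) x y z \<and> \<not> fence (bump x y) x y z \<and> (x, y, z) \<notin> set rem"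
  proof
    assume "\<exists>z' y' b. 0 \<le> z' \<and> z' \<le> 6 \<and> (y', b) \<in> set (zip [0..13] (bumps ! nat x)) \<and>
      occupied \<tau> b x y' z' \<and> \<not> fence b x y' z' \<and> (x, y', z') \<notin> set rem \<and> 16 * z + y = 16 * z' + y'"
    then obtain z' y' b where z': "0 \<le> z'" "z' \<le> 6" and m: "(y', b) \<in> set (zip [0..13] (bumps ! nat x))"
      and c: "occupied \<tau> b x y' z'" "\<not> fence b x y' z'" "(x, y', z') \<notin> set rem" and q: "16 * z + y = 16 * z' + y'" by blast
    have m': "0 \<le> y'" "y' < 14" "b = bump x y'" using m zip_bumps[of x y' b] True by blast+
    then have "z' = z" "y' = y" using dec[of y' z'] q by simp_all
    then show "0 \<le> z \<and> z \<le> 6 \<and> y < 14 \<and> occupied \<tau> (bump x y) x y z \<and> \<not> fence (bump x y) x y z \<and> (x, y, z) \<notin> set rem"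
      using z' m' c by simp
  next
    assume "0 \<le> z \<and> z \<le> 6 \<and> y < 14 \<and> occupied \<tau> (bump x y) x y z \<and> \<not> fence (bump x y) x y z \<and> (x, y, z) \<notin> set rem"
    moreover from this have "(y, bump x y) \<in> set (zip [0..13] (bumps ! nat x))" using zip_bumps[of x y "bump x y"] True y by blast
    ultimately show "\<exists>z' y' b. 0 \<le> z' \<and> z' \<le> 6 \<and> (y', b) \<in> set (zip [0..13] (bumps ! nat x)) \<and>
      occupied \<tau> b x y' z' \<and> \<not> fence b x y' z' \<and> (x, y', z') \<notin> set rem \<and> 16 * z + y = 16 * z' + y'" by blast
  qed
  also have "\<dots> \<longleftrightarrow> (x, y, z) \<in> inner \<tau> - set rem"
    using True y occupied_bound[of x y \<tau> z] by (auto simp: inner_def in_block_def)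
  finally show ?thesis .
next
  case False
  then show ?thesis by (auto simp: plane_outside inner_def in_block_def)
qed

lemma keys_plane: "k \<in> set (plane \<tau> rem x) \<Longrightarrow> k mod 16 < 14"
proof (cases "0 \<le> x \<and> x < 14")
  case True
  assume "k \<in> set (plane \<tau> rem x)"
  then obtain z y b where k: "k = 16 * z + y" "(y, b) \<in> set (zip [0..13] (bumps ! nat x))"
    unfolding plane_def if_P[OF True] by auto
  have "0 \<le> y" "y < 14" using k(2) zip_bumps[of x y b] True by blast+
  then show ?thesis unfolding k(1) by simp
qed (simp add: plane_outside)

text \<open>A port is the place where a wall meets the boundary: the position along the boundary and
  the lower of its two heights. The bits refer to the left, right, bottom and top side; a bit 1
  means that a slab straddling that side has taken the two cells.\<close>

definition rem_cells :: "(int \<times> int) \<times> int \<times> int \<Rightarrow> bool \<times> bool \<times> bool \<times> bool \<Rightarrow> cell list" where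
  "rem_cells = (\<lambda>((hy, hz), vx, vz) (l, r, b, t).
     (if l then [(0, hy, hz), (0, hy, hz + 1)] else []) @ (if r then [(13, hy, hz), (13, hy, hz + 1)] else []) @
     (if b then [(vx, 0, vz), (vx, 0, vz + 1)] else []) @ (if t then [(vx, 13, vz), (vx, 13, vz + 1)] else []))"

text \<open>For a straight wall the condition is that the strip without the cells already taken has
  even length. At a branching, an even or odd remainder of the stem decides whether the stem uses
  the branching cell, which fixes the bits of both arms of the bus or makes them equal.\<close>

definition block_ok :: "nat \<Rightarrow> bool \<times> bool \<times> bool \<times> bool \<Rightarrow> bool" where
  "block_ok \<tau> = (\<lambda>(l, r, b, t).
     if \<tau> = 0 then \<not> l \<and> \<not> r \<and> \<not> b \<and> \<not> t
     else if \<tau> = 1 then l = r \<and> b = t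
     else if \<tau> = 2 then l = r \<and> b = t \<and> (l \<or> b)
     else if \<tau> = 3 then \<not> l \<and> \<not> t \<and> r = b
     else if \<tau> = 4 then \<not> t \<and> (if b then l = r else l \<and> \<not> r)
     else if \<tau> = 5 then \<not> r \<and> \<not> t \<and> l = (\<not> b)
     else if \<tau> = 6 then \<not> l \<and> \<not> b \<and> r = t
     else if \<tau> = 7 then \<not> b \<and> (if t then l = r else l \<and> \<not> r)
     else if \<tau> = 8 then \<not> r \<and> \<not> b \<and> l = (\<not> t)
     else if \<tau> = 9 then \<not> l \<and> \<not> b \<and> r = t
     else if \<tau> = 10 then \<not> l \<and> (if r then b = t else b \<and> \<not> t)
     else if \<tau> = 11 then \<not> l \<and> \<not> t \<and> r = (\<not> b)
     else if \<tau> = 12 then \<not> r \<and> \<not> b \<and> l = t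
     else if \<tau> = 13 then \<not> r \<and> (if l then b = t else b \<and> \<not> t)
     else \<not> r \<and> \<not> t \<and> l = (\<not> b))"

text \<open>If the block lacks a cell which a straddling slab would need, the bits must be
  forbidden; otherwise the remainder must have one tiling or none as prescribed.\<close>

definition block_check :: "nat \<Rightarrow> (int \<times> int) \<times> int \<times> int \<Rightarrow> bool \<times> bool \<times> bool \<times> bool \<Rightarrow> bool" where
  "block_check \<tau> p bits =
    (let rem = rem_cells p bits in
     if list_all (\<lambda>(x, y, z). in_block x y \<and> occupied \<tau> (bump x y) x y z \<and> \<not> fence (bump x y) x y z) rem
     then list_all (\<lambda>x. sorted_wrt (<) (plane \<tau> rem x)) [0..13] \<and>
       solve (plane \<tau> rem) 0 (plane \<tau> rem 0) (plane \<tau> rem 1) = (if block_ok \<tau> bits then 1 else 0)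
     else \<not> block_ok \<tau> bits)"

definition all_bits :: "(bool \<times> bool \<times> bool \<times> bool) list" where
  "all_bits = List.product [False, True] (List.product [False, True] (List.product [False, True] [False, True]))"

lemma block_check_sound:
  assumes "block_check \<tau> p bits"
  shows "set (rem_cells p bits) \<subseteq> inner \<tau> \<Longrightarrow>
      card (tilings is_slab (inner \<tau> - set (rem_cells p bits))) = (if block_ok \<tau> bits then 1 else 0)"
    and "block_ok \<tau> bits \<Longrightarrow> set (rem_cells p bits) \<subseteq> inner \<tau>"
proof -
  let ?rem = "rem_cells p bits"
  have sub: "list_all (\<lambda>(x, y, z). in_block x y \<and> occupied \<tau> (bump x y) x y z \<and> \<not> fence (bump x y) x y z) ?rem \<longleftrightarrow>
      set ?rem \<subseteq> inner \<tau>"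
    by (auto simp: list_all_iff inner_def)
  show "set ?rem \<subseteq> inner \<tau>" if "block_ok \<tau> bits"
    using assms that unfolding block_check_def Let_def sub by (meson)
  assume "set ?rem \<subseteq> inner \<tau>"
  then have c: "\<And>x. 0 \<le> x \<Longrightarrow> x \<le> 13 \<Longrightarrow> sorted_wrt (<) (plane \<tau> ?rem x)"
    "solve (plane \<tau> ?rem) 0 (plane \<tau> ?rem 0) (plane \<tau> ?rem 1) = (if block_ok \<tau> bits then 1 else 0)"
    using assms unfolding block_check_def Let_def sub by (simp_all add: list_all_iff)
  have v: "valid_keys (plane \<tau> ?rem x)" for x
  proof (cases "0 \<le> x \<and> x < 14")
    case True
    then show ?thesis unfolding valid_keys_def using c(1)[of x] keys_plane[of _ \<tau> ?rem x] by auto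
  next
    case False
    then have "plane \<tau> ?rem x = []" by (rule plane_outside)
    then show ?thesis by (simp add: valid_keys_def)
  qed
  have "solve (plane \<tau> ?rem) 0 (plane \<tau> ?rem 0) (plane \<tau> ?rem 1) =
      card (tilings is_slab (slices (plane \<tau> ?rem) 0 (plane \<tau> ?rem 0) (plane \<tau> ?rem 1)))"
    by (rule solve_correct) (use v in \<open>simp_all add: plane_outside\<close>)
  moreover have "slices (plane \<tau> ?rem) 0 (plane \<tau> ?rem 0) (plane \<tau> ?rem 1) = inner \<tau> - set ?rem"
  proof (intro set_eqI)
    fix c :: cell obtain x y z where c: "c = (x, y, z)" by (metis prod_cases3)
    have "(x, y, z) \<in> slices (plane \<tau> ?rem) 0 (plane \<tau> ?rem 0) (plane \<tau> ?rem 1) \<longleftrightarrow>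
       0 \<le> y \<and> y < 16 \<and> 0 \<le> x \<and> x < 14 \<and> 16 * z + y \<in> set (plane \<tau> ?rem x)"
      unfolding in_slices by (cases "x = 0"; cases "x = 1") auto
    also have "\<dots> \<longleftrightarrow> (x, y, z) \<in> inner \<tau> - set ?rem"
      using set_plane[of y z \<tau> ?rem x] by (auto simp: inner_def in_block_def)
    finally show "c \<in> slices (plane \<tau> ?rem) 0 (plane \<tau> ?rem 0) (plane \<tau> ?rem 1) \<longleftrightarrow> c \<in> inner \<tau> - set ?rem"
      unfolding c .
  qed
  ultimately show "card (tilings is_slab (inner \<tau> - set ?rem)) = (if block_ok \<tau> bits then 1 else 0)" using c(2) by simp
qed

section \<open>Fences, and what may cross a block boundary\<close>

text \<open>Each entry consists of a witness cell, an orientation and a corner. The witness is a tip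
  above or below the plate, and the listed slab is the only one through it in any surroundings.
  Neighbouring slabs along a boundary tend to lie on opposite sides of the plate, which keeps the
  tips apart.\<close>

definition fence_slabs :: "(cell \<times> nat \<times> cell) list" where
  "fence_slabs =
    [((1, 0, 2), 1, (0, 0, 2)), ((1, 1, 4), 1, (0, 1, 3)), ((2, 0, 4), 1, (2, 0, 3)),
     ((2, 1, 2), 1, (2, 1, 2)), ((5, 0, 4), 1, (4, 0, 3)), ((5, 1, 2), 1, (4, 1, 2)),
     ((6, 0, 2), 1, (6, 0, 2)), ((9, 0, 4), 1, (8, 0, 3)), ((11, 0, 2), 1, (10, 0, 2)),
     ((10, 1, 4), 1, (10, 1, 3)), ((12, 0, 4), 1, (12, 0, 3)), ((12, 1, 2), 1, (12, 1, 2)),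
     ((0, 3, 4), 2, (0, 2, 3)), ((0, 5, 2), 2, (0, 4, 2)), ((1, 4, 4), 2, (1, 4, 3)),
     ((0, 6, 4), 2, (0, 6, 3)), ((1, 6, 2), 2, (1, 6, 2)), ((0, 8, 2), 2, (0, 8, 2)),
     ((0, 11, 4), 2, (0, 10, 3)), ((1, 10, 2), 2, (1, 10, 2)), ((0, 12, 2), 2, (0, 12, 2)),
     ((1, 12, 4), 2, (1, 12, 3))]"

definition fence_list :: "cell list" where
  "fence_list = concat (map (\<lambda>(w, k, c). slab_cells k c) fence_slabs)"

lemma fence_list_check:
  "list_all (\<lambda>(x, y, z). in_block x y \<and> fence (bump x y) x y z) fence_list"
  "list_all (\<lambda>(x, bs). list_all (\<lambda>(y, b). list_all (\<lambda>z. fence b x y z \<longrightarrow> (x, y, z) \<in> set fence_list) [2, 3, 4])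
     (zip [0..13] bs)) (zip [0..13] bumps)"
  "distinct fence_list"
  by code_simp+

text \<open>The twelve slabs through a cell: three planes and four positions in each.\<close>

definition covering :: "cell \<Rightarrow> cell list list" where
  "covering = (\<lambda>(x, y, z). concat (map (\<lambda>(a, b).
     [slab_cells 0 (x - a, y - b, z), slab_cells 1 (x - a, y, z - b), slab_cells 2 (x, y - a, z - b)])
     [(0, 0), (0, 1), (1, 0), (1, 1)]))"

definition present :: "nat list \<Rightarrow> cell \<Rightarrow> bool" where
  "present ts = (\<lambda>(x, y, z). let x' = x mod 14; y' = y mod 14; b = bump x' y' in list_ex (\<lambda>\<tau>. occupied \<tau> b x' y' z) ts)"

definition free_present :: "nat list \<Rightarrow> cell \<Rightarrow> bool" where
  "free_present ts = (\<lambda>(x, y, z). present ts (x, y, z) \<and> \<not> fence (bump (x mod 14) (y mod 14)) (x mod 14) (y mod 14) z)"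

lemma fence_forced_check:
  "list_all (\<lambda>(w, k, c). w \<in> set (slab_cells k c) \<and>
     list_all (\<lambda>cs. cs = slab_cells k c \<or> \<not> list_all (present [0..<15]) cs) (covering w)) fence_slabs"
  by code_simp

text \<open>Tests all slabs with cells on both sides of the boundary between x = 13 and x = 14: an
  upright one must be at the port, and a flat one must not exist. Both blocks belong to the same row
  of the grid, hence the restricted list of types.\<close>

definition cross_x :: "nat list \<Rightarrow> int \<times> int \<Rightarrow> bool" where
  "cross_x ts = (\<lambda>(hy, hz).
     list_all (\<lambda>y. list_all (\<lambda>z. list_all (free_present ts) (slab_cells 1 (13, y, z)) \<longrightarrow> y = hy \<and> z = hz) [0..5]) [0..13] \<and>
     list_all (\<lambda>y. list_all (\<lambda>z. \<not> list_all (free_present ts) (slab_cells 0 (13, y, z))) [0..6]) [0..12])"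

definition cross_y :: "nat list \<Rightarrow> int \<times> int \<Rightarrow> bool" where
  "cross_y ts = (\<lambda>(vx, vz).
     list_all (\<lambda>x. list_all (\<lambda>z. list_all (free_present ts) (slab_cells 2 (x, 13, z)) \<longrightarrow> x = vx \<and> z = vz) [0..5]) [0..13] \<and>
     list_all (\<lambda>x. list_all (\<lambda>z. \<not> list_all (free_present ts) (slab_cells 0 (x, 13, z))) [0..6]) [0..12])"

text \<open>The outermost rows and columns of the grid have ports of their own, since a bus runs
  along them. The last item deals with flat slabs where four blocks meet.\<close>

lemma cross_check:
  "cross_x [0, 6, 7, 8] (8, 4)" "cross_x [0, 3, 4, 5] (9, 4)" "cross_x [1, 2, 9, 10, 11, 12, 13, 14] (3, 1)"
  "cross_y [0, 9, 10, 11] (8, 1)" "cross_y [0, 12, 13, 14] (9, 1)" "cross_y [1, 2, 3, 4, 5, 6, 7, 8] (7, 4)"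
  "list_all (\<lambda>z. \<not> list_all (free_present [0..<15]) (slab_cells 0 (13, 13, z))) [0..6]"
  by code_simp+

text \<open>A corner has the port positions of two outer lines, whence four combinations, but no
  walls; so all its bits are 0.\<close>

lemma block_check_corner:
  "list_all (block_check 0 ((8, 4), 8, 1)) all_bits" "list_all (block_check 0 ((8, 4), 9, 1)) all_bits"
  "list_all (block_check 0 ((9, 4), 8, 1)) all_bits" "list_all (block_check 0 ((9, 4), 9, 1)) all_bits"
  by code_simp+

lemma block_check_plain: "list_all (block_check 1 ((3, 1), 7, 4)) all_bits"
  by code_simp

lemma block_check_filter: "list_all (block_check 2 ((3, 1), 7, 4)) all_bits"
  by code_simp

lemma block_check_top: "list_all (\<lambda>\<tau>. list_all (block_check \<tau> ((9, 4), 7, 4)) all_bits) [3, 4, 5]"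
  by code_simp

lemma block_check_bottom: "list_all (\<lambda>\<tau>. list_all (block_check \<tau> ((8, 4), 7, 4)) all_bits) [6, 7, 8]"
  by code_simp

lemma block_check_left: "list_all (\<lambda>\<tau>. list_all (block_check \<tau> ((3, 1), 8, 1)) all_bits) [9, 10, 11]"
  by code_simp

lemma block_check_right: "list_all (\<lambda>\<tau>. list_all (block_check \<tau> ((3, 1), 9, 1)) all_bits) [12, 13, 14]"
  by code_simp

section \<open>Wire configurations and assignments\<close>

text \<open>The common rule of the four sides: \<open>s\<close> says that the value is selected,
  that is, its wire carries 0, while \<open>p\<close> and \<open>q\<close> are the bus bits before
  and after the block.\<close>

definition side_ok :: "nat \<Rightarrow> bool \<Rightarrow> bool \<Rightarrow> bool \<Rightarrow> bool" where
  "side_ok k s p q \<longleftrightarrow>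
    (if k = 0 then \<not> p \<and> q = (\<not> s) else if k = 2 then \<not> q \<and> s = p else if s then p \<and> \<not> q else p = q)"

definition kind :: "nat \<Rightarrow> nat \<Rightarrow> nat" where
  "kind D j = (if j mod D = 0 then 0 else if j mod D = D - 1 then 2 else 1)"

lemma kind_less: "kind D j < 3"
  by (simp add: kind_def)

lemma block_ok_side:
  assumes "k < 3"
  shows "block_ok (3 + k) (l, r, b, t) \<longleftrightarrow> \<not> t \<and> side_ok k (\<not> b) l r"
    "block_ok (6 + k) (l, r, b, t) \<longleftrightarrow> \<not> b \<and> side_ok k (\<not> t) l r"
    "block_ok (9 + k) (l, r, b, t) \<longleftrightarrow> \<not> l \<and> side_ok k (\<not> r) b t"
    "block_ok (12 + k) (l, r, b, t) \<longleftrightarrow> \<not> r \<and> side_ok k (\<not> l) b t"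
proof -
  have "k = 0 \<or> k = 1 \<or> k = 2" using assms by auto
  then show "block_ok (3 + k) (l, r, b, t) \<longleftrightarrow> \<not> t \<and> side_ok k (\<not> b) l r"
    "block_ok (6 + k) (l, r, b, t) \<longleftrightarrow> \<not> b \<and> side_ok k (\<not> t) l r"
    "block_ok (9 + k) (l, r, b, t) \<longleftrightarrow> \<not> l \<and> side_ok k (\<not> r) b t"
    "block_ok (12 + k) (l, r, b, t) \<longleftrightarrow> \<not> r \<and> side_ok k (\<not> l) b t"
    by (elim disjE; simp add: block_ok_def side_ok_def; blast)+
qed

text \<open>Along a group the bus bit can only fall, and it falls precisely at a selected value. The
  first block forbids an incoming 1 and the last an outgoing one, so the bit falls exactly once,
  where a first value that is selected at once counts as a fall.\<close>

lemma side_choice: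
  assumes D: "2 \<le> D" and ok: "\<And>j. j < G * D \<Longrightarrow> side_ok (kind D j) (s j) (\<beta> j) (\<beta> (Suc j))" and g: "g < G"
  shows "\<exists>u<D. \<forall>v<D. (s (g * D + v) \<longleftrightarrow> v = u) \<and> (\<beta> (Suc (g * D + v)) \<longleftrightarrow> v < u)"
proof -
  define b where "b v = \<beta> (Suc (g * D + v))" for v
  have lt: "g * D + v < G * D" if "v < D" for v
  proof -
    have "Suc g * D \<le> G * D" using g by (intro mult_le_mono1) simp
    then show ?thesis using that by simp
  qed
  have kd: "kind D (g * D + v) = (if v = 0 then 0 else if v = D - 1 then 2 else 1)" if "v < D" for v
    using that by (simp add: kind_def)
  have pr: "\<beta> (g * D + v) = b (v - 1)" if "0 < v" for v using that by (simp add: b_def)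
  have t: "s (g * D + v) \<longleftrightarrow> (v = 0 \<or> b (v - 1)) \<and> \<not> b v" if v: "v < D" for v
  proof (cases "v = 0")
    case True
    then show ?thesis using ok[OF lt[OF v]] kd[OF v] by (simp add: side_ok_def b_def)
  next
    case False
    then have "0 < v" by simp
    then have o: "side_ok (if v = D - 1 then 2 else 1) (s (g * D + v)) (b (v - 1)) (b v)"
      using ok[OF lt[OF v]] unfolding kd[OF v] pr[OF \<open>0 < v\<close>] b_def[of v, symmetric] by simp
    show ?thesis
    proof (cases "v = D - 1")
      case True
      then show ?thesis using o False by (auto simp: side_ok_def)
    next
      case n: False
      then have "if s (g * D + v) then b (v - 1) \<and> \<not> b v else b (v - 1) = b v" using o by (simp add: side_ok_def)
      then show ?thesis using False by (cases "s (g * D + v)") auto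
    qed
  qed
  have mono: "v = 0 \<or> b (v - 1)" if v: "v < D" "b v" for v
  proof (cases "v = 0")
    case False
    then have "0 < v" by simp
    then have o: "side_ok (if v = D - 1 then 2 else 1) (s (g * D + v)) (b (v - 1)) (b v)"
      using ok[OF lt[OF v(1)]] unfolding kd[OF v(1)] pr[OF \<open>0 < v\<close>] b_def[of v, symmetric] by simp
    show ?thesis
    proof (cases "v = D - 1")
      case True
      then show ?thesis using o v(2) by (simp add: side_ok_def)
    next
      case n: False
      then have "if s (g * D + v) then b (v - 1) \<and> \<not> b v else b (v - 1) = b v" using o by (simp add: side_ok_def)
      then show ?thesis using v(2) by (cases "s (g * D + v)") simp_all
    qed
  qed simp
  have last: "\<not> b (D - 1)" using ok[OF lt, of "D - 1"] kd[of "D - 1"] D by (auto simp: side_ok_def b_def)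
  \<comment> \<open>The selected value is the one after which the bus carries 0 for the first
    time.\<close>
  define u where "u = (LEAST v. \<not> b v)"
  have u: "\<not> b u" "u \<le> D - 1" unfolding u_def by (rule LeastI[of "\<lambda>v. \<not> b v", OF last], rule Least_le, rule last)
  have below: "b v" if "v < u" for v using that not_less_Least unfolding u_def by blast
  have above: "u \<le> v \<Longrightarrow> v < D \<Longrightarrow> \<not> b v" for v
  proof (induction v)
    case 0
    then show ?case using u by simp
  next
    case (Suc v)
    then show ?case using mono[of "Suc v"] u by (cases "u = Suc v") auto
  qed
  have bv: "b v \<longleftrightarrow> v < u" if "v < D" for v using below above that by (meson not_le)
  have "s (g * D + v) \<longleftrightarrow> v = u" if v: "v < D" for v
    using t[OF v] bv[OF v] bv[of "v - 1"] v by auto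
  then show ?thesis using bv u D by (intro exI[of _ u]) (auto simp: b_def)
qed

text \<open>\<open>False\<close> marks edges in the direction of x and \<open>True\<close> those in
  the direction of y; an edge is named after its left or lower block.\<close>

definition edges :: "nat \<Rightarrow> (bool \<times> nat \<times> nat) set" where
  "edges n = {False} \<times> {..<n - 1} \<times> {..<n} \<union> {True} \<times> {..<n} \<times> {..<n - 1}"

definition bits :: "(bool \<times> nat \<times> nat) set \<Rightarrow> nat \<Rightarrow> nat \<Rightarrow> bool \<times> bool \<times> bool \<times> bool" where
  "bits Z I J = (0 < I \<and> (False, I - 1, J) \<in> Z, (False, I, J) \<in> Z, 0 < J \<and> (True, I, J - 1) \<in> Z, (True, I, J) \<in> Z)"

definition block_type :: "nat \<Rightarrow> nat \<Rightarrow> (nat \<Rightarrow> nat \<Rightarrow> nat \<Rightarrow> nat \<Rightarrow> bool) \<Rightarrow> nat \<Rightarrow> nat \<Rightarrow> nat" where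
  "block_type N D cf I J =
    (if J = 0 then if I = 0 \<or> I = N + 1 then 0 else 6 + kind D (I - 1)
     else if J = N + 1 then if I = 0 \<or> I = N + 1 then 0 else 3 + kind D (I - 1)
     else if I = 0 then 9 + kind D (J - 1) else if I = N + 1 then 12 + kind D (J - 1)
     else if cf ((I - 1) div D) ((I - 1) mod D) ((J - 1) div D) ((J - 1) mod D) then 2 else 1)"

text \<open>An edge in the set carries the bit 1. A wire carries 0 exactly if its value is the selected one, and
  the bus along a side carries 1 as long as no value of the current group has been selected.\<close>

definition wiring :: "nat \<Rightarrow> nat \<Rightarrow> (nat \<Rightarrow> nat) \<Rightarrow> (bool \<times> nat \<times> nat) set" where
  "wiring N D U = {(d, I, J). (d, I, J) \<in> edges (N + 2) \<and>
     (let a = (if d then J else I); c = (if d then I else J) in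
      if c = 0 \<or> c = N + 1 then 0 < a \<and> (a - 1) mod D < U ((a - 1) div D) else (c - 1) mod D \<noteq> U ((c - 1) div D))}"

lemma wiring_side:
  assumes "2 \<le> D" "\<And>g. g < G \<Longrightarrow> U g < D" "j < G * D"
  shows "side_ok (kind D j) (j mod D = U (j div D)) (0 < j \<and> (j - 1) mod D < U ((j - 1) div D)) (j mod D < U (j div D))"
proof -
  have jd: "j div D < G" using assms(3) by (rule less_mult_imp_div_less)
  have u: "U (j div D) < D" using assms(2)[OF jd] .
  show ?thesis
  proof (cases "j mod D = 0")
    case True
    \<comment> \<open>The preceding block is the last one of the previous group, and there the bus
      has ended because a selected value is at most \<open>D - 1\<close>.\<close>
    have "\<not> (j - 1) mod D < U ((j - 1) div D)" if j: "0 < j"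
    proof -
      obtain k where k: "j = k * D" using True by (metis mod_eq_0_iff_dvd dvd_def mult.commute)
      then obtain k' where k': "k = Suc k'" using j by (cases k) auto
      define c where "c = D - 1"
      have c: "c < D" using assms(1) by (simp add: c_def)
      have e: "j - 1 = k' * D + c" using k k' assms(1) by (simp add: c_def)
      have "(j - 1) mod D = c" "(j - 1) div D = k'" unfolding e using c by simp_all
      then have "(j - 1) mod D = D - 1" "(j - 1) div D = k'" by (simp_all add: c_def)
      moreover have "k' < G" using jd k k' assms(1) by simp
      ultimately show ?thesis using assms(2)[of k'] by simp
    qed
    then show ?thesis using True by (auto simp: side_ok_def kind_def)
  next
    case False
    then have j: "0 < j" by (cases j) auto
    have e: "j = (j div D) * D + j mod D" by simp
    then have "j - 1 = (j div D) * D + (j mod D - 1)" using False by linarith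
    moreover have "j mod D - 1 < D" using assms(1) by (metis less_imp_diff_less mod_less_divisor less_le_trans zero_less_numeral)
    ultimately have "(j - 1) mod D = j mod D - 1" "(j - 1) div D = j div D"
      using assms(1) by (metis mod_mult_self3 mod_less, metis div_mult_self3 div_less add.right_neutral add_0 add.commute not_numeral_le_zero)
    then show ?thesis using False j u by (auto simp: side_ok_def kind_def)
  qed
qed

text \<open>The left and the right bus see the same rows and hence select the same values; likewise
  the bottom and the top bus for the columns. By \<open>diag\<close> there are filters at all
  crossings of distinct values of one variable, which forces rows and columns to agree. The
  remaining filters are the constraints proper.\<close>

lemma card_wirings:
  fixes cf :: "nat \<Rightarrow> nat \<Rightarrow> nat \<Rightarrow> nat \<Rightarrow> bool"
  assumes D: "2 \<le> D" and G: "0 < G" and diag: "\<And>g v v'. v \<noteq> v' \<Longrightarrow> cf g v g v'"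
  defines "N \<equiv> G * D"
  shows "card {Z. Z \<subseteq> edges (N + 2) \<and> (\<forall>I<N + 2. \<forall>J<N + 2. block_ok (block_type N D cf I J) (bits Z I J))} =
    card {U \<in> {..<G} \<rightarrow>\<^sub>E {..<D}. \<forall>g<G. \<forall>g'<G. \<not> cf g (U g) g' (U g')}"
proof -
  have N: "0 < N" using D G by (simp add: N_def)
  have dv: "j div D < G" if "j < N" for j using that unfolding N_def by (rule less_mult_imp_div_less)
  have gv: "(g * D + v) div D = g" "(g * D + v) mod D = v" if "v < D" for g v using that by simp_all
  have lt: "g * D + v < N" if "v < D" "g < G" for g v
  proof -
    have "Suc g * D \<le> G * D" using that by (intro mult_le_mono1) simp
    then show ?thesis using that by (simp add: N_def)
  qed
  have dm: "j div D * D + j mod D = j" "j mod D < D" for j using D by simp_all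
  let ?V = "{Z. Z \<subseteq> edges (N + 2) \<and> (\<forall>I<N + 2. \<forall>J<N + 2. block_ok (block_type N D cf I J) (bits Z I J))}"
  let ?S = "{U \<in> {..<G} \<rightarrow>\<^sub>E {..<D}. \<forall>g<G. \<forall>g'<G. \<not> cf g (U g) g' (U g')}"
  have inj: "inj_on (wiring N D) ?S"
  proof (rule inj_onI)
    fix U U' assume U: "U \<in> ?S" "U' \<in> ?S" and eq: "wiring N D U = wiring N D U'"
    have "U g = U' g" if g: "g < G" for g
    proof -
      have v: "U g < D" using U(1) g by auto
      have "(False, 0, Suc (g * D + U g)) \<notin> wiring N D U" using v lt[OF v g] gv[OF v] by (simp add: wiring_def)
      then have "(False, 0, Suc (g * D + U g)) \<notin> wiring N D U'" unfolding eq .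
      then show ?thesis using v lt[OF v g] gv[OF v] by (auto simp: wiring_def edges_def)
    qed
    then show "U = U'" using U by (intro PiE_ext[of U "{..<G}" "\<lambda>_. {..<D}" U']) auto
  qed
  have into: "wiring N D U \<in> ?V" if U: "U \<in> ?S" for U
  proof -
    let ?Z = "wiring N D U"
    have ug: "U g < D" if "g < G" for g using U that by auto
    have side: "side_ok (kind D j) (j mod D = U (j div D)) (0 < j \<and> (j - 1) mod D < U ((j - 1) div D)) (j mod D < U (j div D))"
      if "j < N" for j using wiring_side[OF D, of G U j] ug that unfolding N_def by blast
    have wf: "(False, I, J) \<in> ?Z \<longleftrightarrow> I < N + 1 \<and> J < N + 2 \<and> (if J = 0 \<or> J = N + 1
        then 0 < I \<and> (I - 1) mod D < U ((I - 1) div D) else (J - 1) mod D \<noteq> U ((J - 1) div D))"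
      and wt: "(True, I, J) \<in> ?Z \<longleftrightarrow> I < N + 2 \<and> J < N + 1 \<and> (if I = 0 \<or> I = N + 1
        then 0 < J \<and> (J - 1) mod D < U ((J - 1) div D) else (I - 1) mod D \<noteq> U ((I - 1) div D))" for I J
      by (auto simp: wiring_def edges_def)
    have end_bus: "\<not> (N - 1) mod D < U ((N - 1) div D)"
    proof -
      have "N - 1 = (G - 1) * D + (D - 1)" using D G unfolding N_def by (cases G) simp_all
      then have "(N - 1) mod D = D - 1" "(N - 1) div D = G - 1" using gv[of "D - 1" "G - 1"] D by simp_all
      then show ?thesis using ug[of "G - 1"] G by simp
    qed
    have "block_ok (block_type N D cf I J) (bits ?Z I J)" if IJ: "I < N + 2" "J < N + 2" for I J
    proof -
      consider (c) "(I = 0 \<or> I = N + 1) \<and> (J = 0 \<or> J = N + 1)" | (b) i where "I = Suc i" "i < N" "J = 0"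
        | (t) i where "I = Suc i" "i < N" "J = N + 1" | (l) j where "J = Suc j" "j < N" "I = 0"
        | (r) j where "J = Suc j" "j < N" "I = N + 1" | (m) i j where "I = Suc i" "i < N" "J = Suc j" "j < N"
        using IJ by (cases I; cases J) (auto simp: less_Suc_eq)
      then show ?thesis
      proof cases
        case c
        then have t: "block_type N D cf I J = 0" by (auto simp: block_type_def)
        have "bits ?Z I J = (False, False, False, False)"
          unfolding bits_def wf wt using c end_bus N by (elim conjE disjE) simp_all
        then show ?thesis by (simp add: t block_ok_def)
      next
        case b
        then show ?thesis using side[of i] N by (simp add: block_type_def block_ok_side(2)[OF kind_less] bits_def wf wt)
      next
        case t
        then show ?thesis using side[of i] N by (simp add: block_type_def block_ok_side(1)[OF kind_less] bits_def wf wt)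
      next
        case l
        then show ?thesis using side[of j] N by (simp add: block_type_def block_ok_side(3)[OF kind_less] bits_def wf wt)
      next
        case r
        then show ?thesis using side[of j] N by (simp add: block_type_def block_ok_side(4)[OF kind_less] bits_def wf wt)
      next
        case m
        have "i mod D \<noteq> U (i div D) \<or> j mod D \<noteq> U (j div D)" if "cf (i div D) (i mod D) (j div D) (j mod D)"
          using U dv[OF m(2)] dv[OF m(4)] that by auto
        then show ?thesis using m by (auto simp: block_type_def block_ok_def bits_def wf wt)
      qed
    qed
    then have "\<forall>I<N + 2. \<forall>J<N + 2. block_ok (block_type N D cf I J) (bits ?Z I J)" by blast
    moreover have "?Z \<subseteq> edges (N + 2)"
    proof
      fix e assume e: "e \<in> ?Z"
      obtain d I J where e': "e = (d, I, J)" by (metis prod_cases3)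
      show "e \<in> edges (N + 2)" using e unfolding e' wiring_def mem_Collect_eq prod.case by (rule conjunct1)
    qed
    ultimately show ?thesis by (intro CollectI conjI)
  qed
  have onto: "Z \<in> wiring N D ` ?S" if Z: "Z \<in> ?V" for Z
  proof -
    have ok: "block_ok (block_type N D cf I J) (bits Z I J)" if "I < N + 2" "J < N + 2" for I J using Z that by blast
    have sub: "Z \<subseteq> edges (N + 2)" using Z by blast
    \<comment> \<open>Both kinds of inner blocks pass the bits straight on, so a wire has a single
      bit.\<close>
    have row: "(False, I, Suc j) \<in> Z \<longleftrightarrow> (False, 0, Suc j) \<in> Z" if "j < N" "I \<le> N" for I j
      using \<open>I \<le> N\<close>
    proof (induction I)
      case (Suc I)
      then show ?case using ok[of "Suc I" "Suc j"] that by (auto simp: block_type_def block_ok_def bits_def split: if_splits)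
    qed simp
    have col: "(True, Suc i, J) \<in> Z \<longleftrightarrow> (True, Suc i, 0) \<in> Z" if "i < N" "J \<le> N" for J i
      using \<open>J \<le> N\<close>
    proof (induction J)
      case (Suc J)
      then show ?case using ok[of "Suc i" "Suc J"] that by (auto simp: block_type_def block_ok_def bits_def split: if_splits)
    qed simp
    have ol: "side_ok (kind D j) ((False, 0, Suc j) \<notin> Z) ((True, 0, j) \<in> Z) ((True, 0, Suc j) \<in> Z)" if "j < G * D" for j
      using ok[of 0 "Suc j"] that by (simp add: block_type_def block_ok_side(3)[OF kind_less] bits_def N_def)
    have or: "side_ok (kind D j) ((False, 0, Suc j) \<notin> Z) ((True, N + 1, j) \<in> Z) ((True, N + 1, Suc j) \<in> Z)" if "j < G * D" for j
      using ok[of "N + 1" "Suc j"] that row[of j N] by (simp add: block_type_def block_ok_side(4)[OF kind_less] bits_def N_def)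
    have ob: "side_ok (kind D i) ((True, Suc i, 0) \<notin> Z) ((False, i, 0) \<in> Z) ((False, Suc i, 0) \<in> Z)" if "i < G * D" for i
      using ok[of "Suc i" 0] that by (simp add: block_type_def block_ok_side(2)[OF kind_less] bits_def N_def)
    have ot: "side_ok (kind D i) ((True, Suc i, 0) \<notin> Z) ((False, i, N + 1) \<in> Z) ((False, Suc i, N + 1) \<in> Z)" if "i < G * D" for i
      using ok[of "Suc i" "N + 1"] that col[of i N] by (simp add: block_type_def block_ok_side(1)[OF kind_less] bits_def N_def)
    have key: "\<exists>u<D. \<forall>v<D. ((False, 0, Suc (g * D + v)) \<notin> Z \<longleftrightarrow> v = u) \<and> ((True, Suc (g * D + v), 0) \<notin> Z \<longleftrightarrow> v = u) \<and>
      ((True, 0, Suc (g * D + v)) \<in> Z \<longleftrightarrow> v < u) \<and> ((True, N + 1, Suc (g * D + v)) \<in> Z \<longleftrightarrow> v < u) \<and>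
      ((False, Suc (g * D + v), 0) \<in> Z \<longleftrightarrow> v < u) \<and> ((False, Suc (g * D + v), N + 1) \<in> Z \<longleftrightarrow> v < u)" if g: "g < G" for g
    proof -
      obtain a where a: "a < D" "\<And>v. v < D \<Longrightarrow> ((False, 0, Suc (g * D + v)) \<notin> Z \<longleftrightarrow> v = a) \<and> ((True, 0, Suc (g * D + v)) \<in> Z \<longleftrightarrow> v < a)"
        using side_choice[OF D ol g] by blast
      obtain b where b: "b < D" "\<And>v. v < D \<Longrightarrow> ((False, 0, Suc (g * D + v)) \<notin> Z \<longleftrightarrow> v = b) \<and> ((True, N + 1, Suc (g * D + v)) \<in> Z \<longleftrightarrow> v < b)"
        using side_choice[OF D or g] by blast
      obtain c where c: "c < D" "\<And>v. v < D \<Longrightarrow> ((True, Suc (g * D + v), 0) \<notin> Z \<longleftrightarrow> v = c) \<and> ((False, Suc (g * D + v), 0) \<in> Z \<longleftrightarrow> v < c)"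
        using side_choice[OF D ob g] by blast
      obtain d where d: "d < D" "\<And>v. v < D \<Longrightarrow> ((True, Suc (g * D + v), 0) \<notin> Z \<longleftrightarrow> v = d) \<and> ((False, Suc (g * D + v), N + 1) \<in> Z \<longleftrightarrow> v < d)"
        using side_choice[OF D ot g] by blast
      have ba: "b = a" "d = c" using a(2)[OF a(1)] b(2)[OF a(1)] c(2)[OF c(1)] d(2)[OF c(1)] by simp_all
      \<comment> \<open>Otherwise the row of \<open>a\<close> and the column of \<open>c\<close>,
        both carrying 0, would meet in a filter.\<close>
      have "a = c"
      proof (rule ccontr)
        assume "a \<noteq> c"
        then have "cf g c g a" using diag[of c a g] by simp
        then have "block_ok 2 (bits Z (Suc (g * D + c)) (Suc (g * D + a)))"
          using ok[of "Suc (g * D + c)" "Suc (g * D + a)"] lt[OF a(1) g] lt[OF c(1) g] gv[OF a(1)] gv[OF c(1)]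
          by (simp add: block_type_def)
        moreover have "(False, g * D + c, Suc (g * D + a)) \<notin> Z" "(True, Suc (g * D + c), g * D + a) \<notin> Z"
          using row[of "g * D + a" "g * D + c"] col[of "g * D + c" "g * D + a"] lt[OF a(1) g] lt[OF c(1) g] a(2)[OF a(1)] c(2)[OF c(1)]
          by simp_all
        ultimately show False by (simp add: block_ok_def bits_def)
      qed
      then show ?thesis using a b c d ba by (intro exI[of _ a]) simp
    qed
    define u where "u g = (SOME u. u < D \<and> (\<forall>v<D. ((False, 0, Suc (g * D + v)) \<notin> Z \<longleftrightarrow> v = u) \<and> ((True, Suc (g * D + v), 0) \<notin> Z \<longleftrightarrow> v = u) \<and>
      ((True, 0, Suc (g * D + v)) \<in> Z \<longleftrightarrow> v < u) \<and> ((True, N + 1, Suc (g * D + v)) \<in> Z \<longleftrightarrow> v < u) \<and>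
      ((False, Suc (g * D + v), 0) \<in> Z \<longleftrightarrow> v < u) \<and> ((False, Suc (g * D + v), N + 1) \<in> Z \<longleftrightarrow> v < u)))" for g
    have u: "u g < D \<and> (\<forall>v<D. ((False, 0, Suc (g * D + v)) \<notin> Z \<longleftrightarrow> v = u g) \<and> ((True, Suc (g * D + v), 0) \<notin> Z \<longleftrightarrow> v = u g) \<and>
      ((True, 0, Suc (g * D + v)) \<in> Z \<longleftrightarrow> v < u g) \<and> ((True, N + 1, Suc (g * D + v)) \<in> Z \<longleftrightarrow> v < u g) \<and>
      ((False, Suc (g * D + v), 0) \<in> Z \<longleftrightarrow> v < u g) \<and> ((False, Suc (g * D + v), N + 1) \<in> Z \<longleftrightarrow> v < u g))" if "g < G" for g
      unfolding u_def by (rule someI_ex[OF key[OF that]])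
    define U where "U = restrict u {..<G}"
    have Ue: "U g = u g" if "g < G" for g using that by (simp add: U_def)
    have uj: "((False, 0, Suc j) \<notin> Z \<longleftrightarrow> j mod D = U (j div D))" "((True, Suc j, 0) \<notin> Z \<longleftrightarrow> j mod D = U (j div D))"
      "((True, 0, Suc j) \<in> Z \<longleftrightarrow> j mod D < U (j div D))" "((True, N + 1, Suc j) \<in> Z \<longleftrightarrow> j mod D < U (j div D))"
      "((False, Suc j, 0) \<in> Z \<longleftrightarrow> j mod D < U (j div D))" "((False, Suc j, N + 1) \<in> Z \<longleftrightarrow> j mod D < U (j div D))" if "j < N" for j
      using u[OF dv[OF that], THEN conjunct2, THEN spec, THEN mp, OF dm(2)[of j], unfolded dm(1)]
      unfolding Ue[OF dv[OF that]] by blast+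
    have c0: "(False, 0, 0) \<notin> Z" "(True, 0, 0) \<notin> Z" "(True, N + 1, 0) \<notin> Z" "(False, 0, N + 1) \<notin> Z"
      using ok[of 0 0] ok[of "N + 1" 0] ok[of 0 "N + 1"] by (auto simp: block_type_def block_ok_def bits_def split: if_splits)
    have nc: "\<not> cf g (U g) g' (U g')" if g: "g < G" "g' < G" for g g'
    proof
      assume cf: "cf g (U g) g' (U g')"
      have v: "U g < D" "U g' < D" using conjunct1[OF u[OF g(1)]] conjunct1[OF u[OF g(2)]] Ue g by simp_all
      have "block_ok 2 (bits Z (Suc (g * D + U g)) (Suc (g' * D + U g')))"
        using ok[of "Suc (g * D + U g)" "Suc (g' * D + U g')"] lt[OF v(1) g(1)] lt[OF v(2) g(2)] gv[OF v(1)] gv[OF v(2)] cf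
        by (simp add: block_type_def)
      moreover have "(False, g * D + U g, Suc (g' * D + U g')) \<notin> Z" "(True, Suc (g * D + U g), g' * D + U g') \<notin> Z"
        using row[of "g' * D + U g'" "g * D + U g"] col[of "g * D + U g" "g' * D + U g'"] lt[OF v(1) g(1)] lt[OF v(2) g(2)]
          uj(1)[OF lt[OF v(2) g(2)]] uj(2)[OF lt[OF v(1) g(1)]] gv[OF v(1)] gv[OF v(2)] by simp_all
      ultimately show False by (simp add: block_ok_def bits_def)
    qed
    have "(d, I, J) \<in> Z \<longleftrightarrow> (d, I, J) \<in> wiring N D U" for d I J
    proof (cases "(d, I, J) \<in> edges (N + 2)")
      case True
      show ?thesis
      proof (cases d)
        case False
        then have IJ: "I \<le> N" "J \<le> N + 1" using True by (auto simp: edges_def)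
        show ?thesis
        proof (cases "J = 0 \<or> J = N + 1")
          case bus: True
          then show ?thesis using c0 uj(5,6)[of "I - 1"] IJ True False by (cases I) (auto simp: wiring_def)
        next
          case wire: False
          then show ?thesis using row[of "J - 1" I] uj(1)[of "J - 1"] IJ True False by (cases J) (auto simp: wiring_def)
        qed
      next
        case d: True
        then have IJ: "J \<le> N" "I \<le> N + 1" using True by (auto simp: edges_def)
        show ?thesis
        proof (cases "I = 0 \<or> I = N + 1")
          case bus: True
          then show ?thesis using c0 uj(3,4)[of "J - 1"] IJ True d by (cases J) (auto simp: wiring_def)
        next
          case wire: False
          then show ?thesis using col[of "I - 1" J] uj(2)[of "I - 1"] IJ True d by (cases I) (auto simp: wiring_def)
        qed
      qed
    next
      case False
      then show ?thesis using sub by (auto simp: wiring_def)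
    qed
    then have "Z = wiring N D U" by auto
    moreover have "U \<in> {..<G} \<rightarrow>\<^sub>E {..<D}" using conjunct1[OF u] by (auto simp: U_def)
    then have "U \<in> ?S" using nc by simp
    ultimately show ?thesis by blast
  qed
  have "?V = wiring N D ` ?S"
  proof (rule equalityI)
    show "?V \<subseteq> wiring N D ` ?S" by (rule subsetI, rule onto)
    show "wiring N D ` ?S \<subseteq> ?V" by (rule image_subsetI, rule into)
  qed
  then have "card ?V = card (wiring N D ` ?S)" by (rule arg_cong)
  then show ?thesis unfolding card_image[OF inj] .
qed

section \<open>The region composed of blocks\<close>

text \<open>Walls above the plate start at z = 4, walls below it at z = 1. Rows of wires lie below,
  but the buses along the bottom and the top of the grid lie above; \<open>vport\<close> has it the
  other way round.\<close>

definition hport :: "nat \<Rightarrow> nat \<Rightarrow> int \<times> int" where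
  "hport n J = (if J = 0 then (8, 4) else if J = n - 1 then (9, 4) else (3, 1))"

definition vport :: "nat \<Rightarrow> nat \<Rightarrow> int \<times> int" where
  "vport n I = (if I = 0 then (8, 1) else if I = n - 1 then (9, 1) else (7, 4))"

definition row_types :: "nat \<Rightarrow> nat \<Rightarrow> nat list" where
  "row_types n J = (if J = 0 then [0, 6, 7, 8] else if J = n - 1 then [0, 3, 4, 5] else [1, 2, 9, 10, 11, 12, 13, 14])"

definition col_types :: "nat \<Rightarrow> nat \<Rightarrow> nat list" where
  "col_types n I = (if I = 0 then [0, 9, 10, 11] else if I = n - 1 then [0, 12, 13, 14] else [1, 2, 3, 4, 5, 6, 7, 8])"

definition valid_types :: "nat \<Rightarrow> (nat \<Rightarrow> nat \<Rightarrow> nat) \<Rightarrow> bool" where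
  "valid_types n ty \<longleftrightarrow> (\<forall>I<n. \<forall>J<n. ty I J \<in> set (row_types n J) \<and> ty I J \<in> set (col_types n I))"

definition region :: "nat \<Rightarrow> (nat \<Rightarrow> nat \<Rightarrow> nat) \<Rightarrow> cell set" where
  "region n ty = {(x, y, z). 0 \<le> x \<and> x < 14 * int n \<and> 0 \<le> y \<and> y < 14 * int n \<and>
     occupied (ty (nat (x div 14)) (nat (y div 14))) (bump (x mod 14) (y mod 14)) (x mod 14) (y mod 14) z}"

definition translate :: "nat \<Rightarrow> nat \<Rightarrow> cell \<Rightarrow> cell" where
  "translate I J = (\<lambda>(x, y, z). (x + 14 * int I, y + 14 * int J, z))"

definition free :: "nat \<Rightarrow> (nat \<Rightarrow> nat \<Rightarrow> nat) \<Rightarrow> cell set" where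
  "free n ty = (\<Union>(I, J)\<in>{..<n} \<times> {..<n}. translate I J ` inner (ty I J))"

definition edge_slab :: "nat \<Rightarrow> bool \<times> nat \<times> nat \<Rightarrow> cell set" where
  "edge_slab n = (\<lambda>(d, I, J). translate I J ` set (if d then slab_cells 2 (fst (vport n I), 13, snd (vport n I))
     else slab_cells 1 (13, fst (hport n J), snd (hport n J))))"

lemma decompose_14:
  fixes a a' :: int
  assumes "0 \<le> a" "a < 14" "0 \<le> a'" "a' < 14"
  shows "a + 14 * int I = a' + 14 * int I' \<longleftrightarrow> I = I' \<and> a = a'"
  using assms by (cases I I' rule: linorder_cases) simp_all

lemma translate_inject: "in_block a b \<Longrightarrow> in_block a' b' \<Longrightarrow>
    translate I J (a, b, z) = translate I' J' (a', b', z') \<longleftrightarrow> I = I' \<and> J = J' \<and> a = a' \<and> b = b' \<and> z = z'"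
  using decompose_14[of a a' I I'] decompose_14[of b b' J J'] by (auto simp: translate_def in_block_def)

lemma inj_translate: "inj (translate I J)"
  by (auto simp: inj_def translate_def)

lemma is_slab_move: "is_slab (translate I J ` S) \<longleftrightarrow> is_slab S"
  unfolding translate_def by (rule is_slab_translate)

lemma translate_slab_cells: "translate I J ` set (slab_cells k (x, y, z)) = set (slab_cells k (x + 14 * int I, y + 14 * int J, z))"
  by (simp add: translate_def ac_simps)

lemma is_slab_cases: "is_slab T \<Longrightarrow> \<exists>k x y z. k < 3 \<and> T = set (slab_cells k (x, y, z))"
proof -
  assume "is_slab T"
  then obtain k x y z where T: "T = set (slab_cells k (x, y, z))" unfolding is_slab_def by (metis prod_cases3)
  have "slab_cells k (x, y, z) = slab_cells 2 (x, y, z)" if "\<not> k < 3" using that by simp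
  then show ?thesis using T by (cases "k < 3") (metis, metis lessI numeral_2_eq_2 numeral_3_eq_3)
qed

lemma reduce_14: "\<exists>I J a b. I < n \<and> J < n \<and> in_block a b \<and> (x, y, z) = translate I J (a, b, z)"
  if "0 \<le> x" "x < 14 * int n" "0 \<le> y" "y < 14 * int n" for x y z
proof -
  have *: "\<exists>I a. I < n \<and> 0 \<le> a \<and> a < 14 \<and> x = a + 14 * int I" if "0 \<le> x" "x < 14 * int n" for x :: int
  proof -
    have "nat (x div 14) < n" using that by (simp add: nat_less_iff)
    moreover have "x = x mod 14 + 14 * int (nat (x div 14))" using that by simp
    moreover have "0 \<le> x mod 14 \<and> x mod 14 < 14" by simp
    ultimately show ?thesis by blast
  qed
  show ?thesis using *[of x] *[of y] that by (auto simp: translate_def in_block_def)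
qed

lemma region_translate: "in_block a b \<Longrightarrow> translate I J (a, b, z) \<in> region n ty \<longleftrightarrow> I < n \<and> J < n \<and> occupied (ty I J) (bump a b) a b z"
proof -
  assume ab: "in_block a b"
  have *: "(a + 14 * int I) div 14 = int I" "(a + 14 * int I) mod 14 = a" "0 \<le> a + 14 * int I"
    "a + 14 * int I < 14 * int n \<longleftrightarrow> I < n" if "0 \<le> a" "a < 14" for a I
  proof -
    show "a + 14 * int I < 14 * int n \<longleftrightarrow> I < n" using that by (cases "I < n") simp_all
  qed (use that in simp_all)
  show ?thesis using ab *[of a I] *[of b J] by (simp add: region_def translate_def in_block_def)
qed

lemma free_translate: "in_block a b \<Longrightarrow> translate I J (a, b, z) \<in> free n ty \<longleftrightarrow> I < n \<and> J < n \<and> (a, b, z) \<in> inner (ty I J)"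
proof
  assume ab: "in_block a b" and "translate I J (a, b, z) \<in> free n ty"
  then obtain I' J' p where p: "I' < n" "J' < n" "p \<in> inner (ty I' J')" "translate I J (a, b, z) = translate I' J' p"
    by (auto simp: free_def)
  obtain a' b' z' where p': "p = (a', b', z')" by (metis prod_cases3)
  have "in_block a' b'" using p(3) by (simp add: p' inner_def)
  then show "I < n \<and> J < n \<and> (a, b, z) \<in> inner (ty I J)" using p translate_inject[OF ab] by (simp add: p')
qed (auto simp: free_def)

lemma in_freeE: "p \<in> free n ty \<Longrightarrow> \<exists>I J a b z. I < n \<and> J < n \<and> in_block a b \<and> p = translate I J (a, b, z) \<and> (a, b, z) \<in> inner (ty I J)"
proof -
  assume "p \<in> free n ty"
  then obtain I J q where q: "I < n" "J < n" "q \<in> inner (ty I J)" "p = translate I J q" by (auto simp: free_def)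
  obtain a b z where q': "q = (a, b, z)" by (metis prod_cases3)
  have "in_block a b" using q(3) by (simp add: q' inner_def)
  then show ?thesis using q unfolding q' by blast
qed

lemma fence_occupied: "in_block a b \<Longrightarrow> fence (bump a b) a b z \<Longrightarrow> occupied \<tau> (bump a b) a b z"
  using wall_bound[of \<tau> a b] bump_bound[of a b] by (auto simp: fence_def occupied_def)

lemma fence_list_iff: "in_block a b \<Longrightarrow> (a, b, z) \<in> set fence_list \<longleftrightarrow> fence (bump a b) a b z"
proof
  assume ab: "in_block a b" and f: "fence (bump a b) a b z"
  have a: "0 \<le> a" "a < 14" "0 \<le> b" "b < 14" using ab by (simp_all add: in_block_def)
  have z: "z \<in> set [2, 3, 4]" using f bump_bound[OF ab] by (auto simp: fence_def)
  have "(a, bumps ! nat a) \<in> set (zip [0..13] bumps)"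
    unfolding in_set_zip using a bumps_shape(1) by (intro exI[of _ "nat a"]) (simp add: nth_upto nat_less_iff)
  moreover have "(b, bump a b) \<in> set (zip [0..13] (bumps ! nat a))" using zip_bumps[OF a(1,2)] a by simp
  ultimately show "(a, b, z) \<in> set fence_list" using fence_list_check(2) z f unfolding list_all_iff by blast
next
  assume "(a, b, z) \<in> set fence_list"
  then show "fence (bump a b) a b z" using fence_list_check(1) unfolding list_all_iff by blast
qed

lemma fence_disjoint_check:
  "list_all (\<lambda>(w, k, c). list_all (\<lambda>(w', k', c'). slab_cells k c = slab_cells k' c' \<or>
     list_all (\<lambda>p. p \<notin> set (slab_cells k' c')) (slab_cells k c)) fence_slabs) fence_slabs"
  by code_simp

lemma slab_in_covering: "w \<in> set (slab_cells k c) \<Longrightarrow> slab_cells k c \<in> set (covering w)"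
proof -
  assume w: "w \<in> set (slab_cells k c)"
  obtain x y z where c: "c = (x, y, z)" by (metis prod_cases3)
  consider "k = 0" | "k = 1" | "k \<noteq> 0" "k \<noteq> 1" by blast
  then show ?thesis using w by cases (auto simp: c covering_def)
qed

lemma region_present:
  assumes "translate I J p \<in> region n ty" "\<And>I J. I < n \<Longrightarrow> J < n \<Longrightarrow> ty I J < 15"
  shows "present [0..<15] p"
proof -
  obtain x y z where p: "p = (x, y, z)" by (metis prod_cases3)
  obtain I' J' a b where ab: "I' < n" "J' < n" "in_block a b" "translate I J p = translate I' J' (a, b, z)"
    using assms(1) reduce_14[of "x + 14 * int I" n "y + 14 * int J" z] by (auto simp: p translate_def region_def)
  have "(x + 14 * int I) mod 14 = (a + 14 * int I') mod 14" "(y + 14 * int J) mod 14 = (b + 14 * int J') mod 14"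
    using ab(4) by (simp_all add: p translate_def)
  then have m: "x mod 14 = a" "y mod 14 = b" using ab(3) by (simp_all add: in_block_def)
  have "occupied (ty I' J') (bump a b) a b z" using assms(1) region_translate[OF ab(3), of I' J' z n ty] ab(4) by simp
  then show ?thesis using assms(2)[OF ab(1,2)] unfolding present_def p Let_def prod.case m list_ex_iff
    by (intro bexI[of _ "ty I' J'"]) simp_all
qed

lemma valid_types_less: "valid_types n ty \<Longrightarrow> I < n \<Longrightarrow> J < n \<Longrightarrow> ty I J < 15"
  unfolding valid_types_def by (drule spec[of _ I], drule mp, assumption, drule spec[of _ J])
    (auto simp: row_types_def split: if_splits)

text \<open>All fences are forced simultaneously. A slab of the region through a witness, moved back
  to the block at the origin, consists of cells that are \<open>present\<close>, and by evaluation
  only the fence slab is left.\<close>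

lemma card_tilings_free:
  assumes ty: "valid_types n ty"
  shows "card (tilings is_slab (region n ty)) = card (tilings is_slab (free n ty))"
proof -
  define F where "F = (\<lambda>((I, J), (w, k, c)). translate I J ` set (slab_cells k c)) ` (({..<n} \<times> {..<n}) \<times> set fence_slabs)"
  have FE: "\<exists>I J w k c. I < n \<and> J < n \<and> (w, k, c) \<in> set fence_slabs \<and> S = translate I J ` set (slab_cells k c)" if SF: "S \<in> F" for S
  proof -
    from SF[unfolded F_def] obtain e where e: "S = (\<lambda>((I, J), (w, k, c)). translate I J ` set (slab_cells k c)) e"
      "e \<in> ({..<n} \<times> {..<n}) \<times> set fence_slabs" by (rule imageE)
    obtain I J w k c where e': "e = ((I, J), (w, k, c))" by (metis prod.exhaust)
    have "I < n" "J < n" "(w, k, c) \<in> set fence_slabs" using e(2) by (simp_all add: e')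
    moreover have "S = translate I J ` set (slab_cells k c)" using e(1) by (simp only: e' prod.case)
    ultimately show ?thesis by blast
  qed
  have FI: "translate I J ` set (slab_cells k c) \<in> F" if "I < n" "J < n" "(w, k, c) \<in> set fence_slabs" for I J w k c
    unfolding F_def by (rule image_eqI[of _ _ "((I, J), (w, k, c))"], simp only: prod.case)
      (intro SigmaI, simp_all only: lessThan_iff that)
  have fl: "set fence_list = (\<Union>(w, k, c)\<in>set fence_slabs. set (slab_cells k c))"
    by (simp add: fence_list_def case_prod_unfold)
  have blk: "in_block a b" if "(a, b, z) \<in> set (slab_cells k c)" "(w, k, c) \<in> set fence_slabs" for a b z w k c
  proof -
    have "(a, b, z) \<in> set fence_list" unfolding fl using that by blast
    then show ?thesis using fence_list_check(1) unfolding list_all_iff by blast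
  qed
  have UF: "translate I J (a, b, z) \<in> \<Union>F \<longleftrightarrow> I < n \<and> J < n \<and> fence (bump a b) a b z" if ab: "in_block a b" for I J a b z
  proof
    assume "translate I J (a, b, z) \<in> \<Union>F"
    then obtain S where S: "S \<in> F" "translate I J (a, b, z) \<in> S" by blast
    from FE[OF S(1)] S(2) obtain I' J' w k c p where p: "I' < n" "J' < n" "(w, k, c) \<in> set fence_slabs" "p \<in> set (slab_cells k c)"
      "translate I J (a, b, z) = translate I' J' p" by blast
    obtain a' b' z' where p': "p = (a', b', z')" by (metis prod_cases3)
    have "I = I'" "J = J'" "p = (a, b, z)" using translate_inject[OF ab blk[OF p(4)[unfolded p'] p(3)]] p(5) by (simp_all add: p')
    moreover have "p \<in> set fence_list" unfolding fl using p(3,4) by blast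
    ultimately show "I < n \<and> J < n \<and> fence (bump a b) a b z" using p fence_list_iff[OF ab] by simp
  next
    assume *: "I < n \<and> J < n \<and> fence (bump a b) a b z"
    then have "(a, b, z) \<in> set fence_list" using fence_list_iff[OF ab] by simp
    then obtain w k c where "(w, k, c) \<in> set fence_slabs" "(a, b, z) \<in> set (slab_cells k c)" unfolding fl by blast
    then show "translate I J (a, b, z) \<in> \<Union>F" using FI * by blast
  qed
  have sub: "S \<subseteq> region n ty" if S: "S \<in> F" for S
  proof
    fix p assume p: "p \<in> S"
    from FE[OF S] p obtain I J w k c q where q: "I < n" "J < n" "(w, k, c) \<in> set fence_slabs" "q \<in> set (slab_cells k c)"
      "p = translate I J q" by blast
    obtain a b z where q': "q = (a, b, z)" by (metis prod_cases3)
    note ab = blk[OF q(4)[unfolded q'] q(3)]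
    have "fence (bump a b) a b z" using UF[OF ab, of I J z] S p by (auto simp: q q')
    then show "p \<in> region n ty" using fence_occupied[OF ab] region_translate[OF ab] q by (simp add: q')
  qed
  have "card (tilings is_slab (region n ty)) = card (tilings is_slab (region n ty - \<Union>F))"
  proof (rule card_tilings_forced)
    fix S assume S: "S \<in> F"
    then obtain I J w k c where s: "I < n" "J < n" "(w, k, c) \<in> set fence_slabs" "S = translate I J ` set (slab_cells k c)"
      using FE by blast
    have "is_slab S" unfolding s(4) is_slab_move unfolding is_slab_def by (intro exI, rule refl)
    then show "is_slab S \<and> S \<subseteq> region n ty" using sub[OF S] by (rule conjI)
    have F0: "w \<in> set (slab_cells k c) \<and> list_all (\<lambda>cs. cs = slab_cells k c \<or> \<not> list_all (present [0..<15]) cs) (covering w)"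
      using fence_forced_check[unfolded list_all_iff[of _ fence_slabs], THEN bspec, OF s(3)] unfolding prod.case .
    note w = F0[THEN conjunct1]
    have fc: "cs = slab_cells k c \<or> \<not> list_all (present [0..<15]) cs" if "cs \<in> set (covering w)" for cs
      using F0[THEN conjunct2, unfolded list_all_iff[of _ "covering w"]] that by (rule bspec)
    show "\<exists>c\<in>S. c \<in> region n ty \<and> (\<forall>T. is_slab T \<longrightarrow> T \<subseteq> region n ty \<longrightarrow> c \<in> T \<longrightarrow> T = S)"
    proof (intro bexI[of _ "translate I J w"] conjI allI impI)
      show i: "translate I J w \<in> S" unfolding s(4) using w by (rule imageI)
      then show "translate I J w \<in> region n ty" using sub[OF S] by blast
      fix T assume T: "is_slab T" "T \<subseteq> region n ty" "translate I J w \<in> T"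
      obtain k' x y z where T': "T = set (slab_cells k' (x, y, z))" using is_slab_cases[OF T(1)] by blast
      let ?c = "(x - 14 * int I, y - 14 * int J, z)"
      have Ts: "T = translate I J ` set (slab_cells k' ?c)" unfolding translate_slab_cells T' by simp
      have "w \<in> set (slab_cells k' ?c)" using T(3) unfolding Ts inj_image_mem_iff[OF inj_translate] .
      then have cov: "slab_cells k' ?c \<in> set (covering w)" by (rule slab_in_covering)
      have pres: "list_all (present [0..<15]) (slab_cells k' ?c)" unfolding list_all_iff[of _ "slab_cells k' ?c"]
      proof (rule ballI)
        fix q assume "q \<in> set (slab_cells k' ?c)"
        then have "translate I J q \<in> T" unfolding Ts by (rule imageI)
        then have "translate I J q \<in> region n ty" using T(2) by blast
        then show "present [0..<15] q" by (rule region_present) (rule valid_types_less[OF ty])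
      qed
      have eq: "slab_cells k' ?c = slab_cells k c" using fc[OF cov] pres by blast
      show "T = S" unfolding Ts s(4) eq by (rule refl)
    qed
  next
    show "disjoint F"
    proof (rule disjointI)
      fix S T assume ST: "S \<in> F" "T \<in> F" "S \<noteq> T"
      show "S \<inter> T = {}"
      proof (rule ccontr)
        assume "S \<inter> T \<noteq> {}"
        then obtain p where p: "p \<in> S" "p \<in> T" by blast
        from FE[OF ST(1)] p(1) obtain I J w k c q where q: "(w, k, c) \<in> set fence_slabs" "q \<in> set (slab_cells k c)"
          "p = translate I J q" "S = translate I J ` set (slab_cells k c)" by blast
        from FE[OF ST(2)] p(2) obtain I' J' w' k' c' q' where q': "(w', k', c') \<in> set fence_slabs" "q' \<in> set (slab_cells k' c')"
          "p = translate I' J' q'" "T = translate I' J' ` set (slab_cells k' c')" by blast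
        obtain a b z a' b' z' where e: "q = (a, b, z)" "q' = (a', b', z')" by (metis prod_cases3)
        have "translate I J (a, b, z) = translate I' J' (a', b', z')"
          by (rule trans[OF sym[OF q(3)[unfolded e]] q'(3)[unfolded e]])
        then have "I = I' \<and> J = J' \<and> a = a' \<and> b = b' \<and> z = z'"
          unfolding translate_inject[OF blk[OF q(2)[unfolded e] q(1)] blk[OF q'(2)[unfolded e] q'(1)]] .
        then have eq: "I = I'" "J = J'" "q = q'" unfolding e by simp_all
        have "slab_cells k c = slab_cells k' c' \<or> list_all (\<lambda>p. p \<notin> set (slab_cells k' c')) (slab_cells k c)"
          using fence_disjoint_check q(1) q'(1) unfolding list_all_iff[of _ fence_slabs] by blast
        then have "slab_cells k c = slab_cells k' c'" using q(2) q'(2) eq(3) unfolding list_all_iff by blast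
        then show False using ST(3) q(4) q'(4) eq by simp
      qed
    qed
  qed
  also have "region n ty - \<Union>F = free n ty"
  proof (intro set_eqI iffI)
    fix p assume p: "p \<in> region n ty - \<Union>F"
    obtain x y z where p': "p = (x, y, z)" by (metis prod_cases3)
    have "0 \<le> x" "x < 14 * int n" "0 \<le> y" "y < 14 * int n" using p by (simp_all add: p' region_def)
    from reduce_14[OF this, of z] obtain I J a b where s: "I < n" "J < n" "in_block a b" "p = translate I J (a, b, z)"
      unfolding p' by blast
    have oc: "occupied (ty I J) (bump a b) a b z" using DiffD1[OF p] unfolding s(4) region_translate[OF s(3)] by (elim conjE)
    have nf: "\<not> fence (bump a b) a b z" using DiffD2[OF p] unfolding s(4) UF[OF s(3)] using s(1,2) by blast
    show "p \<in> free n ty" unfolding s(4) free_translate[OF s(3)] inner_def using s(1-3) oc nf by simp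
  next
    fix p assume "p \<in> free n ty"
    from in_freeE[OF this] obtain I J a b z where s: "I < n" "J < n" "in_block a b" "p = translate I J (a, b, z)" "(a, b, z) \<in> inner (ty I J)"
      by (elim exE conjE) blast
    have i: "occupied (ty I J) (bump a b) a b z" "\<not> fence (bump a b) a b z" using s(5) by (simp_all add: inner_def)
    show "p \<in> region n ty - \<Union>F"
    proof (rule DiffI)
      show "p \<in> region n ty" unfolding s(4) region_translate[OF s(3)] using s(1,2) i(1) by simp
      show "p \<notin> \<Union>F" unfolding s(4) UF[OF s(3)] using i(2) by simp
    qed
  qed
  finally show ?thesis .
qed

text \<open>The coordinates are relative to block (I, J) and may run over into a neighbour; hence
  the quotients by 14.\<close>

lemma free_free_present:
  assumes "translate I J (x, y, z) \<in> free n ty" "0 \<le> x" "0 \<le> y"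
  shows "I + nat (x div 14) < n" "J + nat (y div 14) < n" "0 \<le> z \<and> z \<le> 6"
    "ty (I + nat (x div 14)) (J + nat (y div 14)) \<in> set ts \<Longrightarrow> free_present ts (x, y, z)"
proof -
  have ab: "in_block (x mod 14) (y mod 14)" by (simp add: in_block_def)
  have e: "translate I J (x, y, z) = translate (I + nat (x div 14)) (J + nat (y div 14)) (x mod 14, y mod 14, z)"
  proof -
    have "0 \<le> x div 14" "0 \<le> y div 14" using assms(2,3) by (simp_all add: pos_imp_zdiv_nonneg_iff)
    then show ?thesis by (simp add: translate_def algebra_simps)
  qed
  have f: "I + nat (x div 14) < n \<and> J + nat (y div 14) < n \<and>
      (x mod 14, y mod 14, z) \<in> inner (ty (I + nat (x div 14)) (J + nat (y div 14)))"
    using assms(1) unfolding e free_translate[OF ab] .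
  then show "I + nat (x div 14) < n" "J + nat (y div 14) < n" by blast+
  have "occupied (ty (I + nat (x div 14)) (J + nat (y div 14))) (bump (x mod 14) (y mod 14)) (x mod 14) (y mod 14) z"
    using f unfolding inner_def by simp
  then show "0 \<le> z \<and> z \<le> 6" by (rule occupied_bound[OF ab])
  assume "ty (I + nat (x div 14)) (J + nat (y div 14)) \<in> set ts"
  then show "free_present ts (x, y, z)" using f by (auto simp: free_present_def present_def inner_def Let_def list_ex_iff)
qed

lemma cross_ports: "cross_x (row_types n J) (hport n J)" "cross_y (col_types n I) (vport n I)"
  using cross_check by (simp_all add: row_types_def hport_def col_types_def vport_def)

lemma port_bounds: "0 \<le> fst (hport n J)" "fst (hport n J) < 14" "0 \<le> fst (vport n I)" "fst (vport n I) < 14"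
  "fst (hport n J) \<noteq> 0" "fst (hport n J) \<noteq> 13" "fst (vport n I) \<noteq> 0" "fst (vport n I) \<noteq> 13"
  by (simp_all add: hport_def vport_def)

text \<open>A slab can leave the block of its smallest corner only if that corner has a coordinate
  13. In this case the evaluated tests of the boundaries leave only the slab at the port.\<close>

lemma slab_in_block_or_edge:
  assumes ty: "valid_types n ty" and S: "is_slab S" "S \<subseteq> free n ty"
  shows "S \<in> edge_slab n ` edges n \<or> (\<exists>k\<in>{..<n} \<times> {..<n}. S \<subseteq> translate (fst k) (snd k) ` inner (ty (fst k) (snd k)))"
proof -
  obtain k x y z where k: "k < 3" "S = set (slab_cells k (x, y, z))" using is_slab_cases[OF S(1)] by blast
  have "(x, y, z) \<in> free n ty" using S(2) by (auto simp: k(2) split: if_splits)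
  then obtain I J a b where IJ: "I < n" "J < n" and ab: "in_block a b" and p: "(x, y, z) = translate I J (a, b, z)"
    using in_freeE[of "(x, y, z)" n ty] by (auto simp: translate_def)
  have Ss: "S = translate I J ` set (slab_cells k (a, b, z))" unfolding translate_slab_cells using k(2) p by (simp add: translate_def)
  have cell: "translate I J c \<in> free n ty" if "c \<in> set (slab_cells k (a, b, z))" for c using S(2) that unfolding Ss by blast
  have a: "0 \<le> a" "a < 14" "0 \<le> b" "b < 14" using ab by (simp_all add: in_block_def)
  have row: "ty I' J' \<in> set (row_types n J')" and col: "ty I' J' \<in> set (col_types n I')" if "I' < n" "J' < n" for I' J'
    using ty that unfolding valid_types_def by blast+
  have inside: ?thesis if "\<And>c1 c2 c3. (c1, c2, c3) \<in> set (slab_cells k (a, b, z)) \<Longrightarrow> in_block c1 c2"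
  proof -
    have "translate I J c \<in> translate I J ` inner (ty I J)" if c: "c \<in> set (slab_cells k (a, b, z))" for c
    proof -
      obtain c1 c2 c3 where c': "c = (c1, c2, c3)" by (metis prod_cases3)
      have "in_block c1 c2" using that c \<open>\<And>c1 c2 c3. (c1, c2, c3) \<in> set (slab_cells k (a, b, z)) \<Longrightarrow> in_block c1 c2\<close> c' by blast
      then show ?thesis using cell[OF c] free_translate unfolding c' by blast
    qed
    then have "S \<subseteq> translate (fst (I, J)) (snd (I, J)) ` inner (ty (fst (I, J)) (snd (I, J)))" unfolding Ss by auto
    then show ?thesis using IJ by blast
  qed
  \<comment> \<open>A cell of the slab lies in another row or column of the grid only if the slab
    crosses at coordinate 13, which limits the types that can be involved.\<close>
  have fp: "free_present ts c" if "c \<in> set (slab_cells k (a, b, z))"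
    "\<And>I' J'. I' < n \<Longrightarrow> J' < n \<Longrightarrow> (J' = J \<or> b = 13 \<and> k \<noteq> 1) \<Longrightarrow> (I' = I \<or> a = 13 \<and> k \<noteq> 2) \<Longrightarrow> ty I' J' \<in> set ts" for ts c
  proof -
    obtain c1 c2 c3 where c': "c = (c1, c2, c3)" by (metis prod_cases3)
    have b: "0 \<le> c1" "0 \<le> c2" "c2 < 14 \<or> b = 13 \<and> k \<noteq> 1" "c1 < 14 \<or> a = 13 \<and> k \<noteq> 2"
      using that(1) a by (auto simp: c' split: if_splits)
    note f = free_free_present[OF cell[OF that(1), unfolded c'] b(1,2)]
    have "J + nat (c2 div 14) = J \<or> b = 13 \<and> k \<noteq> 1" "I + nat (c1 div 14) = I \<or> a = 13 \<and> k \<noteq> 2" using b by auto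
    then show ?thesis unfolding c' using f(1,2,4) that(2) by blast
  qed
  have z: "0 \<le> z" "z \<le> 6" using free_free_present(3)[of I J a b z n ty] cell[of "(a, b, z)"] a by (auto split: if_splits)
  consider "k = 0" | "k = 1" | "k = 2" using k(1) by linarith
  then show ?thesis
  proof cases
    case 1
    have False if "a = 13" "b = 13"
    proof -
      have "list_all (free_present [0..<15]) (slab_cells 0 (13, 13, z))"
        unfolding list_all_iff using fp[of _ "[0..<15]"] valid_types_less[OF ty] that 1 by auto
      moreover have "z \<in> set [0..6]" using z by simp
      ultimately show False using cross_check(7) unfolding list_all_iff[of _ "[0..6]"] by blast
    qed
    moreover have False if "a = 13" "b \<noteq> 13"
    proof -
      have "list_all (free_present (row_types n J)) (slab_cells 0 (13, b, z))"
        unfolding list_all_iff using fp[of _ "row_types n J"] row that 1 by auto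
      moreover have "z \<in> set [0..6]" "b \<in> set [0..12]" using z a that by simp_all
      ultimately show False using cross_ports(1)[of n J] unfolding cross_x_def
        list_all_iff[of _ "[0..6]"] list_all_iff[of _ "[0..12]"] case_prod_unfold by blast
    qed
    moreover have False if "b = 13" "a \<noteq> 13"
    proof -
      have "list_all (free_present (col_types n I)) (slab_cells 0 (a, 13, z))"
        unfolding list_all_iff using fp[of _ "col_types n I"] col that 1 by auto
      moreover have "z \<in> set [0..6]" "a \<in> set [0..12]" using z a that by simp_all
      ultimately show False using cross_ports(2)[of n I] unfolding cross_y_def
        list_all_iff[of _ "[0..6]"] list_all_iff[of _ "[0..12]"] case_prod_unfold by blast
    qed
    ultimately have "a \<noteq> 13" "b \<noteq> 13" by blast+
    then show ?thesis using 1 a by (intro inside) (auto simp: in_block_def)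
  next
    case 2
    have z5: "z \<in> set [0..5]" using free_free_present(3)[of I J a b "z + 1" n ty] cell[of "(a, b, z + 1)"] a z 2 by auto
    show ?thesis
    proof (cases "a = 13")
      case True
      have "list_all (free_present (row_types n J)) (slab_cells 1 (13, b, z))"
        unfolding list_all_iff using fp[of _ "row_types n J"] row True 2 by auto
      moreover have "b \<in> set [0..13]" using a by simp
      ultimately have h: "b = fst (hport n J)" "z = snd (hport n J)"
        using cross_ports(1)[of n J] z5 unfolding cross_x_def
        list_all_iff[of _ "[0..5]"] list_all_iff[of _ "[0..13]"] case_prod_unfold by blast+
      have "I + 1 < n" using free_free_present(1)[of I J 14 b z n ty] cell[of "(14, b, z)"] a True 2 by auto
      then have "(False, I, J) \<in> edges n" using IJ by (auto simp: edges_def)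
      moreover have "S = edge_slab n (False, I, J)" unfolding Ss edge_slab_def using h True 2 by simp
      ultimately show ?thesis by blast
    next
      case False
      then show ?thesis using 2 a by (intro inside) (auto simp: in_block_def)
    qed
  next
    case 3
    have z5: "z \<in> set [0..5]" using free_free_present(3)[of I J a b "z + 1" n ty] cell[of "(a, b, z + 1)"] a z 3 by auto
    show ?thesis
    proof (cases "b = 13")
      case True
      have "list_all (free_present (col_types n I)) (slab_cells 2 (a, 13, z))"
        unfolding list_all_iff using fp[of _ "col_types n I"] col True 3 by auto
      moreover have "a \<in> set [0..13]" using a by simp
      ultimately have h: "a = fst (vport n I)" "z = snd (vport n I)"
        using cross_ports(2)[of n I] z5 unfolding cross_y_def
        list_all_iff[of _ "[0..5]"] list_all_iff[of _ "[0..13]"] case_prod_unfold by blast+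
      have "J + 1 < n" using free_free_present(2)[of I J a 14 z n ty] cell[of "(a, 14, z)"] a True 3 by auto
      then have "(True, I, J) \<in> edges n" using IJ by (auto simp: edges_def)
      moreover have "S = edge_slab n (True, I, J)" unfolding Ss edge_slab_def using h True 3 by simp
      ultimately show ?thesis by blast
    next
      case False
      then show ?thesis using 3 a by (intro inside) (auto simp: in_block_def)
    qed
  qed
qed

lemma edge_slab_cells:
  "edge_slab n (False, I, J) = {translate I J (13, fst (hport n J), snd (hport n J)), translate I J (13, fst (hport n J), snd (hport n J) + 1),
     translate (Suc I) J (0, fst (hport n J), snd (hport n J)), translate (Suc I) J (0, fst (hport n J), snd (hport n J) + 1)}"
  "edge_slab n (True, I, J) = {translate I J (fst (vport n I), 13, snd (vport n I)), translate I J (fst (vport n I), 13, snd (vport n I) + 1),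
     translate I (Suc J) (fst (vport n I), 0, snd (vport n I)), translate I (Suc J) (fst (vport n I), 0, snd (vport n I) + 1)}"
  by (cases "hport n J", auto simp: edge_slab_def translate_def)

lemma in_edge_slab:
  assumes "in_block a b"
  shows "translate I J (a, b, z) \<in> edge_slab n (False, I', J') \<longleftrightarrow> J' = J \<and> b = fst (hport n J) \<and>
      (z = snd (hport n J) \<or> z = snd (hport n J) + 1) \<and> (I' = I \<and> a = 13 \<or> Suc I' = I \<and> a = 0)"
    and "translate I J (a, b, z) \<in> edge_slab n (True, I', J') \<longleftrightarrow> I' = I \<and> a = fst (vport n I) \<and>
      (z = snd (vport n I) \<or> z = snd (vport n I) + 1) \<and> (J' = J \<and> b = 13 \<or> Suc J' = J \<and> b = 0)"
proof -
  have ib: "in_block 13 (fst (hport n J'))" "in_block 0 (fst (hport n J'))" "in_block (fst (vport n I')) 13" "in_block (fst (vport n I')) 0"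
    using port_bounds by (simp_all add: in_block_def)
  show "translate I J (a, b, z) \<in> edge_slab n (False, I', J') \<longleftrightarrow> J' = J \<and> b = fst (hport n J) \<and>
      (z = snd (hport n J) \<or> z = snd (hport n J) + 1) \<and> (I' = I \<and> a = 13 \<or> Suc I' = I \<and> a = 0)"
    unfolding edge_slab_cells insert_iff empty_iff translate_inject[OF assms ib(1)] translate_inject[OF assms ib(2)] by auto
  show "translate I J (a, b, z) \<in> edge_slab n (True, I', J') \<longleftrightarrow> I' = I \<and> a = fst (vport n I) \<and>
      (z = snd (vport n I) \<or> z = snd (vport n I) + 1) \<and> (J' = J \<and> b = 13 \<or> Suc J' = J \<and> b = 0)"
    unfolding edge_slab_cells insert_iff empty_iff translate_inject[OF assms ib(3)] translate_inject[OF assms ib(4)] by auto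
qed

lemma in_edge_slabs:
  assumes "in_block a b"
  shows "translate I J (a, b, z) \<in> \<Union>(edge_slab n ` Z) \<longleftrightarrow> (a, b, z) \<in> set (rem_cells (hport n J, vport n I) (bits Z I J))"
proof -
  have "translate I J (a, b, z) \<in> \<Union>(edge_slab n ` Z) \<longleftrightarrow>
      (\<exists>I' J'. (False, I', J') \<in> Z \<and> translate I J (a, b, z) \<in> edge_slab n (False, I', J')) \<or>
      (\<exists>I' J'. (True, I', J') \<in> Z \<and> translate I J (a, b, z) \<in> edge_slab n (True, I', J'))" (is "_ \<longleftrightarrow> ?h \<or> ?v")
  proof
    assume "translate I J (a, b, z) \<in> \<Union>(edge_slab n ` Z)"
    then obtain d I' J' where "(d, I', J') \<in> Z" "translate I J (a, b, z) \<in> edge_slab n (d, I', J')" by auto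
    then show "?h \<or> ?v" by (cases d) auto
  qed blast
  also have "?h \<longleftrightarrow> b = fst (hport n J) \<and> (z = snd (hport n J) \<or> z = snd (hport n J) + 1) \<and>
      ((False, I, J) \<in> Z \<and> a = 13 \<or> 0 < I \<and> (False, I - 1, J) \<in> Z \<and> a = 0)"
    unfolding in_edge_slab[OF assms] by (cases I) auto
  also have "?v \<longleftrightarrow> a = fst (vport n I) \<and> (z = snd (vport n I) \<or> z = snd (vport n I) + 1) \<and>
      ((True, I, J) \<in> Z \<and> b = 13 \<or> 0 < J \<and> (True, I, J - 1) \<in> Z \<and> b = 0)"
    unfolding in_edge_slab[OF assms] by (cases J) auto
  finally have main: "translate I J (a, b, z) \<in> \<Union>(edge_slab n ` Z) \<longleftrightarrow>
      b = fst (hport n J) \<and> (z = snd (hport n J) \<or> z = snd (hport n J) + 1) \<and>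
      ((False, I, J) \<in> Z \<and> a = 13 \<or> 0 < I \<and> (False, I - 1, J) \<in> Z \<and> a = 0) \<or>
      a = fst (vport n I) \<and> (z = snd (vport n I) \<or> z = snd (vport n I) + 1) \<and>
      ((True, I, J) \<in> Z \<and> b = 13 \<or> 0 < J \<and> (True, I, J - 1) \<in> Z \<and> b = 0)" .
  obtain hy hz vx vz where hv: "hport n J = (hy, hz)" "vport n I = (vx, vz)" by (metis surj_pair)
  have if_mem: "p \<in> set (if c then xs else []) \<longleftrightarrow> c \<and> p \<in> set xs" for p :: cell and c xs by simp
  show ?thesis unfolding main rem_cells_def bits_def hv prod.case set_append Un_iff if_mem fst_conv snd_conv
      list.set insert_iff empty_iff prod.inject by (intro iffI; elim disjE conjE; simp)
qed

text \<open>\<open>valid_types\<close> admits a type only on grid lines whose ports are those with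
  which it was evaluated.\<close>

lemma valid_block_check:
  assumes ty: "valid_types n ty" and IJ: "I < n" "J < n" and n: "2 \<le> n"
  shows "block_check (ty I J) (hport n J, vport n I) bs"
proof -
  obtain l r b t where bs: "bs = (l, r, b, t)" by (metis prod_cases4)
  have all: "bs \<in> set all_bits" by (cases l; cases r; cases b; cases t) (simp_all add: bs all_bits_def)
  have t: "ty I J \<in> set (row_types n J)" "ty I J \<in> set (col_types n I)" using ty IJ unfolding valid_types_def by blast+
  have c: "block_check \<tau> p bs" if "list_all (block_check \<tau> p) all_bits" for \<tau> p
    using that all unfolding list_all_iff by blast
  note k = block_check_corner[THEN c] block_check_plain[THEN c] block_check_filter[THEN c]
  note T = block_check_top[unfolded list_all_iff[of _ "[3, 4, 5 :: nat]"], rule_format, THEN c]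
  note B = block_check_bottom[unfolded list_all_iff[of _ "[6, 7, 8 :: nat]"], rule_format, THEN c]
  note L = block_check_left[unfolded list_all_iff[of _ "[9, 10, 11 :: nat]"], rule_format, THEN c]
  note R = block_check_right[unfolded list_all_iff[of _ "[12, 13, 14 :: nat]"], rule_format, THEN c]
  have s: "block_check 3 ((9, 4), 7, 4) bs" "block_check 4 ((9, 4), 7, 4) bs" "block_check 5 ((9, 4), 7, 4) bs"
    "block_check 6 ((8, 4), 7, 4) bs" "block_check 7 ((8, 4), 7, 4) bs" "block_check 8 ((8, 4), 7, 4) bs"
    "block_check 9 ((3, 1), 8, 1) bs" "block_check 10 ((3, 1), 8, 1) bs" "block_check 11 ((3, 1), 8, 1) bs"
    "block_check 12 ((3, 1), 9, 1) bs" "block_check 13 ((3, 1), 9, 1) bs" "block_check 14 ((3, 1), 9, 1) bs"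
    by (simp_all add: T B L R)
  have h: "(hport n J = (8, 4) \<and> ty I J \<in> {0, 6, 7, 8}) \<or> (hport n J = (9, 4) \<and> ty I J \<in> {0, 3, 4, 5}) \<or>
      (hport n J = (3, 1) \<and> ty I J \<in> {1, 2, 9, 10, 11, 12, 13, 14})"
    using t(1) unfolding hport_def row_types_def by (cases "J = 0"; cases "J = n - 1") simp_all
  have v: "(vport n I = (8, 1) \<and> ty I J \<in> {0, 9, 10, 11}) \<or> (vport n I = (9, 1) \<and> ty I J \<in> {0, 12, 13, 14}) \<or>
      (vport n I = (7, 4) \<and> ty I J \<in> {1, 2, 3, 4, 5, 6, 7, 8})"
    using t(2) unfolding vport_def col_types_def by (cases "I = 0"; cases "I = n - 1") simp_all
  show ?thesis
    using h v by (elim disjE conjE) (auto simp: k k[unfolded One_nat_def] s)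
qed

lemma edge_slab_in_blocks:
  assumes p: "p \<in> edge_slab n (d, I, J)" and e: "(d, I, J) \<in> edges n"
  shows "\<exists>I' J' a b z. I' < n \<and> J' < n \<and> in_block a b \<and> p = translate I' J' (a, b, z)"
proof -
  have ib: "in_block 13 (fst (hport n J))" "in_block 0 (fst (hport n J))" "in_block (fst (vport n I)) 13" "in_block (fst (vport n I)) 0"
    using port_bounds by (simp_all add: in_block_def)
  show ?thesis
  proof (cases d)
    case True
    then have l: "I < n" "J < n" "Suc J < n" using e by (auto simp: edges_def)
    have "p \<in> edge_slab n (True, I, J)" using p True by simp
    then show ?thesis unfolding edge_slab_cells insert_iff empty_iff using l ib by blast
  next
    case False
    then have l: "I < n" "J < n" "Suc I < n" using e by (auto simp: edges_def)
    have "p \<in> edge_slab n (False, I, J)" using p False by simp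
    then show ?thesis unfolding edge_slab_cells insert_iff empty_iff using l ib by blast
  qed
qed

text \<open>The blocks are the pieces and the straddling slabs the interface of
  \<open>card_tilings_pieces\<close>: once the four bits of a block are given, what remains of it
  has at most one tiling.\<close>

theorem card_tilings_region:
  assumes ty: "valid_types n ty" and n: "2 \<le> n"
  shows "card (tilings is_slab (region n ty)) =
    card {Z. Z \<subseteq> edges n \<and> (\<forall>I<n. \<forall>J<n. block_ok (ty I J) (bits Z I J))}"
proof -
  let ?K = "{..<n} \<times> {..<n}" and ?X = "edge_slab n ` edges n"
  let ?B = "\<lambda>k. translate (fst k) (snd k) ` inner (ty (fst k) (snd k))"
  have fin: "finite (inner \<tau>)" for \<tau>
  proof (rule finite_subset)
    show "inner \<tau> \<subseteq> {0..<14} \<times> {0..<14} \<times> {0..6}"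
    proof
      fix p assume p: "p \<in> inner \<tau>"
      obtain a b z where p': "p = (a, b, z)" by (metis prod_cases3)
      have "in_block a b" "occupied \<tau> (bump a b) a b z" using p by (simp_all add: p' inner_def)
      then show "p \<in> {0..<14} \<times> {0..<14} \<times> {0..6}" using occupied_bound[of a b \<tau> z] by (simp add: p' in_block_def)
    qed
  qed simp
  have ib: "in_block a b" if "(a, b, z) \<in> set (rem_cells (hport n J, vport n I) bs)" for a b z I J bs
  proof -
    obtain hy hz vx vz where hv: "hport n J = (hy, hz)" "vport n I = (vx, vz)" by (metis surj_pair)
    have "0 \<le> hy" "hy < 14" "0 \<le> vx" "vx < 14" using port_bounds(1,2)[of n J] port_bounds(3,4)[of n I] by (simp_all add: hv)
    then show ?thesis using that by (cases bs) (auto simp: rem_cells_def hv in_block_def split: if_splits)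
  qed
  have piece: "?B (I, J) - \<Union>(edge_slab n ` Z) = translate I J ` (inner (ty I J) - set (rem_cells (hport n J, vport n I) (bits Z I J)))" for I J Z
  proof (intro set_eqI)
    fix p show "p \<in> ?B (I, J) - \<Union>(edge_slab n ` Z) \<longleftrightarrow> p \<in> translate I J ` (inner (ty I J) - set (rem_cells (hport n J, vport n I) (bits Z I J)))"
    proof (cases "p \<in> translate I J ` inner (ty I J)")
      case True
      then obtain a b z where p: "p = translate I J (a, b, z)" "(a, b, z) \<in> inner (ty I J)" by (metis imageE prod_cases3)
      then have ab: "in_block a b" by (simp add: inner_def)
      show ?thesis unfolding Diff_iff p(1) in_edge_slabs[OF ab] fst_conv snd_conv inj_image_mem_iff[OF inj_translate] by (rule refl)
    qed auto
  qed
  have remsub: "set (rem_cells (hport n J, vport n I) (bits Z I J)) \<subseteq> inner (ty I J)"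
    if "\<Union>(edge_slab n ` Z) \<subseteq> free n ty" for Z I J
  proof
    fix p assume p: "p \<in> set (rem_cells (hport n J, vport n I) (bits Z I J))"
    obtain a b z where p': "p = (a, b, z)" by (metis prod_cases3)
    note ab = ib[OF p[unfolded p']]
    have "translate I J (a, b, z) \<in> \<Union>(edge_slab n ` Z)" using p unfolding p' in_edge_slabs[OF ab] .
    then have "translate I J (a, b, z) \<in> free n ty" by (rule subsetD[OF that])
    then show "p \<in> inner (ty I J)" using free_translate[OF ab] by (simp add: p')
  qed
  have cnt: "card (tilings is_slab (?B (I, J) - \<Union>(edge_slab n ` Z))) = (if block_ok (ty I J) (bits Z I J) then 1 else 0)"
    if "\<Union>(edge_slab n ` Z) \<subseteq> free n ty" "I < n" "J < n" for Z I J
    unfolding piece card_tilings_image[where f = "translate I J" and R = is_slab and R' = is_slab, OF inj_translate is_slab_move]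
    by (rule block_check_sound(1)[OF valid_block_check[OF ty that(2,3) n] remsub[OF that(1)]])
  have fint: "finite (tilings is_slab (?B (I, J) - W))" for I J W
    by (rule finite_tilings_set) (use fin in simp)
  \<comment> \<open>Straddling slabs of different edges are disjoint since no port lies at a corner
    of its block.\<close>
  have ne: "edge_slab n e \<noteq> {}" for e by (cases e; cases "fst e") (auto simp: edge_slab_cells)
  have dis: "edge_slab n e \<inter> edge_slab n e' = {}" if ee: "e \<in> edges n" "e' \<in> edges n" "e \<noteq> e'" for e e'
  proof (rule ccontr)
    assume "edge_slab n e \<inter> edge_slab n e' \<noteq> {}"
    then obtain p where p: "p \<in> edge_slab n e" "p \<in> edge_slab n e'" by blast
    obtain d I J d' I' J' where e: "e = (d, I, J)" "e' = (d', I', J')" by (metis prod_cases3)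
    obtain I0 J0 a b z where ab: "in_block a b" and p0: "p = translate I0 J0 (a, b, z)"
      using edge_slab_in_blocks[of p n d I J] p(1) ee(1) unfolding e by blast
    have mem: "translate I0 J0 (a, b, z) \<in> edge_slab n (d, I, J) \<longleftrightarrow>
      (if d then I = I0 \<and> a = fst (vport n I0) \<and> (z = snd (vport n I0) \<or> z = snd (vport n I0) + 1) \<and> (J = J0 \<and> b = 13 \<or> Suc J = J0 \<and> b = 0)
       else J = J0 \<and> b = fst (hport n J0) \<and> (z = snd (hport n J0) \<or> z = snd (hport n J0) + 1) \<and> (I = I0 \<and> a = 13 \<or> Suc I = I0 \<and> a = 0))" for d I J
      by (cases d) (simp_all only: in_edge_slab[OF ab] if_True if_False)
    show False
      using p[unfolded e p0 mem] ee(3)[unfolded e] port_bounds(5,6)[of n J0] port_bounds(7,8)[of n I0] by (auto split: if_splits)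
  qed
  have inj: "inj_on (edge_slab n) (edges n)"
    by (rule inj_onI) (use dis ne in \<open>metis Int_absorb\<close>)
  have "card (tilings is_slab (region n ty)) = card (tilings is_slab (free n ty))" by (rule card_tilings_free[OF ty])
  also have "\<dots> = card {Y. Y \<subseteq> ?X \<and> \<Union>Y \<subseteq> free n ty \<and> (\<forall>k\<in>?K. tilings is_slab (?B k - \<Union>Y) \<noteq> {})}"
  proof (rule card_tilings_pieces)
    show "free n ty = (\<Union>k\<in>?K. ?B k)" by (auto simp: free_def)
    show "?B k \<inter> ?B l = {}" if "k \<in> ?K" "l \<in> ?K" "k \<noteq> l" for k l
    proof (rule ccontr)
      assume "?B k \<inter> ?B l \<noteq> {}"
      then obtain u where u: "u \<in> ?B k" "u \<in> ?B l" by blast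
      from u(1) obtain p where p: "u = translate (fst k) (snd k) p" "p \<in> inner (ty (fst k) (snd k))" by (rule imageE)
      from u(2) obtain q where q: "u = translate (fst l) (snd l) q" "q \<in> inner (ty (fst l) (snd l))" by (rule imageE)
      obtain a b z where p': "p = (a, b, z)" by (metis prod_cases3)
      obtain a' b' z' where q': "q = (a', b', z')" by (metis prod_cases3)
      have "in_block a b" "in_block a' b'" using p(2) q(2) by (simp_all add: p' q' inner_def)
      from translate_inject[OF this] have "fst k = fst l \<and> snd k = snd l" using p(1) q(1) unfolding p' q' by metis
      then show False using that(3) by (simp add: prod_eq_iff)
    qed
    show "S \<in> ?X \<or> (\<exists>k\<in>?K. S \<subseteq> ?B k)" if "is_slab S" "S \<subseteq> free n ty" for S
      by (rule slab_in_block_or_edge[OF ty that])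
    show "is_slab S" if "S \<in> ?X" for S
    proof -
      obtain d I J where S: "S = edge_slab n (d, I, J)" using \<open>S \<in> ?X\<close> by auto
      show ?thesis unfolding S edge_slab_def prod.case is_slab_move unfolding is_slab_def by (cases d) (simp_all only: if_True if_False, blast+)
    qed
    show "\<not> S \<subseteq> ?B k" if "S \<in> ?X" "k \<in> ?K" for S k
    proof
      assume sub: "S \<subseteq> ?B k"
      obtain d I J where S: "S = edge_slab n (d, I, J)" using \<open>S \<in> ?X\<close> by auto
      have blk: "I1 = fst k \<and> J1 = snd k" if "translate I1 J1 (a, b, z) \<in> S" "in_block a b" for I1 J1 a b z
      proof -
        obtain q where q: "translate I1 J1 (a, b, z) = translate (fst k) (snd k) q" "q \<in> inner (ty (fst k) (snd k))" using sub \<open>translate I1 J1 (a, b, z) \<in> S\<close> by blast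
        then show ?thesis using translate_inject[OF \<open>in_block a b\<close>] by (cases q) (auto simp: inner_def)
      qed
      show False
      proof (cases d)
        case True
        show False using blk[of I J "fst (vport n I)" 13 "snd (vport n I)"] blk[of I "Suc J" "fst (vport n I)" 0 "snd (vport n I)"]
          port_bounds True by (simp add: S edge_slab_cells in_block_def)
      next
        case False
        show False using blk[of I J 13 "fst (hport n J)" "snd (hport n J)"] blk[of "Suc I" J 0 "fst (hport n J)" "snd (hport n J)"]
          port_bounds False by (simp add: S edge_slab_cells in_block_def)
      qed
    qed
    show "disjoint ?X" by (rule disjointI) (use dis in blast)
    show "\<not> is_slab {}" using is_slab_cases[of "{}"] by (auto split: if_splits)
    fix Y k P Q assume Y: "Y \<subseteq> ?X" "\<Union>Y \<subseteq> free n ty" "k \<in> ?K" and PQ: "P \<in> tilings is_slab (?B k - \<Union>Y)" "Q \<in> tilings is_slab (?B k - \<Union>Y)"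
    obtain Z where Z: "Y = edge_slab n ` Z" using Y(1) by (meson subset_imageE)
    obtain I J where k: "k = (I, J)" "I < n" "J < n" using Y(3) by auto
    have "card (tilings is_slab (?B k - \<Union>Y)) \<le> 1" using cnt[of Z I J] Y(2) unfolding Z k(1) using k(2,3) by simp
    then show "P = Q" using PQ fint[of I J "\<Union>Y"] unfolding k(1) by (metis card_le_Suc0_iff_eq One_nat_def)
  qed
  also have "{Y. Y \<subseteq> ?X \<and> \<Union>Y \<subseteq> free n ty \<and> (\<forall>k\<in>?K. tilings is_slab (?B k - \<Union>Y) \<noteq> {})} =
      (`) (edge_slab n) ` {Z. Z \<subseteq> edges n \<and> (\<forall>I<n. \<forall>J<n. block_ok (ty I J) (bits Z I J))}" (is "?L = _ ` ?R")
  proof (intro set_eqI iffI)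
    fix Y assume Y: "Y \<in> ?L"
    then have "Y \<subseteq> ?X" by blast
    then obtain Z where Z: "Z \<subseteq> edges n" "Y = edge_slab n ` Z" by (meson subset_imageE)
    have "block_ok (ty I J) (bits Z I J)" if "I < n" "J < n" for I J
    proof (rule ccontr)
      assume "\<not> block_ok (ty I J) (bits Z I J)"
      then have "card (tilings is_slab (?B (I, J) - \<Union>Y)) = 0" using cnt[of Z I J] Y that unfolding Z(2) by simp
      then have "tilings is_slab (?B (I, J) - \<Union>Y) = {}" using fint[of I J "\<Union>Y"] by simp
      moreover have K: "(I, J) \<in> ?K" using that by simp
      have "tilings is_slab (?B (I, J) - \<Union>Y) \<noteq> {}"
        using Y[unfolded mem_Collect_eq, THEN conjunct2, THEN conjunct2] K by (rule bspec)
      ultimately show False by contradiction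
    qed
    then have "Z \<in> ?R" using Z(1) by simp
    then show "Y \<in> (`) (edge_slab n) ` ?R" unfolding Z(2) by (rule imageI)
  next
    fix Y assume "Y \<in> (`) (edge_slab n) ` ?R"
    then obtain Z where Zr: "Y = edge_slab n ` Z" "Z \<in> ?R" by (rule imageE)
    note Z = Zr(2)[unfolded mem_Collect_eq, THEN conjunct1] Zr(1)
    note ok = Zr(2)[unfolded mem_Collect_eq, THEN conjunct2, rule_format]
    have sub: "\<Union>(edge_slab n ` Z) \<subseteq> free n ty"
    proof
      fix p assume p: "p \<in> \<Union>(edge_slab n ` Z)"
      then obtain d I J where e: "(d, I, J) \<in> Z" "p \<in> edge_slab n (d, I, J)" by auto
      have "(d, I, J) \<in> edges n" using e(1) Z(1) by blast
      from edge_slab_in_blocks[OF e(2) this] obtain I0 J0 a b z where q: "I0 < n" "J0 < n" "in_block a b" "p = translate I0 J0 (a, b, z)" by blast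
      have "(a, b, z) \<in> inner (ty I0 J0)"
        using block_check_sound(2)[OF valid_block_check[OF ty q(1,2) n] ok[OF q(1,2)]] p in_edge_slabs[OF q(3)] unfolding q(4) by blast
      then show "p \<in> free n ty" using q free_translate[OF q(3)] by simp
    qed
    have nz: "tilings is_slab (?B k - \<Union>Y) \<noteq> {}" if "k \<in> ?K" for k
    proof -
      obtain I J where k: "k = (I, J)" "I < n" "J < n" using \<open>k \<in> ?K\<close> by auto
      have "card (tilings is_slab (?B (I, J) - \<Union>Y)) = 1" using cnt[OF sub k(2,3)] ok[OF k(2,3)] unfolding Z(2) by simp
      then show ?thesis unfolding k(1) by (metis card.empty zero_neq_one)
    qed
    have a: "Y \<subseteq> ?X" unfolding Z(2) by (rule image_mono[OF Z(1)])
    have b: "\<Union>Y \<subseteq> free n ty" unfolding Z(2) by (rule sub)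
    show "Y \<in> ?L" by (intro CollectI conjI a b ballI nz)
  qed
  also have "card ((`) (edge_slab n) ` ?R) = card ?R"
    by (rule card_image) (rule inj_on_subset[OF inj_on_image_Pow[OF inj]], blast)
  finally show ?thesis .
qed

section \<open>Contractibility of height fields\<close>

text \<open>A straight-line homotopy leads from the identity to \<open>f\<close>, and a second one
  contracts the convex image to a point.\<close>

lemma contractible_two_step:
  fixes S :: "'a::real_normed_vector set"
  assumes "continuous_on S f" and seg: "\<And>p. p \<in> S \<Longrightarrow> closed_segment p (f p) \<subseteq> S" and conv: "convex (f ` S)"
  shows "contractible S"
proof (cases "S = {}")
  case False
  then obtain a where a: "a \<in> S" by blast
  have sub: "f ` S \<subseteq> S" using seg ends_in_segment by blast
  have "homotopic_with_canon (\<lambda>_. True) S S id f"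
    by (rule homotopic_with_linear) (use assms in \<open>auto intro: continuous_on_id\<close>)
  moreover have "homotopic_with_canon (\<lambda>_. True) S S f (\<lambda>_. f a)"
  proof (rule homotopic_with_linear)
    fix p assume "p \<in> S"
    then have "closed_segment (f p) (f a) \<subseteq> f ` S" using conv a by (intro closed_segment_subset) auto
    then show "closed_segment (f p) (f a) \<subseteq> S" using sub by blast
  qed (use assms in auto)
  ultimately show ?thesis unfolding contractible_def using homotopic_with_trans by blast
qed simp

lemma closed_segment_vertical:
  fixes p :: "real ^ 3"
  assumes "q \<in> closed_segment p (\<chi> i. if i = 3 then h else p $ i)"
  obtains t where "0 \<le> t" "t \<le> 1" "q $ 1 = p $ 1" "q $ 2 = p $ 2" "q $ 3 = (1 - t) * (p $ 3) + t * h"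
proof -
  obtain u where u: "0 \<le> u" "u \<le> 1" "q = (1 - u) *\<^sub>R p + u *\<^sub>R (\<chi> i. if i = 3 then h else p $ i)"
    using assms unfolding in_segment by blast
  show ?thesis by (rule that[OF u(1,2)]) (simp_all add: u(3) algebra_simps)
qed

text \<open>The nearest integer may fall outside the range: \<open>m - 1/2\<close> is rounded to
  \<open>m\<close>. The clamped value is still within 1/2.\<close>

lemma of_int_clamp:
  assumes a: "- 1/2 \<le> a" "a \<le> real_of_int m - 1/2" and m: "0 < m"
  shows "\<bar>a - of_int (max 0 (min (m - 1) (round a)))\<bar> \<le> 1/2"
proof -
  let ?x = "max 0 (min (m - 1) (round a))"
  have r: "\<bar>real_of_int (round a) - a\<bar> \<le> 1/2" by (rule of_int_round_abs_le)
  consider "m - 1 \<le> round a" | "round a \<le> 0" "round a \<le> m - 1" | "0 \<le> round a" "round a \<le> m - 1" by linarith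
  then show ?thesis
  proof cases
    case 1
    then have "?x = m - 1" using m by simp
    then have "real_of_int ?x = real_of_int m - 1" by simp
    moreover have "real_of_int m - 1 \<le> real_of_int (round a)" using 1 by linarith
    ultimately show ?thesis using r a by linarith
  next
    case 2
    then have "?x = 0" by simp
    then have "real_of_int ?x = 0" by simp
    moreover have "real_of_int (round a) \<le> 0" using 2 by linarith
    ultimately show ?thesis using r a by linarith
  next
    case 3
    then have "?x = round a" by simp
    then have "real_of_int ?x = real_of_int (round a)" by simp
    then show ?thesis using r by linarith
  qed
qed

text \<open>Every column contains the height 3, so moving points vertically to this height never
  leaves the column; the image is a square. The same movement works for the interior, but there it
  has to be shown that moved points remain interior.\<close>

lemma contractible_heightfield:
  fixes m :: int and lo hi :: "int \<Rightarrow> int \<Rightarrow> int" and \<Gamma> :: "(int ^ 3) set"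
  assumes m: "0 < m" and lh: "\<And>x y. 0 \<le> x \<Longrightarrow> x < m \<Longrightarrow> 0 \<le> y \<Longrightarrow> y < m \<Longrightarrow> lo x y \<le> 3 \<and> 3 \<le> hi x y"
    and \<Gamma>: "\<Gamma> = {c. 0 \<le> c $ 1 \<and> c $ 1 < m \<and> 0 \<le> c $ 2 \<and> c $ 2 < m \<and> lo (c $ 1) (c $ 2) \<le> c $ 3 \<and> c $ 3 \<le> hi (c $ 1) (c $ 2)}"
  shows "contractible_region \<Gamma>"
proof -
  let ?S = "realization \<Gamma>"
  let ?f = "\<lambda>p :: real ^ 3. (\<chi> i. if i = 3 then 3 else p $ i) :: real ^ 3"
  have mem: "p \<in> ?S \<longleftrightarrow> (\<exists>x y. 0 \<le> x \<and> x < m \<and> 0 \<le> y \<and> y < m \<and> \<bar>p $ 1 - of_int x\<bar> \<le> 1/2 \<and> \<bar>p $ 2 - of_int y\<bar> \<le> 1/2 \<and>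
      of_int (lo x y) - 1/2 \<le> p $ 3 \<and> p $ 3 \<le> of_int (hi x y) + 1/2)" for p
  proof
    assume "p \<in> ?S"
    then obtain c where c: "c \<in> \<Gamma>" "\<And>i. \<bar>p $ i - of_int (c $ i)\<bar> \<le> 1/2"
      by (auto simp: realization_def unit_cube_def lattice_point_def)
    have "of_int (lo (c $ 1) (c $ 2)) \<le> (of_int (c $ 3) :: real)" "of_int (c $ 3) \<le> (of_int (hi (c $ 1) (c $ 2)) :: real)"
      using c(1) by (auto simp: \<Gamma>)
    then have "of_int (lo (c $ 1) (c $ 2)) - 1/2 \<le> p $ 3" "p $ 3 \<le> of_int (hi (c $ 1) (c $ 2)) + 1/2"
      using c(2)[of 3] by linarith+
    then show "\<exists>x y. 0 \<le> x \<and> x < m \<and> 0 \<le> y \<and> y < m \<and> \<bar>p $ 1 - of_int x\<bar> \<le> 1/2 \<and> \<bar>p $ 2 - of_int y\<bar> \<le> 1/2 \<and>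
      of_int (lo x y) - 1/2 \<le> p $ 3 \<and> p $ 3 \<le> of_int (hi x y) + 1/2"
      using c(1) c(2)[of 1] c(2)[of 2] by (rule_tac exI[of _ "c $ 1"], rule_tac exI[of _ "c $ 2"]) (auto simp: \<Gamma>)
  next
    assume "\<exists>x y. 0 \<le> x \<and> x < m \<and> 0 \<le> y \<and> y < m \<and> \<bar>p $ 1 - of_int x\<bar> \<le> 1/2 \<and> \<bar>p $ 2 - of_int y\<bar> \<le> 1/2 \<and>
      of_int (lo x y) - 1/2 \<le> p $ 3 \<and> p $ 3 \<le> of_int (hi x y) + 1/2"
    then obtain x y where xy: "0 \<le> x" "x < m" "0 \<le> y" "y < m" "\<bar>p $ 1 - of_int x\<bar> \<le> 1/2" "\<bar>p $ 2 - of_int y\<bar> \<le> 1/2"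
      "of_int (lo x y) - 1/2 \<le> p $ 3" "p $ 3 \<le> of_int (hi x y) + 1/2" by blast
    note l = lh[OF xy(1-4)]
    define z where "z = max (lo x y) (min (hi x y) (round (p $ 3)))"
    have r: "\<bar>of_int (round (p $ 3)) - p $ 3\<bar> \<le> 1/2" by (rule of_int_round_abs_le)
    have z: "lo x y \<le> z" "z \<le> hi x y" using l by (auto simp: z_def)
    have "\<bar>p $ 3 - of_int z\<bar> \<le> 1/2"
    proof -
      let ?R = "round (p $ 3)"
      consider "hi x y \<le> ?R" | "?R \<le> lo x y" | "lo x y \<le> ?R" "?R \<le> hi x y" by linarith
      then show ?thesis
      proof cases
        case 1
        then have "z = hi x y" "real_of_int (hi x y) \<le> real_of_int ?R" using l by (simp_all add: z_def)
        then show ?thesis using r xy(8) unfolding abs_le_iff by simp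
      next
        case 2
        then have "z = lo x y" "real_of_int ?R \<le> real_of_int (lo x y)" using l by (simp_all add: z_def)
        then show ?thesis using r xy(7) unfolding abs_le_iff by simp
      next
        case 3
        then have "z = ?R" by (simp add: z_def)
        then show ?thesis using r unfolding abs_le_iff by simp
      qed
    qed
    moreover define c :: "int ^ 3" where "c = vector [x, y, z]"
    ultimately have "c \<in> \<Gamma>" "\<forall>i. \<bar>p $ i - of_int (c $ i)\<bar> \<le> 1/2"
      using xy z by (auto simp: \<Gamma> c_def forall_3)
    then show "p \<in> ?S" by (auto simp: realization_def unit_cube_def lattice_point_def)
  qed
  have seg: "closed_segment p (?f p) \<subseteq> ?S" if "p \<in> ?S" for p
  proof
    fix q assume "q \<in> closed_segment p (?f p)"
    then obtain t where t: "0 \<le> t" "t \<le> 1" "q $ 1 = p $ 1" "q $ 2 = p $ 2" "q $ 3 = (1 - t) * (p $ 3) + t * 3"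
      by (rule closed_segment_vertical)
    obtain x y where xy: "0 \<le> x" "x < m" "0 \<le> y" "y < m" "\<bar>p $ 1 - of_int x\<bar> \<le> 1/2" "\<bar>p $ 2 - of_int y\<bar> \<le> 1/2"
      "of_int (lo x y) - 1/2 \<le> p $ 3" "p $ 3 \<le> of_int (hi x y) + 1/2" using \<open>p \<in> ?S\<close> unfolding mem by blast
    have "of_int (lo x y) - 1/2 \<le> (3::real)" "(3::real) \<le> of_int (hi x y) + 1/2" using lh[OF xy(1-4)] by linarith+
    then have "q $ 3 \<in> {of_int (lo x y) - 1/2..of_int (hi x y) + 1/2}"
      using convexD[OF convex_real_interval(5), of "p $ 3" _ _ 3 "1 - t" t] xy(7,8) t by auto
    then show "q \<in> ?S" unfolding mem using xy t by auto
  qed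
  have cont: "continuous_on A ?f" for A
    by (rule continuous_on_vec_lambda, rename_tac i, case_tac "i = 3") (auto intro!: continuous_intros)
  have box: "p \<in> ?S" if "\<bar>p $ 3 - 3\<bar> \<le> 1/2" "- 1/2 \<le> p $ 1" "p $ 1 \<le> of_int m - 1/2" "- 1/2 \<le> p $ 2" "p $ 2 \<le> of_int m - 1/2" for p
  proof -
    have pos: "\<exists>x. 0 \<le> x \<and> x < m \<and> \<bar>a - of_int x\<bar> \<le> 1/2" if "- 1/2 \<le> a" "a \<le> of_int m - 1/2" for a :: real
    proof -
      define x where "x = max 0 (min (m - 1) (round a))"
      have "\<bar>of_int (round a) - a\<bar> \<le> 1/2" by (rule of_int_round_abs_le)
      then have "\<bar>a - of_int x\<bar> \<le> 1/2" using that m of_int_clamp[of a m] unfolding x_def by blast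
      moreover have "0 \<le> x" "x < m" using m by (auto simp: x_def)
      ultimately show ?thesis by blast
    qed
    from pos[OF that(2,3)] pos[OF that(4,5)] obtain x y where
      xy: "0 \<le> x" "x < m" "\<bar>p $ 1 - of_int x\<bar> \<le> 1/2" "0 \<le> y" "y < m" "\<bar>p $ 2 - of_int y\<bar> \<le> 1/2" by blast
    have "of_int (lo x y) \<le> (3::real)" "(3::real) \<le> of_int (hi x y)" using lh[OF xy(1,2,4,5)] by linarith+
    then have "of_int (lo x y) - 1/2 \<le> p $ 3" "p $ 3 \<le> of_int (hi x y) + 1/2" using that(1) by linarith+
    then show ?thesis unfolding mem using xy by blast
  qed
  have bound: "- 1/2 \<le> p $ 1 \<and> p $ 1 \<le> of_int m - 1/2 \<and> - 1/2 \<le> p $ 2 \<and> p $ 2 \<le> of_int m - 1/2" if "p \<in> ?S" for p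
  proof -
    obtain x y where xy: "0 \<le> x" "x < m" "0 \<le> y" "y < m" "\<bar>p $ 1 - of_int x\<bar> \<le> 1/2" "\<bar>p $ 2 - of_int y\<bar> \<le> 1/2"
      using \<open>p \<in> ?S\<close> unfolding mem by blast
    have "of_int x \<le> (of_int (m - 1) :: real)" "of_int y \<le> (of_int (m - 1) :: real)"
      "0 \<le> (of_int x :: real)" "0 \<le> (of_int y :: real)" using xy by (simp_all only: of_int_le_iff of_int_0_le_iff)
    then show ?thesis using xy(5,6) by (intro conjI) linarith+
  qed
  have "?f ` ?S = {p. p $ 3 = 3 \<and> - 1/2 \<le> p $ 1 \<and> p $ 1 \<le> of_int m - 1/2 \<and> - 1/2 \<le> p $ 2 \<and> p $ 2 \<le> of_int m - 1/2}" (is "_ = ?R")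
  proof (intro equalityI subsetI)
    fix p assume "p \<in> ?f ` ?S" then show "p \<in> ?R" using bound by auto
  next
    fix p assume p: "p \<in> ?R"
    then have "p \<in> ?S" by (intro box) auto
    moreover have "p = ?f p" using p by (auto simp: vec_eq_iff)
    ultimately show "p \<in> ?f ` ?S" by blast
  qed
  moreover have "convex ?R"
  proof (rule convexI)
    fix p q :: "real ^ 3" and u v :: real
    assume pq: "p \<in> ?R" "q \<in> ?R" and uv: "0 \<le> u" "0 \<le> v" "u + v = 1"
    have "u * a + v * b \<in> {- 1/2..of_int m - 1/2}" if "a \<in> {- 1/2..of_int m - 1/2}" "b \<in> {- 1/2..of_int m - 1/2}" for a b :: real
      using convexD[OF convex_real_interval(5) that uv] by simp
    moreover have "u * 3 + v * 3 = (3::real)" using uv(3) by (simp add: distrib_right[symmetric])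
    ultimately show "u *\<^sub>R p + v *\<^sub>R q \<in> ?R" using pq by auto
  qed
  ultimately have "contractible ?S" using contractible_two_step[OF cont seg] by simp
  moreover have "contractible (interior ?S)"
  proof (rule contractible_two_step[OF cont])
    let ?O = "{p :: real ^ 3. - 1/2 < p $ 1 \<and> p $ 1 < of_int m - 1/2 \<and> - 1/2 < p $ 2 \<and> p $ 2 < of_int m - 1/2}"
    \<comment> \<open>The open middle layer lies in the interior and contains the endpoints of the
      movement.\<close>
    let ?B = "?O \<inter> {p. 5/2 < p $ 3 \<and> p $ 3 < 7/2}"
    have "open ?O" by (intro open_Collect_conj open_Collect_less continuous_intros)
    have "open ?B" by (intro open_Int \<open>open ?O\<close> open_Collect_conj open_Collect_less continuous_intros)
    moreover have "?B \<subseteq> ?S"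
    proof
      fix q assume "q \<in> ?B"
      then have f: "- 1/2 < q $ 1" "q $ 1 < of_int m - 1/2" "- 1/2 < q $ 2" "q $ 2 < of_int m - 1/2" "5/2 < q $ 3" "q $ 3 < 7/2"
        by blast+
      show "q \<in> ?S" by (rule box) (use f in linarith)+
    qed
    ultimately have B: "?B \<subseteq> interior ?S" by (rule interior_maximal[rotated])
    have SO: "interior ?S \<subseteq> ?O"
    proof
      fix p assume "p \<in> interior ?S"
      then obtain e where e: "0 < e" "cball p e \<subseteq> ?S" using mem_interior_cball by blast
      \<comment> \<open>Applying the bounds at distance \<open>e\<close> on either side makes them
        strict.\<close>
      have "p + s *\<^sub>R axis i 1 \<in> ?S" if "\<bar>s\<bar> = e" for s i
        using e that by (auto simp: subset_eq dist_norm norm_axis_1)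
      note * = bound[OF this[of e 1]] bound[OF this[of "- e" 1]] bound[OF this[of e 2]] bound[OF this[of "- e" 2]]
      show "p \<in> ?O" using * e(1) by (auto simp: axis_def)
    qed
    show "closed_segment p (?f p) \<subseteq> interior ?S" if p: "p \<in> interior ?S" for p
    proof
      fix q assume q: "q \<in> closed_segment p (?f p)"
      then obtain t where t: "0 \<le> t" "t \<le> 1" "q $ 1 = p $ 1" "q $ 2 = p $ 2" "q $ 3 = (1 - t) * (p $ 3) + t * 3"
        by (rule closed_segment_vertical)
      show "q \<in> interior ?S"
      proof (cases "t = 1")
        case True
        then show ?thesis using subsetD[OF SO p] t subsetD[OF B, of q] by simp
      next
        case False
        \<comment> \<open>\<open>?g\<close> undoes the movement up to time \<open>t\<close>. The
          preimage of the interior under it is open and contains \<open>q\<close>, and it lies in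
          \<open>?S\<close> because each of its points is on the path of a point of the
          interior.\<close>
        let ?g = "\<lambda>r :: real ^ 3. (\<chi> i. if i = 3 then (r $ 3 - t * 3) / (1 - t) else r $ i) :: real ^ 3"
        have "continuous_on UNIV ?g"
          by (rule continuous_on_vec_lambda, rename_tac i, case_tac "i = 3") (use False in \<open>auto intro!: continuous_intros\<close>)
        then have "open (?g -` interior ?S)" by (simp add: open_vimage)
        moreover have "?g -` interior ?S \<subseteq> ?S"
        proof
          fix r assume "r \<in> ?g -` interior ?S"
          then have g: "?g r \<in> ?S" using interior_subset by blast
          have "r = (1 - t) *\<^sub>R ?g r + t *\<^sub>R ?f (?g r)"
          proof -
            have nt: "1 - t \<noteq> 0" using False by simp
            have c1: "(1 - t) * a + t * a = a" for a :: real by (simp add: left_diff_distrib)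
            have c3: "(1 - t) * ((r $ 3 - t * 3) / (1 - t)) = r $ 3 - t * 3" using nt by simp
            show ?thesis using False by (simp add: vec_eq_iff forall_3 c1 c3 nt)
          qed
          then have "r \<in> closed_segment (?g r) (?f (?g r))" unfolding in_segment using t by blast
          then show "r \<in> ?S" using seg[OF g] by blast
        qed
        ultimately have "?g -` interior ?S \<subseteq> interior ?S" by (rule interior_maximal[rotated])
        moreover have "?g q = p" using t False by (auto simp: vec_eq_iff forall_3)
        ultimately show ?thesis using p by blast
      qed
    qed
    have "?f ` interior ?S = {p. p $ 3 = 3} \<inter> ?O"
    proof (intro equalityI subsetI)
      fix p assume "p \<in> ?f ` interior ?S" then show "p \<in> {p. p $ 3 = 3} \<inter> ?O" using SO by auto
    next
      fix p assume p: "p \<in> {p. p $ 3 = 3} \<inter> ?O"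
      then have "p \<in> interior ?S" using B by auto
      moreover have "p = ?f p" using p by (auto simp: vec_eq_iff)
      ultimately show "p \<in> ?f ` interior ?S" by blast
    qed
    moreover have "convex ({p :: real ^ 3. p $ 3 = 3} \<inter> ?O)"
    proof (rule convexI)
      fix p q :: "real ^ 3" and u v :: real
      assume pq: "p \<in> {p. p $ 3 = 3} \<inter> ?O" "q \<in> {p. p $ 3 = 3} \<inter> ?O" and uv: "0 \<le> u" "0 \<le> v" "u + v = 1"
      have "u * a + v * b \<in> {- 1/2<..<of_int m - 1/2}" if "a \<in> {- 1/2<..<of_int m - 1/2}" "b \<in> {- 1/2<..<of_int m - 1/2}" for a b :: real
        using convexD[OF convex_real_interval(8) that uv] by simp
      moreover have "u * 3 + v * 3 = (3::real)" using uv(3) by (simp add: distrib_right[symmetric])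
      ultimately show "u *\<^sub>R p + v *\<^sub>R q \<in> {p. p $ 3 = 3} \<inter> ?O" using pq by auto
    qed
    ultimately show "convex (?f ` interior ?S)" by simp
  qed
  moreover have "vector [0, 0, 3] \<in> \<Gamma>" using m lh[of 0 0] by (simp add: \<Gamma>)
  ultimately show ?thesis unfolding contractible_region_def by blast
qed

section \<open>Counter programs and their compilation to Turing machines\<close>

datatype com = Skip | Inc nat | Dec nat | MvR | MvL | Emit bool
  | Seq com com (infixr ";;" 60) | While nat com | WhileIn com | IfIn nat com com

type_synonym st = "(nat \<Rightarrow> nat) \<times> nat \<times> bool list"

definition in_sym :: "bool list \<Rightarrow> nat \<Rightarrow> nat" where
  "in_sym w h = (if h < length w then bit_symbol (w ! h) else blank)"

text \<open>Durations are steps of the compiled machine: a round of a loop costs one step for the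
  test and one for the jump back, and the first branch of a conditional one more for skipping the
  second. The input head is a natural number, so \<open>MvL\<close> is possible only away from cell
  0.\<close>

inductive exec :: "bool list \<Rightarrow> com \<Rightarrow> st \<Rightarrow> nat \<Rightarrow> st \<Rightarrow> bool" for w where
  Skip: "exec w Skip s 0 s"
| Inc: "exec w (Inc v) (\<sigma>, h, u) 1 (\<sigma>(v := Suc (\<sigma> v)), h, u)"
| Dec: "exec w (Dec v) (\<sigma>, h, u) 1 (\<sigma>(v := \<sigma> v - 1), h, u)"
| MvR: "exec w MvR (\<sigma>, h, u) 1 (\<sigma>, Suc h, u)"
| MvL: "exec w MvL (\<sigma>, Suc h, u) 1 (\<sigma>, h, u)"
| Emit: "exec w (Emit b) (\<sigma>, h, u) 1 (\<sigma>, h, u @ [b])"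
| Seq: "exec w c s t s' \<Longrightarrow> exec w d s' t' s'' \<Longrightarrow> exec w (c ;; d) s (t + t') s''"
| WhileF: "fst s v = 0 \<Longrightarrow> exec w (While v c) s 1 s"
| WhileT: "fst s v \<noteq> 0 \<Longrightarrow> exec w c s t s' \<Longrightarrow> exec w (While v c) s' t' s'' \<Longrightarrow>
    exec w (While v c) s (t + t' + 2) s''"
| WhileInF: "in_sym w (fst (snd s)) = blank \<Longrightarrow> exec w (WhileIn c) s 1 s"
| WhileInT: "in_sym w (fst (snd s)) \<noteq> blank \<Longrightarrow> exec w c s t s' \<Longrightarrow> exec w (WhileIn c) s' t' s'' \<Longrightarrow>
    exec w (WhileIn c) s (t + t' + 2) s''"
| IfT: "in_sym w (fst (snd s)) = a \<Longrightarrow> exec w c s t s' \<Longrightarrow> exec w (IfIn a c d) s (t + 2) s'"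
| IfF: "in_sym w (fst (snd s)) \<noteq> a \<Longrightarrow> exec w d s t s' \<Longrightarrow> exec w (IfIn a c d) s (t + 1) s'"

fun counters :: "com \<Rightarrow> nat set" where
  "counters (Inc v) = {v}"
| "counters (Dec v) = {v}"
| "counters (c ;; d) = counters c \<union> counters d"
| "counters (While v c) = insert v (counters c)"
| "counters (WhileIn c) = counters c"
| "counters (IfIn a c d) = counters c \<union> counters d"
| "counters _ = {}"

lemma finite_counters: "finite (counters c)"
  by (induction c) auto

type_synonym instr = "nat list \<Rightarrow> nat \<times> (nat \<times> move) list"

definition keep :: "nat list \<Rightarrow> (nat \<times> move) list" where
  "keep ss = map (\<lambda>s. (s, MStay)) ss"

fun code_size :: "com \<Rightarrow> nat" where
  "code_size Skip = 0"
| "code_size (c ;; d) = code_size c + code_size d"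
| "code_size (While v c) = code_size c + 2"
| "code_size (WhileIn c) = code_size c + 2"
| "code_size (IfIn a c d) = code_size c + code_size d + 2"
| "code_size _ = 1"

text \<open>The second argument is the address of the first instruction, and control leaves the code
  at its end. Tape 0 is the input and tape 1 the output, so counter \<open>v\<close> sits on tape
  \<open>v + 2\<close>.\<close>

fun compile :: "com \<Rightarrow> nat \<Rightarrow> instr list" where
  "compile Skip b = []"
| "compile (Inc v) b = [\<lambda>ss. (Suc b, (keep ss)[v + 2 := (ss ! (v + 2), MRight)])]"
| "compile (Dec v) b =
    [\<lambda>ss. (Suc b, (keep ss)[v + 2 := (ss ! (v + 2), if ss ! (v + 2) = 1 then MStay else MLeft)])]"
| "compile MvR b = [\<lambda>ss. (Suc b, (keep ss)[0 := (ss ! 0, MRight)])]"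
| "compile MvL b = [\<lambda>ss. (Suc b, (keep ss)[0 := (ss ! 0, MLeft)])]"
| "compile (Emit x) b = [\<lambda>ss. (Suc b, (keep ss)[1 := (bit_symbol x, MRight)])]"
| "compile (c ;; d) b = compile c b @ compile d (b + code_size c)"
| "compile (While v c) b =
    (\<lambda>ss. (if ss ! (v + 2) = 1 then b + code_size c + 2 else Suc b, keep ss)) #
    compile c (Suc b) @ [\<lambda>ss. (b, keep ss)]"
| "compile (WhileIn c) b =
    (\<lambda>ss. (if ss ! 0 = blank then b + code_size c + 2 else Suc b, keep ss)) #
    compile c (Suc b) @ [\<lambda>ss. (b, keep ss)]"
| "compile (IfIn a c d) b =
    (\<lambda>ss. (if ss ! 0 = a then Suc b else b + code_size c + 2, keep ss)) #
    compile c (Suc b) @ [\<lambda>ss. (b + code_size c + code_size d + 2, keep ss)] @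
    compile d (b + code_size c + 2)"

lemma length_compile [simp]: "length (compile c b) = code_size c"
  by (induction c arbitrary: b) auto

text \<open>A counter is the distance of the head from a mark in cell 0: counting is moving, and
  zero is recognised by reading the mark.\<close>

definition mark_tape :: "nat \<Rightarrow> tape" where
  "mark_tape n = ((\<lambda>i. if i = 0 then 1 else blank), int n)"

fun tapes :: "nat \<Rightarrow> bool list \<Rightarrow> st \<Rightarrow> tape list" where
  "tapes K w (\<sigma>, h, u) = (fst (word_tape w), int h) # (fst (word_tape u), int (length u)) #
     map (\<lambda>v. mark_tape (\<sigma> v)) [0..<K]"

lemma length_tapes [simp]: "length (tapes K w s) = K + 2"
  by (cases s) auto

lemma keep_act: "map2 act_tape (keep (map read_tape ts)) ts = ts"
  by (rule nth_equalityI) (auto simp: keep_def act_tape_def read_tape_def)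

lemma keep_update_act:
  "i < length ts \<Longrightarrow>
   map2 act_tape ((keep (map read_tape ts))[i := a]) ts = ts[i := act_tape a (ts ! i)]"
  by (rule nth_equalityI) (auto simp: keep_def act_tape_def read_tape_def nth_list_update)

lemma tapes_upd_counter: "v < K \<Longrightarrow>
   (tapes K w (\<sigma>, h, u))[v + 2 := mark_tape n] = tapes K w (\<sigma>(v := n), h, u)"
  by (auto intro!: nth_equalityI simp: nth_list_update nth_Cons split: nat.splits)

definition loaded :: "machine \<Rightarrow> nat \<Rightarrow> instr list \<Rightarrow> bool" where
  "loaded M b is \<longleftrightarrow> (\<forall>i < length is. trans M (b + i) = is ! i)"

lemma loaded_Cons: "loaded M b (i # is) \<longleftrightarrow> trans M b = i \<and> loaded M (Suc b) is"
  by (simp add: loaded_def All_less_Suc2)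

lemma loaded_append: "loaded M b (is @ js) \<longleftrightarrow> loaded M b is \<and> loaded M (b + length is) js"
  by (induction "is" arbitrary: b) (auto simp: loaded_Cons, auto simp: loaded_def)

lemma step_keep:
  assumes "trans M q = i" "q \<noteq> 1" "q \<noteq> 2" "i (map read_tape ts) = (q', keep (map read_tape ts))"
  shows "step M Or (q, ts) (q', ts)"
  using step.ordinary[of q M ts q' "keep (map read_tape ts)" Or] assms by (simp add: keep_act)

lemma step_update:
  assumes "trans M q = i" "q \<noteq> 1" "q \<noteq> 2" "k < length ts"
    "i (map read_tape ts) = (q', (keep (map read_tape ts))[k := a])" "ts[k := act_tape a (ts ! k)] = ts'"
  shows "step M Or (q, ts) (q', ts')"
  using step.ordinary[of q M ts q' "(keep (map read_tape ts))[k := a]" Or] assms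
  by (simp add: keep_update_act)

lemma nth_tapes:
  "tapes K w (\<sigma>, h, u) ! 0 = (fst (word_tape w), int h)"
  "tapes K w (\<sigma>, h, u) ! 1 = (fst (word_tape u), int (length u))"
  "v < K \<Longrightarrow> tapes K w (\<sigma>, h, u) ! (v + 2) = mark_tape (\<sigma> v)"
  by (auto simp: nth_append)

lemma nth_read_tapes:
  "map read_tape (tapes K w s) ! 0 = in_sym w (fst (snd s))"
  "v < K \<Longrightarrow> map read_tape (tapes K w s) ! (v + 2) = (if fst s v = 0 then 1 else blank)"
  by (cases s; simp add: read_tape_def in_sym_def word_tape_def mark_tape_def)+

lemma tapes_update:
  "(tapes K w (\<sigma>, h, u))[0 := (fst (word_tape w), int h')] = tapes K w (\<sigma>, h', u)"
  "(tapes K w (\<sigma>, h, u))[1 := (fst (word_tape u'), int (length u'))] = tapes K w (\<sigma>, h, u')"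
  by auto

lemma relpowp_add_intro:
  fixes R :: "'a \<Rightarrow> 'a \<Rightarrow> bool"
  shows "(R ^^ m) x y \<Longrightarrow> (R ^^ n) y z \<Longrightarrow> (R ^^ (m + n)) x z"
  by (auto simp: relpowp_add)

lemma relpowp_1_intro:
  fixes R :: "'a \<Rightarrow> 'a \<Rightarrow> bool"
  shows "R x y \<Longrightarrow> (R ^^ (1::nat)) x y"
  by (simp add: eq_OO)

lemma act_mark_tape:
  "act_tape (if n = 0 then 1 else blank, MRight) (mark_tape n) = mark_tape (Suc n)"
  "act_tape (if n = 0 then 1 else blank, if (if n = 0 then 1 else blank) = (1::nat) then MStay else MLeft)
     (mark_tape n) = mark_tape (n - 1)"
  by (auto simp: act_tape_def mark_tape_def)

lemma compile_correct:
  assumes "exec w c s t s'" "loaded M b (compile c b)" "4 \<le> b" "counters c \<subseteq> {..<K}"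
  shows "(step M Or ^^ t) (b, tapes K w s) (b + code_size c, tapes K w s')"
  using assms
proof (induction arbitrary: b rule: exec.induct)
  case (Skip s)
  then show ?case by (simp add: eq_OO)
next
  case (Inc v \<sigma> h u)
  let ?ts = "tapes K w (\<sigma>, h, u)"
  let ?a = "(if \<sigma> v = 0 then 1 else blank, MRight)"
  have v: "v < K" using Inc by simp
  have "step M Or (b, ?ts) (Suc b, tapes K w (\<sigma>(v := Suc (\<sigma> v)), h, u))"
  proof (rule step_update[where k = "v + 2" and a = ?a])
    show "trans M b = hd (compile (Inc v) b)" using Inc by (simp add: loaded_Cons)
    show "hd (compile (Inc v) b) (map read_tape ?ts) = (Suc b, (keep (map read_tape ?ts))[v + 2 := ?a])"
      using v by (simp only: compile.simps list.sel nth_read_tapes fst_conv)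
    show "?ts[v + 2 := act_tape ?a (?ts ! (v + 2))] = tapes K w (\<sigma>(v := Suc (\<sigma> v)), h, u)"
      using v by (simp only: nth_tapes act_mark_tape tapes_upd_counter)
  qed (use v Inc in auto)
  then show ?case by (simp add: eq_OO)
next
  case (Dec v \<sigma> h u)
  let ?ts = "tapes K w (\<sigma>, h, u)"
  let ?a = "(if \<sigma> v = 0 then 1 else blank, if (if \<sigma> v = 0 then 1 else blank) = (1::nat) then MStay else MLeft)"
  have v: "v < K" using Dec by simp
  have "step M Or (b, ?ts) (Suc b, tapes K w (\<sigma>(v := \<sigma> v - 1), h, u))"
  proof (rule step_update[where k = "v + 2" and a = ?a])
    show "trans M b = hd (compile (Dec v) b)" using Dec by (simp add: loaded_Cons)
    show "hd (compile (Dec v) b) (map read_tape ?ts) = (Suc b, (keep (map read_tape ?ts))[v + 2 := ?a])"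
      using v by (simp only: compile.simps list.sel nth_read_tapes fst_conv)
    show "?ts[v + 2 := act_tape ?a (?ts ! (v + 2))] = tapes K w (\<sigma>(v := \<sigma> v - 1), h, u)"
      using v by (simp only: nth_tapes act_mark_tape tapes_upd_counter)
  qed (use v Dec in auto)
  then show ?case by (simp add: eq_OO)
next
  case (MvR \<sigma> h u)
  then have "step M Or (b, tapes K w (\<sigma>, h, u)) (Suc b, tapes K w (\<sigma>, Suc h, u))"
    by (intro step_update[where k = 0, OF refl])
       (auto simp: loaded_Cons act_tape_def read_tape_def)
  then show ?case by (simp add: eq_OO)
next
  case (MvL \<sigma> h u)
  then have "step M Or (b, tapes K w (\<sigma>, Suc h, u)) (Suc b, tapes K w (\<sigma>, h, u))"
    by (intro step_update[where k = 0, OF refl])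
       (auto simp: loaded_Cons act_tape_def read_tape_def)
  then show ?case by (simp add: eq_OO)
next
  case (Emit x \<sigma> h u)
  have "act_tape (bit_symbol x, MRight) (fst (word_tape u), int (length u)) =
      (fst (word_tape (u @ [x])), int (length (u @ [x])))"
    by (auto simp: act_tape_def word_tape_def nth_append fun_eq_iff)
  with Emit have "step M Or (b, tapes K w (\<sigma>, h, u)) (Suc b, tapes K w (\<sigma>, h, u @ [x]))"
    by (intro step_update[where k = 1, OF refl]) (auto simp: loaded_Cons)
  then show ?case by (simp add: eq_OO)
next
  case (Seq c s t s' d t' s'')
  then have "(step M Or ^^ t) (b, tapes K w s) (b + code_size c, tapes K w s')"
    by (auto simp: loaded_append)
  moreover have "(step M Or ^^ t') (b + code_size c, tapes K w s')
      (b + code_size c + code_size d, tapes K w s'')"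
    using Seq by (auto simp: loaded_append)
  ultimately show ?case using relpowp_add_intro[of t "step M Or"] by (simp add: add.assoc)
next
  case (WhileF s v c)
  then have "step M Or (b, tapes K w s) (b + code_size (While v c), tapes K w s)"
    by (intro step_keep[OF refl])
       (auto simp: loaded_Cons loaded_append nth_read_tapes simp del: nth_map add_2_eq_Suc')
  then show ?case by (simp add: eq_OO)
next
  case (WhileT s v c t s' t' s'')
  have s1: "step M Or (b, tapes K w s) (Suc b, tapes K w s)"
    using WhileT
    by (intro step_keep[OF refl])
       (auto simp: loaded_Cons loaded_append nth_read_tapes simp del: nth_map add_2_eq_Suc')
  have s2: "(step M Or ^^ t) (Suc b, tapes K w s) (Suc b + code_size c, tapes K w s')"
    using WhileT.IH(1)[of "Suc b"] WhileT.prems by (simp add: loaded_append loaded_Cons)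
  have s3: "step M Or (Suc b + code_size c, tapes K w s') (b, tapes K w s')"
    using WhileT
    by (intro step_keep[OF refl])
       (auto simp: loaded_Cons loaded_append nth_read_tapes simp del: nth_map add_2_eq_Suc')
  have s4: "(step M Or ^^ t') (b, tapes K w s') (b + code_size (While v c), tapes K w s'')"
    using WhileT by auto
  have "(step M Or ^^ (1 + t + 1 + t')) (b, tapes K w s) (b + code_size (While v c), tapes K w s'')"
    by (rule relpowp_add_intro[OF relpowp_add_intro[OF relpowp_add_intro[OF relpowp_1_intro[of "step M Or", OF s1] s2] relpowp_1_intro[of "step M Or", OF s3]] s4])
  then show ?case by (simp add: algebra_simps)
next
  case (WhileInF s c)
  then have "step M Or (b, tapes K w s) (b + code_size (WhileIn c), tapes K w s)"
    by (intro step_keep[OF refl])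
       (auto simp: loaded_Cons loaded_append nth_read_tapes simp del: nth_map add_2_eq_Suc')
  then show ?case by (simp add: eq_OO)
next
  case (WhileInT s c t s' t' s'')
  have s1: "step M Or (b, tapes K w s) (Suc b, tapes K w s)"
    using WhileInT
    by (intro step_keep[OF refl])
       (auto simp: loaded_Cons loaded_append nth_read_tapes simp del: nth_map add_2_eq_Suc')
  have s2: "(step M Or ^^ t) (Suc b, tapes K w s) (Suc b + code_size c, tapes K w s')"
    using WhileInT.IH(1)[of "Suc b"] WhileInT.prems by (simp add: loaded_append loaded_Cons)
  have s3: "step M Or (Suc b + code_size c, tapes K w s') (b, tapes K w s')"
    using WhileInT
    by (intro step_keep[OF refl])
       (auto simp: loaded_Cons loaded_append nth_read_tapes simp del: nth_map add_2_eq_Suc')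
  have s4: "(step M Or ^^ t') (b, tapes K w s') (b + code_size (WhileIn c), tapes K w s'')"
    using WhileInT by auto
  have "(step M Or ^^ (1 + t + 1 + t')) (b, tapes K w s) (b + code_size (WhileIn c), tapes K w s'')"
    by (rule relpowp_add_intro[OF relpowp_add_intro[OF relpowp_add_intro[OF relpowp_1_intro[of "step M Or", OF s1] s2] relpowp_1_intro[of "step M Or", OF s3]] s4])
  then show ?case by (simp add: algebra_simps)
next
  case (IfT s a c t s' d)
  have s1: "step M Or (b, tapes K w s) (Suc b, tapes K w s)"
    using IfT
    by (intro step_keep[OF refl])
       (auto simp: loaded_Cons loaded_append nth_read_tapes simp del: nth_map add_2_eq_Suc')
  have s2: "(step M Or ^^ t) (Suc b, tapes K w s) (Suc b + code_size c, tapes K w s')"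
    using IfT.IH(1)[of "Suc b"] IfT.prems by (simp add: loaded_append loaded_Cons)
  have s3: "step M Or (Suc b + code_size c, tapes K w s') (b + code_size (IfIn a c d), tapes K w s')"
    using IfT
    by (intro step_keep[OF refl])
       (auto simp: loaded_Cons loaded_append nth_read_tapes simp del: nth_map add_2_eq_Suc')
  have "(step M Or ^^ (1 + t + 1)) (b, tapes K w s) (b + code_size (IfIn a c d), tapes K w s')"
    by (rule relpowp_add_intro[OF relpowp_add_intro[OF relpowp_1_intro[of "step M Or", OF s1] s2] relpowp_1_intro[of "step M Or", OF s3]])
  then show ?case by (simp add: algebra_simps)
next
  case (IfF s a d t s' c)
  have s1: "step M Or (b, tapes K w s) (b + code_size c + 2, tapes K w s)"
    using IfF
    by (intro step_keep[OF refl])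
       (auto simp: loaded_Cons loaded_append nth_read_tapes simp del: nth_map add_2_eq_Suc')
  have s2: "(step M Or ^^ t) (b + code_size c + 2, tapes K w s)
      (b + code_size c + 2 + code_size d, tapes K w s')"
    using IfF.IH(1)[of "b + code_size c + 2"] IfF.prems by (simp add: loaded_append loaded_Cons)
  have "(step M Or ^^ (1 + t)) (b, tapes K w s) (b + code_size c + 2 + code_size d, tapes K w s')"
    by (rule relpowp_add_intro[OF relpowp_1_intro[of "step M Or", OF s1] s2])
  then show ?case by (simp add: algebra_simps)
qed


definition machine_of :: "nat \<Rightarrow> instr list \<Rightarrow> machine" where
  "machine_of K code = \<lparr>num_tapes = K + 2, num_states = length code, num_symbols = 3,
     trans = (\<lambda>q. if q < length code then code ! q else (\<lambda>ss. (halt_state, keep ss)))\<rparr>"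

definition wf_instr :: "nat \<Rightarrow> nat \<Rightarrow> instr \<Rightarrow> bool" where
  "wf_instr K n i \<longleftrightarrow> (\<forall>ss. length ss = K + 2 \<and> (\<forall>s\<in>set ss. s < 3) \<longrightarrow>
     fst (i ss) < n \<and> length (snd (i ss)) = K + 2 \<and> (\<forall>a\<in>set (snd (i ss)). fst a < 3))"

lemma wf_machine_of:
  assumes "\<forall>i\<in>set code. wf_instr K (length code) i" "4 \<le> length code"
  shows "wf_machine (machine_of K code)"
proof -
  have "wf_instr K (length code) (code ! q)" if "q < length code" for q
    using assms(1) nth_mem[OF that] by blast
  then show ?thesis
    using assms(2) unfolding wf_machine_def machine_of_def by (simp add: wf_instr_def)
qed

lemma keep_update_ok:
  assumes "length ss = K + 2" "\<forall>s\<in>set ss. s < 3" "fst a < 3"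
  shows "length ((keep ss)[i := a]) = K + 2" "\<forall>b\<in>set ((keep ss)[i := a]). fst b < 3"
    "length (keep ss) = K + 2" "\<forall>b\<in>set (keep ss). fst b < 3"
  using assms set_update_subset_insert[of "keep ss" i a] by (auto simp: keep_def)

lemma wf_instr_keep: "f ` UNIV \<subseteq> {..<n} \<Longrightarrow> wf_instr K n (\<lambda>ss. (f ss, keep ss))"
  by (auto simp: wf_instr_def keep_def)

lemma wf_instr_update:
  assumes "\<And>ss. f ss < n" "\<And>ss. length ss = K + 2 \<Longrightarrow> \<forall>s\<in>set ss. s < 3 \<Longrightarrow> fst (g ss) < 3"
  shows "wf_instr K n (\<lambda>ss. (f ss, (keep ss)[i := g ss]))"
  unfolding wf_instr_def using keep_update_ok assms by (metis fst_conv snd_conv)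

lemma bit_symbol_less: "bit_symbol b < 3"
  by (simp add: bit_symbol_def)

lemma wf_compile:
  "counters c \<subseteq> {..<K} \<Longrightarrow> b + code_size c < n \<Longrightarrow> i \<in> set (compile c b) \<Longrightarrow> wf_instr K n i"
proof (induction c arbitrary: b)
  case (Emit x)
  then show ?case by (auto intro!: wf_instr_update simp: bit_symbol_less)
next
  case (Seq c d)
  then show ?case using Seq.IH(1)[of b] Seq.IH(2)[of "b + code_size c"] by auto
next
  case (While v c)
  then show ?case using While.IH[of "Suc b"] by (auto intro!: wf_instr_keep)
next
  case (WhileIn c)
  then show ?case using WhileIn.IH[of "Suc b"] by (auto intro!: wf_instr_keep)
next
  case (IfIn a c d)
  then show ?case using IfIn.IH(1)[of "Suc b"] IfIn.IH(2)[of "b + code_size c + 2"]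
    by (auto intro!: wf_instr_keep)
qed (auto intro!: wf_instr_update)

text \<open>Puts the marks on the counter tapes. The states 0 to 3 have fixed meanings, so compiled
  code starts at 4.\<close>

abbreviation start_instr :: "nat \<Rightarrow> instr" where
  "start_instr K \<equiv> (\<lambda>ss. (4, take 2 (keep ss) @ replicate K (1, MStay)))"

lemma wf_start_instr: "4 < n \<Longrightarrow> wf_instr K n (start_instr K)"
proof -
  have "length (take 2 (keep ss)) = 2" "\<forall>b\<in>set (take 2 (keep ss)). fst b < 3"
    if "length ss = K + 2" "\<forall>s\<in>set ss. s < 3" for ss
    using that keep_update_ok(3,4)[OF that, of "(0, MStay)"] by (auto dest: in_set_takeD)
  then show "4 < n \<Longrightarrow> ?thesis" unfolding wf_instr_def by auto
qed

lemma start_step: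
  assumes "trans M 0 = start_instr K" "num_tapes M = K + 2"
  shows "step M Or (init_config M w) (4, tapes K w (\<lambda>_. 0, 0, []))"
proof -
  let ?ts = "word_tape w # replicate (K + 1) (word_tape [])"
  have "map2 act_tape (snd (start_instr K (map read_tape ?ts))) ?ts = tapes K w (\<lambda>_. 0, 0, [])"
    by (intro nth_equalityI)
       (auto simp: keep_def nth_Cons act_tape_def read_tape_def word_tape_def mark_tape_def
         nth_append fun_eq_iff split: nat.splits)
  then show ?thesis
    using step.ordinary[of 0 M ?ts 4 "snd (start_instr K (map read_tape ?ts))" Or] assms
    by (simp add: init_config_def)
qed

definition counters_below :: "com \<Rightarrow> nat" where
  "counters_below c = Suc (Max (insert 0 (counters c)))"

lemma counters_below: "counters c \<subseteq> {..<counters_below c}" "0 < counters_below c"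
  by (auto simp: counters_below_def finite_counters less_Suc_eq_le)

text \<open>The verdict is whether counter 0 is nonzero. It replaces the beginning of the input on
  tape 0, followed by a blank; the program must therefore have returned the input head to cell
  0.\<close>

definition decider :: "com \<Rightarrow> machine" where
  "decider c = machine_of (counters_below c)
     ([start_instr (counters_below c), \<lambda>ss. (1, keep ss), \<lambda>ss. (1, keep ss), \<lambda>ss. (1, keep ss)] @
      compile c 4 @
      [\<lambda>ss. (5 + code_size c, (keep ss)[0 := (bit_symbol (ss ! 2 \<noteq> 1), MRight)]),
       \<lambda>ss. (1, (keep ss)[0 := (blank, MStay)])])"

lemma poly_time_decider:
  fixes p :: "nat poly"
  assumes "\<And>w. \<exists>t \<le> poly p (length w). \<exists>\<sigma> u. exec w c (\<lambda>_. 0, 0, []) t (\<sigma>, 0, u) \<and> (\<sigma> 0 \<noteq> 0 \<longleftrightarrow> L w)"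
  shows "poly_time Or (\<lambda>w. [L w])"
proof -
  let ?K = "counters_below c"
  have wf: "wf_machine (decider c)"
    unfolding decider_def
    by (rule wf_machine_of)
       (auto intro!: wf_instr_keep wf_instr_update wf_start_instr
         simp: bit_symbol_less simp del: One_nat_def,
        erule wf_compile[OF counters_below(1), rotated], simp)
  have tr: "trans (decider c) 0 = start_instr ?K" "loaded (decider c) 4 (compile c 4)"
    "trans (decider c) (4 + code_size c) =
      (\<lambda>ss. (5 + code_size c, (keep ss)[0 := (bit_symbol (ss ! 2 \<noteq> 1), MRight)]))"
    "trans (decider c) (5 + code_size c) = (\<lambda>ss. (1, (keep ss)[0 := (blank, MStay)]))"
    "num_tapes (decider c) = ?K + 2"
    by (auto simp: decider_def machine_of_def loaded_def nth_append nth_Cons' simp del: One_nat_def)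
  have "computes_within (decider c) Or w [L w] (poly (p + [:3:]) (length w))" for w
  proof -
    obtain t \<sigma> u where t: "t \<le> poly p (length w)" "exec w c (\<lambda>_. 0, 0, []) t (\<sigma>, 0, u)"
      and L: "\<sigma> 0 \<noteq> 0 \<longleftrightarrow> L w" using assms by blast
    let ?ts = "tapes ?K w (\<sigma>, 0, u)"
    let ?ts1 = "?ts[0 := act_tape (bit_symbol (L w), MRight) (?ts ! 0)]"
    let ?ts2 = "?ts1[0 := act_tape (blank, MStay) (?ts1 ! 0)]"
    have "map read_tape ?ts ! 2 = (if \<sigma> 0 = 0 then 1 else blank)"
      using nth_read_tapes(2)[of 0 ?K w "(\<sigma>, 0, u)"] counters_below(2) by simp
    then have "step (decider c) Or (4 + code_size c, ?ts) (5 + code_size c, ?ts1)"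
      using L
      by (intro step_update[where k = 0 and a = "(bit_symbol (L w), MRight)", OF tr(3)])
         (auto simp del: tapes.simps One_nat_def nth_map)
    moreover have "step (decider c) Or (5 + code_size c, ?ts1) (1, ?ts2)"
      by (intro step_update[where k = 0 and a = "(blank, MStay)", OF tr(4)])
         (auto simp del: tapes.simps One_nat_def)
    moreover have "(step (decider c) Or ^^ t) (4, tapes ?K w (\<lambda>_. 0, 0, [])) (4 + code_size c, ?ts)"
      by (rule compile_correct[OF t(2) tr(2) _ counters_below(1)]) simp
    ultimately have "(step (decider c) Or ^^ (1 + t + 1 + 1)) (init_config (decider c) w) (1, ?ts2)"
      by (intro relpowp_add_intro[OF relpowp_add_intro[OF relpowp_add_intro]] relpowp_1_intro)
         (auto intro: start_step[OF tr(1) tr(5)] simp del: tapes.simps One_nat_def)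
    moreover have "tape_holds (?ts2 ! 0) [L w]"
      by (simp add: tape_holds_def act_tape_def)
    ultimately show ?thesis
      unfolding computes_within_def using t(1)
      by (intro exI[of _ "1 + t + 1 + 1"] conjI exI[of _ ?ts2]) (auto simp del: tapes.simps)
  qed
  then show ?thesis unfolding poly_time_def using wf by blast
qed

text \<open>The program writes the query on tape 1. The answer state itself is the loop that copies
  the answer from tape 1 over the input on tape 0.\<close>

definition querier :: "com \<Rightarrow> machine" where
  "querier c = machine_of (counters_below c)
     ([start_instr (counters_below c), \<lambda>ss. (1, keep ss), \<lambda>ss. (1, keep ss),
       \<lambda>ss. if ss ! 1 = blank then (1, (keep ss)[0 := (blank, MStay)])
            else (3, (keep ss)[0 := (ss ! 1, MRight), 1 := (ss ! 1, MRight)])] @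
      compile c 4 @ [\<lambda>ss. (2, keep ss)])"

lemma copy_answer:
  assumes tr: "trans M 3 = (\<lambda>ss. if ss ! 1 = blank then (1, (keep ss)[0 := (blank, MStay)])
            else (3, (keep ss)[0 := (ss ! 1, MRight), 1 := (ss ! 1, MRight)]))"
    and "i \<le> length a" "2 \<le> length ts" "ts ! 1 = (fst (word_tape a), int i)"
    "snd (ts ! 0) = int i" "\<forall>k < i. fst (ts ! 0) (int k) = bit_symbol (a ! k)"
  shows "\<exists>ts'. (step M Or ^^ (length a - i + 1)) (3, ts) (1, ts') \<and> tape_holds (ts' ! 0) a"
  using assms(2-)
proof (induction "length a - i" arbitrary: i ts)
  case 0
  let ?ts' = "ts[0 := act_tape (blank, MStay) (ts ! 0)]"
  have "map read_tape ts ! 1 = blank" using 0 by (simp add: read_tape_def word_tape_def)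
  then have "step M Or (3, ts) (1, ?ts')"
    using 0 by (intro step_update[where k = 0 and a = "(blank, MStay)", OF tr])
       (auto simp del: One_nat_def nth_map)
  moreover have "tape_holds (?ts' ! 0) a"
    using 0 by (cases ts) (auto simp: tape_holds_def act_tape_def)
  ultimately show ?case using 0 by (intro exI[of _ ?ts']) (simp add: eq_OO)
next
  case (Suc n)
  let ?b = "bit_symbol (a ! i)"
  let ?ts' = "ts[0 := act_tape (?b, MRight) (ts ! 0), 1 := act_tape (?b, MRight) (ts ! 1)]"
  have i: "i < length a" using Suc by simp
  have rd: "map read_tape ts ! 1 = ?b" "?b \<noteq> blank"
    using Suc i by (simp_all add: read_tape_def word_tape_def bit_symbol_def)
  have "map2 act_tape ((keep (map read_tape ts))[0 := (?b, MRight), 1 := (?b, MRight)]) ts = ?ts'"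
  proof -
    obtain t0 t1 tr where "ts = t0 # t1 # tr"
      using Suc.prems(2) by (cases ts; cases "tl ts") auto
    then show ?thesis using keep_act[of tr] by simp (simp add: keep_def)
  qed
  then have s: "step M Or (3, ts) (3, ?ts')"
    using step.ordinary[of 3 M ts 3 "(keep (map read_tape ts))[0 := (?b, MRight), 1 := (?b, MRight)]" Or]
      rd tr by (simp del: nth_map One_nat_def)
  have "\<exists>ts''. (step M Or ^^ (length a - Suc i + 1)) (3, ?ts') (1, ts'') \<and> tape_holds (ts'' ! 0) a"
  proof (rule Suc.hyps(1))
    show "n = length a - Suc i" "Suc i \<le> length a" "2 \<le> length ?ts'" using Suc i by auto
    show "snd (?ts' ! 0) = int (Suc i)" using Suc by (cases ts) (auto simp: act_tape_def)
    show "?ts' ! 1 = (fst (word_tape a), int (Suc i))"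
      using Suc i by (auto simp: act_tape_def nth_list_update word_tape_def fun_eq_iff)
    show "\<forall>k<Suc i. fst (?ts' ! 0) (int k) = bit_symbol (a ! k)"
      using Suc i by (cases ts) (auto simp: act_tape_def less_Suc_eq)
  qed
  then obtain ts'' where ts'': "(step M Or ^^ (length a - Suc i + 1)) (3, ?ts') (1, ts'')"
    "tape_holds (ts'' ! 0) a" by blast
  have "(step M Or ^^ (1 + (length a - Suc i + 1))) (3, ts) (1, ts'')"
    by (rule relpowp_add_intro[OF relpowp_1_intro[of "step M Or", OF s] ts''(1)])
  moreover have "1 + (length a - Suc i + 1) = length a - i + 1" using i by simp
  ultimately show ?case using ts''(2) by metis
qed

text \<open>The length of the answer enters the time because the answer has to be copied.\<close>

lemma poly_time_querier:
  fixes p r :: "nat poly"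
  assumes "\<And>w. \<exists>t \<le> poly p (length w). \<exists>\<sigma> u. exec w c (\<lambda>_. 0, 0, []) t (\<sigma>, 0, u) \<and> Or u = Some (F w)"
    and len: "\<And>w. length (F w) \<le> poly r (length w)"
  shows "poly_time Or F"
proof -
  let ?K = "counters_below c"
  have "wf_instr ?K (length ([start_instr ?K, \<lambda>ss. (1, keep ss), \<lambda>ss. (1, keep ss),
       \<lambda>ss. if ss ! 1 = blank then (1, (keep ss)[0 := (blank, MStay)])
            else (3, (keep ss)[0 := (ss ! 1, MRight), 1 := (ss ! 1, MRight)])] @
      compile c 4 @ [\<lambda>ss. (2, keep ss)]))
     (\<lambda>ss. if ss ! 1 = blank then (1, (keep ss)[0 := (blank, MStay)])
            else (3, (keep ss)[0 := (ss ! 1, MRight), 1 := (ss ! 1, MRight)]))"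
    unfolding wf_instr_def
  proof (intro allI impI, goal_cases)
    case (1 ss)
    then have "ss ! 1 < 3" by (simp add: nth_mem)
    with 1 show ?case by (auto simp: keep_def list_update_swap dest!: set_update_subset_insert[THEN subsetD])
  qed
  then have wf: "wf_machine (querier c)"
    unfolding querier_def
    by (intro wf_machine_of)
       (auto intro!: wf_instr_keep wf_start_instr simp del: One_nat_def,
        erule wf_compile[OF counters_below(1), rotated], simp)
  have tr: "trans (querier c) 0 = start_instr ?K" "loaded (querier c) 4 (compile c 4)"
    "trans (querier c) (4 + code_size c) = (\<lambda>ss. (2, keep ss))"
    "trans (querier c) 3 = (\<lambda>ss. if ss ! 1 = blank then (1, (keep ss)[0 := (blank, MStay)])
            else (3, (keep ss)[0 := (ss ! 1, MRight), 1 := (ss ! 1, MRight)]))"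
    "num_tapes (querier c) = ?K + 2"
    by (auto simp: querier_def machine_of_def loaded_def nth_append nth_Cons' simp del: One_nat_def)
  have "computes_within (querier c) Or w (F w) (poly (p + r + [:4:]) (length w))" for w
  proof -
    let ?M = "querier c"
    obtain t \<sigma> u where t: "t \<le> poly p (length w)" "exec w c (\<lambda>_. 0, 0, []) t (\<sigma>, 0, u)"
      and Or: "Or u = Some (F w)" using assms(1) by blast
    let ?ts = "tapes ?K w (\<sigma>, 0, u)"
    let ?ts1 = "?ts[1 := word_tape (F w)]"
    have s1: "step ?M Or (init_config ?M w) (4, tapes ?K w (\<lambda>_. 0, 0, []))"
      by (rule start_step[OF tr(1) tr(5)])
    have s2: "(step ?M Or ^^ t) (4, tapes ?K w (\<lambda>_. 0, 0, [])) (4 + code_size c, ?ts)"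
      by (rule compile_correct[OF t(2) tr(2) _ counters_below(1)]) simp
    have s3: "step ?M Or (4 + code_size c, ?ts) (2, ?ts)"
      by (rule step_keep[OF tr(3)]) auto
    have s4: "step ?M Or (2, ?ts) (3, ?ts1)"
      by (rule step.oracle_call[of ?ts u Or "F w" ?M]) (auto simp: Or tape_holds_def word_tape_def)
    obtain ts' where s5: "(step ?M Or ^^ (length (F w) - 0 + 1)) (3, ?ts1) (1, ts')"
      and th: "tape_holds (ts' ! 0) (F w)"
      using copy_answer[OF tr(4), of 0 "F w" ?ts1 Or] by (auto simp: word_tape_def)
    have "(step ?M Or ^^ (1 + t + 1 + 1 + (length (F w) - 0 + 1))) (init_config ?M w) (1, ts')"
      by (rule relpowp_add_intro[OF relpowp_add_intro[OF relpowp_add_intro[OF relpowp_add_intro[OF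
        relpowp_1_intro[of "step ?M Or", OF s1] s2] relpowp_1_intro[of "step ?M Or", OF s3]]
        relpowp_1_intro[of "step ?M Or", OF s4]] s5])
    with th show ?thesis
      unfolding computes_within_def using t(1) len[of w]
      by (intro exI[of _ "1 + t + 1 + 1 + (length (F w) - 0 + 1)"] conjI exI[of _ ts']) auto
  qed
  then show ?thesis unfolding poly_time_def using wf by blast
qed

section \<open>Evaluating expressions with bounded sums\<close>

definition runs :: "bool list \<Rightarrow> com \<Rightarrow> st \<Rightarrow> nat \<Rightarrow> st \<Rightarrow> bool" where
  "runs w c s n s' \<longleftrightarrow> (\<exists>t\<le>n. exec w c s t s')"

lemma runs_mono: "runs w c s n s' \<Longrightarrow> n \<le> m \<Longrightarrow> runs w c s m s'"
  unfolding runs_def by (meson le_trans)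

lemma runs_eq: "runs w c s n s' \<Longrightarrow> s' = s'' \<Longrightarrow> n \<le> m \<Longrightarrow> runs w c s m s''"
  using runs_mono by blast

lemma runs_Seq: "runs w c s n s' \<Longrightarrow> runs w d s' m s'' \<Longrightarrow> runs w (c ;; d) s (n + m) s''"
  unfolding runs_def by (meson add_mono exec.Seq)

text \<open>\<open>S i\<close> is the state in which \<open>i\<close> rounds are still to be
  made.\<close>

lemma runs_While:
  assumes "\<And>i. i < n \<Longrightarrow> fst (S (Suc i)) v \<noteq> 0 \<and> runs w c (S (Suc i)) b (S i)" "fst (S 0) v = 0"
  shows "runs w (While v c) (S n) (n * (b + 2) + 1) (S 0)"
  using assms
proof (induction n)
  case 0
  then show ?case unfolding runs_def using exec.WhileF[of "S 0" v w c] by auto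
next
  case (Suc n)
  then obtain t t' where "exec w c (S (Suc n)) t (S n)" "t \<le> b"
    "exec w (While v c) (S n) t' (S 0)" "t' \<le> n * (b + 2) + 1"
    unfolding runs_def by (metis lessI less_Suc_eq)
  then show ?case
    unfolding runs_def using exec.WhileT[of "S (Suc n)" v w c t "S n" t' "S 0"] Suc.prems(1)[of n]
    by (intro exI[of _ "t + t' + 2"]) auto
qed

lemma runs_basic:
  "runs w (Inc v) (\<sigma>, h, u) 1 (\<sigma>(v := Suc (\<sigma> v)), h, u)"
  "runs w (Dec v) (\<sigma>, h, u) 1 (\<sigma>(v := \<sigma> v - 1), h, u)"
  "runs w MvR (\<sigma>, h, u) 1 (\<sigma>, Suc h, u)"
  "runs w MvL (\<sigma>, Suc h, u) 1 (\<sigma>, h, u)"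
  "runs w (Emit b) (\<sigma>, h, u) 1 (\<sigma>, h, u @ [b])"
  "runs w Skip s 0 s"
  unfolding runs_def by (meson exec.intros le_refl)+

definition "clear v = While v (Dec v)"
definition "shift v r = While v (Dec v ;; Inc r)"
definition "dup v r r' = While v (Dec v ;; Inc r ;; Inc r')"
definition "drain v r = While v (Dec v ;; Dec r)"

lemma runs_clear: "runs w (clear v) (\<sigma>, h, u) (\<sigma> v * 3 + 1) (\<sigma>(v := 0), h, u)"
proof -
  let ?S = "\<lambda>i. (\<sigma>(v := i), h, u)"
  have "runs w (Dec v) (?S (Suc i)) 1 (?S i)" for i
    using runs_basic(2)[of w v "\<sigma>(v := Suc i)" h u] by simp
  from runs_While[of "\<sigma> v" ?S v w "Dec v" 1, OF conjI[OF _ this]] show ?thesis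
    by (simp add: clear_def numeral_3_eq_3)
qed

lemma runs_shift:
  assumes "v \<noteq> r"
  shows "runs w (shift v r) (\<sigma>, h, u) (\<sigma> v * 4 + 1) (\<sigma>(v := 0, r := \<sigma> r + \<sigma> v), h, u)"
proof -
  let ?S = "\<lambda>i. (\<sigma>(v := i, r := \<sigma> r + (\<sigma> v - i)), h, u)"
  have "runs w (Dec v ;; Inc r) (?S (Suc i)) 2 (?S i)" if "i < \<sigma> v" for i
    using runs_Seq[OF runs_basic(2)[of w v "fst (?S (Suc i))" h u] runs_basic(1)[of w r]] assms that
    by (simp add: fun_upd_twist Suc_diff_Suc numeral_2_eq_2)
  with runs_While[of "\<sigma> v" ?S v w "Dec v ;; Inc r" 2] show ?thesis
    using assms by (simp add: shift_def numeral_eq_Suc)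
qed

lemma runs_drain:
  assumes "v \<noteq> r"
  shows "runs w (drain v r) (\<sigma>, h, u) (\<sigma> v * 4 + 1) (\<sigma>(v := 0, r := \<sigma> r - \<sigma> v), h, u)"
proof -
  let ?S = "\<lambda>i. (\<sigma>(v := i, r := \<sigma> r - (\<sigma> v - i)), h, u)"
  have "runs w (Dec v ;; Dec r) (?S (Suc i)) 2 (?S i)" if "i < \<sigma> v" for i
  proof -
    have "\<sigma> r - (\<sigma> v - Suc i) - 1 = \<sigma> r - (\<sigma> v - i)" using that by linarith
    then show ?thesis
      using runs_Seq[OF runs_basic(2)[of w v "fst (?S (Suc i))" h u] runs_basic(2)[of w r]] assms that
      by (simp add: fun_upd_twist numeral_2_eq_2)
  qed
  with runs_While[of "\<sigma> v" ?S v w "Dec v ;; Dec r" 2] show ?thesis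
    using assms by (simp add: drain_def numeral_eq_Suc)
qed

lemma runs_dup:
  assumes "v \<noteq> r" "v \<noteq> r'" "r \<noteq> r'"
  shows "runs w (dup v r r') (\<sigma>, h, u) (\<sigma> v * 5 + 1)
    (\<sigma>(v := 0, r := \<sigma> r + \<sigma> v, r' := \<sigma> r' + \<sigma> v), h, u)"
proof -
  let ?S = "\<lambda>i. (\<sigma>(v := i, r := \<sigma> r + (\<sigma> v - i), r' := \<sigma> r' + (\<sigma> v - i)), h, u)"
  have "runs w (Dec v ;; Inc r ;; Inc r') (?S (Suc i)) 3 (?S i)" if "i < \<sigma> v" for i
    by (rule runs_eq[OF runs_Seq[OF runs_basic(2) runs_Seq[OF runs_basic(1) runs_basic(1)]]])
       (use assms that in \<open>auto simp: fun_eq_iff\<close>)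
  with runs_While[of "\<sigma> v" ?S v w "Dec v ;; Inc r ;; Inc r'" 3] show ?thesis
    using assms by (simp add: dup_def numeral_eq_Suc)
qed

text \<open>\<open>In a\<close> is the code of the input symbol at position \<open>a\<close>, with 0
  beyond the end. The only loop is a sum whose bound is evaluated beforehand, so values and running
  times are polynomial whatever the expression.\<close>

datatype ex = V nat | C nat | In ex | Len | Add ex ex | Sub ex ex | Sum nat ex ex

fun eval :: "bool list \<Rightarrow> (nat \<Rightarrow> nat) \<Rightarrow> ex \<Rightarrow> nat" where
  "eval w s (V x) = s x"
| "eval w s (C n) = n"
| "eval w s (In a) = in_sym w (eval w s a)"
| "eval w s Len = length w"
| "eval w s (Add a b) = eval w s a + eval w s b"
| "eval w s (Sub a b) = eval w s a - eval w s b"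
| "eval w s (Sum x a b) = (\<Sum>k<eval w s a. eval w (s(x := k)) b)"

fun incs :: "nat \<Rightarrow> nat \<Rightarrow> com" where
  "incs r 0 = Skip"
| "incs r (Suc n) = Inc r ;; incs r n"

lemma runs_incs: "runs w (incs r n) (\<sigma>, h, u) n (\<sigma>(r := \<sigma> r + n), h, u)"
proof (induction n arbitrary: \<sigma>)
  case 0
  then show ?case using runs_basic(6) by simp
next
  case (Suc n)
  show ?case unfolding incs.simps
    by (rule runs_eq[OF runs_Seq[OF runs_basic(1) Suc]]) (auto simp: fun_eq_iff)
qed

text \<open>Variables live in counters below \<open>r\<close>; counters from \<open>r\<close> on are
  0 and may be used, and the result appears in \<open>r\<close>. Reading a counter destroys it,
  hence the copy that is shifted back. For \<open>In\<close> the counter \<open>r + 1\<close>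
  records the way back of the head. A sum keeps its total in \<open>r\<close>, the index in
  \<open>r + 1\<close> and the remaining rounds in \<open>r + 2\<close>.\<close>

fun cexp :: "(nat \<Rightarrow> nat) \<Rightarrow> nat \<Rightarrow> ex \<Rightarrow> com" where
  "cexp f r (V x) = dup (f x) r (r + 1) ;; shift (r + 1) (f x)"
| "cexp f r (C n) = incs r n"
| "cexp f r (In a) = cexp f r a ;; While r (Dec r ;; Inc (r + 1) ;; MvR) ;;
     IfIn 1 (Inc r) (IfIn 2 (incs r 2) Skip) ;; While (r + 1) (Dec (r + 1) ;; MvL)"
| "cexp f r Len = WhileIn (Inc r ;; Inc (r + 1) ;; MvR) ;; While (r + 1) (Dec (r + 1) ;; MvL)"
| "cexp f r (Add a b) = cexp f r a ;; cexp f (r + 1) b ;; shift (r + 1) r"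
| "cexp f r (Sub a b) = cexp f r a ;; cexp f (r + 1) b ;; drain (r + 1) r"
| "cexp f r (Sum x a b) = cexp f (r + 2) a ;;
     While (r + 2) (Dec (r + 2) ;; cexp (f(x := r + 1)) (r + 3) b ;; shift (r + 3) r ;; Inc (r + 1)) ;;
     clear (r + 1)"

lemma poly_nat_mono: "x \<le> y \<Longrightarrow> poly p x \<le> poly p y" for x y :: nat
  by (induction p) (auto intro: mult_mono add_mono)

lemma runs_back:
  "\<sigma> v = n \<Longrightarrow> runs w (While v (Dec v ;; MvL)) (\<sigma>, n, u) (n * 4 + 1) (\<sigma>(v := 0), 0, u)"
proof -
  assume n: "\<sigma> v = n"
  let ?S = "\<lambda>i. (\<sigma>(v := i), i, u)"
  have "runs w (Dec v ;; MvL) (?S (Suc i)) 2 (?S i)" for i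
    using runs_Seq[OF runs_basic(2)[of w v "\<sigma>(v := Suc i)" "Suc i" u] runs_basic(4)]
    by (simp add: numeral_2_eq_2)
  with runs_While[of n ?S v w "Dec v ;; MvL" 2] show ?thesis
    using n by (auto simp: numeral_eq_Suc)
qed

lemma runs_forth:
  "\<sigma> r = n \<Longrightarrow> \<sigma> (r + 1) = 0 \<Longrightarrow>
   runs w (While r (Dec r ;; Inc (r + 1) ;; MvR)) (\<sigma>, 0, u) (n * 5 + 1) (\<sigma>(r := 0, r + 1 := n), n, u)"
proof -
  assume n: "\<sigma> r = n" "\<sigma> (r + 1) = 0"
  let ?S = "\<lambda>i. (\<sigma>(r := i, r + 1 := n - i), n - i, u)"
  have "runs w (Dec r ;; Inc (r + 1) ;; MvR) (?S (Suc i)) 3 (?S i)" if "i < n" for i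
    using runs_Seq[OF runs_basic(2)[of w r "fst (?S (Suc i))" "n - Suc i" u]
        runs_Seq[OF runs_basic(1)[of w "r + 1"] runs_basic(3)]] that
    by (simp add: fun_upd_twist Suc_diff_Suc numeral_3_eq_3)
  with runs_While[of n ?S r w "Dec r ;; Inc (r + 1) ;; MvR" 3]
  have "runs w (While r (Dec r ;; Inc (r + 1) ;; MvR)) (?S n) (n * 5 + 1) (?S 0)"
    by (simp add: numeral_eq_Suc)
  moreover have "?S n = (\<sigma>, 0, u)" using n by (auto simp: fun_eq_iff)
  ultimately show ?thesis by simp
qed

lemma runs_len:
  assumes "\<sigma> r = 0" "\<sigma> (r + 1) = 0"
  shows "runs w (WhileIn (Inc r ;; Inc (r + 1) ;; MvR)) (\<sigma>, 0, u) (length w * 5 + 1)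
    (\<sigma>(r := length w, r + 1 := length w), length w, u)"
proof -
  let ?S = "\<lambda>i. (\<sigma>(r := i, r + 1 := i), i, u)"
  let ?c = "Inc r ;; Inc (r + 1) ;; MvR"
  have "runs w (WhileIn ?c) (?S (length w - i)) (i * 5 + 1) (?S (length w))" if "i \<le> length w" for i
    using that
  proof (induction i)
    case 0
    show ?case unfolding runs_def
      using exec.WhileInF[of w "?S (length w)" ?c] by (auto simp: in_sym_def)
  next
    case (Suc i)
    define j where "j = length w - Suc i"
    have j: "length w - i = Suc j" "j < length w" using Suc.prems by (auto simp: j_def)
    have "runs w ?c (?S j) 3 (?S (Suc j))"
      using runs_Seq[OF runs_basic(1)[of w r "fst (?S j)" j u]
        runs_Seq[OF runs_basic(1)[of w "r + 1"] runs_basic(3)]]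
      by (simp add: fun_upd_twist numeral_3_eq_3)
    then obtain t where t: "t \<le> 3" "exec w ?c (?S j) t (?S (Suc j))" unfolding runs_def by blast
    obtain t' where t': "t' \<le> i * 5 + 1" "exec w (WhileIn ?c) (?S (Suc j)) t' (?S (length w))"
      using Suc j unfolding runs_def by auto
    have "exec w (WhileIn ?c) (?S j) (t + t' + 2) (?S (length w))"
      by (rule exec.WhileInT[OF _ t(2) t'(2)]) (use j in \<open>auto simp: in_sym_def bit_symbol_def\<close>)
    then show ?case unfolding runs_def using t t' by (intro exI[of _ "t + t' + 2"]) (auto simp: j_def)
  qed
  from this[of "length w"] show ?thesis using assms by (simp add: fun_upd_idem)
qed

lemma runs_IfT: "in_sym w (fst (snd s)) = a \<Longrightarrow> runs w c s n s' \<Longrightarrow> runs w (IfIn a c d) s (n + 2) s'"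
  unfolding runs_def by (metis add_le_mono1 exec.IfT)

lemma runs_IfF: "in_sym w (fst (snd s)) \<noteq> a \<Longrightarrow> runs w d s n s' \<Longrightarrow> runs w (IfIn a c d) s (n + 1) s'"
  unfolding runs_def by (metis add_le_mono1 exec.IfF)

lemma runs_read:
  "\<sigma> r = 0 \<Longrightarrow> runs w (IfIn 1 (Inc r) (IfIn 2 (incs r 2) Skip)) (\<sigma>, h, u) 5 (\<sigma>(r := in_sym w h), h, u)"
proof -
  assume r: "\<sigma> r = 0"
  consider "in_sym w h = 1" | "in_sym w h = 2" | "in_sym w h = 0"
    by (cases "h < length w"; cases "w ! h") (auto simp: in_sym_def bit_symbol_def)
  then show ?thesis
  proof cases
    case 1
    then show ?thesis
      using runs_mono[OF runs_IfT[OF _ runs_basic(1)[of w r \<sigma> h u], of 1], of 5] r by simp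
  next
    case 2
    then show ?thesis
      by (intro runs_eq[OF runs_IfF[OF _ runs_IfT[OF _ runs_incs]]]) (use r in auto)
  next
    case 3
    then show ?thesis
      using runs_mono[OF runs_IfF[OF _ runs_IfF[OF _ runs_basic(6)[of w "(\<sigma>, h, u)"]], of 1 2], of 5] r
      by (simp add: fun_upd_idem)
  qed
qed

text \<open>One polynomial bounds both the value and the time in terms of a common bound
  \<open>B\<close> for the variables and the input length. Bounding the value as well is what makes
  the induction work, since values are bounds of loops.\<close>

lemma cexp_correct:
  "\<exists>p :: nat poly. \<forall>w s f r \<sigma> u B. (\<forall>x. s x \<le> B) \<and> length w \<le> B \<and> (\<forall>x. f x < r \<and> \<sigma> (f x) = s x) \<and>
     (\<forall>v\<ge>r. \<sigma> v = 0) \<longrightarrow>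
     eval w s e \<le> poly p B \<and> runs w (cexp f r e) (\<sigma>, 0, u) (poly p B) (\<sigma>(r := eval w s e), 0, u)"
proof (induction e)
  case (V x)
  show ?case
  proof (intro exI[of _ "[:2, 9:]"] allI impI, elim conjE, intro conjI)
    fix w u :: "bool list" and s f :: "nat \<Rightarrow> nat" and \<sigma> and r B :: nat
    assume a: "\<forall>x. s x \<le> (B::nat)" "length w \<le> B" "\<forall>x. f x < r \<and> \<sigma> (f x) = s x" "\<forall>v\<ge>r. \<sigma> v = (0::nat)"
    show "eval w s (V x) \<le> poly [:2, 9:] B" using a(1)[rule_format, of x] by simp
    have f: "f x < r" "\<sigma> (f x) = s x" "s x \<le> B" using a by auto
    have "f x \<noteq> r" "f x \<noteq> r + 1" "r \<noteq> r + 1" "r + 1 \<noteq> f x" using f by auto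
    from runs_Seq[OF runs_dup[OF this(1-3), of w \<sigma> 0 u] runs_shift[OF this(4)]]
    show "runs w (cexp f r (V x)) (\<sigma>, 0, u) (poly [:2, 9:] B) (\<sigma>(r := eval w s (V x)), 0, u)"
      unfolding cexp.simps
    proof (rule runs_eq)
      have z: "\<sigma> r = 0" "\<sigma> (r + 1) = 0" using a(4) by auto
      show "((\<sigma>(f x := 0, r := \<sigma> r + \<sigma> (f x), r + 1 := \<sigma> (r + 1) + \<sigma> (f x)))
        (r + 1 := 0, f x := (\<sigma>(f x := 0, r := \<sigma> r + \<sigma> (f x), r + 1 := \<sigma> (r + 1) + \<sigma> (f x))) (f x) +
          (\<sigma>(f x := 0, r := \<sigma> r + \<sigma> (f x), r + 1 := \<sigma> (r + 1) + \<sigma> (f x))) (r + 1)), 0, u) =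
        (\<sigma>(r := eval w s (V x)), 0, u)"
        using f z by (auto simp: fun_eq_iff)
      show "\<sigma> (f x) * 5 + 1 +
        ((\<sigma>(f x := 0, r := \<sigma> r + \<sigma> (f x), r + 1 := \<sigma> (r + 1) + \<sigma> (f x))) (r + 1) * 4 + 1) \<le> poly [:2, 9:] B"
        using f z by simp
    qed
  qed
next
  case (C n)
  show ?case
  proof (intro exI[of _ "[:n:]"] allI impI, elim conjE, intro conjI)
    fix w u :: "bool list" and s f :: "nat \<Rightarrow> nat" and \<sigma> and r B :: nat
    assume a: "\<forall>v\<ge>r. \<sigma> v = (0::nat)"
    show "eval w s (C n) \<le> poly [:n:] B" by simp
    show "runs w (cexp f r (C n)) (\<sigma>, 0, u) (poly [:n:] B) (\<sigma>(r := eval w s (C n)), 0, u)"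
      unfolding cexp.simps by (rule runs_eq[OF runs_incs]) (use a in simp_all)
  qed
next
  case Len
  show ?case
  proof (intro exI[of _ "[:2, 9:]"] allI impI, elim conjE, intro conjI)
    fix w u :: "bool list" and s f :: "nat \<Rightarrow> nat" and \<sigma> and r B :: nat
    assume a: "length w \<le> (B::nat)" "\<forall>v\<ge>r. \<sigma> v = (0::nat)"
    show "eval w s Len \<le> poly [:2, 9:] B" using a(1) by simp
    let ?\<sigma>1 = "\<sigma>(r := length w, r + 1 := length w)"
    have z: "\<sigma> r = 0" "\<sigma> (r + 1) = 0" using a(2) by auto
    have "?\<sigma>1 (r + 1) = length w" by simp
    from runs_Seq[OF runs_len[OF z, of w u] runs_back[where \<sigma> = ?\<sigma>1, OF this]]
    show "runs w (cexp f r Len) (\<sigma>, 0, u) (poly [:2, 9:] B) (\<sigma>(r := eval w s Len), 0, u)"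
      unfolding cexp.simps by (rule runs_eq) (use a(1) z in \<open>simp_all add: fun_eq_iff\<close>)
  qed
next
  case (In e)
  then obtain p :: "nat poly" where p: "\<And>w s f r \<sigma> u B. \<lbrakk>\<forall>x. s x \<le> B; length w \<le> B;
     \<forall>x. f x < r \<and> \<sigma> (f x) = s x; \<forall>v\<ge>r. \<sigma> v = 0\<rbrakk> \<Longrightarrow>
     eval w s e \<le> poly p B \<and> runs w (cexp f r e) (\<sigma>, 0, u) (poly p B) (\<sigma>(r := eval w s e), 0, u)" by metis
  show ?case
  proof (intro exI[of _ "10 * p + [:9:]"] allI impI, elim conjE, intro conjI)
    fix w u :: "bool list" and s f :: "nat \<Rightarrow> nat" and \<sigma> and r B :: nat
    assume a: "\<forall>x. s x \<le> B" "length w \<le> B" "\<forall>x. f x < r \<and> \<sigma> (f x) = s x" "\<forall>v\<ge>r. \<sigma> v = 0"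
    show "eval w s (In e) \<le> poly (10 * p + [:9:]) B" by (auto simp: in_sym_def bit_symbol_def)
    note p = p[OF a, of u]
    let ?n = "eval w s e"
    let ?\<sigma>1 = "\<sigma>(r := ?n)" let ?\<sigma>2 = "?\<sigma>1(r := 0, r + 1 := ?n)" let ?\<sigma>3 = "?\<sigma>2(r := in_sym w ?n)"
    have z: "\<sigma> r = 0" "\<sigma> (r + 1) = 0" using a(4) by auto
    have "?\<sigma>1 r = ?n" "?\<sigma>1 (r + 1) = 0" "?\<sigma>2 r = 0" "?\<sigma>3 (r + 1) = ?n" using z by auto
    from runs_Seq[OF conjunct2[OF p] runs_Seq[OF runs_forth[where \<sigma> = ?\<sigma>1 and w = w and u = u, OF this(1,2)]
      runs_Seq[OF runs_read[where \<sigma> = ?\<sigma>2, OF this(3)] runs_back[where \<sigma> = ?\<sigma>3, OF this(4)]]]]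
    show "runs w (cexp f r (In e)) (\<sigma>, 0, u) (poly (10 * p + [:9:]) B) (\<sigma>(r := eval w s (In e)), 0, u)"
      unfolding cexp.simps
      by (rule runs_eq) (use conjunct1[OF p] z in \<open>simp_all add: fun_eq_iff\<close>)
  qed
next
  case (Add e1 e2)
  then obtain p q :: "nat poly" where p: "\<And>w s f r \<sigma> u B. \<lbrakk>\<forall>x. s x \<le> B; length w \<le> B;
     \<forall>x. f x < r \<and> \<sigma> (f x) = s x; \<forall>v\<ge>r. \<sigma> v = 0\<rbrakk> \<Longrightarrow>
     eval w s e1 \<le> poly p B \<and> runs w (cexp f r e1) (\<sigma>, 0, u) (poly p B) (\<sigma>(r := eval w s e1), 0, u)"
    and q: "\<And>w s f r \<sigma> u B. \<lbrakk>\<forall>x. s x \<le> B; length w \<le> B;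
     \<forall>x. f x < r \<and> \<sigma> (f x) = s x; \<forall>v\<ge>r. \<sigma> v = 0\<rbrakk> \<Longrightarrow>
     eval w s e2 \<le> poly q B \<and> runs w (cexp f r e2) (\<sigma>, 0, u) (poly q B) (\<sigma>(r := eval w s e2), 0, u)" by metis
  show ?case
  proof (intro exI[of _ "p + 5 * q + [:1:]"] allI impI, elim conjE, intro conjI)
    fix w u :: "bool list" and s f :: "nat \<Rightarrow> nat" and \<sigma> and r B :: nat
    assume a: "\<forall>x. s x \<le> B" "length w \<le> B" "\<forall>x. f x < r \<and> \<sigma> (f x) = s x" "\<forall>v\<ge>r. \<sigma> v = 0"
    let ?m = "eval w s e1" let ?n = "eval w s e2" let ?\<sigma>1 = "\<sigma>(r := ?m)" let ?\<sigma>2 = "?\<sigma>1(r + 1 := ?n)"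
    note p = p[OF a, of u]
    have "\<forall>x. f x < r + 1 \<and> ?\<sigma>1 (f x) = s x" "\<forall>v\<ge>r + 1. ?\<sigma>1 v = 0"
      using a(3,4) by (auto simp: less_Suc_eq)
    note q = q[OF a(1,2) this, of u]
    show "eval w s (Add e1 e2) \<le> poly (p + 5 * q + [:1:]) B" using p q by simp
    have ne: "r + 1 \<noteq> r" and z: "\<sigma> (r + 1) = 0" using a(4) by auto
    from runs_Seq[OF conjunct2[OF p] runs_Seq[OF conjunct2[OF q] runs_shift[OF ne, of w ?\<sigma>2 0 u]]]
    show "runs w (cexp f r (Add e1 e2)) (\<sigma>, 0, u) (poly (p + 5 * q + [:1:]) B) (\<sigma>(r := eval w s (Add e1 e2)), 0, u)"
      unfolding cexp.simps
      by (rule runs_eq) (use conjunct1[OF p] conjunct1[OF q] z in \<open>simp_all add: fun_eq_iff\<close>)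
  qed
next
  case (Sub e1 e2)
  then obtain p q :: "nat poly" where p: "\<And>w s f r \<sigma> u B. \<lbrakk>\<forall>x. s x \<le> B; length w \<le> B;
     \<forall>x. f x < r \<and> \<sigma> (f x) = s x; \<forall>v\<ge>r. \<sigma> v = 0\<rbrakk> \<Longrightarrow>
     eval w s e1 \<le> poly p B \<and> runs w (cexp f r e1) (\<sigma>, 0, u) (poly p B) (\<sigma>(r := eval w s e1), 0, u)"
    and q: "\<And>w s f r \<sigma> u B. \<lbrakk>\<forall>x. s x \<le> B; length w \<le> B;
     \<forall>x. f x < r \<and> \<sigma> (f x) = s x; \<forall>v\<ge>r. \<sigma> v = 0\<rbrakk> \<Longrightarrow>
     eval w s e2 \<le> poly q B \<and> runs w (cexp f r e2) (\<sigma>, 0, u) (poly q B) (\<sigma>(r := eval w s e2), 0, u)" by metis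
  show ?case
  proof (intro exI[of _ "p + 5 * q + [:1:]"] allI impI, elim conjE, intro conjI)
    fix w u :: "bool list" and s f :: "nat \<Rightarrow> nat" and \<sigma> and r B :: nat
    assume a: "\<forall>x. s x \<le> B" "length w \<le> B" "\<forall>x. f x < r \<and> \<sigma> (f x) = s x" "\<forall>v\<ge>r. \<sigma> v = 0"
    let ?m = "eval w s e1" let ?n = "eval w s e2" let ?\<sigma>1 = "\<sigma>(r := ?m)" let ?\<sigma>2 = "?\<sigma>1(r + 1 := ?n)"
    note p = p[OF a, of u]
    have "\<forall>x. f x < r + 1 \<and> ?\<sigma>1 (f x) = s x" "\<forall>v\<ge>r + 1. ?\<sigma>1 v = 0"
      using a(3,4) by (auto simp: less_Suc_eq)
    note q = q[OF a(1,2) this, of u]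
    show "eval w s (Sub e1 e2) \<le> poly (p + 5 * q + [:1:]) B" using conjunct1[OF p] by simp
    have ne: "r + 1 \<noteq> r" and z: "\<sigma> (r + 1) = 0" using a(4) by auto
    from runs_Seq[OF conjunct2[OF p] runs_Seq[OF conjunct2[OF q] runs_drain[OF ne, of w ?\<sigma>2 0 u]]]
    show "runs w (cexp f r (Sub e1 e2)) (\<sigma>, 0, u) (poly (p + 5 * q + [:1:]) B) (\<sigma>(r := eval w s (Sub e1 e2)), 0, u)"
      unfolding cexp.simps
      by (rule runs_eq) (use conjunct1[OF p] conjunct1[OF q] z in \<open>simp_all add: fun_eq_iff\<close>)
  qed
next
  case (Sum x e1 e2)
  then obtain p q :: "nat poly" where p: "\<And>w s f r \<sigma> u B. \<lbrakk>\<forall>x. s x \<le> B; length w \<le> B;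
     \<forall>x. f x < r \<and> \<sigma> (f x) = s x; \<forall>v\<ge>r. \<sigma> v = 0\<rbrakk> \<Longrightarrow>
     eval w s e1 \<le> poly p B \<and> runs w (cexp f r e1) (\<sigma>, 0, u) (poly p B) (\<sigma>(r := eval w s e1), 0, u)"
    and q: "\<And>w s f r \<sigma> u B. \<lbrakk>\<forall>x. s x \<le> B; length w \<le> B;
     \<forall>x. f x < r \<and> \<sigma> (f x) = s x; \<forall>v\<ge>r. \<sigma> v = 0\<rbrakk> \<Longrightarrow>
     eval w s e2 \<le> poly q B \<and> runs w (cexp f r e2) (\<sigma>, 0, u) (poly q B) (\<sigma>(r := eval w s e2), 0, u)" by metis
  \<comment> \<open>In the body the new variable stays below the value of the bound, so the body
    runs with \<open>B + p(B)\<close> in the place of \<open>B\<close>.\<close>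
  define q' where "q' = pcompose q ([:0, 1:] + p)"
  let ?P = "p * (5 * q' + [:9:]) + [:2:]"
  show ?case
  proof (intro exI[of _ ?P] allI impI, elim conjE, intro conjI)
    fix w u :: "bool list" and s f :: "nat \<Rightarrow> nat" and \<sigma> and r B :: nat
    assume a: "\<forall>x. s x \<le> B" "length w \<le> B" "\<forall>x. f x < r \<and> \<sigma> (f x) = s x" "\<forall>v\<ge>r. \<sigma> v = 0"
    let ?n = "eval w s e1" let ?g = "\<lambda>k. eval w (s(x := k)) e2" let ?B = "poly ([:0, 1:] + p) B"
    have "\<forall>x. f x < r + 2 \<and> \<sigma> (f x) = s x" "\<forall>v\<ge>r + 2. \<sigma> v = 0" using a(3,4) by (auto simp: less_SucI)
    note p = p[OF a(1,2) this, of u]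
    have q': "poly q' B = poly q ?B" by (simp add: q'_def poly_pcompose)
    let ?S = "\<lambda>i. (\<sigma>(r := (\<Sum>k<?n - i. ?g k), r + 1 := ?n - i, r + 2 := i), 0::nat, u)"
    let ?c = "Dec (r + 2) ;; cexp (f(x := r + 1)) (r + 3) e2 ;; shift (r + 3) r ;; Inc (r + 1)"
    have body: "?g (?n - Suc i) \<le> poly q' B \<and> runs w ?c (?S (Suc i)) (poly q' B * 5 + 3) (?S i)" if i: "i < ?n" for i
    proof -
      define k where "k = ?n - Suc i"
      have k: "?n - i = Suc k" "?n - Suc i = k" using i by (auto simp: k_def)
      let ?\<sigma>1 = "(fst (?S (Suc i)))(r + 2 := i)" let ?\<sigma>2 = "?\<sigma>1(r + 3 := ?g k)"
      let ?\<sigma>3 = "?\<sigma>2(r + 3 := 0, r := ?\<sigma>2 r + ?\<sigma>2 (r + 3))"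
      have "\<forall>y. (s(x := k)) y \<le> ?B" using a(1) p i by (auto simp: k_def intro: trans_le_add1 trans_le_add2)
      moreover have "length w \<le> ?B" using a(2) by simp
      moreover have "\<forall>y. (f(x := r + 1)) y < r + 3 \<and> ?\<sigma>1 ((f(x := r + 1)) y) = (s(x := k)) y"
      proof
        fix y
        show "(f(x := r + 1)) y < r + 3 \<and> ?\<sigma>1 ((f(x := r + 1)) y) = (s(x := k)) y"
          using a(3)[rule_format, of y] k by auto
      qed
      moreover have "\<forall>v\<ge>r + 3. ?\<sigma>1 v = 0" using a(4) by auto
      ultimately have q: "?g k \<le> poly q ?B"
        "runs w (cexp (f(x := r + 1)) (r + 3) e2) (?\<sigma>1, 0, u) (poly q ?B) (?\<sigma>2, 0, u)"
        using q[of "s(x := k)" ?B w "f(x := r + 1)" "r + 3" ?\<sigma>1 u] by blast+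
      have "runs w (Dec (r + 2)) (?S (Suc i)) 1 (?\<sigma>1, 0, u)"
        using runs_basic(2)[of w "r + 2" "fst (?S (Suc i))" 0 u] by simp
      moreover have ne: "r + 3 \<noteq> r" by simp
      ultimately have "runs w ?c (?S (Suc i)) (1 + (poly q ?B + ((?\<sigma>2 (r + 3) * 4 + 1) + 1))) (?\<sigma>3(r + 1 := Suc (?\<sigma>3 (r + 1))), 0, u)"
        using runs_Seq[OF _ runs_Seq[OF q(2) runs_Seq[OF runs_shift[OF ne] runs_basic(1)]]] by blast
      moreover have z: "\<sigma> (r + 3) = 0" using a(4) by simp
      ultimately have "runs w ?c (?S (Suc i)) (poly q' B * 5 + 3) (?S i)"
        by (elim runs_eq) (use k q(1) q' in \<open>auto simp: fun_eq_iff\<close>)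
      then show ?thesis using q(1) by (simp add: k q')
    qed
    have "?g k \<le> poly q' B" if "k < ?n" for k
      using body[of "?n - Suc k"] that by (simp add: Suc_diff_Suc)
    then have sum: "(\<Sum>k<?n. ?g k) \<le> ?n * poly q' B"
      using sum_bounded_above[of "{..<?n}" ?g "poly q' B"] by simp
    also have "\<dots> \<le> poly p B * poly q' B" using p by simp
    finally show "eval w s (Sum x e1 e2) \<le> poly ?P B" by (simp add: algebra_simps)
    have W: "runs w (While (r + 2) ?c) (?S ?n) (?n * (poly q' B * 5 + 3 + 2) + 1) (?S 0)"
    proof (rule runs_While)
      show "fst (?S (Suc i)) (r + 2) \<noteq> 0 \<and> runs w ?c (?S (Suc i)) (poly q' B * 5 + 3) (?S i)" if "i < ?n" for i
        by (rule conjI[OF _ conjunct2[OF body[OF that]]]) simp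
    qed simp
    have n: "?S ?n = (\<sigma>(r + 2 := ?n), 0, u)" using a(4) by (auto simp: fun_eq_iff)
    have cl: "runs w (clear (r + 1)) (?S 0) (?n * 3 + 1) (\<sigma>(r := eval w s (Sum x e1 e2)), 0, u)"
      by (rule runs_eq[OF runs_clear]) (use a(4) in \<open>auto simp: fun_eq_iff\<close>)
    have "?n * (poly q' B * 5 + 8) \<le> poly p B * (poly q' B * 5 + 8)" using p by (intro mult_le_mono1) blast
    then show "runs w (cexp f r (Sum x e1 e2)) (\<sigma>, 0, u) (poly ?P B) (\<sigma>(r := eval w s (Sum x e1 e2)), 0, u)"
      unfolding cexp.simps
      by (intro runs_mono[OF runs_Seq[OF conjunct2[OF p] runs_Seq[OF W[unfolded n] cl]]])
         (simp add: algebra_simps)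
  qed
qed


section \<open>Programs that write a word\<close>

datatype oc = ONil | OEmit bool | OSeq oc oc | OIf ex oc | OFor nat ex oc

fun ow :: "bool list \<Rightarrow> (nat \<Rightarrow> nat) \<Rightarrow> oc \<Rightarrow> bool list" where
  "ow w s ONil = []"
| "ow w s (OEmit b) = [b]"
| "ow w s (OSeq c d) = ow w s c @ ow w s d"
| "ow w s (OIf e c) = (if eval w s e \<noteq> 0 then ow w s c else [])"
| "ow w s (OFor x e c) = concat (map (\<lambda>k. ow w (s(x := k)) c) [0..<eval w s e])"

text \<open>The loop for \<open>OIf\<close> runs at most once, because its counter is cleared at the
  start of the round.\<close>

fun coc :: "(nat \<Rightarrow> nat) \<Rightarrow> nat \<Rightarrow> oc \<Rightarrow> com" where
  "coc f r ONil = Skip"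
| "coc f r (OEmit b) = Emit b"
| "coc f r (OSeq c d) = coc f r c ;; coc f r d"
| "coc f r (OIf e c) = cexp f r e ;; While r (clear r ;; coc f r c)"
| "coc f r (OFor x e c) = cexp f (r + 1) e ;;
     While (r + 1) (Dec (r + 1) ;; coc (f(x := r)) (r + 2) c ;; Inc r) ;; clear r"

lemma coc_correct:
  "\<exists>p :: nat poly. \<forall>w s f r \<sigma> u B. (\<forall>x. s x \<le> B) \<and> length w \<le> B \<and> (\<forall>x. f x < r \<and> \<sigma> (f x) = s x) \<and>
     (\<forall>v\<ge>r. \<sigma> v = 0) \<longrightarrow> runs w (coc f r c) (\<sigma>, 0, u) (poly p B) (\<sigma>, 0, u @ ow w s c)"
proof (induction c)
  case ONil
  show ?case using runs_basic(6) by (intro exI[of _ 0]) auto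
next
  case (OEmit b)
  show ?case using runs_basic(5) by (intro exI[of _ 1]) auto
next
  case (OSeq c d)
  then obtain p q :: "nat poly" where p: "\<And>w s f r \<sigma> u B. \<lbrakk>\<forall>x. s x \<le> B; length w \<le> B;
     \<forall>x. f x < r \<and> \<sigma> (f x) = s x; \<forall>v\<ge>r. \<sigma> v = 0\<rbrakk> \<Longrightarrow>
     runs w (coc f r c) (\<sigma>, 0, u) (poly p B) (\<sigma>, 0, u @ ow w s c)"
    and q: "\<And>w s f r \<sigma> u B. \<lbrakk>\<forall>x. s x \<le> B; length w \<le> B;
     \<forall>x. f x < r \<and> \<sigma> (f x) = s x; \<forall>v\<ge>r. \<sigma> v = 0\<rbrakk> \<Longrightarrow>
     runs w (coc f r d) (\<sigma>, 0, u) (poly q B) (\<sigma>, 0, u @ ow w s d)" by metis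
  show ?case
  proof (intro exI[of _ "p + q"] allI impI, elim conjE)
    fix w u :: "bool list" and s f :: "nat \<Rightarrow> nat" and \<sigma> and r B :: nat
    assume a: "\<forall>x. s x \<le> B" "length w \<le> B" "\<forall>x. f x < r \<and> \<sigma> (f x) = s x" "\<forall>v\<ge>r. \<sigma> v = 0"
    show "runs w (coc f r (OSeq c d)) (\<sigma>, 0, u) (poly (p + q) B) (\<sigma>, 0, u @ ow w s (OSeq c d))"
      using runs_Seq[OF p[OF a] q[OF a]] by simp
  qed
next
  case (OIf e c)
  then obtain p :: "nat poly" where p: "\<And>w s f r \<sigma> u B. \<lbrakk>\<forall>x. s x \<le> B; length w \<le> B;
     \<forall>x. f x < r \<and> \<sigma> (f x) = s x; \<forall>v\<ge>r. \<sigma> v = 0\<rbrakk> \<Longrightarrow>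
     runs w (coc f r c) (\<sigma>, 0, u) (poly p B) (\<sigma>, 0, u @ ow w s c)" by metis
  obtain q :: "nat poly" where q: "\<And>w s f r \<sigma> u B. \<lbrakk>\<forall>x. s x \<le> B; length w \<le> B;
     \<forall>x. f x < r \<and> \<sigma> (f x) = s x; \<forall>v\<ge>r. \<sigma> v = 0\<rbrakk> \<Longrightarrow>
     eval w s e \<le> poly q B \<and> runs w (cexp f r e) (\<sigma>, 0, u) (poly q B) (\<sigma>(r := eval w s e), 0, u)"
    using cexp_correct[of e] by metis
  show ?case
  proof (intro exI[of _ "p + 4 * q + 4"] allI impI, elim conjE)
    fix w u :: "bool list" and s f :: "nat \<Rightarrow> nat" and \<sigma> and r B :: nat
    assume a: "\<forall>x. s x \<le> B" "length w \<le> B" "\<forall>x. f x < r \<and> \<sigma> (f x) = s x" "\<forall>v\<ge>r. \<sigma> v = 0"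
    note q = q[OF a, of u]
    let ?n = "eval w s e" let ?s = "(\<sigma>(r := ?n), 0, u)" let ?d = "clear r ;; coc f r c"
    have r: "\<sigma>(r := 0) = \<sigma>" using a(4) by auto
    have W: "runs w (While r ?d) ?s (poly p B + ?n * 3 + 4) (\<sigma>, 0, u @ ow w s (OIf e c))"
    proof (cases "?n = 0")
      case True
      then have "?s = (\<sigma>, 0, u @ ow w s (OIf e c))" using r by simp
      moreover have "exec w (While r ?d) ?s 1 ?s" using True by (intro exec.WhileF) simp
      ultimately show ?thesis unfolding runs_def by (intro exI[of _ 1]) simp
    next
      case False
      have u: "u @ ow w s (OIf e c) = u @ ow w s c" using False by simp
      have "runs w (clear r) ?s (?n * 3 + 1) (\<sigma>, 0, u)"
        by (rule runs_eq[OF runs_clear]) (use r in simp_all)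
      from runs_Seq[OF this p[OF a, of u]]
      obtain t where t: "t \<le> ?n * 3 + 1 + poly p B" "exec w ?d ?s t (\<sigma>, 0, u @ ow w s c)"
        unfolding runs_def by blast
      have "exec w (While r ?d) (\<sigma>, 0, u @ ow w s c) 1 (\<sigma>, 0, u @ ow w s c)"
        using a(4) by (intro exec.WhileF) simp
      from exec.WhileT[OF _ t(2) this] False
      have "exec w (While r ?d) ?s (t + 1 + 2) (\<sigma>, 0, u @ ow w s c)" by simp
      then show ?thesis unfolding runs_def u using t(1) by (intro exI[of _ "t + 1 + 2"]) simp
    qed
    show "runs w (coc f r (OIf e c)) (\<sigma>, 0, u) (poly (p + 4 * q + 4) B) (\<sigma>, 0, u @ ow w s (OIf e c))"
      unfolding coc.simps by (rule runs_mono[OF runs_Seq[OF conjunct2[OF q] W]]) (use q in simp)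
  qed
next
  case (OFor x e c)
  then obtain q :: "nat poly" where q: "\<And>w s f r \<sigma> u B. \<lbrakk>\<forall>x. s x \<le> B; length w \<le> B;
     \<forall>x. f x < r \<and> \<sigma> (f x) = s x; \<forall>v\<ge>r. \<sigma> v = 0\<rbrakk> \<Longrightarrow>
     runs w (coc f r c) (\<sigma>, 0, u) (poly q B) (\<sigma>, 0, u @ ow w s c)" by metis
  obtain p :: "nat poly" where p: "\<And>w s f r \<sigma> u B. \<lbrakk>\<forall>x. s x \<le> B; length w \<le> B;
     \<forall>x. f x < r \<and> \<sigma> (f x) = s x; \<forall>v\<ge>r. \<sigma> v = 0\<rbrakk> \<Longrightarrow>
     eval w s e \<le> poly p B \<and> runs w (cexp f r e) (\<sigma>, 0, u) (poly p B) (\<sigma>(r := eval w s e), 0, u)"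
    using cexp_correct[of e] by metis
  \<comment> \<open>As for sums: the loop variable is bounded by the value of the loop bound, whence
    the composition.\<close>
  define q' where "q' = pcompose q ([:0, 1:] + p)"
  let ?P = "p * (q' + [:8:]) + [:2:]"
  show ?case
  proof (intro exI[of _ ?P] allI impI, elim conjE)
    fix w u :: "bool list" and s f :: "nat \<Rightarrow> nat" and \<sigma> and r B :: nat
    assume a: "\<forall>x. s x \<le> B" "length w \<le> B" "\<forall>x. f x < r \<and> \<sigma> (f x) = s x" "\<forall>v\<ge>r. \<sigma> v = 0"
    let ?n = "eval w s e" let ?g = "\<lambda>k. ow w (s(x := k)) c" let ?B = "poly ([:0, 1:] + p) B"
    have "\<forall>x. f x < r + 1 \<and> \<sigma> (f x) = s x" "\<forall>v\<ge>r + 1. \<sigma> v = 0" using a(3,4) by (auto simp: less_Suc_eq)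
    note p = p[OF a(1,2) this, of u]
    have q': "poly q' B = poly q ?B" by (simp add: q'_def poly_pcompose)
    let ?S = "\<lambda>i. (\<sigma>(r := ?n - i, r + 1 := i), 0::nat, u @ concat (map ?g [0..<?n - i]))"
    let ?c = "Dec (r + 1) ;; coc (f(x := r)) (r + 2) c ;; Inc r"
    have body: "runs w ?c (?S (Suc i)) (poly q' B + 2) (?S i)" if i: "i < ?n" for i
    proof -
      define k where "k = ?n - Suc i"
      have k: "?n - i = Suc k" "?n - Suc i = k" using i by (auto simp: k_def)
      let ?\<sigma>1 = "(fst (?S (Suc i)))(r + 1 := i)" let ?u = "u @ concat (map ?g [0..<k])"
      have "\<forall>y. (s(x := k)) y \<le> ?B" using a(1) p i by (auto simp: k_def intro: trans_le_add1 trans_le_add2)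
      moreover have "length w \<le> ?B" using a(2) by simp
      moreover have "\<forall>y. (f(x := r)) y < r + 2 \<and> ?\<sigma>1 ((f(x := r)) y) = (s(x := k)) y"
      proof
        fix y
        show "(f(x := r)) y < r + 2 \<and> ?\<sigma>1 ((f(x := r)) y) = (s(x := k)) y"
          using a(3)[rule_format, of y] k by auto
      qed
      moreover have "\<forall>v\<ge>r + 2. ?\<sigma>1 v = 0" using a(4) by auto
      ultimately have q: "runs w (coc (f(x := r)) (r + 2) c) (?\<sigma>1, 0, ?u) (poly q ?B) (?\<sigma>1, 0, ?u @ ?g k)"
        using q[of "s(x := k)" ?B w "f(x := r)" "r + 2" ?\<sigma>1 ?u] by blast
      have "runs w (Dec (r + 1)) (?S (Suc i)) 1 (?\<sigma>1, 0, ?u)"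
        using runs_basic(2)[of w "r + 1" "fst (?S (Suc i))" 0 ?u] k by simp
      from runs_Seq[OF this runs_Seq[OF q runs_basic(1)[of w r]]] show ?thesis
        by (rule runs_eq) (auto simp: k q' fun_eq_iff)
    qed
    have W: "runs w (While (r + 1) ?c) (?S ?n) (?n * (poly q' B + 2 + 2) + 1) (?S 0)"
    proof (rule runs_While)
      show "fst (?S (Suc i)) (r + 1) \<noteq> 0 \<and> runs w ?c (?S (Suc i)) (poly q' B + 2) (?S i)" if "i < ?n" for i
        by (rule conjI[OF _ body[OF that]]) simp
    qed simp
    have n: "?S ?n = (\<sigma>(r + 1 := ?n), 0, u)" using a(4) by (auto simp: fun_eq_iff)
    have cl: "runs w (clear r) (?S 0) (?n * 3 + 1) (\<sigma>, 0, u @ ow w s (OFor x e c))"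
      by (rule runs_eq[OF runs_clear]) (use a(4) in \<open>auto simp: fun_eq_iff\<close>)
    have "?n * (poly q' B + 7) \<le> poly p B * (poly q' B + 7)" using p by (intro mult_le_mono1) blast
    then show "runs w (coc f r (OFor x e c)) (\<sigma>, 0, u) (poly ?P B) (\<sigma>, 0, u @ ow w s (OFor x e c))"
      unfolding coc.simps
      by (intro runs_mono[OF runs_Seq[OF conjunct2[OF p] runs_Seq[OF W[unfolded n] cl]]])
         (simp add: algebra_simps)
  qed
qed

theorem poly_time_eval: "poly_time Or (\<lambda>w. [eval w (\<lambda>_. 0) e \<noteq> 0])"
proof -
  obtain p :: "nat poly" where p: "\<And>w s f r \<sigma> u B. \<lbrakk>\<forall>x. s x \<le> B; length w \<le> B;
     \<forall>x. f x < r \<and> \<sigma> (f x) = s x; \<forall>v\<ge>r. \<sigma> v = 0\<rbrakk> \<Longrightarrow>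
     eval w s e \<le> poly p B \<and> runs w (cexp f r e) (\<sigma>, 0, u) (poly p B) (\<sigma>(r := eval w s e), 0, u)"
    using cexp_correct[of e] by metis
  let ?c = "cexp (\<lambda>_. 0) 1 e ;; shift 1 0"
  have "\<exists>t \<le> poly (5 * p + 1) (length w). \<exists>\<sigma> u. exec w ?c (\<lambda>_. 0, 0, []) t (\<sigma>, 0, u) \<and>
      (\<sigma> 0 \<noteq> 0 \<longleftrightarrow> eval w (\<lambda>_. 0) e \<noteq> 0)" for w
  proof -
    let ?n = "eval w (\<lambda>_. 0) e" let ?\<sigma> = "(\<lambda>_. 0::nat)(1 := ?n)" let ?\<tau> = "(\<lambda>_. 0::nat)(0 := ?n)"
    have e: "?n \<le> poly p (length w) \<and>
      runs w (cexp (\<lambda>_. 0) 1 e) (\<lambda>_. 0, 0, []) (poly p (length w)) (?\<sigma>, 0, [])"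
      by (rule p) simp_all
    have "(1::nat) \<noteq> 0" by simp
    from runs_Seq[OF conjunct2[OF e] runs_shift[OF this, of w ?\<sigma> 0 "[]"]]
    have "runs w ?c (\<lambda>_. 0, 0, []) (poly (5 * p + 1) (length w)) (?\<tau>, 0, [])"
      by (rule runs_eq) (use conjunct1[OF e] in \<open>simp_all add: fun_eq_iff\<close>)
    then obtain t where "t \<le> poly (5 * p + 1) (length w)"
      "exec w ?c (\<lambda>_. 0, 0, []) t (?\<tau>, 0, [])"
      unfolding runs_def by blast
    moreover have "?\<tau> 0 \<noteq> 0 \<longleftrightarrow> ?n \<noteq> 0" by simp
    ultimately show ?thesis by blast
  qed
  then show ?thesis by (rule poly_time_decider[where p = "5 * p + 1" and c = ?c])
qed

theorem poly_time_query:
  fixes r :: "nat poly"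
  assumes "\<And>w. Or (ow w (\<lambda>_. 0) c) = Some (F w)" "\<And>w. length (F w) \<le> poly r (length w)"
  shows "poly_time Or F"
proof -
  obtain p :: "nat poly" where p: "\<And>w s f r \<sigma> u B. \<lbrakk>\<forall>x. s x \<le> B; length w \<le> B;
     \<forall>x. f x < r \<and> \<sigma> (f x) = s x; \<forall>v\<ge>r. \<sigma> v = 0\<rbrakk> \<Longrightarrow>
     runs w (coc f r c) (\<sigma>, 0, u) (poly p B) (\<sigma>, 0, u @ ow w s c)"
    using coc_correct[of c] by metis
  have "\<exists>t \<le> poly p (length w). \<exists>\<sigma> u. exec w (coc (\<lambda>_. 0) 1 c) (\<lambda>_. 0, 0, []) t (\<sigma>, 0, u) \<and>
      Or u = Some (F w)" for w
  proof -
    have "runs w (coc (\<lambda>_. 0) 1 c) (\<lambda>_. 0, 0, []) (poly p (length w)) (\<lambda>_. 0, 0, [] @ ow w (\<lambda>_. 0) c)"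
      by (rule p) simp_all
    then obtain t where "t \<le> poly p (length w)"
      "exec w (coc (\<lambda>_. 0) 1 c) (\<lambda>_. 0, 0, []) t (\<lambda>_. 0, 0, [] @ ow w (\<lambda>_. 0) c)"
      unfolding runs_def by blast
    moreover have "Or ([] @ ow w (\<lambda>_. 0) c) = Some (F w)" using assms(1) by simp
    ultimately show ?thesis by blast
  qed
  then show ?thesis using assms(2) by (rule poly_time_querier[where p = p and r = r and c = "coc (\<lambda>_. 0) 1 c"])
qed

section \<open>Derived operations on expressions\<close>

fun vars :: "ex \<Rightarrow> nat set" where
  "vars (V x) = {x}"
| "vars (C n) = {}"
| "vars (In a) = vars a"
| "vars Len = {}"
| "vars (Add a b) = vars a \<union> vars b"
| "vars (Sub a b) = vars a \<union> vars b"
| "vars (Sum x a b) = vars a \<union> vars b"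

lemma finite_vars: "finite (vars e)"
  by (induction e) auto

lemma eval_cong: "(\<And>x. x \<in> vars e \<Longrightarrow> s x = s' x) \<Longrightarrow> eval w s e = eval w s' e"
proof (induction e arbitrary: s s')
  case (Sum x a b)
  have "eval w s a = eval w s' a" by (rule Sum.IH(1)) (simp add: Sum.prems)
  moreover have "eval w (s(x := k)) b = eval w (s'(x := k)) b" for k
    by (rule Sum.IH(2)) (simp add: Sum.prems)
  ultimately show ?case by simp
next
  case (In e)
  show ?case using In.IH[of s s'] In.prems by simp
next
  case (Add a b)
  show ?case using Add.IH(1,2)[of s s'] Add.prems by simp
next
  case (Sub a b)
  show ?case using Sub.IH(1,2)[of s s'] Sub.prems by simp
qed simp_all

text \<open>Exceeds all variables that occur, so that binding it in a sum captures nothing.\<close>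

definition fresh :: "ex \<Rightarrow> ex \<Rightarrow> nat" where
  "fresh a b = Suc (Max (insert 0 (vars a \<union> vars b)))"

lemma eval_fresh [simp]:
  "eval w (s(fresh a b := k)) a = eval w s a" "eval w (s(fresh a b := k)) b = eval w s b"
proof -
  have "fresh a b \<notin> vars a \<union> vars b"
  proof
    assume f: "fresh a b \<in> vars a \<union> vars b"
    have "fresh a b \<le> Max (insert 0 (vars a \<union> vars b))"
      by (rule Max_ge) (use f finite_vars in simp_all)
    then show False by (simp add: fresh_def)
  qed
  then show "eval w (s(fresh a b := k)) a = eval w s a" "eval w (s(fresh a b := k)) b = eval w s b"
    by (auto intro!: eval_cong)
qed

definition "ENot a = Sub (C 1) a"
definition "Leq a b = ENot (Sub a b)"
definition "Less a b = ENot (Leq b a)"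
definition "Conj a b = ENot (Add (ENot a) (ENot b))"
definition "Disj a b = ENot (ENot (Add a b))"
definition "EEq a b = ENot (Add (Sub a b) (Sub b a))"
definition "Mul a b = Sum (fresh a b) a b"
definition "EEx x a b = ENot (ENot (Sum x a b))"
definition "EAll x a b = ENot (Sum x a (ENot b))"
text \<open>For positive \<open>b\<close> the quotient is the number of \<open>k\<close> such that
  the (k + 1)-fold of \<open>b\<close> is at most \<open>a\<close>.\<close>

definition "Div a b = Sum (fresh a b) a (Leq (Mul (Add (V (fresh a b)) (C 1)) b) a)"
definition "Mod a b = Sub a (Mul (Div a b) b)"
definition "Ite c a b = Add (Mul (ENot (ENot c)) a) (Mul (ENot c) b)"

lemma eval_ENot [simp]: "eval w s (ENot a) = of_bool (eval w s a = 0)"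
  by (auto simp: ENot_def)
lemma eval_Leq [simp]: "eval w s (Leq a b) = of_bool (eval w s a \<le> eval w s b)"
  by (auto simp: Leq_def)
lemma eval_Less [simp]: "eval w s (Less a b) = of_bool (eval w s a < eval w s b)"
  by (auto simp: Less_def)
lemma eval_Conj [simp]: "eval w s (Conj a b) = of_bool (eval w s a \<noteq> 0 \<and> eval w s b \<noteq> 0)"
  by (auto simp: Conj_def)
lemma eval_Disj [simp]: "eval w s (Disj a b) = of_bool (eval w s a \<noteq> 0 \<or> eval w s b \<noteq> 0)"
  by (auto simp: Disj_def)
lemma eval_EEq [simp]: "eval w s (EEq a b) = of_bool (eval w s a = eval w s b)"
  by (auto simp: EEq_def)
lemma eval_Mul [simp]: "eval w s (Mul a b) = eval w s a * eval w s b"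
  by (simp add: Mul_def)
lemma eval_EEx [simp]: "eval w s (EEx x a b) = of_bool (\<exists>k<eval w s a. eval w (s(x := k)) b \<noteq> 0)"
  by (auto simp: EEx_def)
lemma eval_EAll [simp]: "eval w s (EAll x a b) = of_bool (\<forall>k<eval w s a. eval w (s(x := k)) b \<noteq> 0)"
  by (auto simp: EAll_def)
lemma eval_Ite [simp]: "eval w s (Ite c a b) = (if eval w s c \<noteq> 0 then eval w s a else eval w s b)"
  by (auto simp: Ite_def)

lemma eval_Div [simp]:
  assumes "0 < eval w s b"
  shows "eval w s (Div a b) = eval w s a div eval w s b"
proof -
  let ?a = "eval w s a" and ?b = "eval w s b"
  have "eval w s (Div a b) = (\<Sum>k<?a. of_bool (Suc k * ?b \<le> ?a))"
    by (simp add: Div_def del: mult_Suc)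
  also have "\<dots> = card {k. k < ?a \<and> Suc k * ?b \<le> ?a}"
    by (simp add: sum.If_cases of_bool_def lessThan_def Collect_conj_eq[symmetric])
  also have "{k. k < ?a \<and> Suc k * ?b \<le> ?a} = {..<?a div ?b}"
  proof (intro set_eqI)
    fix k
    have "Suc k * ?b \<le> ?a \<longleftrightarrow> Suc k \<le> ?a div ?b" using assms by (simp add: less_eq_div_iff_mult_less_eq)
    moreover have "?a div ?b \<le> ?a" by simp
    ultimately show "k \<in> {k. k < ?a \<and> Suc k * ?b \<le> ?a} \<longleftrightarrow> k \<in> {..<?a div ?b}"
      by (metis (no_types, lifting) Suc_le_eq lessThan_iff less_le_trans mem_Collect_eq)
  qed
  finally show ?thesis by simp
qed

lemma eval_Mod [simp]: "0 < eval w s b \<Longrightarrow> eval w s (Mod a b) = eval w s a mod eval w s b"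
  by (simp add: Mod_def modulo_nat_def)

fun Poly_ex :: "nat list \<Rightarrow> ex \<Rightarrow> ex" where
  "Poly_ex [] e = C 0"
| "Poly_ex (c # cs) e = Add (C c) (Mul e (Poly_ex cs e))"

lemma eval_Poly_ex: "eval w s (Poly_ex (coeffs p) e) = poly p (eval w s e)"
proof -
  have "eval w s (Poly_ex cs e) = poly (Poly cs) (eval w s e)" for cs
    by (induction cs) auto
  then show ?thesis by simp
qed

definition "DisjL es = foldr Disj es (C 0)"

lemma eval_DisjL [simp]: "eval w s (DisjL es) = of_bool (\<exists>e\<in>set es. eval w s e \<noteq> 0)"
  by (induction es) (auto simp: DisjL_def)

text \<open>A finite relation is written out as a disjunction of its pairs. In this way the
  transitions of a fixed machine and the shapes of the blocks enter an expression.\<close>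

definition "Table R m n a b =
  DisjL [Conj (EEq a (C i)) (EEq b (C j)). i \<leftarrow> [0..<m], j \<leftarrow> [0..<n], R i j]"

lemma eval_Table [simp]: "eval w s (Table R m n a b) =
    of_bool (eval w s a < m \<and> eval w s b < n \<and> R (eval w s a) (eval w s b))"
  by (auto simp: Table_def)

section \<open>Runs of a verifier as solutions of binary constraints\<close>

text \<open>Halted configurations are repeated forever, and so are queries, which the nowhere
  defined oracle would never answer. The run thus has a configuration at every time without gaining
  an accepting one.\<close>

definition action :: "machine \<Rightarrow> nat \<Rightarrow> nat list \<Rightarrow> nat \<times> (nat \<times> move) list" where
  "action M q rs = (if q = halt_state \<or> q = query_state then (q, keep rs) else trans M q rs)"

definition next_config :: "machine \<Rightarrow> config \<Rightarrow> config" where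
  "next_config M = (\<lambda>(q, ts). (fst (action M q (map read_tape ts)), map2 act_tape (snd (action M q (map read_tape ts))) ts))"

lemma next_config_stuck: "q = halt_state \<or> q = query_state \<Longrightarrow> next_config M (q, ts) = (q, ts)"
  by (simp add: next_config_def action_def keep_act)

lemma step_next_config: "step M (\<lambda>_. None) c d \<Longrightarrow> d = next_config M c"
  by (cases rule: step.cases) (auto simp: next_config_def action_def)

lemma steps_next_config: "(step M (\<lambda>_. None) ^^ n) c d \<Longrightarrow> d = (next_config M ^^ n) c"
proof (induction n arbitrary: d)
  case (Suc n)
  then obtain e where "(step M (\<lambda>_. None) ^^ n) c e" "step M (\<lambda>_. None) e d" by auto
  then show ?case using Suc.IH step_next_config by auto
qed simp

lemma halted_next_config: "(next_config M ^^ n) (halt_state, ts) = (halt_state, ts)"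
  by (induction n) (simp_all add: next_config_stuck)

type_synonym view = "nat \<times> nat list \<times> nat list \<times> bool list"

text \<open>The symbols under all heads are repeated in every view of the same time: the heads of
  different tapes are at different places, and yet each cell must know which transition is
  taken.\<close>

definition view :: "config \<Rightarrow> int \<Rightarrow> view" where
  "view c i = (fst c, map read_tape (snd c), map (\<lambda>T. fst T i) (snd c), map (\<lambda>T. snd T = i) (snd c))"

definition views :: "machine \<Rightarrow> view set" where
  "views M = {(q, rs, ss, hs). q < num_states M \<and> length rs = num_tapes M \<and> set rs \<subseteq> {..<num_symbols M} \<and>
     length ss = num_tapes M \<and> set ss \<subseteq> {..<num_symbols M} \<and> length hs = num_tapes M}"

lemma finite_views: "finite (views M)"
proof -
  have "views M \<subseteq> {..<num_states M} \<times> {xs. set xs \<subseteq> {..<num_symbols M} \<and> length xs = num_tapes M} \<times>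
    {xs. set xs \<subseteq> {..<num_symbols M} \<and> length xs = num_tapes M} \<times> {xs. set xs \<subseteq> UNIV \<and> length xs = num_tapes M}"
    by (auto simp: views_def)
  moreover have "finite {xs :: nat list. set xs \<subseteq> {..<num_symbols M} \<and> length xs = num_tapes M}"
    "finite {xs :: bool list. set xs \<subseteq> UNIV \<and> length xs = num_tapes M}"
    by (rule finite_lists_length_eq, simp)+
  ultimately show ?thesis by (meson finite_SigmaI finite_lessThan finite_subset)
qed

definition wf_config :: "machine \<Rightarrow> nat \<Rightarrow> config \<Rightarrow> bool" where
  "wf_config M n c \<longleftrightarrow> fst c < num_states M \<and> length (snd c) = num_tapes M \<and>
     (\<forall>T\<in>set (snd c). (\<forall>i. fst T i < num_symbols M) \<and> \<bar>snd T\<bar> \<le> int n)"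

lemma action_wf:
  assumes "wf_machine M" "q < num_states M" "length rs = num_tapes M" "set rs \<subseteq> {..<num_symbols M}"
  shows "fst (action M q rs) < num_states M" "length (snd (action M q rs)) = num_tapes M"
    "\<And>j. j < num_tapes M \<Longrightarrow> fst (snd (action M q rs) ! j) < num_symbols M"
proof -
  have "fst (action M q rs) < num_states M \<and> length (snd (action M q rs)) = num_tapes M \<and>
      (\<forall>a\<in>set (snd (action M q rs)). fst a < num_symbols M)"
    using assms by (auto simp: action_def keep_def wf_machine_def)
  then show "fst (action M q rs) < num_states M" "length (snd (action M q rs)) = num_tapes M"
    "\<And>j. j < num_tapes M \<Longrightarrow> fst (snd (action M q rs) ! j) < num_symbols M" by auto
qed

lemma wf_config_reads:
  assumes "wf_config M n (q, ts)"
  shows "length (map read_tape ts) = num_tapes M" "set (map read_tape ts) \<subseteq> {..<num_symbols M}"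
  using assms by (auto simp: wf_config_def read_tape_def)

lemma move_offset_bound: "\<bar>move_offset m\<bar> \<le> 1"
  by (cases m) auto

lemma wf_next_config:
  assumes M: "wf_machine M" and c: "wf_config M n c"
  shows "wf_config M (Suc n) (next_config M c)"
proof -
  obtain q ts where qts: "c = (q, ts)" by (cases c)
  let ?a = "action M q (map read_tape ts)"
  have q: "q < num_states M" and len: "length ts = num_tapes M"
    and T: "\<And>j. j < num_tapes M \<Longrightarrow> (\<forall>i. fst (ts ! j) i < num_symbols M) \<and> \<bar>snd (ts ! j)\<bar> \<le> int n"
    using c by (auto simp: wf_config_def qts)
  note a = action_wf[OF M q wf_config_reads[OF c[unfolded qts]]]
  have "(\<forall>i. fst U i < num_symbols M) \<and> \<bar>snd U\<bar> \<le> int (Suc n)" if U: "U \<in> set (map2 act_tape (snd ?a) ts)" for U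
  proof -
    obtain j where j: "j < num_tapes M" "U = act_tape (snd ?a ! j) (ts ! j)"
      using U a(2) len by (auto simp: in_set_conv_nth)
    show ?thesis using a(3)[OF j(1)] T[OF j(1)] move_offset_bound[of "snd (snd ?a ! j)"] unfolding j(2) act_tape_def by auto
  qed
  then show ?thesis unfolding wf_config_def next_config_def qts using a(1,2) len by simp
qed

lemma wf_init_config: "wf_machine M \<Longrightarrow> wf_config M 0 (init_config M z)"
  by (auto simp: wf_config_def init_config_def wf_machine_def word_tape_def bit_symbol_def)

lemma wf_run: "wf_machine M \<Longrightarrow> wf_config M t ((next_config M ^^ t) (init_config M z))"
  by (induction t) (simp_all add: wf_init_config wf_next_config)

lemma view_in_views: "wf_config M n c \<Longrightarrow> view c i \<in> views M"
  by (auto simp: wf_config_def view_def views_def read_tape_def)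

definition consistent :: "view \<Rightarrow> bool" where
  "consistent = (\<lambda>(q, rs, ss, hs). \<forall>j<length hs. hs ! j \<longrightarrow> ss ! j = rs ! j)"

text \<open>\<kappa> is the prescribed symbol of tape 0, where 3 leaves the choice between the two
  bits; \<open>b0\<close> tells whether the cell is cell 0, at which all heads start.\<close>

definition initial :: "nat \<Rightarrow> bool \<Rightarrow> view \<Rightarrow> bool" where
  "initial \<kappa> b0 = (\<lambda>(q, rs, ss, hs). q = 0 \<and> (\<forall>j<length hs. hs ! j = b0) \<and>
     (if \<kappa> = 3 then ss ! 0 \<in> {1, 2} else ss ! 0 = \<kappa>) \<and> (\<forall>j<length ss. 0 < j \<longrightarrow> ss ! j = 0))"

definition same_row :: "view \<Rightarrow> view \<Rightarrow> bool" where
  "same_row = (\<lambda>(q, rs, ss, hs) (q', rs', ss', hs'). q = q' \<and> rs = rs')"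

text \<open>The argument \<open>d\<close> is the displacement from the first view to the second; only its values
  \<open>-1\<close>, \<open>0\<close> and \<open>1\<close> matter, and \<open>3\<close> stands for all others.\<close>

definition successive :: "machine \<Rightarrow> int \<Rightarrow> view \<Rightarrow> view \<Rightarrow> bool" where
  "successive M d = (\<lambda>(q, rs, ss, hs) (q', rs', ss', hs'). q' = fst (action M q rs) \<and>
     (d = 0 \<longrightarrow> (\<forall>j<length ss. ss' ! j = (if hs ! j then fst (snd (action M q rs) ! j) else ss ! j))) \<and>
     (\<forall>j<length hs. hs ! j \<longrightarrow> (hs' ! j \<longleftrightarrow> move_offset (snd (snd (action M q rs) ! j)) = d)))"

lemma consistent_view: "consistent (view c i)"
  by (auto simp: consistent_def view_def read_tape_def)

lemma same_row_view: "same_row (view c i) (view c j)"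
  by (simp add: same_row_def view_def)

lemma successive_view:
  assumes M: "wf_machine M" and c: "wf_config M n c" and d: "d = j - i \<or> d = 3 \<and> \<bar>j - i\<bar> > 1"
  shows "successive M d (view c i) (view (next_config M c) j)"
proof -
  obtain q ts where qts: "c = (q, ts)" by (cases c)
  let ?a = "action M q (map read_tape ts)"
  have q: "q < num_states M" and len: "length ts = num_tapes M" using c by (auto simp: wf_config_def qts)
  note a = action_wf[OF M q wf_config_reads[OF c[unfolded qts]]]
  have nx: "next_config M c = (fst ?a, map2 act_tape (snd ?a) ts)" by (simp add: next_config_def qts)
  have th: "map2 act_tape (snd ?a) ts ! k = act_tape (snd ?a ! k) (ts ! k)" if "k < num_tapes M" for k
    using that a(2) len by simp
  have "move_offset m = d \<longleftrightarrow> i + move_offset m = j" for m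
    using d move_offset_bound[of m] by auto
  then show ?thesis
    unfolding successive_def view_def nx using a(2) len th d
    by (auto simp: qts act_tape_def)
qed

text \<open>The old head cell is related to every cell of the window, adjacent or not, and this
  settles whether the head is there afterwards. New symbols follow from displacement 0. The new
  reads are then known at the new head cell by consistency and everywhere else by
  \<open>same_row\<close>; the margin of \<open>B\<close> keeps that cell inside the window.\<close>

lemma successive_unique:
  fixes W :: "int \<Rightarrow> view"
  assumes M: "wf_machine M" and c: "wf_config M n c" and B: "int n < int B"
    and W: "\<And>i. \<bar>i\<bar> \<le> int B \<Longrightarrow> W i \<in> views M \<and> consistent (W i)"
    and same: "\<And>i j. \<bar>i\<bar> \<le> int B \<Longrightarrow> \<bar>j\<bar> \<le> int B \<Longrightarrow> same_row (W i) (W j)"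
    and succ: "\<And>i j. \<bar>i\<bar> \<le> int B \<Longrightarrow> \<bar>j\<bar> \<le> int B \<Longrightarrow>
       successive M (if \<bar>j - i\<bar> \<le> 1 then j - i else 3) (view c i) (W j)"
    and i: "\<bar>i\<bar> \<le> int B"
  shows "W i = view (next_config M c) i"
proof -
  obtain q ts where qts: "c = (q, ts)" by (cases c)
  let ?a = "action M q (map read_tape ts)"
  have q: "q < num_states M" and len: "length ts = num_tapes M"
    and T: "\<And>k. k < num_tapes M \<Longrightarrow> \<bar>snd (ts ! k)\<bar> \<le> int n"
    using c by (auto simp: wf_config_def qts)
  note a = action_wf[OF M q wf_config_reads[OF c[unfolded qts]]]
  let ?c' = "next_config M c"
  have nx: "?c' = (fst ?a, map2 act_tape (snd ?a) ts)" by (simp add: next_config_def qts)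
  have th: "map2 act_tape (snd ?a) ts ! k = act_tape (snd ?a ! k) (ts ! k)" if "k < num_tapes M" for k
    using that a(2) len by simp
  define p where "p k = snd (ts ! k)" for k
  define p' where "p' k = p k + move_offset (snd (snd ?a ! k))" for k
  have pB: "\<bar>p k\<bar> \<le> int B" "\<bar>p' k\<bar> \<le> int B" if "k < num_tapes M" for k
    using T[OF that] B move_offset_bound[of "snd (snd ?a ! k)"] by (auto simp: p_def p'_def)
  have st: "fst (W j) = fst ?a" if "\<bar>j\<bar> \<le> int B" for j
    using succ[OF that that] by (auto simp: successive_def view_def qts split: prod.splits)
  have sy: "fst (snd (snd (W j))) ! k = fst (map2 act_tape (snd ?a) ts ! k) j" if "\<bar>j\<bar> \<le> int B" "k < num_tapes M" for j k
    using succ[OF that(1) that(1)] that(2) len th[OF that(2)]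
    by (auto simp: successive_def view_def qts act_tape_def split: prod.splits)
  have hd: "snd (snd (snd (W j))) ! k \<longleftrightarrow> j = p' k" if j: "\<bar>j\<bar> \<le> int B" and k: "k < num_tapes M" for j k
  proof -
    have "snd (snd (snd (W j))) ! k \<longleftrightarrow> move_offset (snd (snd ?a ! k)) = (if \<bar>j - p k\<bar> \<le> 1 then j - p k else 3)"
      using succ[OF pB(1)[OF k] j] k len by (auto simp: successive_def view_def qts p_def split: prod.splits)
    then show ?thesis using move_offset_bound[of "snd (snd ?a ! k)"] by (auto simp: p'_def split: if_splits)
  qed
  have rd: "fst (snd (W j)) ! k = read_tape (map2 act_tape (snd ?a) ts ! k)" if j: "\<bar>j\<bar> \<le> int B" and k: "k < num_tapes M" for j k
  proof -
    have "fst (snd (W j)) = fst (snd (W (p' k)))"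
      using same[OF j pB(2)[OF k]] by (auto simp: same_row_def split: prod.splits)
    moreover have "fst (snd (W (p' k))) ! k = fst (snd (snd (W (p' k)))) ! k"
      using W[OF pB(2)[OF k]] hd[OF pB(2)[OF k] k] k by (auto simp: consistent_def views_def split: prod.splits)
    moreover have "snd (map2 act_tape (snd ?a) ts ! k) = p' k"
      unfolding th[OF k] by (simp add: act_tape_def p_def p'_def)
    ultimately show ?thesis using sy[OF pB(2)[OF k] k] by (simp add: read_tape_def)
  qed
  obtain q' rs ss hs where Wi: "W i = (q', rs, ss, hs)" by (metis prod_cases4)
  have l: "length rs = num_tapes M" "length ss = num_tapes M" "length hs = num_tapes M"
    using W[OF i] by (auto simp: Wi views_def)
  have l': "length (map2 act_tape (snd ?a) ts) = num_tapes M" using a(2) len by simp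
  have "rs = map read_tape (map2 act_tape (snd ?a) ts)"
    by (rule nth_equalityI) (use l l' rd[OF i] in \<open>simp_all add: Wi del: map_zip_map2\<close>)
  moreover have "ss = map (\<lambda>T. fst T i) (map2 act_tape (snd ?a) ts)"
    by (rule nth_equalityI) (use l l' sy[OF i] in \<open>simp_all add: Wi\<close>)
  moreover have "hs = map (\<lambda>T. snd T = i) (map2 act_tape (snd ?a) ts)"
    by (rule nth_equalityI) (use l l' hd[OF i] th in \<open>auto simp: Wi act_tape_def p_def p'_def\<close>)
  ultimately show ?thesis using st[OF i] unfolding nx view_def Wi by simp
qed


lemma length_delimit: "length (delimit w) = 2 * length w + 2"
  by (induction w) (simp_all add: delimit_def)

lemma nth_delimit: "i < 2 * length w \<Longrightarrow> delimit w ! i = w ! (i div 2)"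
proof (induction w arbitrary: i)
  case (Cons b w)
  have d: "delimit (b # w) = b # b # delimit w" by (simp add: delimit_def)
  show ?case
  proof (cases "i < 2")
    case True
    then have "i = 0 \<or> i = 1" by auto
    then show ?thesis by (auto simp: d)
  next
    case False
    then obtain j where j: "i = Suc (Suc j)" by (metis add_2_eq_Suc le_Suc_ex not_less)
    then show ?thesis using Cons by (simp add: d)
  qed
qed simp

lemma nth_delimit_end: "delimit w ! (2 * length w) = False" "delimit w ! Suc (2 * length w) = True"
  by (induction w) (simp_all add: delimit_def)

text \<open>The contents of cell \<open>i\<close> for the word \<open>pair_word x y\<close> as far
  as they do not depend on \<open>y\<close>: 3 stands for a bit of the certificate, and the symbols
  at 2 n and 2 n + 1 are the end mark of \<open>delimit\<close>.\<close>

definition start_symbol :: "bool list \<Rightarrow> nat \<Rightarrow> nat \<Rightarrow> nat" where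
  "start_symbol x m i = (let n = length x in
     if i < 2 * n then in_sym x (i div 2) else if i = 2 * n then 1 else if i = 2 * n + 1 then 2
     else if i < 2 * n + 2 + m then 3 else 0)"

lemma start_symbol:
  assumes "length y = m"
  shows "fst (word_tape (pair_word x y)) (int i) =
    (if start_symbol x m i = 3 then bit_symbol (y ! (i - 2 * length x - 2)) else start_symbol x m i)"
proof -
  let ?n = "length x"
  have len: "length (pair_word x y) = 2 * ?n + 2 + m" by (simp add: pair_word_def length_delimit assms)
  have nth: "pair_word x y ! i = (if i < 2 * ?n + 2 then delimit x ! i else y ! (i - (2 * ?n + 2)))"
    by (simp add: pair_word_def nth_append length_delimit)
  have wt: "fst (word_tape (pair_word x y)) (int i) = (if i < length (pair_word x y) then bit_symbol (pair_word x y ! i) else 0)"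
    by (simp add: word_tape_def)
  consider "i < 2 * ?n" | "i = 2 * ?n" | "i = Suc (2 * ?n)" | "2 * ?n + 2 \<le> i" by linarith
  then show ?thesis
  proof cases
    case 1
    then have "in_sym x (i div 2) = bit_symbol (x ! (i div 2))" by (simp add: in_sym_def)
    moreover have "bit_symbol b \<noteq> 3" for b by (simp add: bit_symbol_def)
    ultimately show ?thesis unfolding wt using 1 len nth nth_delimit[of i x] by (simp add: start_symbol_def)
  next
    case 2
    then show ?thesis unfolding wt using len nth nth_delimit_end[of x] by (simp add: start_symbol_def bit_symbol_def)
  next
    case 3
    then show ?thesis unfolding wt using len nth nth_delimit_end[of x] by (simp add: start_symbol_def bit_symbol_def)
  next
    case 4
    then show ?thesis unfolding wt using len nth by (auto simp: start_symbol_def)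
  qed
qed

text \<open>A natural number below 4, with 2 for -1, so that it can be packed into an index of a
  \<open>Table\<close>.\<close>

definition displacement :: "nat \<Rightarrow> nat \<Rightarrow> nat" where
  "displacement p p' = (if p' = p then 0 else if p' = p + 1 then 1 else if p = p' + 1 then 2 else 3)"

definition decode_displacement :: "nat \<Rightarrow> int" where
  "decode_displacement d = (if d = 0 then 0 else if d = 1 then 1 else if d = 2 then -1 else 3)"

lemma decode_displacement: "decode_displacement (displacement p p') =
    (if \<bar>(int p' - c) - (int p - c)\<bar> \<le> 1 then (int p' - c) - (int p - c) else 3)"
  by (auto simp: decode_displacement_def displacement_def)

text \<open>The variable of index \<open>g\<close> is the view of time \<open>g div P\<close> at tape position \<open>g mod P - T\<close>.\<close>

definition compatible :: "machine \<Rightarrow> view list \<Rightarrow> bool list \<Rightarrow> nat \<Rightarrow> nat \<Rightarrow> nat \<Rightarrow> nat \<Rightarrow> nat \<Rightarrow> nat \<Rightarrow> bool" where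
  "compatible M vals x m T g v g' v' \<longleftrightarrow>
    (let P = 2 * T + 1; t = g div P; p = g mod P; t' = g' div P; p' = g' mod P in
      consistent (vals ! v) \<and>
      (t = 0 \<longrightarrow> initial (if p < T then 0 else start_symbol x m (p - T)) (p = T) (vals ! v)) \<and>
      (t = t' \<longrightarrow> same_row (vals ! v) (vals ! v')) \<and>
      (t' = t + 1 \<longrightarrow> successive M (decode_displacement (displacement p p')) (vals ! v) (vals ! v')) \<and>
      (t = T \<and> p = T \<longrightarrow> fst (snd (snd (vals ! v))) ! 0 = 2))"

definition Start_ex :: "ex \<Rightarrow> ex \<Rightarrow> ex" where
  "Start_ex m i = Ite (Less i (Mul (C 2) Len)) (In (Div i (C 2))) (Ite (EEq i (Mul (C 2) Len)) (C 1)
     (Ite (EEq i (Add (Mul (C 2) Len) (C 1))) (C 2) (Ite (Less i (Add (Add (Mul (C 2) Len) (C 2)) m)) (C 3) (C 0))))"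

lemma eval_Start_ex: "eval x s (Start_ex m i) = start_symbol x (eval x s m) (eval x s i)"
  by (simp add: Start_ex_def start_symbol_def Let_def)

text \<open>Variables 0 to 3 hold g, v, g' and v'. A \<open>Table\<close> has two arguments; so the
  initial symbol and the mark of cell 0 are packed as 2 a + b, and a view and a displacement as 4 v
  + d.\<close>

definition Compatible_ex :: "machine \<Rightarrow> view list \<Rightarrow> ex \<Rightarrow> ex \<Rightarrow> ex" where
  "Compatible_ex M vals m T =
    (let D = length vals; P = Add (Mul (C 2) T) (C 1); t = Div (V 0) P; p = Mod (V 0) P; t' = Div (V 2) P; p' = Mod (V 2) P;
       d = Ite (EEq p' p) (C 0) (Ite (EEq p' (Add p (C 1))) (C 1) (Ite (EEq p (Add p' (C 1))) (C 2) (C 3))) in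
     Conj (Table (\<lambda>v _. consistent (vals ! v)) D 1 (V 1) (C 0))
    (Conj (Disj (ENot (EEq t (C 0))) (Table (\<lambda>a v. initial (a div 2) (odd a) (vals ! v)) 8 D
        (Add (Mul (C 2) (Ite (Less p T) (C 0) (Start_ex m (Sub p T)))) (EEq p T)) (V 1)))
    (Conj (Disj (ENot (EEq t t')) (Table (\<lambda>v v'. same_row (vals ! v) (vals ! v')) D D (V 1) (V 3)))
    (Conj (Disj (ENot (EEq t' (Add t (C 1)))) (Table (\<lambda>a v'. successive M (decode_displacement (a mod 4)) (vals ! (a div 4)) (vals ! v'))
        (4 * D) D (Add (Mul (C 4) (V 1)) d) (V 3)))
      (Disj (ENot (Conj (EEq t T) (EEq p T))) (Table (\<lambda>v _. fst (snd (snd (vals ! v))) ! 0 = 2) D 1 (V 1) (C 0)))))))"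

lemma start_symbol_less: "start_symbol x m i < 4"
  by (auto simp: start_symbol_def Let_def in_sym_def bit_symbol_def)

lemma eval_Compatible_ex:
  assumes "s 1 < length vals" "s 3 < length vals"
  shows "eval x s (Compatible_ex M vals m T) = of_bool (compatible M vals x (eval x s m) (eval x s T) (s 0) (s 1) (s 2) (s 3))"
proof -
  have d: "(if p' = p then 0 else if p' = p + 1 then 1 else if p = p' + 1 then 2 else 3) = displacement p p'" for p p'
    by (simp add: displacement_def)
  have d4: "displacement p p' < 4" for p p' by (simp add: displacement_def)
  have q: "(4 * v + displacement p p') mod 4 = displacement p p'" "(4 * v + displacement p p') div 4 = v"
    "4 * v + displacement p p' < 4 * n \<longleftrightarrow> v < n" for v p p' n using d4[of p p'] by auto
  have i: "(2 * a + of_bool b) div 2 = a" "odd (2 * a + of_bool b) \<longleftrightarrow> b" "2 * a + of_bool b < 8 \<longleftrightarrow> a < 4" for a :: nat and b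
    by (cases b; auto)+
  let ?Pe = "Add (Mul (C 2) T) (C 1)"
  define n P where "n = eval x s T" and "P = 2 * n + 1"
  have Pp: "0 < P" by (simp add: P_def)
  have Pe: "eval x s ?Pe = P" by (simp add: P_def n_def)
  have e: "eval x s (Div (V a) ?Pe) = s a div P" "eval x s (Mod (V a) ?Pe) = s a mod P" for a
    using Pp Pe eval_Div[of x s ?Pe "V a"] eval_Mod[of x s ?Pe "V a"] by (simp_all only: eval.simps(1))
  have dd: "eval x s (Ite (EEq (Mod (V 2) ?Pe) (Mod (V 0) ?Pe)) (C 0) (Ite (EEq (Mod (V 2) ?Pe) (Add (Mod (V 0) ?Pe) (C 1))) (C 1)
      (Ite (EEq (Mod (V 0) ?Pe) (Add (Mod (V 2) ?Pe) (C 1))) (C 2) (C 3)))) = displacement (s 0 mod P) (s 2 mod P)"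
    unfolding displacement_def eval_Ite eval_EEq eval.simps(2,5) e by simp
  have st: "eval x s (Ite (Less (Mod (V 0) ?Pe) T) (C 0) (Start_ex m (Sub (Mod (V 0) ?Pe) T))) =
      (if s 0 mod P < n then 0 else start_symbol x (eval x s m) (s 0 mod P - n))"
    unfolding eval_Ite eval_Less eval_Start_ex eval.simps(2,6) e n_def by simp
  define K where "K = (if s 0 mod P < n then 0 else start_symbol x (eval x s m) (s 0 mod P - n))"
  have K: "K < 4" using start_symbol_less by (simp add: K_def)
  show ?thesis
    unfolding Compatible_ex_def Let_def eval_Conj eval_Disj eval_ENot eval_EEq eval_Table eval_Mul eval.simps(1,2,5) e dd st
      compatible_def n_def[symmetric] P_def[symmetric] K_def[symmetric] q i
    using assms K by simp
qed

lemma init_config_tapes: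
  assumes "wf_machine M"
  shows "length (snd (init_config M z)) = num_tapes M"
    "j < num_tapes M \<Longrightarrow> snd (init_config M z) ! j = word_tape (if j = 0 then z else [])"
  using assms by (auto simp: init_config_def wf_machine_def nth_Cons split: nat.split)

text \<open>As halted configurations are repeated, the verdict can be read at time \<open>T\<close>
  no matter when the machine stopped.\<close>

lemma accepting_symbol:
  assumes "computes_within M (\<lambda>_. None) z [b] t" "t \<le> T"
  shows "fst (snd ((next_config M ^^ T) (init_config M z)) ! 0) 0 = bit_symbol b"
proof -
  from assms(1) obtain n ts where n: "n \<le> t" "(step M (\<lambda>_. None) ^^ n) (init_config M z) (halt_state, ts)"
    "tape_holds (ts ! 0) [b]" unfolding computes_within_def by blast
  have "(next_config M ^^ T) (init_config M z) = (next_config M ^^ (T - n)) ((next_config M ^^ n) (init_config M z))"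
    using n(1) assms(2) funpow_add[of "T - n" n "next_config M"] by simp
  also have "\<dots> = (halt_state, ts)" unfolding steps_next_config[OF n(2), symmetric] by (rule halted_next_config)
  finally show ?thesis using n(3) by (simp add: tape_holds_def)
qed

lemma start_position:
  assumes "length y = m"
  shows "fst (word_tape (pair_word x y)) (int p - int T) =
    (if (if p < T then 0 else start_symbol x m (p - T)) = 3 then bit_symbol (y ! (p - T - 2 * length x - 2))
     else (if p < T then 0 else start_symbol x m (p - T)))"
proof (cases "p < T")
  case True
  then show ?thesis by (simp add: word_tape_def)
next
  case False
  then have "int p - int T = int (p - T)" by simp
  then show ?thesis using start_symbol[OF assms, of x "p - T"] False by simp
qed

lemma initial_view:
  assumes M: "wf_machine M" and y: "length y = m"
  shows "initial (if p < T then 0 else start_symbol x m (p - T)) (p = T)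
    (view (init_config M (pair_word x y)) (int p - int T))"
proof -
  let ?c = "init_config M (pair_word x y)"
  note t = init_config_tapes(2)[OF M, of _ "pair_word x y"]
  have len: "length (snd ?c) = num_tapes M" using init_config_tapes(1)[OF M] .
  have z: "0 < num_tapes M" using M by (simp add: wf_machine_def)
  have "bit_symbol b \<in> {1, 2}" for b by (simp add: bit_symbol_def)
  moreover have "fst ?c = 0" by (simp add: init_config_def)
  moreover have "snd (word_tape w) = 0" "fst (word_tape []) i = 0" for w i by (simp_all add: word_tape_def)
  ultimately show ?thesis
    using start_position[OF y, of x p T] t len z unfolding initial_def view_def by auto
qed

text \<open>All heads start at position \<open>T\<close> of the window, which represents cell 0. Its
  view reveals the symbols read, and \<open>same_row\<close> carries them to position
  \<open>p\<close>.\<close>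

lemma initial_view_unique:
  assumes M: "wf_machine M" and y: "length y = m" and W: "W p \<in> views M" "W T \<in> views M" "consistent (W T)"
    and same: "same_row (W p) (W T)" and T: "T < P" "p < P"
    and init: "\<And>p. p < P \<Longrightarrow> initial (if p < T then 0 else start_symbol x m (p - T)) (p = T) (W p)"
    and sym: "\<And>p. p < P \<Longrightarrow> T \<le> p \<Longrightarrow> start_symbol x m (p - T) = 3 \<Longrightarrow>
      fst (snd (snd (W p))) ! 0 = bit_symbol (y ! (p - T - 2 * length x - 2))"
  shows "W p = view (init_config M (pair_word x y)) (int p - int T)"
proof -
  let ?c = "init_config M (pair_word x y)"
  have len: "length (snd ?c) = num_tapes M" using init_config_tapes(1)[OF M] .
  note t = init_config_tapes(2)[OF M, of _ "pair_word x y"]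
  have ss: "fst (snd (snd (W p))) ! j = fst (snd ?c ! j) (int p - int T)"
    if "j < num_tapes M" "p < P" "W p \<in> views M" for j p
  proof (cases "j = 0")
    case True
    then show ?thesis using init[OF that(2)] sym[OF that(2)] start_position[OF y, of x p T] t[OF that(1)]
      by (auto simp: initial_def split: prod.splits if_splits)
  next
    case False
    then show ?thesis using init[OF that(2)] t[OF that(1)] that
      by (auto simp: initial_def views_def word_tape_def split: prod.splits)
  qed
  obtain q rs as hs where Wp: "W p = (q, rs, as, hs)" by (metis prod_cases4)
  obtain q0 rs0 ss0 hs0 where W0: "W T = (q0, rs0, ss0, hs0)" by (metis prod_cases4)
  have l: "length rs = num_tapes M" "length as = num_tapes M" "length hs = num_tapes M"
    "length rs0 = num_tapes M" "length ss0 = num_tapes M" "length hs0 = num_tapes M"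
    using W by (auto simp: Wp W0 views_def)
  have hs0: "\<forall>j<num_tapes M. hs0 ! j" using init[OF T(1)] l by (auto simp: W0 initial_def)
  have rs: "rs ! j = read_tape (snd ?c ! j)" if "j < num_tapes M" for j
  proof -
    have "rs ! j = ss0 ! j" using same W(3) hs0 that l by (auto simp: same_row_def consistent_def Wp W0)
    also have "\<dots> = fst (snd ?c ! j) 0" using ss[OF that T(1) W(2)] by (simp add: W0)
    finally show ?thesis using t[OF that] by (simp add: read_tape_def word_tape_def)
  qed
  have q: "q = fst ?c" using init[OF T(2)] by (simp add: Wp initial_def init_config_def)
  have "rs = map read_tape (snd ?c)" by (rule nth_equalityI) (use l len rs in simp_all)
  moreover have "as = map (\<lambda>T'. fst T' (int p - int T)) (snd ?c)"
    by (rule nth_equalityI) (use l len ss[OF _ T(2) W(1)] in \<open>simp_all add: Wp\<close>)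
  moreover have "hs = map (\<lambda>T'. snd T' = int p - int T) (snd ?c)"
    by (rule nth_equalityI) (use l len t init[OF T(2)] in \<open>auto simp: Wp initial_def word_tape_def\<close>)
  ultimately show ?thesis using q by (simp add: Wp view_def)
qed

text \<open>With two values at least, the first and the last block of a group are different.\<close>

lemma card_views: "wf_machine M \<Longrightarrow> 2 \<le> card (views M)"
proof -
  assume M: "wf_machine M"
  let ?v = "\<lambda>q. (q, replicate (num_tapes M) 0, replicate (num_tapes M) 0, replicate (num_tapes M) True)"
  have "{?v 0, ?v 1} \<subseteq> views M" using M by (auto simp: views_def wf_machine_def)
  from card_mono[OF finite_views this] show ?thesis by simp
qed

text \<open>A certificate determines the run and with it all views. Conversely, the views of time 0
  spell out a certificate, and each later time is forced by the one before. The window from -T to T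
  contains the input and every place a head can reach in \<open>T\<close> steps.\<close>

lemma run_as_constraints:
  fixes T m :: nat
  assumes M: "wf_machine M" and vals: "set vals = views M" "distinct vals"
    and T: "2 * length x + 2 + m \<le> T"
    and V: "\<And>y. length y = m \<Longrightarrow> \<exists>t\<le>T. computes_within M (\<lambda>_. None) (pair_word x y) [Vf (pair_word x y)] t"
  defines "G \<equiv> (T + 1) * (2 * T + 1)" and "D \<equiv> length vals"
  shows "card {y. length y = m \<and> Vf (pair_word x y)} =
    card {U \<in> {..<G} \<rightarrow>\<^sub>E {..<D}. \<forall>g<G. \<forall>g'<G. compatible M vals x m T g (U g) g' (U g')}"
proof -
  define P where "P = 2 * T + 1"
  define run where "run y t = (next_config M ^^ t) (init_config M (pair_word x y))" for y t
  define tv where "tv y g = view (run y (g div P)) (int (g mod P) - int T)" for y g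
  define ix where "ix v = (SOME i. i < D \<and> vals ! i = v)" for v
  define \<Phi> where "\<Phi> y = restrict (\<lambda>g. ix (tv y g)) {..<G}" for y
  have P: "0 < P" "T < P" by (simp_all add: P_def)
  have GP: "G = (T + 1) * P" by (simp add: G_def P_def)
  have ix: "ix v < D \<and> vals ! ix v = v" if "v \<in> views M" for v
  proof -
    have "\<exists>i. i < D \<and> vals ! i = v" using that unfolding vals(1)[symmetric] in_set_conv_nth D_def .
    then show ?thesis unfolding ix_def by (rule someI_ex)
  qed
  have wf: "wf_config M t (run y t)" for y t unfolding run_def by (rule wf_run[OF M])
  have tvv: "tv y g \<in> views M" for y g unfolding tv_def by (rule view_in_views[OF wf])
  have \<Phi>: "\<Phi> y g < D" "vals ! \<Phi> y g = tv y g" if "g < G" for y g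
    using ix[OF tvv] that by (simp_all add: \<Phi>_def)
  have acc: "fst (snd (run y T) ! 0) 0 = bit_symbol (Vf (pair_word x y))" if "length y = m" for y
    using V[OF that] accepting_symbol unfolding run_def by blast
  have bs: "bit_symbol b = 2 \<longleftrightarrow> b" "bit_symbol b = bit_symbol b' \<longleftrightarrow> b = b'" for b b' by (auto simp: bit_symbol_def)
  have nt: "0 < num_tapes M" using M by (simp add: wf_machine_def)
  have lenr: "length (snd (run y t)) = num_tapes M" for y t using wf[where y=y and t=t] by (simp add: wf_config_def)
  have v0: "fst (snd (snd (view (run y t) i))) ! 0 = fst (snd (run y t) ! 0) i" for y t i
    using nt lenr[of y t] by (simp add: view_def)
  have into: "\<Phi> y \<in> {U \<in> {..<G} \<rightarrow>\<^sub>E {..<D}. \<forall>g<G. \<forall>g'<G. compatible M vals x m T g (U g) g' (U g')}"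
    if y: "length y = m" "Vf (pair_word x y)" for y
  proof -
    have "compatible M vals x m T g (\<Phi> y g) g' (\<Phi> y g')" if g: "g < G" "g' < G" for g g'
    proof -
      have 1: "initial (if g mod P < T then 0 else start_symbol x m (g mod P - T)) (g mod P = T) (tv y g)" if "g div P = 0"
        using initial_view[OF M y(1), of "g mod P" T x] that by (simp add: tv_def run_def)
      have 2: "same_row (tv y g) (tv y g')" if "g div P = g' div P" using that same_row_view by (simp add: tv_def)
      have 3: "successive M (decode_displacement (displacement (g mod P) (g' mod P))) (tv y g) (tv y g')" if "g' div P = g div P + 1"
      proof -
        have r: "run y (g div P + 1) = next_config M (run y (g div P))" by (simp add: run_def)
        show ?thesis unfolding tv_def that r
          by (rule successive_view[OF M wf]) (auto simp: decode_displacement[where c="int T"])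
      qed
      have 4: "fst (snd (snd (tv y g))) ! 0 = 2" if "g div P = T" "g mod P = T"
        using that v0 acc[OF y(1)] y(2) bs by (simp add: tv_def)
      show ?thesis unfolding compatible_def Let_def P_def[symmetric] \<Phi>(2)[OF g(1)] \<Phi>(2)[OF g(2)]
        using 1 2 3 4 consistent_view by (simp add: tv_def)
    qed
    then show ?thesis using \<Phi>(1) by (auto simp: \<Phi>_def)
  qed
  have pos: "P * 0 + (T + 2 * length x + 2 + i) < G" "T + 2 * length x + 2 + i < P" if "i < m" for i
    using that T by (auto simp: GP P_def)
  have "inj_on \<Phi> {y. length y = m \<and> Vf (pair_word x y)}"
  proof (rule inj_onI)
    fix y y' assume yy: "y \<in> {y. length y = m \<and> Vf (pair_word x y)}" "y' \<in> {y. length y = m \<and> Vf (pair_word x y)}"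
      and eq: "\<Phi> y = \<Phi> y'"
    have y: "length y = m" "length y' = m" using yy by simp_all
    have "y ! i = y' ! i" if i: "i < m" for i
    proof -
      let ?g = "T + 2 * length x + 2 + i"
      have g: "?g < G" "?g < P" using pos[OF i] by simp_all
      have "tv y ?g = tv y' ?g" using \<Phi>(2)[OF g(1)] eq by metis
      then have "fst (snd (snd (tv y ?g))) ! 0 = fst (snd (snd (tv y' ?g))) ! 0" by simp
      then have "fst (snd (run y 0) ! 0) (int ?g - int T) = fst (snd (run y' 0) ! 0) (int ?g - int T)"
        unfolding tv_def v0 div_less[OF g(2)] mod_less[OF g(2)] .
      then have "fst (word_tape (pair_word x y)) (int ?g - int T) = fst (word_tape (pair_word x y')) (int ?g - int T)"
        using init_config_tapes(2)[OF M nt] by (simp add: run_def)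
      moreover have "start_symbol x m (?g - T) = 3" using i by (simp add: start_symbol_def)
      ultimately show ?thesis
        using start_position[of y m x ?g T] start_position[of y' m x ?g T] y bs by simp
    qed
    then show "y = y'" using y by (simp add: list_eq_iff_nth_eq)
  qed
  moreover have "\<exists>y. length y = m \<and> Vf (pair_word x y) \<and> U = \<Phi> y"
    if U: "U \<in> {..<G} \<rightarrow>\<^sub>E {..<D}" and c: "\<And>g g'. g < G \<Longrightarrow> g' < G \<Longrightarrow> compatible M vals x m T g (U g) g' (U g')" for U
  proof -
    define W where "W t p = vals ! U (t * P + p)" for t p
    have gl: "t * P + p < G" if "t \<le> T" "p < P" for t p
    proof -
      have "t * P \<le> T * P" using that by simp
      from add_le_less_mono[OF this that(2)] show ?thesis by (simp add: GP add.commute)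
    qed
    have dm: "(t * P + p) div P = t" "(t * P + p) mod P = p" if "p < P" for t p using that by simp_all
    have Wv: "W t p \<in> views M" if "t \<le> T" "p < P" for t p
      using gl[OF that] U vals(1) unfolding W_def D_def by (metis PiE_mem lessThan_iff nth_mem)
    note cc = c[unfolded compatible_def Let_def P_def[symmetric]]
    have con: "consistent (W t p)" if "t \<le> T" "p < P" for t p
      using cc[OF gl gl, OF that that] by (simp add: W_def)
    have ini: "initial (if p < T then 0 else start_symbol x m (p - T)) (p = T) (W 0 p)" if "p < P" for p
      using cc[OF gl gl, OF le0 that le0 that] unfolding dm[OF that] W_def by blast
    have sam: "same_row (W t p) (W t p')" if "t \<le> T" "p < P" "p' < P" for t p p'
      using cc[OF gl gl, OF that(1,2) that(1,3)] that by (simp add: W_def dm del: mult_Suc)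
    have suc: "successive M (decode_displacement (displacement p p')) (W t p) (W (t + 1) p')"
      if "t + 1 \<le> T" "p < P" "p' < P" for t p p'
    proof -
      have "t \<le> T" using that by simp
      from cc[OF gl[OF this that(2)] gl[OF that(1,3)]] show ?thesis
        unfolding dm[OF that(2)] dm[OF that(3)] W_def by blast
    qed
    have ac: "fst (snd (snd (W T T))) ! 0 = 2"
      using cc[OF gl gl, OF le_refl P(2) le_refl P(2)] unfolding dm[OF P(2)] W_def by blast
    \<comment> \<open>The certificate is read off the cells behind the end mark at time 0.\<close>
    define y where "y = map (\<lambda>i. fst (snd (snd (W 0 (T + 2 * length x + 2 + i)))) ! 0 = 2) [0..<m]"
    have y: "length y = m" by (simp add: y_def)
    have W0: "W 0 p = view (run y 0) (int p - int T)" if p: "p < P" for p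
    proof -
      have "W 0 p = view (init_config M (pair_word x y)) (int p - int T)"
      proof (rule initial_view_unique[OF M y, where P = P and W = "W 0"])
        fix p assume p: "p < P" "T \<le> p" "start_symbol x m (p - T) = 3"
        then have k: "2 * length x + 2 \<le> p - T" "p - T < 2 * length x + 2 + m"
          by (auto simp: start_symbol_def Let_def in_sym_def bit_symbol_def split: if_splits)
        define i where "i = p - T - 2 * length x - 2"
        have i: "i < m" "p = T + 2 * length x + 2 + i" using k p by (auto simp: i_def)
        have "fst (snd (snd (W 0 p))) ! 0 \<in> {1, 2}"
          using ini[OF p(1)] p by (auto simp: initial_def split: prod.splits if_splits)
        moreover have "y ! i \<longleftrightarrow> fst (snd (snd (W 0 p))) ! 0 = 2" using i by (simp add: y_def)
        ultimately show "fst (snd (snd (W 0 p))) ! 0 = bit_symbol (y ! (p - T - 2 * length x - 2))"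
          unfolding i_def[symmetric] by (auto simp: bit_symbol_def)
      qed (use Wv con sam ini P p in simp_all)
      then show ?thesis by (simp add: run_def)
    qed
    have Wt: "t \<le> T \<Longrightarrow> p < P \<Longrightarrow> W t p = view (run y t) (int p - int T)" for t p
    proof (induction t arbitrary: p)
      case 0
      then show ?case using W0 by simp
    next
      case (Suc t)
      have pi: "nat (i + int T) < P" "int (nat (i + int T)) - int T = i" if "\<bar>i\<bar> \<le> int T" for i
        using that by (auto simp: P_def)
      have r: "run y (Suc t) = next_config M (run y t)" by (simp add: run_def)
      have "W (Suc t) (nat ((int p - int T) + int T)) = view (next_config M (run y t)) (int p - int T)"
      proof (rule successive_unique[OF M wf, where B = T and W = "\<lambda>i. W (Suc t) (nat (i + int T))"])
        show "int t < int T" using Suc.prems by simp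
        show "\<bar>int p - int T\<bar> \<le> int T" using Suc.prems by (auto simp: P_def)
        fix i assume i: "\<bar>i\<bar> \<le> int T"
        show "W (Suc t) (nat (i + int T)) \<in> views M \<and> consistent (W (Suc t) (nat (i + int T)))"
          using Wv con Suc.prems pi(1)[OF i] by blast
        fix j assume j: "\<bar>j\<bar> \<le> int T"
        show "same_row (W (Suc t) (nat (i + int T))) (W (Suc t) (nat (j + int T)))"
          using sam Suc.prems pi(1)[OF i] pi(1)[OF j] by blast
        have "t + 1 \<le> T" "t \<le> T" using Suc.prems by simp_all
        from suc[OF this(1) pi(1)[OF i] pi(1)[OF j]] Suc.IH[OF this(2) pi(1)[OF i]]
        show "successive M (if \<bar>j - i\<bar> \<le> 1 then j - i else 3) (view (run y t) i) (W (Suc t) (nat (j + int T)))"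
          unfolding decode_displacement[where c = "int T"] pi(2)[OF i] pi(2)[OF j] by simp
      qed
      then show ?case by (simp add: r)
    qed
    have "fst (snd (run y T) ! 0) 0 = 2" using ac Wt[OF le_refl P(2)] v0 by simp
    then have "Vf (pair_word x y)" using acc[OF y] bs by simp
    moreover have "U = \<Phi> y"
    proof (rule PiE_ext[OF U])
      show "\<Phi> y \<in> {..<G} \<rightarrow>\<^sub>E {..<D}" using \<Phi>(1) by (auto simp: \<Phi>_def)
      fix g assume "g \<in> {..<G}"
      then have g: "g < G" by simp
      have "g div P < T + 1" using g unfolding GP by (rule less_mult_imp_div_less)
      then have "W (g div P) (g mod P) = tv y g" using Wt[of "g div P" "g mod P"] P by (simp add: tv_def)
      then have "vals ! U g = vals ! \<Phi> y g" using \<Phi>(2)[OF g] by (simp add: W_def)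
      moreover have "U g < D" using U g by auto
      ultimately show "U g = \<Phi> y g" using \<Phi>(1)[OF g] vals(2) by (simp add: nth_eq_iff_index_eq D_def)
    qed
    ultimately show ?thesis using y by blast
  qed
  ultimately have "bij_betw \<Phi> {y. length y = m \<and> Vf (pair_word x y)}
      {U \<in> {..<G} \<rightarrow>\<^sub>E {..<D}. \<forall>g<G. \<forall>g'<G. compatible M vals x m T g (U g) g' (U g')}"
    unfolding bij_betw_def using into by (intro conjI set_eqI iffI) (auto simp: image_iff)
  then show ?thesis by (rule bij_betw_same_card)
qed

theorem sharp_P_as_constraints:
  assumes "h \<in> sharp_P"
  shows "\<exists>(p :: nat poly) (r :: nat poly) M vals. 2 \<le> length vals \<and> (\<forall>x. h x \<le> 2 ^ poly p (length x) \<and>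
    h x = card {U \<in> {..<(poly r (length x) + 1) * (2 * poly r (length x) + 1)} \<rightarrow>\<^sub>E {..<length vals}.
      \<forall>g<(poly r (length x) + 1) * (2 * poly r (length x) + 1). \<forall>g'<(poly r (length x) + 1) * (2 * poly r (length x) + 1).
        compatible M vals x (poly p (length x)) (poly r (length x)) g (U g) g' (U g')})"
proof -
  from assms obtain p :: "nat poly" and Vf where V: "poly_time (\<lambda>_. None) (\<lambda>z. [Vf z])"
    and h: "\<And>x. h x = card {y. length y = poly p (length x) \<and> Vf (pair_word x y)}"
    unfolding sharp_P_def by blast
  from V obtain M and q :: "nat poly" where M: "wf_machine M"
    and q: "\<And>z. computes_within M (\<lambda>_. None) z [Vf z] (poly q (length z))" unfolding poly_time_def by blast
  obtain vals where vals: "set vals = views M" "distinct vals" using finite_distinct_list[OF finite_views] by blast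
  \<comment> \<open>The time bound of the verifier plus the length of its input, since the window
    has to contain the input as well.\<close>
  define r where "r = pcompose (q + [:0, 1:]) ([:2, 2:] + p)"
  have r: "poly r n = poly q (2 * n + 2 + poly p n) + (2 * n + 2 + poly p n)" for n
  proof -
    have "poly ([:2, 2:] + p) n = 2 * n + 2 + poly p n" by simp
    then show ?thesis unfolding r_def poly_pcompose by (simp add: mult.commute)
  qed
  have le: "h x \<le> 2 ^ poly p (length x)" for x
  proof -
    have f: "{y. length y = poly p (length x)} = {y. set y \<subseteq> (UNIV :: bool set) \<and> length y = poly p (length x)}" by simp
    have "h x \<le> card {y :: bool list. length y = poly p (length x)}"
      unfolding h
    proof (rule card_mono)
      show "finite {y :: bool list. length y = poly p (length x)}" unfolding f by (rule finite_lists_length_eq) simp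
    qed blast
    also have "\<dots> = 2 ^ poly p (length x)" unfolding f by (subst card_lists_length_eq) simp_all
    finally show ?thesis .
  qed
  have "h x = card {U \<in> {..<(poly r (length x) + 1) * (2 * poly r (length x) + 1)} \<rightarrow>\<^sub>E {..<length vals}.
      \<forall>g<(poly r (length x) + 1) * (2 * poly r (length x) + 1). \<forall>g'<(poly r (length x) + 1) * (2 * poly r (length x) + 1).
        compatible M vals x (poly p (length x)) (poly r (length x)) g (U g) g' (U g')}" for x
    unfolding h
  proof (rule run_as_constraints[OF M vals])
    show "2 * length x + 2 + poly p (length x) \<le> poly r (length x)" by (simp add: r)
    fix y :: "bool list" assume "length y = poly p (length x)"
    then have "length (pair_word x y) = 2 * length x + 2 + poly p (length x)" by (simp add: pair_word_def length_delimit)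
    then show "\<exists>t\<le>poly r (length x). computes_within M (\<lambda>_. None) (pair_word x y) [Vf (pair_word x y)] t"
      using q[of "pair_word x y"] by (intro exI[of _ "poly q (length (pair_word x y))"]) (simp add: r)
  qed
  moreover have "2 \<le> length vals" using card_views[OF M] vals distinct_card by metis
  ultimately show ?thesis using le by blast
qed

section \<open>Writing the region in binary\<close>

text \<open>Expressions have no exponentiation. A power of 2 is recognised by the absence of odd
  divisors other than 1, which needs only bounded quantifiers.\<close>

lemma power_of_2_iff: "(\<exists>j. p = 2 ^ j) \<longleftrightarrow> 0 < p \<and> (\<forall>k<p + 1. k < 2 \<or> p mod k \<noteq> 0 \<or> k mod 2 = 0)" for p :: nat
proof
  assume "\<exists>j. p = 2 ^ j"
  then obtain j where j: "p = 2 ^ j" by blast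
  have "k mod 2 = 0" if k: "2 \<le> k" "p mod k = 0" for k
  proof -
    have "k dvd 2 ^ j" using k(2) by (simp add: j mod_eq_0_iff_dvd)
    then obtain i where "k = 2 ^ i" using divides_primepow_nat[OF two_is_prime_nat] by blast
    then show ?thesis using k(1) by (cases i) auto
  qed
  then have K: "k < 2 \<or> p mod k \<noteq> 0 \<or> k mod 2 = 0" for k by (metis not_le)
  have P: "0 < p" using j by simp
  show "0 < p \<and> (\<forall>k<p + 1. k < 2 \<or> p mod k \<noteq> 0 \<or> k mod 2 = 0)" by (intro conjI allI impI, rule P, rule K)
next
  show "0 < p \<and> (\<forall>k<p + 1. k < 2 \<or> p mod k \<noteq> 0 \<or> k mod 2 = 0) \<Longrightarrow> \<exists>j. p = 2 ^ j"
  proof (induction p rule: less_induct)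
    case (less p)
    show ?case
    proof (cases "p = 1")
      case True
      then show ?thesis by (intro exI[of _ 0]) simp
    next
      case False
      \<comment> \<open>\<open>p\<close> is one of its own divisors.\<close>
      then have "p mod 2 = 0" using less.prems by (auto dest!: spec[of _ p])
      then obtain q where q: "p = 2 * q" by (metis mod_eq_0_iff_dvd dvdE)
      have "k < 2 \<or> q mod k \<noteq> 0 \<or> k mod 2 = 0" if "k < q + 1" for k
      proof -
        have "p mod k = 0" if "q mod k = 0" using that by (simp add: q mod_eq_0_iff_dvd)
        moreover have "k < p + 1" using that q by simp
        from less.prems[THEN conjunct2, rule_format, OF this] have "k < 2 \<or> p mod k \<noteq> 0 \<or> k mod 2 = 0" .
        ultimately show ?thesis by metis
      qed
      moreover have "q < p" "0 < q" using q less.prems by auto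
      ultimately obtain j where "q = 2 ^ j" using less.IH[of q] by blast
      then show ?thesis using q by (intro exI[of _ "Suc j"]) simp
    qed
  qed
qed

text \<open>Looping over the numbers up to \<open>k\<close> and keeping the powers of 2 produces the
  digits without mentioning their positions. The loop is affordable because coordinates are
  polynomial in the length of the input.\<close>

lemma binary_as_filter: "binary k = map (\<lambda>p. odd (k div p)) (filter (\<lambda>p. \<exists>j. p = 2 ^ j) [0..<Suc k])"
proof (induction k rule: binary.induct)
  case (1 k)
  let ?P = "\<lambda>p :: nat. \<exists>j. p = 2 ^ j"
  show ?case
  proof (cases "k = 0")
    case True
    then show ?thesis by (simp add: binary.simps)
  next
    case False
    have P2: "?P (2 * p) \<longleftrightarrow> ?P p" for p
    proof
      assume "?P (2 * p)"
      then obtain j where j: "2 * p = 2 ^ j" by blast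
      then show "?P p" by (cases j) auto
    next
      assume "?P p"
      then obtain j where "p = 2 ^ j" by blast
      then show "?P (2 * p)" by (intro exI[of _ "Suc j"]) simp
    qed
    \<comment> \<open>The powers of 2 up to \<open>k\<close> are 1 and the doubles of those up to
      \<open>k div 2\<close>.\<close>
    have "filter ?P [0..<Suc k] = 1 # map ((*) 2) (filter ?P [0..<Suc (k div 2)])"
    proof (rule sorted_distinct_set_unique)
      show "sorted (filter ?P [0..<Suc k])" by (intro sorted_wrt_filter sorted_upt)
      have s: "sorted (filter ?P [0..<Suc (k div 2)])" by (intro sorted_wrt_filter sorted_upt)
      have "sorted (map ((*) 2) (filter ?P [0..<Suc (k div 2)]))" unfolding sorted_map using s by simp
      moreover have "1 \<le> y" if y: "y \<in> set (map ((*) 2) (filter ?P [0..<Suc (k div 2)]))" for y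
      proof -
        obtain x j where "y = 2 * x" "x = 2 ^ j" using y unfolding set_map set_filter by blast
        then show ?thesis by simp
      qed
      ultimately show "sorted (1 # map ((*) 2) (filter ?P [0..<Suc (k div 2)]))" unfolding sorted_simps(2) by blast
      show "distinct (filter ?P [0..<Suc k])" by simp
      show "distinct (1 # map ((*) 2) (filter ?P [0..<Suc (k div 2)]))" by (auto simp: distinct_map inj_on_def)
      show "set (filter ?P [0..<Suc k]) = set (1 # map ((*) 2) (filter ?P [0..<Suc (k div 2)]))"
      proof (intro set_eqI)
        fix p
        have "p \<le> k \<and> ?P p \<longleftrightarrow> p = 1 \<or> (\<exists>q. p = 2 * q \<and> q \<le> k div 2 \<and> ?P q)"
        proof
          assume p: "p \<le> k \<and> ?P p"
          then obtain j where j: "p = 2 ^ j" by blast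
          show "p = 1 \<or> (\<exists>q. p = 2 * q \<and> q \<le> k div 2 \<and> ?P q)"
          proof (cases j)
            case (Suc i)
            then have "p = 2 * 2 ^ i" using j by simp
            then show ?thesis using p by auto
          qed (use j in simp)
        next
          assume "p = 1 \<or> (\<exists>q. p = 2 * q \<and> q \<le> k div 2 \<and> ?P q)"
          then show "p \<le> k \<and> ?P p" using False P2 by (auto intro: exI[of _ 0])
        qed
        then show "p \<in> set (filter ?P [0..<Suc k]) \<longleftrightarrow> p \<in> set (1 # map ((*) 2) (filter ?P [0..<Suc (k div 2)]))"
          by (auto simp: less_Suc_eq_le simp del: upt_Suc)
      qed
    qed
    then have "map (\<lambda>p. odd (k div p)) (filter ?P [0..<Suc k]) =
        odd k # map (\<lambda>p. odd (k div 2 div p)) (filter ?P [0..<Suc (k div 2)])"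
      by (simp add: div_mult2_eq comp_def del: upt_Suc)
    then show ?thesis using "1.IH" False by (subst binary.simps) (simp del: upt_Suc)
  qed
qed

definition Pow2 :: "nat \<Rightarrow> ex" where
  "Pow2 v = Conj (V v) (EAll (v + 1) (Add (V v) (C 1))
     (Disj (Less (V (v + 1)) (C 2)) (Disj (Mod (V v) (V (v + 1))) (ENot (Mod (V (v + 1)) (C 2))))))"

lemma eval_Pow2: "eval w s (Pow2 v) \<noteq> 0 \<longleftrightarrow> (\<exists>j. s v = 2 ^ j)"
proof -
  have "eval w (s(v + 1 := k)) (Disj (Less (V (v + 1)) (C 2)) (Disj (Mod (V v) (V (v + 1))) (ENot (Mod (V (v + 1)) (C 2))))) \<noteq> 0 \<longleftrightarrow>
    k < 2 \<or> s v mod k \<noteq> 0 \<or> k mod 2 = 0" for k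
    by (cases "k < 2") auto
  then show ?thesis unfolding power_of_2_iff Pow2_def eval_Conj eval_EAll by simp
qed

definition Bit_oc :: "nat \<Rightarrow> ex \<Rightarrow> oc" where
  "Bit_oc v e = OSeq (OIf (Mod (Div e (V v)) (C 2)) (OEmit True)) (OIf (ENot (Mod (Div e (V v)) (C 2))) (OEmit False))"

text \<open>The first pair is the sign bit of a nonnegative number and the last is the end mark of
  \<open>delimit\<close>. Besides \<open>v\<close> the variable \<open>v + 1\<close> is occupied, by
  \<open>Pow2\<close>.\<close>

definition Num_oc :: "nat \<Rightarrow> ex \<Rightarrow> oc" where
  "Num_oc v e = OSeq (OEmit False) (OSeq (OEmit False) (OSeq
     (OFor v (Add e (C 1)) (OIf (Pow2 v) (OSeq (Bit_oc v e) (Bit_oc v e)))) (OSeq (OEmit False) (OEmit True))))"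

lemma ow_Num_oc:
  assumes "\<And>k. eval w (s(v := k)) e = eval w s e"
  shows "ow w s (Num_oc v e) = delimit (encode_int (int (eval w s e)))"
proof -
  let ?k = "eval w s e"
  have b: "ow w (s(v := p)) (Bit_oc v e) = [odd (?k div p)]" if "0 < p" for p
    using that assms by (auto simp: Bit_oc_def odd_iff_mod_2_eq_one)
  have "ow w (s(v := p)) (OIf (Pow2 v) (OSeq (Bit_oc v e) (Bit_oc v e))) =
      (if \<exists>j. p = 2 ^ j then [odd (?k div p), odd (?k div p)] else [])" for p
    using eval_Pow2[of w "s(v := p)" v] b[of p] by auto
  then have "ow w s (OFor v (Add e (C 1)) (OIf (Pow2 v) (OSeq (Bit_oc v e) (Bit_oc v e)))) =
      concat (map (\<lambda>p. if \<exists>j. p = 2 ^ j then [odd (?k div p), odd (?k div p)] else []) [0..<Suc ?k])"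
    by (simp del: upt_Suc)
  also have "\<dots> = concat (map (\<lambda>b. [b, b]) (map (\<lambda>p. odd (?k div p)) (filter (\<lambda>p. \<exists>j. p = 2 ^ j) [0..<Suc ?k])))"
  proof -
    have "concat (map (\<lambda>p. if P p then [f p, f p] else []) xs) = concat (map (\<lambda>b. [b, b]) (map f (filter P xs)))"
      for P :: "nat \<Rightarrow> bool" and f :: "nat \<Rightarrow> bool" and xs by (induction xs) auto
    then show ?thesis .
  qed
  finally show ?thesis unfolding binary_as_filter[symmetric]
    by (simp add: Num_oc_def encode_int_def delimit_def)
qed

text \<open>Variables 4 to 8 hold the two block indices, the position in the block and the height; 9
  and 10 are left to \<open>Num_oc\<close>.\<close>

definition Cube_oc :: oc where
  "Cube_oc = OSeq (Num_oc 9 (Add (Mul (C 14) (V 4)) (V 6))) (OSeq (Num_oc 9 (Add (Mul (C 14) (V 5)) (V 7))) (Num_oc 9 (V 8)))"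

lemma ow_Cube_oc: "ow w s Cube_oc = encode_cube (vector [int (14 * s 4 + s 6), int (14 * s 5 + s 7), int (s 8)])"
  unfolding Cube_oc_def ow.simps encode_cube_def by (subst ow_Num_oc, simp)+ simp

text \<open>The shape of the fifteen block types is a \<open>Table\<close>; 1372 is 14 * 14 * 7, the
  number of cells in the box around a block.\<close>

definition Region_oc :: "(nat \<Rightarrow> nat \<Rightarrow> bool) \<Rightarrow> ex \<Rightarrow> ex \<Rightarrow> oc" where
  "Region_oc occ n Ty = OFor 4 n (OFor 5 n (OFor 6 (C 14) (OFor 7 (C 14) (OFor 8 (C 7)
     (OIf (Table occ 15 1372 Ty (Add (Mul (C 7) (Add (Mul (C 14) (V 6)) (V 7))) (V 8))) Cube_oc)))))"

lemma concat_product: "concat (map (\<lambda>x. concat (map (\<lambda>y. f (x, y)) ys)) xs) = concat (map f (List.product xs ys))"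
  by (induction xs) (simp_all add: comp_def)

lemma ow_Region_oc:
  assumes n: "\<And>s. eval w s n = m" and ty: "\<And>s. s 4 < m \<Longrightarrow> s 5 < m \<Longrightarrow> eval w s Ty = ty (s 4) (s 5)"
    and t15: "\<And>I J. I < m \<Longrightarrow> J < m \<Longrightarrow> ty I J < 15"
  shows "ow w s (Region_oc occ n Ty) = encode_region
    (map (\<lambda>(I, J, a, b, z). vector [int (14 * I + a), int (14 * J + b), int z])
      (filter (\<lambda>(I, J, a, b, z). occ (ty I J) (7 * (14 * a + b) + z))
        (List.product [0..<m] (List.product [0..<m] (List.product [0..<14] (List.product [0..<14] [0..<7]))))))"
proof -
  let ?g = "\<lambda>(I, J, a, b, z). vector [int (14 * I + a), int (14 * J + b), int z] :: int ^ 3"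
  let ?P = "\<lambda>(I, J, a, b, z). occ (ty I J) (7 * (14 * a + b) + z)"
  let ?e = "\<lambda>t. if ?P t then encode_cube (?g t) else []"
  have body: "ow w (s(4 := I, 5 := J, 6 := a, 7 := b, 8 := z))
      (OIf (Table occ 15 1372 Ty (Add (Mul (C 7) (Add (Mul (C 14) (V 6)) (V 7))) (V 8))) Cube_oc) = ?e (I, J, a, b, z)"
    if "I < m" "J < m" "a < 14" "b < 14" "z < 7" for I J a b z
  proof -
    have "7 * (14 * a + b) + z < 1372" using that by simp
    then show ?thesis using t15[of I J] that by (simp add: ty ow_Cube_oc)
  qed
  have "ow w s (Region_oc occ n Ty) = concat (map (\<lambda>I. concat (map (\<lambda>J. concat (map (\<lambda>a. concat (map (\<lambda>b. concat (map (\<lambda>z.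
      ?e (I, J, a, b, z)) [0..<7])) [0..<14])) [0..<14])) [0..<m])) [0..<m])"
    unfolding Region_oc_def ow.simps n eval.simps(2)
    by (intro arg_cong[where f = concat] map_cong refl) (rule body[unfolded ow.simps]; simp)
  also have "\<dots> = concat (map ?e (List.product [0..<m] (List.product [0..<m] (List.product [0..<14] (List.product [0..<14] [0..<7])))))"
    unfolding concat_product[symmetric] ..
  also have "\<dots> = concat (map encode_cube (map ?g (filter ?P (List.product [0..<m] (List.product [0..<m] (List.product [0..<14] (List.product [0..<14] [0..<7])))))))"
  proof -
    have "concat (map (\<lambda>t. if P t then f (g t) else []) xs) = concat (map f (map g (filter P xs)))" for P f g xs by (induction xs) auto
    then show ?thesis .
  qed
  finally show ?thesis unfolding encode_region_def .
qed

definition Kind_ex :: "nat \<Rightarrow> ex \<Rightarrow> ex" where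
  "Kind_ex D e = Ite (EEq (Mod e (C D)) (C 0)) (C 0) (Ite (EEq (Mod e (C D)) (C (D - 1))) (C 2) (C 1))"

lemma eval_Kind_ex: "0 < D \<Longrightarrow> eval w s (Kind_ex D e) = kind D (eval w s e)"
  by (simp add: Kind_ex_def kind_def)

text \<open>The existential quantifiers act as a binding: they search for the quotient and remainder
  of I - 1 and J - 1 by \<open>D\<close>, so that \<open>K\<close> finds them in variables 0 to
  3.\<close>

definition Conflict_ex :: "nat \<Rightarrow> ex \<Rightarrow> ex \<Rightarrow> ex" where
  "Conflict_ex D G K = EEx 0 G (EEx 1 (C D) (EEx 2 G (EEx 3 (C D)
     (Conj (EEq (Add (Mul (V 0) (C D)) (V 1)) (Sub (V 4) (C 1)))
     (Conj (EEq (Add (Mul (V 2) (C D)) (V 3)) (Sub (V 5) (C 1)))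
     (Disj (ENot K) (Conj (EEq (V 0) (V 2)) (ENot (EEq (V 1) (V 3))))))))))"

definition Type_ex :: "nat \<Rightarrow> ex \<Rightarrow> ex \<Rightarrow> ex" where
  "Type_ex D G K = (let N = Mul G (C D); I = V 4; J = V 5 in
     Ite (EEq J (C 0)) (Ite (Disj (EEq I (C 0)) (EEq I (Add N (C 1)))) (C 0) (Add (C 6) (Kind_ex D (Sub I (C 1)))))
     (Ite (EEq J (Add N (C 1))) (Ite (Disj (EEq I (C 0)) (EEq I (Add N (C 1)))) (C 0) (Add (C 3) (Kind_ex D (Sub I (C 1)))))
     (Ite (EEq I (C 0)) (Add (C 9) (Kind_ex D (Sub J (C 1))))
     (Ite (EEq I (Add N (C 1))) (Add (C 12) (Kind_ex D (Sub J (C 1))))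
     (Ite (Conflict_ex D G K) (C 2) (C 1))))))"

text \<open>The second disjunct makes the crossings of distinct values of one variable into filters,
  as \<open>card_wirings\<close> demands.\<close>

definition conflict :: "(nat \<Rightarrow> nat \<Rightarrow> nat \<Rightarrow> nat \<Rightarrow> bool) \<Rightarrow> nat \<Rightarrow> nat \<Rightarrow> nat \<Rightarrow> nat \<Rightarrow> bool" where
  "conflict k g v g' v' \<longleftrightarrow> \<not> k g v g' v' \<or> g = g' \<and> v \<noteq> v'"

lemma eval_Conflict_ex:
  assumes G: "\<And>s. eval w s G = m" and D: "0 < D"
    and K: "\<And>s. s 1 < D \<Longrightarrow> s 3 < D \<Longrightarrow> eval w s K = of_bool (k (s 0) (s 1) (s 2) (s 3))"
  shows "eval w s (Conflict_ex D G K) = of_bool (\<exists>g<m. \<exists>v<D. \<exists>g'<m. \<exists>v'<D. g * D + v = s 4 - 1 \<and> g' * D + v' = s 5 - 1 \<and> conflict k g v g' v')"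
proof -
  have "eval w (s(0 := g, 1 := v, 2 := g', 3 := v')) (Conj (EEq (Add (Mul (V 0) (C D)) (V 1)) (Sub (V 4) (C 1)))
     (Conj (EEq (Add (Mul (V 2) (C D)) (V 3)) (Sub (V 5) (C 1)))
     (Disj (ENot K) (Conj (EEq (V 0) (V 2)) (ENot (EEq (V 1) (V 3))))))) \<noteq> 0 \<longleftrightarrow>
    g * D + v = s 4 - 1 \<and> g' * D + v' = s 5 - 1 \<and> conflict k g v g' v'" if "v < D" "v' < D" for g v g' v'
    using K[of "s(0 := g, 1 := v, 2 := g', 3 := v')"] that by (auto simp: conflict_def)
  then show ?thesis unfolding Conflict_ex_def eval_EEx G eval.simps(2) of_bool_eq_0_iff not_not by (intro arg_cong[where f = of_bool]) blast
qed

lemma eval_Type_ex: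
  assumes G: "\<And>s. eval w s G = m" and D: "0 < D"
    and K: "\<And>s. s 1 < D \<Longrightarrow> s 3 < D \<Longrightarrow> eval w s K = of_bool (k (s 0) (s 1) (s 2) (s 3))"
    and s: "s 4 < m * D + 2" "s 5 < m * D + 2"
  shows "eval w s (Type_ex D G K) = block_type (m * D) D (conflict k) (s 4) (s 5)"
proof -
  have "(\<exists>g<m. \<exists>v<D. \<exists>g'<m. \<exists>v'<D. g * D + v = s 4 - 1 \<and> g' * D + v' = s 5 - 1 \<and> conflict k g v g' v') \<longleftrightarrow>
     conflict k ((s 4 - 1) div D) ((s 4 - 1) mod D) ((s 5 - 1) div D) ((s 5 - 1) mod D)" (is "?L \<longleftrightarrow> ?R")
    if "s 4 - 1 < m * D" "s 5 - 1 < m * D"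
  proof
    assume ?L
    then obtain g v g' v' where "v < D" "v' < D" "g * D + v = s 4 - 1" "g' * D + v' = s 5 - 1" "conflict k g v g' v'" by blast
    moreover have "(g * D + v) div D = g" "(g * D + v) mod D = v" "(g' * D + v') div D = g'" "(g' * D + v') mod D = v'"
      using \<open>v < D\<close> \<open>v' < D\<close> by simp_all
    ultimately show ?R by simp
  next
    assume ?R
    moreover have "(s 4 - 1) div D < m" "(s 5 - 1) div D < m" using that less_mult_imp_div_less by blast+
    moreover have "(s 4 - 1) mod D < D" "(s 5 - 1) mod D < D" using D by simp_all
    ultimately show ?L using div_mult_mod_eq[of "s 4 - 1" D] div_mult_mod_eq[of "s 5 - 1" D] by blast
  qed
  moreover have "eval w s (Conflict_ex D G K) = of_bool (\<exists>g<m. \<exists>v<D. \<exists>g'<m. \<exists>v'<D. g * D + v = s 4 - 1 \<and> g' * D + v' = s 5 - 1 \<and> conflict k g v g' v')"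
    by (rule eval_Conflict_ex[OF G D]) (rule K)
  ultimately have cf: "eval w s (Conflict_ex D G K) = of_bool (conflict k ((s 4 - 1) div D) ((s 4 - 1) mod D) ((s 5 - 1) div D) ((s 5 - 1) mod D))"
    if "s 4 - 1 < m * D" "s 5 - 1 < m * D" using that by simp
  show ?thesis
  proof (cases "s 4 = 0 \<or> s 4 = m * D + 1 \<or> s 5 = 0 \<or> s 5 = m * D + 1")
    case True
    then show ?thesis by (auto simp: Type_ex_def Let_def eval_Kind_ex[OF D] G block_type_def)
  next
    case False
    then have "s 4 - 1 < m * D" "s 5 - 1 < m * D" using s by auto
    from cf[OF this] False show ?thesis by (simp add: Type_ex_def Let_def eval_Kind_ex[OF D] G block_type_def)
  qed
qed

section \<open>Tilings as relations on the list of cubes\<close>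

definition coord :: "nat \<Rightarrow> int ^ 3 \<Rightarrow> int" where
  "coord a v = (if a = 0 then v $ 1 else if a = 1 then v $ 2 else v $ 3)"

definition adjacent :: "nat \<Rightarrow> int ^ 3 \<Rightarrow> int ^ 3 \<Rightarrow> bool" where
  "adjacent a u v \<longleftrightarrow> (\<forall>c<3. if c = a then \<bar>coord c u - coord c v\<bar> = 1 else coord c u = coord c v)"

text \<open>The corners of a unit square: \<open>v\<close> and \<open>w\<close> are the neighbours
  of \<open>u\<close> in two different directions, and \<open>t\<close> is opposite.\<close>

definition quad :: "int ^ 3 \<Rightarrow> int ^ 3 \<Rightarrow> int ^ 3 \<Rightarrow> int ^ 3 \<Rightarrow> bool" where
  "quad u v w t \<longleftrightarrow> (\<exists>a<3. \<exists>b<3. a \<noteq> b \<and> adjacent a u v \<and> adjacent b u w \<and> adjacent b v t \<and> adjacent a w t)"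

text \<open>Such a relation is an equivalence whose classes are slabs, formulated for each index
  separately so that bounded quantifiers suffice to check it.\<close>

definition tile_relations :: "(int ^ 3) list \<Rightarrow> (nat \<times> nat) set set" where
  "tile_relations cs = {R. R \<subseteq> {..<length cs} \<times> {..<length cs} \<and> (\<forall>i<length cs.
     \<exists>j<length cs. \<exists>k<length cs. \<exists>l<length cs. quad (cs ! i) (cs ! j) (cs ! k) (cs ! l) \<and>
       R `` {i} = {i, j, k, l} \<and> (\<forall>h\<in>R `` {i}. R `` {h} = R `` {i}))}"

lemma all_less_3: "(\<forall>c<3. P c) \<longleftrightarrow> P 0 \<and> P 1 \<and> P (2 :: nat)"
  by (auto simp: numeral_3_eq_3 less_Suc_eq numeral_2_eq_2)

lemma adjacent_vector:
  "adjacent 0 (vector [x, y, z]) (vector [x', y', z']) \<longleftrightarrow> \<bar>x - x'\<bar> = 1 \<and> y = y' \<and> z = z'"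
  "adjacent (Suc 0) (vector [x, y, z]) (vector [x', y', z']) \<longleftrightarrow> x = x' \<and> \<bar>y - y'\<bar> = 1 \<and> z = z'"
  "adjacent 2 (vector [x, y, z]) (vector [x', y', z']) \<longleftrightarrow> x = x' \<and> y = y' \<and> \<bar>z - z'\<bar> = 1"
  by (simp_all add: adjacent_def all_less_3 coord_def vector_3)

lemma abs_diff_1: "\<bar>x - x'\<bar> = 1 \<longleftrightarrow> x' = x + 1 \<or> x = x' + 1" for x x' :: int
  by auto

lemma unit_parallelogram_is_slab:
  assumes "\<bar>x - x'\<bar> = 1" "\<bar>y - y'\<bar> = 1"
  shows "is_slab {(x, y, z), (x', y, z), (x, y', z), (x', y', z)}"
    "is_slab {(x, z, y), (x', z, y), (x, z, y'), (x', z, y')}"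
    "is_slab {(z, x, y), (z, x', y), (z, x, y'), (z, x', y')}"
proof -
  let ?x = "min x x'" and ?y = "min y y'"
  have 1: "{(x, y, z), (x', y, z), (x, y', z), (x', y', z)} = set (slab_cells 0 (?x, ?y, z))"
    using assms unfolding abs_diff_1 by (elim disjE) (simp_all add: min_def insert_commute)
  have 2: "{(x, z, y), (x', z, y), (x, z, y'), (x', z, y')} = set (slab_cells 1 (?x, z, ?y))"
    using assms unfolding abs_diff_1 by (elim disjE) (simp_all add: min_def insert_commute)
  have 3: "{(z, x, y), (z, x', y), (z, x, y'), (z, x', y')} = set (slab_cells 2 (z, ?x, ?y))"
    using assms unfolding abs_diff_1 by (elim disjE) (simp_all add: min_def insert_commute)
  show "is_slab {(x, y, z), (x', y, z), (x, y', z), (x', y', z)}"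
    "is_slab {(x, z, y), (x', z, y), (x, z, y'), (x', z, y')}"
    "is_slab {(z, x, y), (z, x', y), (z, x, y'), (z, x', y')}" unfolding 1 2 3 is_slab_def by blast+
qed

lemma quad_is_slab: "quad (cube p) (cube q) (cube r) (cube t) \<Longrightarrow> is_slab {p, q, r, t}"
proof -
  have main: "is_slab {p, q, r, t}" if ab: "(a, b) \<in> {(0, 1), (0, 2), (1, 2)}"
    and ad: "adjacent a (cube p) (cube q)" "adjacent b (cube p) (cube r)" "adjacent b (cube q) (cube t)" "adjacent a (cube r) (cube t)"
    for a b p q r t
  proof -
    obtain x y z where p: "p = (x, y, z)" by (metis prod_cases3)
    obtain x' y' z' where q: "q = (x', y', z')" by (metis prod_cases3)
    obtain x2 y2 z2 where r: "r = (x2, y2, z2)" by (metis prod_cases3)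
    obtain x3 y3 z3 where t: "t = (x3, y3, z3)" by (metis prod_cases3)
    consider "a = 0" "b = 1" | "a = 0" "b = 2" | "a = 1" "b = 2" using ab by auto
    then show ?thesis
    proof cases
      case 1
      then show ?thesis using ad unit_parallelogram_is_slab(1)[of x x' y y2 z] unfolding p q r t by (auto simp: adjacent_vector)
    next
      case 2
      then show ?thesis using ad unit_parallelogram_is_slab(2)[of x x' z z2 y] unfolding p q r t by (auto simp: adjacent_vector)
    next
      case 3
      then show ?thesis using ad unit_parallelogram_is_slab(3)[of y y' z z2 x] unfolding p q r t by (auto simp: adjacent_vector)
    qed
  qed
  assume "quad (cube p) (cube q) (cube r) (cube t)"
  then obtain a b where ab: "a < 3" "b < 3" "a \<noteq> b" and
    ad: "adjacent a (cube p) (cube q)" "adjacent b (cube p) (cube r)" "adjacent b (cube q) (cube t)" "adjacent a (cube r) (cube t)"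
    unfolding quad_def by blast
  have "(a, b) \<in> {(0, 1), (0, 2), (1, 2)} \<or> (b, a) \<in> {(0, 1), (0, 2), (1, 2)}" using ab by auto
  then show ?thesis using main[of a b p q r t] main[of b a p r q t] ad by (auto simp: insert_commute)
qed

lemma is_slab_quad:
  assumes "is_slab S" "p \<in> S"
  shows "\<exists>q r t. S = {p, q, r, t} \<and> quad (cube p) (cube q) (cube r) (cube t)"
proof -
  obtain k x y z where S: "S = set (slab_cells k (x, y, z))" using assms(1) unfolding is_slab_def by (metis prod_cases3)
  obtain u v w where p: "p = (u, v, w)" by (metis prod_cases3)
  have quadI: "quad a b c d" if "adjacent i a b" "adjacent j a c" "adjacent j b d" "adjacent i c d" "i < 3" "j < 3" "i \<noteq> j" for a b c d i j
    unfolding quad_def using that by blast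
  consider "k = 0" | "k = 1" | "k \<noteq> 0" "k \<noteq> 1" by blast
  then show ?thesis
  proof cases
    case 1
    \<comment> \<open>This reflection exchanges \<open>x\<close> and \<open>x + 1\<close>, so any
      cell of the slab can serve as first corner.\<close>
    let ?u = "2 * x + 1 - u" and ?v = "2 * y + 1 - v"
    have uv: "u = x \<or> u = x + 1" "v = y \<or> v = y + 1" "w = z" using assms(2) 1 by (auto simp: S p)
    then have "S = {p, (?u, v, w), (u, ?v, w), (?u, ?v, w)}" using 1 by (elim disjE) (auto simp: S p)
    moreover have "quad (cube p) (cube (?u, v, w)) (cube (u, ?v, w)) (cube (?u, ?v, w))"
      by (rule quadI[where i = 0 and j = 1]) (use uv in \<open>auto simp: p adjacent_vector\<close>)
    ultimately show ?thesis by blast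
  next
    case 2
    let ?u = "2 * x + 1 - u" and ?w = "2 * z + 1 - w"
    have uv: "u = x \<or> u = x + 1" "w = z \<or> w = z + 1" "v = y" using assms(2) 2 by (auto simp: S p)
    then have "S = {p, (?u, v, w), (u, v, ?w), (?u, v, ?w)}" using 2 by (elim disjE) (auto simp: S p)
    moreover have "quad (cube p) (cube (?u, v, w)) (cube (u, v, ?w)) (cube (?u, v, ?w))"
      by (rule quadI[where i = 0 and j = 2]) (use uv in \<open>auto simp: p adjacent_vector\<close>)
    ultimately show ?thesis by blast
  next
    case 3
    let ?v = "2 * y + 1 - v" and ?w = "2 * z + 1 - w"
    have uv: "v = y \<or> v = y + 1" "w = z \<or> w = z + 1" "u = x" using assms(2) 3 by (auto simp: S p)
    then have "S = {p, (u, ?v, w), (u, v, ?w), (u, ?v, ?w)}" using 3 by (elim disjE) (auto simp: S p)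
    moreover have "quad (cube p) (cube (u, ?v, w)) (cube (u, v, ?w)) (cube (u, ?v, ?w))"
      by (rule quadI[where i = 1 and j = 2]) (use uv in \<open>auto simp: p adjacent_vector\<close>)
    ultimately show ?thesis by blast
  qed
qed

theorem card_tile_relations:
  assumes cs: "distinct cs"
  shows "card (tile_relations cs) = num_tilings slab (set cs)"
proof -
  define cl where "cl = map (inv cube) cs"
  have ci: "cube (inv cube v) = v" for v by (rule f_inv_into_f) (metis cube_surj rangeI)
  have csl: "cs = map cube cl" by (simp add: cl_def comp_def ci)
  have dl: "distinct cl" using cs unfolding csl by (simp add: distinct_map)
  define L where "L = length cl"
  have Ls: "length cs = L" by (simp add: csl L_def)
  have nth: "cs ! i = cube (cl ! i)" if "i < L" for i using that by (simp add: csl L_def)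
  have eqi: "cl ! i = cl ! j \<longleftrightarrow> i = j" if "i < L" "j < L" for i j using nth_eq_iff_index_eq[OF dl] that by (simp add: L_def)
  have tr: "R \<in> tile_relations cs \<longleftrightarrow> R \<subseteq> {..<L} \<times> {..<L} \<and> (\<forall>i<L. \<exists>j<L. \<exists>k<L. \<exists>l<L.
      quad (cube (cl ! i)) (cube (cl ! j)) (cube (cl ! k)) (cube (cl ! l)) \<and> R `` {i} = {i, j, k, l} \<and> (\<forall>h\<in>R `` {i}. R `` {h} = R `` {i}))" for R
    unfolding tile_relations_def Ls mem_Collect_eq by (simp add: nth cong: conj_cong)
  define f where "f P = {(i, j). i < L \<and> j < L \<and> (\<exists>S\<in>P. cl ! i \<in> S \<and> cl ! j \<in> S)}" for P
  define g where "g R = {(!) cl ` (R `` {i}) |i. i < L}" for R :: "(nat \<times> nat) set"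
  have ind: "\<exists>i<L. p = cl ! i" if "p \<in> set cl" for p using that by (auto simp: in_set_conv_nth L_def)
  have fP: "f P `` {i} = {j. j < L \<and> cl ! j \<in> S}" "(!) cl ` (f P `` {i}) = S"
    if P: "P \<in> tilings is_slab (set cl)" and S: "S \<in> P" "cl ! i \<in> S" "i < L" for P i S
  proof -
    show e: "f P `` {i} = {j. j < L \<and> cl ! j \<in> S}"
    proof (intro set_eqI)
      fix j
      have "cl ! j \<in> S" if "S' \<in> P" "cl ! i \<in> S'" "cl ! j \<in> S'" for S'
      proof -
        have "S' = S"
        proof (rule ccontr)
          assume "S' \<noteq> S"
          then have "S' \<inter> S = {}" using tilingsD(2)[OF P \<open>S' \<in> P\<close> S(1)] by simp
          then show False using S(2) \<open>cl ! i \<in> S'\<close> by blast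
        qed
        then show ?thesis using \<open>cl ! j \<in> S'\<close> by simp
      qed
      then show "j \<in> f P `` {i} \<longleftrightarrow> j \<in> {j. j < L \<and> cl ! j \<in> S}" using S by (auto simp: f_def)
    qed
    have "S \<subseteq> set cl" using tilingsD(1)[OF P] S(1) by blast
    then show "(!) cl ` (f P `` {i}) = S" unfolding e using ind by blast
  qed
  have "bij_betw f (tilings is_slab (set cl)) (tile_relations cs)"
  proof (rule bij_betw_byWitness[where f' = g])
    show "\<forall>P\<in>tilings is_slab (set cl). g (f P) = P"
    proof
      fix P assume P: "P \<in> tilings is_slab (set cl)"
      show "g (f P) = P"
      proof (intro set_eqI iffI)
        fix S assume "S \<in> g (f P)"
        then obtain i where i: "i < L" "S = (!) cl ` (f P `` {i})" by (auto simp: g_def)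
        have "cl ! i \<in> \<Union>P" using tilingsD(1)[OF P] i(1) by (simp add: L_def)
        then obtain T where "T \<in> P" "cl ! i \<in> T" by blast
        then show "S \<in> P" using fP(2)[OF P _ _ i(1)] i(2) by simp
      next
        fix S assume S: "S \<in> P"
        then obtain p where p: "p \<in> S" using tilingsD(3)[OF P] by (metis ex_in_conv)
        then have "p \<in> set cl" using tilingsD(1)[OF P] S by blast
        then obtain i where i: "i < L" "p = cl ! i" using ind by blast
        then have "S = (!) cl ` (f P `` {i})" using fP(2)[OF P S _ i(1)] p by simp
        then show "S \<in> g (f P)" using i(1) by (auto simp: g_def)
      qed
    qed
    have gT: "g R \<in> tilings is_slab (set cl) \<and> f (g R) = R" if R: "R \<in> tile_relations cs" for R
    proof -
      have sub: "R \<subseteq> {..<L} \<times> {..<L}" using R unfolding tr by blast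
      have r: "i \<in> R `` {i}" "is_slab ((!) cl ` (R `` {i}))" "\<And>h. h \<in> R `` {i} \<Longrightarrow> R `` {h} = R `` {i}" if "i < L" for i
      proof -
        have "\<forall>i<L. \<exists>j<L. \<exists>k<L. \<exists>l<L. quad (cube (cl ! i)) (cube (cl ! j)) (cube (cl ! k)) (cube (cl ! l)) \<and>
            R `` {i} = {i, j, k, l} \<and> (\<forall>h\<in>R `` {i}. R `` {h} = R `` {i})" using R unfolding tr by (rule conjunct2)
        from this[rule_format, OF \<open>i < L\<close>] obtain j k l where
          "quad (cube (cl ! i)) (cube (cl ! j)) (cube (cl ! k)) (cube (cl ! l))" "R `` {i} = {i, j, k, l}"
          "\<forall>h\<in>R `` {i}. R `` {h} = R `` {i}" by (elim exE conjE) blast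
        moreover from this have "(!) cl ` (R `` {i}) = {cl ! i, cl ! j, cl ! k, cl ! l}" by simp
        ultimately show "i \<in> R `` {i}" "is_slab ((!) cl ` (R `` {i}))" "\<And>h. h \<in> R `` {i} \<Longrightarrow> R `` {h} = R `` {i}"
          using quad_is_slab by (simp, simp, blast)
      qed
      have lt: "h < L" if "h \<in> R `` {i}" for h i using sub that by auto
      have same: "R `` {i} = R `` {i'}" if ii: "i < L" "i' < L" "p \<in> (!) cl ` (R `` {i})" "p \<in> (!) cl ` (R `` {i'})" for i i' p
      proof -
        obtain h h' where h: "h \<in> R `` {i}" "p = cl ! h" "h' \<in> R `` {i'}" "p = cl ! h'" using ii(3,4) by auto
        have "h = h'" using eqi[OF lt[OF h(1)] lt[OF h(3)]] h by simp
        then show ?thesis using r(3)[OF ii(1) h(1)] r(3)[OF ii(2) h(3)] by simp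
      qed
      have "g R \<in> tilings is_slab (set cl)"
      proof (rule tilingsI)
        show "\<Union>(g R) = set cl"
        proof (intro set_eqI iffI)
          fix p assume "p \<in> \<Union>(g R)"
          then obtain i h where "h \<in> R `` {i}" "p = cl ! h" by (auto simp: g_def)
          then show "p \<in> set cl" using lt by (simp add: L_def)
        next
          fix p assume "p \<in> set cl"
          then obtain i where "i < L" "p = cl ! i" using ind by blast
          then show "p \<in> \<Union>(g R)" using r(1) unfolding g_def by blast
        qed
        show "S \<inter> T = {}" if ST: "S \<in> g R" "T \<in> g R" "S \<noteq> T" for S T
        proof (rule ccontr)
          assume "S \<inter> T \<noteq> {}"
          then obtain p where p: "p \<in> S" "p \<in> T" by blast
          obtain i i' where i: "i < L" "S = (!) cl ` (R `` {i})" "i' < L" "T = (!) cl ` (R `` {i'})" using ST(1,2) by (auto simp: g_def)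
          have "R `` {i} = R `` {i'}" using same[OF i(1,3)] p unfolding i(2,4) by blast
          then show False using ST(3) i(2,4) by simp
        qed
        show "{} \<notin> g R" using r(1) by (auto simp: g_def)
        show "is_slab S" if "S \<in> g R" for S using that r(2) by (auto simp: g_def)
      qed
      moreover have "f (g R) = R"
      proof (intro set_eqI, clarify)
        fix i j
        show "(i, j) \<in> f (g R) \<longleftrightarrow> (i, j) \<in> R"
        proof
          assume "(i, j) \<in> f (g R)"
          then obtain h where h: "i < L" "j < L" "h < L" "cl ! i \<in> (!) cl ` (R `` {h})" "cl ! j \<in> (!) cl ` (R `` {h})"
            by (auto simp: f_def g_def)
          obtain a b where ab: "a \<in> R `` {h}" "cl ! i = cl ! a" "b \<in> R `` {h}" "cl ! j = cl ! b" using h by auto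
          then have "i = a" "j = b" using eqi h lt by blast+
          then show "(i, j) \<in> R" using r(3)[OF h(3)] ab by blast
        next
          assume ij: "(i, j) \<in> R"
          then have l: "i < L" "j < L" using sub by auto
          have "cl ! i \<in> (!) cl ` (R `` {i})" "cl ! j \<in> (!) cl ` (R `` {i})" using r(1)[OF l(1)] ij by auto
          then show "(i, j) \<in> f (g R)" using l unfolding f_def g_def by blast
        qed
      qed
      ultimately show ?thesis ..
    qed
    show "\<forall>R\<in>tile_relations cs. f (g R) = R" "g ` tile_relations cs \<subseteq> tilings is_slab (set cl)" using gT by blast+
    show "f ` tilings is_slab (set cl) \<subseteq> tile_relations cs"
    proof clarify
      fix P assume P: "P \<in> tilings is_slab (set cl)"
      have "\<exists>j<L. \<exists>k<L. \<exists>l<L. quad (cube (cl ! i)) (cube (cl ! j)) (cube (cl ! k)) (cube (cl ! l)) \<and>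
          f P `` {i} = {i, j, k, l} \<and> (\<forall>h\<in>f P `` {i}. f P `` {h} = f P `` {i})" if i: "i < L" for i
      proof -
        have "cl ! i \<in> \<Union>P" using tilingsD(1)[OF P] i by (simp add: L_def)
        then obtain S where S: "S \<in> P" "cl ! i \<in> S" by blast
        obtain q r t where qrt: "S = {cl ! i, q, r, t}" "quad (cube (cl ! i)) (cube q) (cube r) (cube t)"
          using is_slab_quad[OF tilingsD(4)[OF P S(1)] S(2)] by blast
        have "S \<subseteq> set cl" using tilingsD(1)[OF P] S(1) by blast
        then obtain j k l where jkl: "j < L" "q = cl ! j" "k < L" "r = cl ! k" "l < L" "t = cl ! l"
          using ind qrt(1) by (metis insert_subset)
        have "f P `` {i} = {i, j, k, l}" unfolding fP(1)[OF P S i] qrt(1) jkl(2,4,6) using eqi i jkl(1,3,5) by auto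
        moreover have "f P `` {h} = f P `` {i}" if "h \<in> f P `` {i}" for h
        proof -
          have "h < L" "cl ! h \<in> S" using that fP(1)[OF P S i] by auto
          then show ?thesis using fP(1)[OF P S(1)] S(2) i by simp
        qed
        ultimately show ?thesis using qrt(2) jkl by blast
      qed
      then show "f P \<in> tile_relations cs" unfolding tr by (auto simp: f_def)
    qed
  qed
  then have "card (tile_relations cs) = card (tilings is_slab (set cl))" using bij_betw_same_card by metis
  also have "\<dots> = num_tilings slab (cube ` set cl)" by (rule num_tilings_cube[symmetric])
  finally show ?thesis by (simp add: csl)
qed

section \<open>Parsing an encoded region bit by bit\<close>

text \<open>An encoded region is a sequence of delimited integers, called tokens. A pair of unequal
  bits ends a token, so the number of such pairs before pair \<open>q\<close> is the index of its
  token.\<close>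

definition token_count :: "bool list \<Rightarrow> nat \<Rightarrow> nat" where
  "token_count x q = (\<Sum>k<q. of_bool (x ! (2 * k) \<noteq> x ! (2 * k + 1)))"

text \<open>The last sum counts the earlier pairs of the same token and thereby gives the position
  of the bit in it. A position beyond the end behaves like a bit 0.\<close>

definition token_bit :: "bool list \<Rightarrow> nat \<Rightarrow> nat \<Rightarrow> bool" where
  "token_bit x t d \<longleftrightarrow> (\<exists>q. 2 * q + 1 < length x \<and> x ! (2 * q) \<and> x ! (2 * q + 1) \<and> token_count x q = t \<and>
     (\<Sum>k<q. of_bool (token_count x k = t)) = d)"

lemma sum_lessThan_split: "(\<Sum>k<a + b. f k) = (\<Sum>k<a. f k) + (\<Sum>k<b. f (a + k))" for f :: "nat \<Rightarrow> nat"
  by (induction b) simp_all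

text \<open>Behind the first token, positions are shifted by its length plus one pair and token
  indices by one, which is an induction over the tokens.\<close>

lemma token_bit_concat:
  "token_bit (concat (map delimit ts)) t d \<longleftrightarrow> t < length ts \<and> d < length (ts ! t) \<and> ts ! t ! d"
  "token_count (concat (map delimit ts)) (length (concat (map delimit ts)) div 2) = length ts"
  "even (length (concat (map delimit ts)))"
proof -
  have "(\<forall>t d. token_bit (concat (map delimit ts)) t d \<longleftrightarrow> t < length ts \<and> d < length (ts ! t) \<and> ts ! t ! d) \<and>
    token_count (concat (map delimit ts)) (length (concat (map delimit ts)) div 2) = length ts \<and>
    even (length (concat (map delimit ts)))"
  proof (induction ts)
    case Nil
    show ?case by (simp add: token_bit_def token_count_def)
  next
    case (Cons w ts)
    let ?x = "concat (map delimit ts)" let ?X = "delimit w @ ?x"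
    have lo: "?X ! (2 * q) = w ! q" "?X ! (2 * q + 1) = w ! q" if "q < length w" for q
    proof -
      have "2 * q < 2 * length w" "2 * q + 1 < 2 * length w" using that by simp_all
      moreover have "(2 * q) div 2 = q" "(2 * q + 1) div 2 = q" by simp_all
      ultimately show "?X ! (2 * q) = w ! q" "?X ! (2 * q + 1) = w ! q"
        using nth_delimit[of "2 * q" w] nth_delimit[of "2 * q + 1" w] by (simp_all add: nth_append length_delimit)
    qed
    have mid: "?X ! (2 * length w) = False" "?X ! (2 * length w + 1) = True"
      using nth_delimit_end[of w] by (simp_all add: nth_append length_delimit)
    have hi: "?X ! (2 * (Suc (length w) + r)) = ?x ! (2 * r)" "?X ! (2 * (Suc (length w) + r) + 1) = ?x ! (2 * r + 1)" for r
      by (simp_all add: nth_append length_delimit)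
    have c0: "token_count ?X q = 0" if "q \<le> length w" for q
      using that lo unfolding token_count_def by simp
    have c1: "token_count ?X (Suc (length w) + r) = Suc (token_count ?x r)" for r
    proof -
      have "token_count ?X (Suc (length w)) = 1" using c0[of "length w"] mid unfolding token_count_def by simp
      then show ?thesis unfolding token_count_def sum_lessThan_split hi by simp
    qed
    have s0: "(\<Sum>k<q. of_bool (token_count ?X k = t)) = (if t = 0 then q else 0)" if "q \<le> Suc (length w)" for q t
      using that c0 by simp
    have s1: "(\<Sum>k<Suc (length w) + r. of_bool (token_count ?X k = Suc t)) = ((\<Sum>k<r. of_bool (token_count ?x k = t)) :: nat)" for r t
      unfolding sum_lessThan_split c1 using s0[of "Suc (length w)" "Suc t"] by simp
    have "token_bit ?X t d \<longleftrightarrow> t < length (w # ts) \<and> d < length ((w # ts) ! t) \<and> (w # ts) ! t ! d" for t d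
    proof (cases t)
      case 0
      show ?thesis
      proof
        assume "token_bit ?X t d"
        then obtain q where q: "?X ! (2 * q)" "token_count ?X q = 0" "(\<Sum>k<q. of_bool (token_count ?X k = 0)) = d"
          unfolding token_bit_def 0 by blast
        have "q \<le> length w"
        proof (rule ccontr)
          assume "\<not> q \<le> length w"
          then obtain r where "q = Suc (length w) + r" using le_Suc_ex[of "Suc (length w)" q] by auto
          then show False using c1[of r] q(2) by simp
        qed
        moreover have "q \<noteq> length w" using mid(1) q(1) by auto
        ultimately have "q < length w" "d = q" using s0[of q 0] q(3) by simp_all
        then show "t < length (w # ts) \<and> d < length ((w # ts) ! t) \<and> (w # ts) ! t ! d" using lo[of q] q(1) 0 by simp
      next
        assume "t < length (w # ts) \<and> d < length ((w # ts) ! t) \<and> (w # ts) ! t ! d"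
        then have d: "d < length w" "w ! d" using 0 by simp_all
        show "token_bit ?X t d" unfolding token_bit_def 0
          using d lo[of d] c0[of d] s0[of d 0] by (intro exI[of _ d]) (simp add: length_delimit)
      qed
    next
      case (Suc t')
      have "token_bit ?X t d \<longleftrightarrow> token_bit ?x t' d"
      proof
        assume "token_bit ?X t d"
        then obtain q where q: "2 * q + 1 < length ?X" "?X ! (2 * q)" "?X ! (2 * q + 1)" "token_count ?X q = Suc t'"
          "(\<Sum>k<q. of_bool (token_count ?X k = Suc t')) = d" unfolding token_bit_def Suc by blast
        have "\<not> q \<le> length w" using c0[of q] q(4) by auto
        then obtain r where r: "q = Suc (length w) + r" using le_Suc_ex[of "Suc (length w)" q] by auto
        have "2 * r + 1 < length ?x" using q(1) unfolding r by (simp add: length_delimit)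
        then show "token_bit ?x t' d" using q(2-5) unfolding r hi c1 s1 token_bit_def by blast
      next
        assume "token_bit ?x t' d"
        then obtain r where r: "2 * r + 1 < length ?x" "?x ! (2 * r)" "?x ! (2 * r + 1)" "token_count ?x r = t'"
          "(\<Sum>k<r. of_bool (token_count ?x k = t')) = d" unfolding token_bit_def by blast
        have "2 * (Suc (length w) + r) + 1 < length ?X" using r(1) by (simp add: length_delimit)
        moreover have "?X ! (2 * (Suc (length w) + r))" "?X ! (2 * (Suc (length w) + r) + 1)"
          "token_count ?X (Suc (length w) + r) = t" "(\<Sum>k<Suc (length w) + r. of_bool (token_count ?X k = t)) = d"
          unfolding hi c1 Suc s1 using r by simp_all
        ultimately show "token_bit ?X t d" unfolding token_bit_def by blast
      qed
      then show ?thesis using Cons.IH Suc by simp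
    qed
    moreover have "token_count ?X (length ?X div 2) = length (w # ts)"
    proof -
      have "length ?X div 2 = Suc (length w) + length ?x div 2" by (simp add: length_delimit)
      then show ?thesis using c1[of "length ?x div 2"] Cons.IH by simp
    qed
    ultimately show ?case using Cons.IH by (simp add: length_delimit)
  qed
  then show "token_bit (concat (map delimit ts)) t d \<longleftrightarrow> t < length ts \<and> d < length (ts ! t) \<and> ts ! t ! d"
    "token_count (concat (map delimit ts)) (length (concat (map delimit ts)) div 2) = length ts"
    "even (length (concat (map delimit ts)))" by blast+
qed

text \<open>Bit 0 is the sign and bit d + 1 the digit d of the absolute value. Reading 0 beyond the
  end loses nothing, because the top binary digit of a positive number is 1.\<close>

definition int_bit :: "int \<Rightarrow> nat \<Rightarrow> bool" where
  "int_bit v d \<longleftrightarrow> d < length (encode_int v) \<and> encode_int v ! d"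

lemma binary_nth: "d < length (binary k) \<and> binary k ! d \<longleftrightarrow> odd (k div 2 ^ d)"
proof (induction k arbitrary: d rule: binary.induct)
  case (1 k)
  show ?case
  proof (cases "k = 0")
    case True
    then show ?thesis by (simp add: binary.simps)
  next
    case False
    then show ?thesis using "1.IH" by (subst (1 2) binary.simps) (cases d; simp add: div_mult2_eq)
  qed
qed

lemma int_bit_0: "int_bit v 0 \<longleftrightarrow> v < 0"
  by (simp add: int_bit_def encode_int_def)

lemma int_bit_Suc: "int_bit v (Suc d) \<longleftrightarrow> odd (nat \<bar>v\<bar> div 2 ^ d)"
  unfolding binary_nth[symmetric] by (simp add: int_bit_def encode_int_def)

lemma bits_eqI: "(\<And>d. odd (a div 2 ^ d) = odd (b div 2 ^ d)) \<Longrightarrow> a = b" for a b :: nat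
  by (rule bit_eqI) (simp add: bit_iff_odd)

text \<open>\<open>c\<close> is the digit at which the carry stops.\<close>

lemma successor_bits:
  "b = a + 1 \<longleftrightarrow> (\<exists>c. (\<forall>d<c. odd (a div 2 ^ d) \<and> even (b div 2 ^ d)) \<and> even (a div 2 ^ c) \<and> odd (b div 2 ^ c) \<and>
     (\<forall>d>c. odd (a div 2 ^ d) = odd (b div 2 ^ d)))" for a b :: nat
proof
  have "\<exists>c. (\<forall>d<c. odd (a div 2 ^ d) \<and> even ((a + 1) div 2 ^ d)) \<and> even (a div 2 ^ c) \<and> odd ((a + 1) div 2 ^ c) \<and>
     (\<forall>d>c. odd (a div 2 ^ d) = odd ((a + 1) div 2 ^ d))" for a :: nat
  proof (induction a rule: less_induct)
    case (less a)
    show ?case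
    proof (cases "even a")
      case True
      have "(a + 1) div 2 ^ d = a div 2 ^ d" if d: "0 < d" for d
      proof -
        obtain e where "d = Suc e" using d by (cases d) auto
        then show ?thesis using True by (simp add: div_mult2_eq)
      qed
      then show ?thesis using True by (intro exI[of _ 0]) simp
    next
      case False
      then have e: "(a + 1) div 2 = a div 2 + 1" by presburger
      have "a div 2 < a" using False by (cases a) auto
      from less.IH[OF this] obtain c where c: "\<forall>d<c. odd (a div 2 div 2 ^ d) \<and> even ((a div 2 + 1) div 2 ^ d)"
        "even (a div 2 div 2 ^ c)" "odd ((a div 2 + 1) div 2 ^ c)" "\<forall>d>c. odd (a div 2 div 2 ^ d) = odd ((a div 2 + 1) div 2 ^ d)" by blast
      have s: "a div 2 ^ Suc d = a div 2 div 2 ^ d" "(a + 1) div 2 ^ Suc d = (a div 2 + 1) div 2 ^ d" for d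
        using e by (simp_all add: div_mult2_eq)
      show ?thesis
      proof (intro exI[of _ "Suc c"] conjI allI impI)
        fix d assume d: "d < Suc c"
        show "odd (a div 2 ^ d)" "even ((a + 1) div 2 ^ d)" using d c(1) False s by (cases d; simp del: power_Suc)+
      next
        fix d assume d: "Suc c < d"
        then show "odd (a div 2 ^ d) = odd ((a + 1) div 2 ^ d)" using c(4) s by (cases d) (simp_all del: power_Suc)
      qed (use c(2,3) s in \<open>simp_all del: power_Suc\<close>)
    qed
  qed
  then show "b = a + 1 \<Longrightarrow> \<exists>c. (\<forall>d<c. odd (a div 2 ^ d) \<and> even (b div 2 ^ d)) \<and> even (a div 2 ^ c) \<and> odd (b div 2 ^ c) \<and>
     (\<forall>d>c. odd (a div 2 ^ d) = odd (b div 2 ^ d))" by blast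
next
  have "(\<forall>d<c. odd (a div 2 ^ d) \<and> even (b div 2 ^ d)) \<Longrightarrow> even (a div 2 ^ c) \<Longrightarrow> odd (b div 2 ^ c) \<Longrightarrow>
     (\<forall>d>c. odd (a div 2 ^ d) = odd (b div 2 ^ d)) \<Longrightarrow> b = a + 1" for c
  proof (induction c arbitrary: a b)
    case 0
    have "a div 2 = b div 2"
    proof (rule bits_eqI)
      fix d show "odd (a div 2 div 2 ^ d) = odd (b div 2 div 2 ^ d)"
        using "0.prems"(4)[rule_format, of "Suc d"] by (simp add: div_mult2_eq)
    qed
    moreover have "even a" "odd b" using "0.prems" by simp_all
    ultimately show ?case by presburger
  next
    case (Suc c)
    have s: "x div 2 ^ Suc d = x div 2 div 2 ^ d" for x d :: nat by (simp add: div_mult2_eq)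
    have "b div 2 = a div 2 + 1"
    proof (rule Suc.IH)
      show "\<forall>d<c. odd (a div 2 div 2 ^ d) \<and> even (b div 2 div 2 ^ d)" using Suc.prems(1) unfolding s[symmetric] by blast
      show "even (a div 2 div 2 ^ c)" "odd (b div 2 div 2 ^ c)" using Suc.prems(2,3) unfolding s by blast+
      show "\<forall>d>c. odd (a div 2 div 2 ^ d) = odd (b div 2 div 2 ^ d)" using Suc.prems(4) unfolding s[symmetric] by blast
    qed
    moreover have "odd a" "even b" using Suc.prems(1)[rule_format, of 0] by simp_all
    ultimately show ?case by presburger
  qed
  then show "\<exists>c. (\<forall>d<c. odd (a div 2 ^ d) \<and> even (b div 2 ^ d)) \<and> even (a div 2 ^ c) \<and> odd (b div 2 ^ c) \<and>
     (\<forall>d>c. odd (a div 2 ^ d) = odd (b div 2 ^ d)) \<Longrightarrow> b = a + 1" by blast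
qed

definition eq_bits :: "nat \<Rightarrow> (nat \<Rightarrow> bool) \<Rightarrow> (nat \<Rightarrow> bool) \<Rightarrow> bool" where
  "eq_bits n f g \<longleftrightarrow> (\<forall>d<n. f d = g d)"

text \<open>Digits only: the shift by one skips the sign.\<close>

definition succ_bits :: "nat \<Rightarrow> (nat \<Rightarrow> bool) \<Rightarrow> (nat \<Rightarrow> bool) \<Rightarrow> bool" where
  "succ_bits n f g \<longleftrightarrow> (\<exists>c<n. \<forall>d<n. (d < c \<longrightarrow> f (d + 1) \<and> \<not> g (d + 1)) \<and> (d = c \<longrightarrow> \<not> f (d + 1) \<and> g (d + 1)) \<and>
     (c < d \<longrightarrow> f (d + 1) = g (d + 1)))"

definition zero_bits :: "nat \<Rightarrow> (nat \<Rightarrow> bool) \<Rightarrow> bool" where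
  "zero_bits n f \<longleftrightarrow> (\<forall>d<n. \<not> f (d + 1))"

text \<open>Besides absolute values that differ by one, the signs must agree unless one of the
  numbers is 0.\<close>

definition near_bits :: "nat \<Rightarrow> (nat \<Rightarrow> bool) \<Rightarrow> (nat \<Rightarrow> bool) \<Rightarrow> bool" where
  "near_bits n f g \<longleftrightarrow> (succ_bits n f g \<or> succ_bits n g f) \<and> (f 0 = g 0 \<or> zero_bits n f \<or> zero_bits n g)"

lemma int_bits_sound:
  assumes "length (encode_int u) \<le> n" "length (encode_int v) \<le> n"
  shows "eq_bits n (int_bit u) (int_bit v) \<longleftrightarrow> u = v"
    and "near_bits n (int_bit u) (int_bit v) \<longleftrightarrow> \<bar>u - v\<bar> = 1"
proof -
  have off: "\<not> int_bit w d" if "length (encode_int w) \<le> n" "n \<le> d" for w d using that by (simp add: int_bit_def)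
  let ?a = "nat \<bar>u\<bar>" and ?b = "nat \<bar>v\<bar>"
  have zero: "zero_bits n (int_bit w) \<longleftrightarrow> w = 0" if l: "length (encode_int w) \<le> n" for w
  proof
    assume z: "zero_bits n (int_bit w)"
    have "nat \<bar>w\<bar> = 0"
    proof (rule bits_eqI)
      fix d show "odd (nat \<bar>w\<bar> div 2 ^ d) = odd (0 div 2 ^ d :: nat)"
        using z off[OF l, of "Suc d"] unfolding int_bit_Suc[symmetric] zero_bits_def by (cases "d < n") auto
    qed
    then show "w = 0" by simp
  qed (simp add: zero_bits_def int_bit_Suc)
  show "eq_bits n (int_bit u) (int_bit v) \<longleftrightarrow> u = v"
  proof
    assume e: "eq_bits n (int_bit u) (int_bit v)"
    have all: "int_bit u d = int_bit v d" for d using e off[OF assms(1)] off[OF assms(2)] unfolding eq_bits_def by (cases "d < n") auto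
    have "?a = ?b"
      by (rule bits_eqI) (use all int_bit_Suc in blast)
    moreover have "u < 0 \<longleftrightarrow> v < 0" using all[of 0] by (simp add: int_bit_0)
    ultimately show "u = v" by (auto simp: abs_if split: if_splits)
  qed (simp add: eq_bits_def)
  have succ: "succ_bits n (int_bit u) (int_bit v) \<longleftrightarrow> nat \<bar>v\<bar> = nat \<bar>u\<bar> + 1"
    if l: "length (encode_int u) \<le> n" "length (encode_int v) \<le> n" for u v
  proof
    assume "succ_bits n (int_bit u) (int_bit v)"
    then obtain c where c: "c < n" "\<And>d. d < n \<Longrightarrow> (d < c \<longrightarrow> int_bit u (d + 1) \<and> \<not> int_bit v (d + 1)) \<and>
      (d = c \<longrightarrow> \<not> int_bit u (d + 1) \<and> int_bit v (d + 1)) \<and> (c < d \<longrightarrow> int_bit u (d + 1) = int_bit v (d + 1))"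
      unfolding succ_bits_def by blast
    show "nat \<bar>v\<bar> = nat \<bar>u\<bar> + 1" unfolding successor_bits
    proof (intro exI[of _ c] conjI allI impI)
      fix d assume "d < c"
      then show "odd (nat \<bar>u\<bar> div 2 ^ d)" "even (nat \<bar>v\<bar> div 2 ^ d)" using c(2)[of d] c(1) by (simp_all add: int_bit_Suc)
    next
      fix d assume "c < d"
      then show "odd (nat \<bar>u\<bar> div 2 ^ d) = odd (nat \<bar>v\<bar> div 2 ^ d)"
        using c(2)[of d] off[OF l(1), of "Suc d"] off[OF l(2), of "Suc d"] by (cases "d < n") (simp_all add: int_bit_Suc)
    qed (use c(2)[OF c(1)] in \<open>simp_all add: int_bit_Suc\<close>)
  next
    assume "nat \<bar>v\<bar> = nat \<bar>u\<bar> + 1"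
    then obtain c where c: "\<forall>d<c. odd (nat \<bar>u\<bar> div 2 ^ d) \<and> even (nat \<bar>v\<bar> div 2 ^ d)" "even (nat \<bar>u\<bar> div 2 ^ c)"
      "odd (nat \<bar>v\<bar> div 2 ^ c)" "\<forall>d>c. odd (nat \<bar>u\<bar> div 2 ^ d) = odd (nat \<bar>v\<bar> div 2 ^ d)" unfolding successor_bits by blast
    have "c < n" using off[OF l(2), of "Suc c"] c(3) unfolding int_bit_Suc[symmetric] by (cases "c < n") auto
    then show "succ_bits n (int_bit u) (int_bit v)" unfolding succ_bits_def
      using c by (intro exI[of _ c]) (auto simp: int_bit_Suc)
  qed
  show "near_bits n (int_bit u) (int_bit v) \<longleftrightarrow> \<bar>u - v\<bar> = 1"
    unfolding near_bits_def succ[OF assms] succ[OF assms(2,1)] zero[OF assms(1)] zero[OF assms(2)] int_bit_0 by auto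
qed

section \<open>The verifier for tile relations\<close>

text \<open>In \<open>pair_word x y\<close> the bits of \<open>x\<close> are doubled, so the length
  of \<open>x\<close> is the number of equal pairs before the end mark 01.\<close>

definition Size_ex :: ex where
  "Size_ex = Sum 20 Len (EAll 21 (Add (V 20) (C 1))
     (Conj (EEq (In (Mul (C 2) (V 21))) (In (Add (Mul (C 2) (V 21)) (C 1)))) (In (Add (Mul (C 2) (V 21)) (C 1)))))"

text \<open>Pair \<open>k\<close> of \<open>x\<close> consists of the bits 2 k and 2 k + 1, which
  doubling moves to the positions 4 k and 4 k + 2.\<close>

definition Count_ex :: "ex \<Rightarrow> ex" where
  "Count_ex q = Sum 22 q (ENot (EEq (In (Mul (C 4) (V 22))) (In (Add (Mul (C 4) (V 22)) (C 2)))))"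

definition Token_ex :: "ex \<Rightarrow> ex \<Rightarrow> ex" where
  "Token_ex t d = EEx 23 Size_ex (Conj (Less (Add (Mul (C 2) (V 23)) (C 1)) Size_ex)
     (Conj (EEq (In (Mul (C 4) (V 23))) (C 2)) (Conj (EEq (In (Add (Mul (C 4) (V 23)) (C 2))) (C 2))
     (Conj (EEq (Count_ex (V 23)) t) (EEq (Sum 24 (V 23) (EEq (Count_ex (V 24)) t)) d)))))"

text \<open>The certificate starts behind the delimited \<open>x\<close> and is a square matrix
  stored row by row.\<close>

definition Cert_ex :: "ex \<Rightarrow> ex \<Rightarrow> ex" where
  "Cert_ex i j = EEq (In (Add (Add (Mul (C 2) Size_ex) (C 2)) (Add (Mul i Size_ex) j))) (C 2)"

lemma in_sym_pair_word:
  "k < length x \<Longrightarrow> in_sym (pair_word x y) (2 * k) = bit_symbol (x ! k)"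
  "k < length x \<Longrightarrow> in_sym (pair_word x y) (2 * k + 1) = bit_symbol (x ! k)"
  "in_sym (pair_word x y) (2 * length x) = 1" "in_sym (pair_word x y) (2 * length x + 1) = 2"
  "k < length y \<Longrightarrow> in_sym (pair_word x y) (2 * length x + 2 + k) = bit_symbol (y ! k)"
proof -
  let ?z = "pair_word x y"
  have len: "length ?z = 2 * length x + 2 + length y" by (simp add: pair_word_def length_delimit)
  have lo: "?z ! i = delimit x ! i" if "i < 2 * length x + 2" for i using that by (simp add: pair_word_def nth_append length_delimit)
  show "in_sym ?z (2 * k) = bit_symbol (x ! k)" if "k < length x"
    using that len lo[of "2 * k"] nth_delimit[of "2 * k" x] by (simp add: in_sym_def)
  show "in_sym ?z (2 * k + 1) = bit_symbol (x ! k)" if "k < length x"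
    using that len lo[of "2 * k + 1"] nth_delimit[of "2 * k + 1" x] by (simp add: in_sym_def)
  show "in_sym ?z (2 * length x) = 1" "in_sym ?z (2 * length x + 1) = 2"
    using len lo[of "2 * length x"] lo[of "2 * length x + 1"] nth_delimit_end[of x] by (simp_all add: in_sym_def bit_symbol_def)
  show "in_sym ?z (2 * length x + 2 + k) = bit_symbol (y ! k)" if "k < length y"
  proof -
    have "?z ! (2 * length x + 2 + k) = y ! k" unfolding pair_word_def using nth_append_length_plus[of "delimit x" y k] by (simp add: length_delimit)
    then show ?thesis using that len by (simp add: in_sym_def)
  qed
qed

lemma bit_symbol_simps: "bit_symbol b \<noteq> 0" "bit_symbol b = 2 \<longleftrightarrow> b" "bit_symbol b = bit_symbol b' \<longleftrightarrow> b = b'"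
  by (auto simp: bit_symbol_def)

lemma eval_Size_ex: "eval (pair_word x y) s Size_ex = length x"
proof -
  let ?z = "pair_word x y"
  let ?P = "\<lambda>q. in_sym ?z (2 * q) = in_sym ?z (2 * q + 1) \<and> in_sym ?z (2 * q + 1) \<noteq> 0"
  have all: "(\<forall>q<k + 1. ?P q) \<longleftrightarrow> k < length x" for k
  proof
    assume a: "\<forall>q<k + 1. ?P q"
    show "k < length x"
    proof (rule ccontr)
      assume "\<not> k < length x"
      then have "?P (length x)" using a by simp
      then show False unfolding in_sym_pair_word(3,4) by simp
    qed
  next
    assume "k < length x"
    then show "\<forall>q<k + 1. ?P q" using in_sym_pair_word(1,2)[of _ x y] bit_symbol_simps(1) by simp
  qed
  have "eval ?z s Size_ex = (\<Sum>k<length ?z. of_bool (\<forall>q<k + 1. ?P q))" by (simp add: Size_ex_def)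
  also have "\<dots> = card {k. k < length ?z \<and> k < length x}"
    unfolding all by (simp add: Int_def lessThan_def)
  also have "{k. k < length ?z \<and> k < length x} = {..<length x}" by (auto simp: pair_word_def length_delimit)
  finally show ?thesis by simp
qed

lemma eval_Count_ex:
  assumes "2 * eval (pair_word x y) s q \<le> length x"
  shows "eval (pair_word x y) s (Count_ex q) = token_count x (eval (pair_word x y) s q)"
proof -
  let ?z = "pair_word x y"
  have "in_sym ?z (4 * k) = in_sym ?z (4 * k + 2) \<longleftrightarrow> x ! (2 * k) = x ! (2 * k + 1)" if "k < eval ?z s q" for k
  proof -
    have k: "2 * k < length x" "2 * k + 1 < length x" using that assms by linarith+
    have "in_sym ?z (4 * k) = bit_symbol (x ! (2 * k))" using in_sym_pair_word(1)[OF k(1), of y] by simp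
    moreover have "in_sym ?z (4 * k + 2) = bit_symbol (x ! (2 * k + 1))" using in_sym_pair_word(1)[OF k(2), of y] by simp
    ultimately show ?thesis by (simp only: bit_symbol_simps)
  qed
  then show ?thesis unfolding Count_ex_def token_count_def eval.simps(7) by (intro sum.cong) simp_all
qed

text \<open>Variables from 20 on are reserved for the parsing expressions; arguments supplied to
  them use smaller ones.\<close>

definition low :: "ex \<Rightarrow> bool" where
  "low e \<longleftrightarrow> vars e \<subseteq> {..<20}"

lemma eval_low: "low e \<Longrightarrow> 20 \<le> v \<Longrightarrow> eval w (s(v := k)) e = eval w s e"
  by (rule eval_cong) (auto simp: low_def)

lemma eval_Token_ex:
  assumes "low t" "low d"
  shows "eval (pair_word x y) s (Token_ex t d) = of_bool (token_bit x (eval (pair_word x y) s t) (eval (pair_word x y) s d))"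
proof -
  let ?z = "pair_word x y"
  let ?B = "Conj (Less (Add (Mul (C 2) (V 23)) (C 1)) Size_ex)
     (Conj (EEq (In (Mul (C 4) (V 23))) (C 2)) (Conj (EEq (In (Add (Mul (C 4) (V 23)) (C 2))) (C 2))
     (Conj (EEq (Count_ex (V 23)) t) (EEq (Sum 24 (V 23) (EEq (Count_ex (V 24)) t)) d))))"
  have H: "eval ?z (s(23 := q)) ?B \<noteq> 0 \<longleftrightarrow> 2 * q + 1 < length x \<and> x ! (2 * q) \<and> x ! (2 * q + 1) \<and> token_count x q = eval ?z s t \<and>
     (\<Sum>k<q. of_bool (token_count x k = eval ?z s t)) = eval ?z s d" for q
  proof (cases "2 * q + 1 < length x")
    case True
    have e: "4 * q = 2 * (2 * q)" "4 * q + 2 = 2 * (2 * q + 1)" by simp_all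
    have i: "in_sym ?z (4 * q) = bit_symbol (x ! (2 * q))" "in_sym ?z (4 * q + 2) = bit_symbol (x ! (2 * q + 1))"
      unfolding e using True in_sym_pair_word(1)[of "2 * q" x y] in_sym_pair_word(1)[of "2 * q + 1" x y] by simp_all
    have c: "eval ?z (s(23 := q)) (Count_ex (V 23)) = token_count x q"
      using eval_Count_ex[of x y "s(23 := q)" "V 23"] True by simp
    have c2: "eval ?z (s(23 := q, 24 := k)) (Count_ex (V 24)) = token_count x k" if "k < q" for k
      using eval_Count_ex[of x y "s(23 := q, 24 := k)" "V 24"] True that by simp
    have S: "eval ?z (s(23 := q)) (Sum 24 (V 23) (EEq (Count_ex (V 24)) t)) = (\<Sum>k<q. of_bool (token_count x k = eval ?z s t))"
      using c2 assms(1) by (simp add: eval_low)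
    show ?thesis unfolding eval_Conj of_bool_eq_0_iff not_not eval_Less eval_EEq S c eval_Size_ex
      using True i assms by (simp add: eval_low bit_symbol_simps)
  qed (simp add: eval_Size_ex)
  have "q < length x" if "2 * q + 1 < length x" for q using that by simp
  then show ?thesis unfolding Token_ex_def eval_EEx eval_Size_ex token_bit_def H by (intro arg_cong[where f = of_bool]) blast
qed

lemma eval_Cert_ex:
  assumes "length y = length x ^ 2" "eval (pair_word x y) s i < length x" "eval (pair_word x y) s j < length x"
  shows "eval (pair_word x y) s (Cert_ex i j) = of_bool (y ! (eval (pair_word x y) s i * length x + eval (pair_word x y) s j))"
proof -
  let ?i = "eval (pair_word x y) s i" and ?j = "eval (pair_word x y) s j"
  have "Suc ?i * length x \<le> length x * length x" using assms(2) by (intro mult_le_mono1) simp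
  then have "?i * length x + ?j < length y" using assms by (simp add: power2_eq_square)
  from in_sym_pair_word(5)[OF this, of x] show ?thesis by (simp add: Cert_ex_def eval_Size_ex bit_symbol_simps)
qed

text \<open>Cube \<open>i\<close> owns the tokens 3 i, 3 i + 1 and 3 i + 2; variable 8 holds the
  coordinate.\<close>

definition Tok :: "nat \<Rightarrow> ex \<Rightarrow> ex" where
  "Tok i d = Token_ex (Add (Mul (C 3) (V i)) (V 8)) d"

definition Eq_ex :: "nat \<Rightarrow> nat \<Rightarrow> ex" where
  "Eq_ex i j = EAll 9 Size_ex (EEq (Tok i (V 9)) (Tok j (V 9)))"

definition Succ_ex :: "nat \<Rightarrow> nat \<Rightarrow> ex" where
  "Succ_ex i j = (let f = Tok i (Add (V 9) (C 1)); g = Tok j (Add (V 9) (C 1)) in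
     EEx 10 Size_ex (EAll 9 Size_ex (Conj (Disj (Leq (V 10) (V 9)) (Conj f (ENot g)))
       (Conj (Disj (ENot (EEq (V 9) (V 10))) (Conj (ENot f) g)) (Disj (Leq (V 9) (V 10)) (EEq f g))))))"

definition Zero_ex :: "nat \<Rightarrow> ex" where
  "Zero_ex i = EAll 9 Size_ex (ENot (Tok i (Add (V 9) (C 1))))"

definition Near_ex :: "nat \<Rightarrow> nat \<Rightarrow> ex" where
  "Near_ex i j = Conj (Disj (Succ_ex i j) (Succ_ex j i))
     (Disj (EEq (Tok i (C 0)) (Tok j (C 0))) (Disj (Zero_ex i) (Zero_ex j)))"

definition Adj_ex :: "nat \<Rightarrow> nat \<Rightarrow> nat \<Rightarrow> ex" where
  "Adj_ex a i j = EAll 8 (C 3) (Ite (EEq (V 8) (V a)) (Near_ex i j) (Eq_ex i j))"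

definition Quad_ex :: ex where
  "Quad_ex = EEx 6 (C 3) (EEx 7 (C 3) (Conj (ENot (EEq (V 6) (V 7)))
     (Conj (Adj_ex 6 0 1) (Conj (Adj_ex 7 0 2) (Conj (Adj_ex 7 1 3) (Adj_ex 6 2 3))))))"

text \<open>Counting up to half of the length gives the number of all tokens; an index is valid if
  the third token of its cube exists.\<close>

definition Valid_ex :: "nat \<Rightarrow> ex" where
  "Valid_ex i = Less (Add (Mul (C 3) (V i)) (C 2)) (Count_ex (Div Size_ex (C 2)))"

text \<open>The certificate matrix is larger than the list of cubes. The first conjunct makes all
  entries outside vanish, so that each relation has exactly one certificate.\<close>

definition Verify_ex :: ex where
  "Verify_ex = Conj
    (EAll 0 Size_ex (EAll 1 Size_ex (Disj (ENot (Cert_ex (V 0) (V 1))) (Conj (Valid_ex 0) (Valid_ex 1)))))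
    (EAll 0 Size_ex (Disj (ENot (Valid_ex 0)) (EEx 1 Size_ex (EEx 2 Size_ex (EEx 3 Size_ex
      (Conj (Conj (Valid_ex 1) (Conj (Valid_ex 2) (Valid_ex 3))) (Conj Quad_ex
      (Conj (EAll 4 Size_ex (EEq (Cert_ex (V 0) (V 4)) (Disj (EEq (V 4) (V 0)) (Disj (EEq (V 4) (V 1)) (Disj (EEq (V 4) (V 2)) (EEq (V 4) (V 3)))))))
        (EAll 4 Size_ex (Disj (ENot (Cert_ex (V 0) (V 4))) (EAll 5 Size_ex (EEq (Cert_ex (V 4) (V 5)) (Cert_ex (V 0) (V 5)))))))))))))) "

lemma eval_Tok:
  assumes "low d" "i < 20"
  shows "eval (pair_word x y) s (Tok i d) = of_bool (token_bit x (3 * s i + s 8) (eval (pair_word x y) s d))"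
proof -
  have "low (Add (Mul (C 3) (V i)) (V 8))" using assms by (simp add: low_def Mul_def)
  from eval_Token_ex[OF this assms(1)] show ?thesis unfolding Tok_def by simp
qed

lemma low_simps: "low (V 9)" "low (Add (V 9) (C 1))" "low (C 0)"
  by (simp_all add: low_def)

lemma of_bool_eq_of_bool: "of_bool p = (of_bool q :: nat) \<longleftrightarrow> p = q"
  by (cases p; cases q) simp_all

lemma eval_Adj_ex:
  assumes i: "i < 4" "j < 4" and a: "a \<in> {6, 7}"
  shows "eval (pair_word x y) s (Adj_ex a i j) = of_bool (\<forall>c<3. if c = s a
     then near_bits (length x) (token_bit x (3 * s i + c)) (token_bit x (3 * s j + c))
     else eq_bits (length x) (token_bit x (3 * s i + c)) (token_bit x (3 * s j + c)))"
proof -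
  let ?z = "pair_word x y"
  have ne: "i \<noteq> 8" "i \<noteq> 9" "i \<noteq> 10" "j \<noteq> 8" "j \<noteq> 9" "j \<noteq> 10" "i < 20" "j < 20" "a \<noteq> 8" using i a by auto
  note tok = eval_Tok[OF low_simps(1)] eval_Tok[OF low_simps(2)] eval_Tok[OF low_simps(2), unfolded One_nat_def] eval_Tok[OF low_simps(3)]
  have eq: "eval ?z s' (Eq_ex i j) \<noteq> 0 \<longleftrightarrow> eq_bits (length x) (token_bit x (3 * s' i + s' 8)) (token_bit x (3 * s' j + s' 8))"
    if "i \<noteq> 9" "j \<noteq> 9" "i < 20" "j < 20" for s' i j
    using that by (simp add: Eq_ex_def eval_Size_ex tok eq_bits_def of_bool_eq_of_bool)
  have su: "eval ?z s' (Succ_ex i j) \<noteq> 0 \<longleftrightarrow> succ_bits (length x) (token_bit x (3 * s' i + s' 8)) (token_bit x (3 * s' j + s' 8))"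
    if "i \<noteq> 9" "j \<noteq> 9" "i \<noteq> 10" "j \<noteq> 10" "i < 20" "j < 20" for s' i j
  proof -
    have b: "(c \<le> d \<or> f \<and> \<not> g) \<and> (d \<noteq> c \<or> \<not> f \<and> g) \<and> (d \<le> c \<or> f = g) \<longleftrightarrow>
      (d < c \<longrightarrow> f \<and> \<not> g) \<and> (d = c \<longrightarrow> \<not> f \<and> g) \<and> (c < d \<longrightarrow> f = g)" for c d :: nat and f g by auto
    show ?thesis unfolding succ_bits_def b[symmetric] using that by (simp add: Succ_ex_def Let_def eval_Size_ex tok of_bool_eq_of_bool)
  qed
  have ze: "eval ?z s' (Zero_ex i) \<noteq> 0 \<longleftrightarrow> zero_bits (length x) (token_bit x (3 * s' i + s' 8))"
    if "i \<noteq> 9" "i < 20" for s' i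
    using that by (simp add: Zero_ex_def eval_Size_ex tok zero_bits_def)
  have nr: "eval ?z s' (Near_ex i j) \<noteq> 0 \<longleftrightarrow> near_bits (length x) (token_bit x (3 * s' i + s' 8)) (token_bit x (3 * s' j + s' 8))" for s'
    unfolding Near_ex_def near_bits_def eval_Conj eval_Disj of_bool_eq_0_iff not_not eval_EEq
    using ne su[of i j s'] su[of j i s'] ze[of i s'] ze[of j s'] tok by (simp add: of_bool_eq_of_bool)
  have "eval ?z (s(8 := c)) (Ite (EEq (V 8) (V a)) (Near_ex i j) (Eq_ex i j)) \<noteq> 0 \<longleftrightarrow> (if c = s a
     then near_bits (length x) (token_bit x (3 * s i + c)) (token_bit x (3 * s j + c))
     else eq_bits (length x) (token_bit x (3 * s i + c)) (token_bit x (3 * s j + c)))" for c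
  proof -
    have "eval ?z (s(8 := c)) (EEq (V 8) (V a)) = of_bool (c = s a)" using ne by simp
    then show ?thesis unfolding eval_Ite
      using nr[of "s(8 := c)"] eq[of i j "s(8 := c)"] ne by (cases "c = s a") simp_all
  qed
  then show ?thesis unfolding Adj_ex_def eval_EAll eval.simps(2) by simp
qed

lemma region_tokens:
  "encode_region cs = concat (map delimit (concat (map (\<lambda>c. [encode_int (c $ 1), encode_int (c $ 2), encode_int (c $ 3)]) cs)))"
  by (induction cs) (simp_all add: encode_region_def encode_cube_def)

lemma nth_region_tokens:
  "i < length cs \<Longrightarrow> a < 3 \<Longrightarrow>
    concat (map (\<lambda>c. [encode_int (c $ 1), encode_int (c $ 2), encode_int (c $ 3)]) cs) ! (3 * i + a) = encode_int (coord a (cs ! i))"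
proof (induction cs arbitrary: i)
  case (Cons c cs)
  have "a = 0 \<or> a = 1 \<or> a = 2" using Cons.prems by auto
  then show ?case using Cons by (cases i) (auto simp: coord_def)
qed simp

lemma length_region_tokens:
  "length (concat (map (\<lambda>c :: int ^ 3. [encode_int (c $ 1), encode_int (c $ 2), encode_int (c $ 3)]) cs)) = 3 * length cs"
  by (induction cs) simp_all

lemma length_concat_ge: "w \<in> set ts \<Longrightarrow> length w \<le> length (concat (map delimit ts))"
  by (induction ts) (auto simp: length_delimit)

lemma length_concat_ge_length: "length ts \<le> length (concat (map delimit ts))"
  by (induction ts) (auto simp: length_delimit)

lemma relation_bijection:
  "bij_betw (\<lambda>y. {(i, j). i < n \<and> j < n \<and> y ! (i * n + j)}) {y :: bool list. length y = n ^ 2} (Pow ({..<n} \<times> {..<n}))"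
proof (rule bij_betw_byWitness[where f' = "\<lambda>R. map (\<lambda>k. (k div n, k mod n) \<in> R) [0..<n ^ 2]"])
  have ij: "i * n + j < n ^ 2" "(i * n + j) div n = i" "(i * n + j) mod n = j" if "i < n" "j < n" for i j
  proof -
    have "Suc i * n \<le> n * n" using that by (intro mult_le_mono1) simp
    then show "i * n + j < n ^ 2" using that by (simp add: power2_eq_square)
  qed (use that in simp_all)
  show "\<forall>y\<in>{y :: bool list. length y = n ^ 2}.
      map (\<lambda>k. (k div n, k mod n) \<in> {(i, j). i < n \<and> j < n \<and> y ! (i * n + j)}) [0..<n ^ 2] = y"
  proof
    fix y :: "bool list" assume "y \<in> {y. length y = n ^ 2}"
    then have l: "length y = n ^ 2" by simp
    have "k div n < n \<and> k mod n < n \<and> y ! (k div n * n + k mod n) \<longleftrightarrow> y ! k" if "k < n ^ 2" for k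
    proof -
      have "k div n < n" using that by (simp add: power2_eq_square less_mult_imp_div_less)
      moreover have "0 < n" using calculation by simp
      ultimately show ?thesis by simp
    qed
    then show "map (\<lambda>k. (k div n, k mod n) \<in> {(i, j). i < n \<and> j < n \<and> y ! (i * n + j)}) [0..<n ^ 2] = y"
      using l by (intro nth_equalityI) simp_all
  qed
  show "\<forall>R\<in>Pow ({..<n} \<times> {..<n}). {(i, j). i < n \<and> j < n \<and> map (\<lambda>k. (k div n, k mod n) \<in> R) [0..<n ^ 2] ! (i * n + j)} = R"
    using ij by auto
qed auto

text \<open>The length of the certificate has to be a polynomial in the length of the word alone,
  which does not reveal the number of cubes; therefore the matrix has as many rows and columns as
  the word has letters.\<close>

theorem certificates_in_sharp_P:
  "\<exists>f\<in>sharp_P. \<forall>cs. f (encode_region cs) = card (tile_relations cs)"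
proof -
  define Vf where "Vf z = (eval z (\<lambda>_. 0) Verify_ex \<noteq> 0)" for z
  define f where "f x = card {y. length y = poly (monom 1 2 :: nat poly) (length x) \<and> Vf (pair_word x y)}" for x
  have pt: "poly_time (\<lambda>_. None) (\<lambda>z. [Vf z])" unfolding Vf_def by (rule poly_time_eval)
  have "f \<in> sharp_P" unfolding sharp_P_def
    by (rule CollectI, rule exI[of _ "monom 1 2"], rule exI[of _ Vf]) (simp add: pt f_def)
  moreover have "f (encode_region cs) = card (tile_relations cs)" for cs
  proof -
    define x where "x = encode_region cs"
    define n where "n = length x"
    define L where "L = length cs"
    let ?ts = "concat (map (\<lambda>c. [encode_int (c $ 1), encode_int (c $ 2), encode_int (c $ 3)]) cs)"
    have x: "x = concat (map delimit ?ts)" unfolding x_def by (rule region_tokens)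
    have lts: "length ?ts = 3 * L" unfolding L_def by (rule length_region_tokens)
    have Ln: "L \<le> n" using length_concat_ge_length[of ?ts] lts unfolding n_def x by linarith
    have cnt: "token_count x (n div 2) = 3 * L" unfolding n_def x token_bit_concat(2) lts ..
    have tb: "token_bit x (3 * i + c) = int_bit (coord c (cs ! i))" if "i < L" "c < 3" for i c
    proof
      fix d
      have "3 * i + c < length ?ts" using that lts by simp
      then show "token_bit x (3 * i + c) d = int_bit (coord c (cs ! i)) d"
        using nth_region_tokens[of i cs c] that unfolding x token_bit_concat(1) int_bit_def L_def by simp
    qed
    have le: "length (encode_int (coord c (cs ! i))) \<le> n" if "i < L" "c < 3" for i c
    proof -
      have "3 * i + c < length ?ts" using that lts by simp
      then have m: "?ts ! (3 * i + c) \<in> set ?ts" by (rule nth_mem)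
      have eq: "?ts ! (3 * i + c) = encode_int (coord c (cs ! i))" by (rule nth_region_tokens) (use that in \<open>simp_all add: L_def\<close>)
      have "encode_int (coord c (cs ! i)) \<in> set ?ts" using m unfolding eq .
      then show ?thesis unfolding n_def x by (rule length_concat_ge)
    qed
    have ver: "Vf (pair_word x y) \<longleftrightarrow> {(i, j). i < n \<and> j < n \<and> y ! (i * n + j)} \<in> tile_relations cs" if y: "length y = n ^ 2" for y
    proof -
      let ?z = "pair_word x y"
      define R where "R = {(i, j). i < n \<and> j < n \<and> y ! (i * n + j)}"
      have sz: "eval ?z s Size_ex = n" for s unfolding n_def by (rule eval_Size_ex)
      have va: "eval ?z s (Valid_ex i) \<noteq> 0 \<longleftrightarrow> s i < L" for s i
      proof -
        have "eval ?z s (Div Size_ex (C 2)) = n div 2" by (simp add: sz)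
        moreover have "2 * (n div 2) \<le> length x" by (simp add: n_def)
        ultimately have "eval ?z s (Count_ex (Div Size_ex (C 2))) = 3 * L" using eval_Count_ex[of x y s "Div Size_ex (C 2)"] cnt by simp
        then show ?thesis by (auto simp: Valid_ex_def)
      qed
      have ce: "eval ?z s (Cert_ex (V i) (V j)) = of_bool ((s i, s j) \<in> R)" if "s i < n" "s j < n" for s i j
        using eval_Cert_ex[of y x s "V i" "V j"] y that by (simp add: R_def n_def)
      have ad: "eval ?z s (Adj_ex a i j) \<noteq> 0 \<longleftrightarrow> adjacent (s a) (cs ! s i) (cs ! s j)"
        if "i < 4" "j < 4" "a \<in> {6, 7}" "s i < L" "s j < L" for s a i j
        unfolding eval_Adj_ex[OF that(1-3)] adjacent_def of_bool_eq_0_iff not_not n_def[symmetric]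
        using tb that(4,5) int_bits_sound[OF le le] by (intro all_cong) simp
      have qu: "eval ?z s Quad_ex \<noteq> 0 \<longleftrightarrow> quad (cs ! s 0) (cs ! s 1) (cs ! s 2) (cs ! s 3)"
        if "s 0 < L" "s 1 < L" "s 2 < L" "s 3 < L" for s
      proof -
        have "eval ?z (s(6 := a, 7 := b)) (Adj_ex 6 0 1) \<noteq> 0 \<longleftrightarrow> adjacent a (cs ! s 0) (cs ! s 1)"
          "eval ?z (s(6 := a, 7 := b)) (Adj_ex 7 0 2) \<noteq> 0 \<longleftrightarrow> adjacent b (cs ! s 0) (cs ! s 2)"
          "eval ?z (s(6 := a, 7 := b)) (Adj_ex 7 1 3) \<noteq> 0 \<longleftrightarrow> adjacent b (cs ! s 1) (cs ! s 3)"
          "eval ?z (s(6 := a, 7 := b)) (Adj_ex 6 2 3) \<noteq> 0 \<longleftrightarrow> adjacent a (cs ! s 2) (cs ! s 3)" for a b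
          using ad[of 0 1 6 "s(6 := a, 7 := b)"] ad[of 0 2 7 "s(6 := a, 7 := b)"] ad[of 1 3 7 "s(6 := a, 7 := b)"]
            ad[of 2 3 6 "s(6 := a, 7 := b)"] that by simp_all
        note adj = this
        have ne: "eval ?z (s(6 := a, 7 := b)) (ENot (EEq (V 6) (V 7))) \<noteq> 0 \<longleftrightarrow> a \<noteq> b" for a b by simp
        show ?thesis unfolding Quad_ex_def quad_def eval_EEx eval_Conj of_bool_eq_0_iff not_not eval.simps(2) adj ne by (rule refl)
      qed
      define A where "A \<longleftrightarrow> (\<forall>i<n. \<forall>j<n. (i, j) \<in> R \<longrightarrow> i < L \<and> j < L)"
      define B where "B i j k l \<longleftrightarrow> (\<forall>h<n. ((i, h) \<in> R) = (h = i \<or> h = j \<or> h = k \<or> h = l)) \<and>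
        (\<forall>h<n. (i, h) \<in> R \<longrightarrow> (\<forall>h'<n. ((h, h') \<in> R) = ((i, h') \<in> R)))" for i j k l
      have p1: "eval ?z s (EAll 0 Size_ex (EAll 1 Size_ex (Disj (ENot (Cert_ex (V 0) (V 1))) (Conj (Valid_ex 0) (Valid_ex 1))))) \<noteq> 0 \<longleftrightarrow> A" for s
        unfolding eval_EAll sz of_bool_eq_0_iff not_not eval_Disj eval_ENot eval_Conj va A_def
        using ce[of "s(0 := _, 1 := _)" 0 1] by simp
      have p2: "eval ?z s (Conj (EAll 4 Size_ex (EEq (Cert_ex (V 0) (V 4)) (Disj (EEq (V 4) (V 0)) (Disj (EEq (V 4) (V 1)) (Disj (EEq (V 4) (V 2)) (EEq (V 4) (V 3)))))))
        (EAll 4 Size_ex (Disj (ENot (Cert_ex (V 0) (V 4))) (EAll 5 Size_ex (EEq (Cert_ex (V 4) (V 5)) (Cert_ex (V 0) (V 5))))))) \<noteq> 0 \<longleftrightarrow>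
        B (s 0) (s 1) (s 2) (s 3)" if "s 0 < n" for s
      proof -
        have a: "eval ?z (s(4 := h)) (EEq (Cert_ex (V 0) (V 4)) (Disj (EEq (V 4) (V 0)) (Disj (EEq (V 4) (V 1)) (Disj (EEq (V 4) (V 2)) (EEq (V 4) (V 3)))))) \<noteq> 0 \<longleftrightarrow>
          ((s 0, h) \<in> R) = (h = s 0 \<or> h = s 1 \<or> h = s 2 \<or> h = s 3)" if "h < n" for h
          using ce[of "s(4 := h)" 0 4] that \<open>s 0 < n\<close> by (simp add: of_bool_eq_of_bool)
        have b: "eval ?z (s(4 := h, 5 := h')) (EEq (Cert_ex (V 4) (V 5)) (Cert_ex (V 0) (V 5))) \<noteq> 0 \<longleftrightarrow> ((h, h') \<in> R) = ((s 0, h') \<in> R)"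
          if "h < n" "h' < n" for h h'
          using ce[of "s(4 := h, 5 := h')" 4 5] ce[of "s(4 := h, 5 := h')" 0 5] that \<open>s 0 < n\<close> by (simp add: of_bool_eq_of_bool)
        have c: "eval ?z (s(4 := h)) (Cert_ex (V 0) (V 4)) = of_bool ((s 0, h) \<in> R)" if "h < n" for h
          using ce[of "s(4 := h)" 0 4] that \<open>s 0 < n\<close> by simp
        show ?thesis unfolding B_def eval_Conj eval_EAll sz of_bool_eq_0_iff not_not eval_Disj eval_ENot using a b c by auto
      qed
      have p3: "eval ?z (s(0 := i)) (Disj (ENot (Valid_ex 0)) (EEx 1 Size_ex (EEx 2 Size_ex (EEx 3 Size_ex
      (Conj (Conj (Valid_ex 1) (Conj (Valid_ex 2) (Valid_ex 3))) (Conj Quad_ex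
      (Conj (EAll 4 Size_ex (EEq (Cert_ex (V 0) (V 4)) (Disj (EEq (V 4) (V 0)) (Disj (EEq (V 4) (V 1)) (Disj (EEq (V 4) (V 2)) (EEq (V 4) (V 3)))))))
        (EAll 4 Size_ex (Disj (ENot (Cert_ex (V 0) (V 4))) (EAll 5 Size_ex (EEq (Cert_ex (V 4) (V 5)) (Cert_ex (V 0) (V 5)))))))))))))  \<noteq> 0 \<longleftrightarrow>
        (i < L \<longrightarrow> (\<exists>j<n. \<exists>k<n. \<exists>l<n. (j < L \<and> k < L \<and> l < L) \<and> quad (cs ! i) (cs ! j) (cs ! k) (cs ! l) \<and> B i j k l))" if "i < n" for s i
      proof -
        have d: "eval ?z (s(0 := i)) (Disj (ENot (Valid_ex 0)) E) \<noteq> 0 \<longleftrightarrow> (i < L \<longrightarrow> eval ?z (s(0 := i)) E \<noteq> 0)" for E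
          using va[of "s(0 := i)" 0] by auto
        have H: "eval ?z (s(0 := i, 1 := j, 2 := k, 3 := l)) (Conj (Conj (Valid_ex 1) (Conj (Valid_ex 2) (Valid_ex 3))) (Conj Quad_ex
          (Conj (EAll 4 Size_ex (EEq (Cert_ex (V 0) (V 4)) (Disj (EEq (V 4) (V 0)) (Disj (EEq (V 4) (V 1)) (Disj (EEq (V 4) (V 2)) (EEq (V 4) (V 3)))))))
          (EAll 4 Size_ex (Disj (ENot (Cert_ex (V 0) (V 4))) (EAll 5 Size_ex (EEq (Cert_ex (V 4) (V 5)) (Cert_ex (V 0) (V 5))))))))) \<noteq> 0 \<longleftrightarrow>
          (j < L \<and> k < L \<and> l < L) \<and> quad (cs ! i) (cs ! j) (cs ! k) (cs ! l) \<and> B i j k l" if iL: "i < L" for j k l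
        proof -
          let ?s = "s(0 := i, 1 := j, 2 := k, 3 := l)"
          have sv: "?s 0 = i" "?s 1 = j" "?s 2 = k" "?s 3 = l" by simp_all
          note P2 = p2[of ?s, unfolded sv, OF \<open>i < n\<close>]
          note v = va[of ?s 1, unfolded sv] va[of ?s 2, unfolded sv] va[of ?s 3, unfolded sv]
          have q: "eval ?z ?s Quad_ex \<noteq> 0 \<longleftrightarrow> quad (cs ! i) (cs ! j) (cs ! k) (cs ! l)" if "j < L" "k < L" "l < L"
            using qu[of ?s, unfolded sv, OF iL that] .
          show ?thesis
            unfolding eval_Conj[of _ _ "Conj (Valid_ex 1) (Conj (Valid_ex 2) (Valid_ex 3))"] eval_Conj[of _ _ "Valid_ex 1"]
              eval_Conj[of _ _ "Valid_ex 2"] eval_Conj[of _ _ Quad_ex] of_bool_eq_0_iff not_not P2 v using q by blast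
        qed
        show ?thesis unfolding d eval_EEx sz of_bool_eq_0_iff not_not
        proof (cases "i < L")
          case True
          show "(i < L \<longrightarrow> (\<exists>j<n. \<exists>k<n. \<exists>l<n. eval ?z (s(0 := i, 1 := j, 2 := k, 3 := l)) (Conj (Conj (Valid_ex 1) (Conj (Valid_ex 2) (Valid_ex 3))) (Conj Quad_ex
            (Conj (EAll 4 Size_ex (EEq (Cert_ex (V 0) (V 4)) (Disj (EEq (V 4) (V 0)) (Disj (EEq (V 4) (V 1)) (Disj (EEq (V 4) (V 2)) (EEq (V 4) (V 3)))))))
          (EAll 4 Size_ex (Disj (ENot (Cert_ex (V 0) (V 4))) (EAll 5 Size_ex (EEq (Cert_ex (V 4) (V 5)) (Cert_ex (V 0) (V 5))))))))) \<noteq> 0)) \<longleftrightarrow>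
            (i < L \<longrightarrow> (\<exists>j<n. \<exists>k<n. \<exists>l<n. (j < L \<and> k < L \<and> l < L) \<and> quad (cs ! i) (cs ! j) (cs ! k) (cs ! l) \<and> B i j k l))"
            unfolding H[OF True] by (rule refl)
        qed blast
      qed
      let ?E = "\<lambda>i. \<exists>j<n. \<exists>k<n. \<exists>l<n. (j < L \<and> k < L \<and> l < L) \<and> quad (cs ! i) (cs ! j) (cs ! k) (cs ! l) \<and> B i j k l"
      let ?F = "\<lambda>i. \<exists>j<L. \<exists>k<L. \<exists>l<L. quad (cs ! i) (cs ! j) (cs ! k) (cs ! l) \<and> R `` {i} = {i, j, k, l} \<and> (\<forall>h\<in>R `` {i}. R `` {h} = R `` {i})"
      have "Vf ?z \<longleftrightarrow> A \<and> (\<forall>i<n. i < L \<longrightarrow> ?E i)"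
        unfolding Vf_def Verify_ex_def eval_Conj[of _ _ "EAll 0 _ _"] of_bool_eq_0_iff not_not p1
        unfolding eval_EAll[of _ _ 0] sz of_bool_eq_0_iff not_not by (intro conj_cong refl all_cong p3)
      also have "\<dots> \<longleftrightarrow> R \<in> tile_relations cs"
      proof -
        \<comment> \<open>Quantifiers of the verifier range up to the word length \<open>n\<close>;
          together with the validity tests they are quantifiers over the \<open>L\<close>
          cubes.\<close>
        have lt: "j < n" if "j < L" for j using that Ln by simp
        have A: "A \<longleftrightarrow> R \<subseteq> {..<L} \<times> {..<L}" unfolding A_def R_def by auto
        have Rn: "h < n" if "(i, h) \<in> R" for i h using that by (simp add: R_def)
        have e1: "(\<forall>h<n. ((i, h) \<in> R) = (h = i \<or> h = j \<or> h = k \<or> h = l)) \<longleftrightarrow> R `` {i} = {i, j, k, l}"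
          if ijkl: "i < L" "j < L" "k < L" "l < L" for i j k l
        proof
          assume h: "\<forall>h<n. ((i, h) \<in> R) = (h = i \<or> h = j \<or> h = k \<or> h = l)"
          have b: "i < n" "j < n" "k < n" "l < n" using ijkl lt by blast+
          show "R `` {i} = {i, j, k, l}"
          proof (intro set_eqI)
            fix y show "y \<in> R `` {i} \<longleftrightarrow> y \<in> {i, j, k, l}" using h Rn b by (cases "y < n") auto
          qed
        next
          assume r: "R `` {i} = {i, j, k, l}"
          show "\<forall>h<n. ((i, h) \<in> R) = (h = i \<or> h = j \<or> h = k \<or> h = l)"
          proof (intro allI impI)
            fix h have "(i, h) \<in> R \<longleftrightarrow> h \<in> R `` {i}" by simp
            then show "((i, h) \<in> R) = (h = i \<or> h = j \<or> h = k \<or> h = l)" unfolding r by simp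
          qed
        qed
        have e2: "(\<forall>h'<n. ((h, h') \<in> R) = ((i, h') \<in> R)) \<longleftrightarrow> R `` {h} = R `` {i}" for h i
        proof
          assume h: "\<forall>h'<n. ((h, h') \<in> R) = ((i, h') \<in> R)"
          show "R `` {h} = R `` {i}"
          proof (intro set_eqI)
            fix y show "y \<in> R `` {h} \<longleftrightarrow> y \<in> R `` {i}" using h Rn by (cases "y < n") auto
          qed
        next
          assume r: "R `` {h} = R `` {i}"
          show "\<forall>h'<n. ((h, h') \<in> R) = ((i, h') \<in> R)" using r by blast
        qed
        have B: "B i j k l \<longleftrightarrow> R `` {i} = {i, j, k, l} \<and> (\<forall>h\<in>R `` {i}. R `` {h} = R `` {i})"
          if "i < L" "j < L" "k < L" "l < L" for i j k l
        proof -
          have "(\<forall>h<n. (i, h) \<in> R \<longrightarrow> R `` {h} = R `` {i}) \<longleftrightarrow> (\<forall>h\<in>R `` {i}. R `` {h} = R `` {i})" using Rn by blast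
          then show ?thesis unfolding B_def e1[OF that] e2 by (rule arg_cong)
        qed
        have Q: "?E i \<longleftrightarrow> ?F i" if "i < L" for i
        proof
          assume "?E i"
          then obtain j k l where o: "j < L" "k < L" "l < L" "quad (cs ! i) (cs ! j) (cs ! k) (cs ! l)" "B i j k l" by (elim exE conjE) blast
          from o(5)[unfolded B[OF that o(1-3)]] o(4) have FF: "quad (cs ! i) (cs ! j) (cs ! k) (cs ! l) \<and> R `` {i} = {i, j, k, l} \<and> (\<forall>h\<in>R `` {i}. R `` {h} = R `` {i})"
            by (intro conjI) (assumption | erule conjunct1 | erule conjunct2)+
          show "?F i" by (rule exI[of _ j], rule conjI, rule o(1), rule exI[of _ k], rule conjI, rule o(2),
            rule exI[of _ l], rule conjI, rule o(3), rule FF)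
        next
          assume "?F i"
          then obtain j k l where o: "j < L" "k < L" "l < L" and r: "quad (cs ! i) (cs ! j) (cs ! k) (cs ! l) \<and> R `` {i} = {i, j, k, l} \<and> (\<forall>h\<in>R `` {i}. R `` {h} = R `` {i})"
            by (elim exE conjE) blast
          have "B i j k l" unfolding B[OF that o] by (rule conjunct2[OF r])
          then show "?E i" using o lt[OF o(1)] lt[OF o(2)] lt[OF o(3)] conjunct1[OF r] by blast
        qed
        have "(\<forall>i<n. i < L \<longrightarrow> ?E i) \<longleftrightarrow> (\<forall>i<L. ?E i)" using lt by blast
        also have "\<dots> \<longleftrightarrow> (\<forall>i<L. ?F i)" by (rule all_cong) (rule Q)
        finally have "A \<and> (\<forall>i<n. i < L \<longrightarrow> ?E i) \<longleftrightarrow> R \<subseteq> {..<L} \<times> {..<L} \<and> (\<forall>i<L. ?F i)" using A by (simp only:)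
        then show ?thesis unfolding tile_relations_def mem_Collect_eq L_def[symmetric] .
      qed
      finally show ?thesis unfolding R_def .
    qed
    let ?g = "\<lambda>y. {(i, j). i < n \<and> j < n \<and> y ! (i * n + j)}"
    have "card {y. length y = n ^ 2 \<and> Vf (pair_word x y)} = card (tile_relations cs)"
    proof (rule bij_betw_same_card[of ?g], rule bij_betw_subset[OF relation_bijection[of n]])
      show "{y. length y = n ^ 2 \<and> Vf (pair_word x y)} \<subseteq> {y. length y = n ^ 2}" by blast
      have tsub: "tile_relations cs \<subseteq> Pow ({..<n} \<times> {..<n})" unfolding tile_relations_def L_def[symmetric] using Ln by auto
      have surj: "?g ` {y. length y = n ^ 2} = Pow ({..<n} \<times> {..<n})" using relation_bijection[of n] by (rule bij_betw_imp_surj_on)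
      have onto: "R \<in> ?g ` {y. length y = n ^ 2}" if R: "R \<in> tile_relations cs" for R
        unfolding surj by (rule subsetD[OF tsub R])
      show "?g ` {y. length y = n ^ 2 \<and> Vf (pair_word x y)} = tile_relations cs"
      proof (rule equalityI)
        show "?g ` {y. length y = n ^ 2 \<and> Vf (pair_word x y)} \<subseteq> tile_relations cs"
        proof (rule image_subsetI)
          fix y assume "y \<in> {y. length y = n ^ 2 \<and> Vf (pair_word x y)}"
          then have "length y = n ^ 2" "Vf (pair_word x y)" by blast+
          then show "?g y \<in> tile_relations cs" by (rule ver[THEN iffD1])
        qed
        show "tile_relations cs \<subseteq> ?g ` {y. length y = n ^ 2 \<and> Vf (pair_word x y)}"
        proof
          fix R assume R: "R \<in> tile_relations cs"
          from onto[OF R] obtain y where y: "R = ?g y" "y \<in> {y. length y = n ^ 2}" by (rule imageE)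
          have l: "length y = n ^ 2" using y(2) by blast
          have "Vf (pair_word x y)" by (rule ver[THEN iffD2, OF l]) (rule R[unfolded y(1)])
          then show "R \<in> ?g ` {y. length y = n ^ 2 \<and> Vf (pair_word x y)}" unfolding y(1) using l by (intro imageI CollectI conjI)
        qed
      qed
    qed
    then show ?thesis unfolding f_def x_def[symmetric] n_def by (simp add: poly_monom)
  qed
  ultimately show ?thesis by blast
qed

section \<open>The reduction\<close>

lemma contractible_region_cubes:
  assumes "0 < n"
  shows "contractible_region (cube ` region n ty)"
proof (rule contractible_heightfield)
  let ?t = "\<lambda>x y. ty (nat (x div 14)) (nat (y div 14))"
  let ?b = "\<lambda>x y. bump (x mod 14) (y mod 14)"
  let ?lo = "\<lambda>x y. 3 - max (- ?b x y) (wall_down (?t x y) (x mod 14) (y mod 14))"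
  let ?hi = "\<lambda>x y. 3 + max (?b x y) (wall_up (?t x y) (x mod 14) (y mod 14))"
  show "0 < 14 * int n" using assms by simp
  show "?lo x y \<le> 3 \<and> 3 \<le> ?hi x y" for x y
  proof -
    have "0 \<le> wall_down (?t x y) (x mod 14) (y mod 14)" "0 \<le> wall_up (?t x y) (x mod 14) (y mod 14)"
      using wall_bound by blast+
    then show ?thesis by (simp add: le_max_iff_disj)
  qed
  show "cube ` region n ty = {c. 0 \<le> c $ 1 \<and> c $ 1 < 14 * int n \<and> 0 \<le> c $ 2 \<and> c $ 2 < 14 * int n \<and>
      ?lo (c $ 1) (c $ 2) \<le> c $ 3 \<and> c $ 3 \<le> ?hi (c $ 1) (c $ 2)}"
  proof (intro set_eqI)
    fix c :: "int ^ 3"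
    have "c \<in> cube ` region n ty \<longleftrightarrow> (c $ 1, c $ 2, c $ 3) \<in> region n ty"
      using inj_image_mem_iff[OF inj_cube, of "(c $ 1, c $ 2, c $ 3)" "region n ty"] unfolding cube_surj .
    then show "c \<in> cube ` region n ty \<longleftrightarrow> c \<in> {c. 0 \<le> c $ 1 \<and> c $ 1 < 14 * int n \<and> 0 \<le> c $ 2 \<and> c $ 2 < 14 * int n \<and>
      ?lo (c $ 1) (c $ 2) \<le> c $ 3 \<and> c $ 3 \<le> ?hi (c $ 1) (c $ 2)}"
      unfolding region_def occupied_def mem_Collect_eq prod.case by blast
  qed
qed

lemma valid_block_type: "0 < N \<Longrightarrow> valid_types (N + 2) (block_type N D cf)"
proof -
  assume N: "0 < N"
  have "block_type N D cf I J \<in> set (row_types (N + 2) J) \<and> block_type N D cf I J \<in> set (col_types (N + 2) I)"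
    if IJ: "I < N + 2" "J < N + 2" for I J
  proof -
    have k: "kind D j = 0 \<or> kind D j = 1 \<or> kind D j = 2" for j by (simp add: kind_def)
    show ?thesis using k[of "I - 1"] k[of "J - 1"] N
      by (cases "J = 0"; cases "J = N + 1"; cases "I = 0"; cases "I = N + 1")
        (simp_all add: block_type_def row_types_def col_types_def, (elim disjE; simp)+)
  qed
  then show ?thesis unfolding valid_types_def by blast
qed

text \<open>Decodes the single index in which \<open>Region_oc\<close> packs the position in the
  block and the height.\<close>

definition occupied_code :: "nat \<Rightarrow> nat \<Rightarrow> bool" where
  "occupied_code \<tau> q = occupied \<tau> (bump (int (q div 7 div 14)) (int (q div 7 mod 14))) (int (q div 7 div 14)) (int (q div 7 mod 14)) (int (q mod 7))"

lemma occupied_code: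
  assumes "a < 14" "b < 14" "z < 7"
  shows "occupied_code \<tau> (7 * (14 * a + b) + z) = occupied \<tau> (bump (int a) (int b)) (int a) (int b) (int z)"
proof -
  have "(7 * c + z) div 7 = c" "(7 * c + z) mod 7 = z" for c using assms by simp_all
  from this[of "14 * a + b"] have "(7 * (14 * a + b) + z) div 7 = 14 * a + b" "(7 * (14 * a + b) + z) mod 7 = z" .
  moreover have "(14 * a + b) div 14 = a" "(14 * a + b) mod 14 = b" using assms by simp_all
  ultimately show ?thesis by (simp only: occupied_code_def)
qed

text \<open>The cubes in the order in which \<open>Region_oc\<close> writes them; the encoding
  depends on the order, so the query has to be this very list.\<close>

definition region_list :: "nat \<Rightarrow> (nat \<Rightarrow> nat \<Rightarrow> nat) \<Rightarrow> (int ^ 3) list" where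
  "region_list n ty = map (\<lambda>(I, J, a, b, z). vector [int (14 * I + a), int (14 * J + b), int z])
     (filter (\<lambda>(I, J, a, b, z). occupied_code (ty I J) (7 * (14 * a + b) + z))
       (List.product [0..<n] (List.product [0..<n] (List.product [0..<14] (List.product [0..<14] [0..<7])))))"

lemma region_list:
  "distinct (region_list n ty)" "set (region_list n ty) = cube ` region n ty"
proof -
  let ?Q = "List.product [0..<n] (List.product [0..<n] (List.product [0..<14] (List.product [0..<14] [0..<7])))"
  let ?g = "\<lambda>(I, J, a, b, z). vector [int (14 * I + a), int (14 * J + b), int z] :: int ^ 3"
  have g: "?g (I, J, a, b, z) = cube (translate I J (int a, int b, int z))" for I J a b z
    by (simp add: translate_def add.commute)
  have Q: "(I, J, a, b, z) \<in> set ?Q \<longleftrightarrow> I < n \<and> J < n \<and> a < 14 \<and> b < 14 \<and> z < 7" for I J a b z by auto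
  have "inj_on ?g (set ?Q)"
  proof (rule inj_onI)
    fix s t assume st: "s \<in> set ?Q" "t \<in> set ?Q" "?g s = ?g t"
    obtain I J a b z where s: "s = (I, J, a, b, z)" by (metis prod.exhaust)
    obtain I' J' a' b' z' where t: "t = (I', J', a', b', z')" by (metis prod.exhaust)
    have "in_block (int a) (int b)" "in_block (int a') (int b')" using st(1,2) unfolding s t Q by (simp_all add: in_block_def)
    moreover have "translate I J (int a, int b, int z) = translate I' J' (int a', int b', int z')"
      using st(3) inj_cube unfolding s t g by (rule_tac injD)
    ultimately show "s = t" using translate_inject unfolding s t by simp
  qed
  moreover have "distinct ?Q" by (intro distinct_product distinct_upt)
  ultimately show "distinct (region_list n ty)"
    unfolding region_list_def distinct_map by (intro conjI distinct_filter) (auto intro: inj_on_subset)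
  show "set (region_list n ty) = cube ` region n ty"
  proof (intro set_eqI iffI)
    fix c assume "c \<in> set (region_list n ty)"
    then obtain t where t: "t \<in> set ?Q" "(\<lambda>(I, J, a, b, z). occupied_code (ty I J) (7 * (14 * a + b) + z)) t" "c = ?g t"
      unfolding region_list_def set_map set_filter by blast
    obtain I J a b z where t': "t = (I, J, a, b, z)" by (metis prod.exhaust)
    have q: "I < n" "J < n" "a < 14" "b < 14" "z < 7" using t(1) unfolding t' Q by blast+
    have ab: "in_block (int a) (int b)" using q by (simp add: in_block_def)
    have "translate I J (int a, int b, int z) \<in> region n ty"
      using t(2) occupied_code[OF q(3-5)] region_translate[OF ab] q by (simp add: t')
    then show "c \<in> cube ` region n ty" unfolding t(3) t' g by (rule imageI)
  next
    fix c assume "c \<in> cube ` region n ty"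
    then obtain p where p: "p \<in> region n ty" "c = cube p" by blast
    obtain x y w where p': "p = (x, y, w)" by (metis prod_cases3)
    have "0 \<le> x" "x < 14 * int n" "0 \<le> y" "y < 14 * int n" using p(1) by (simp_all add: p' region_def)
    from reduce_14[OF this, of w] obtain I J a b where r: "I < n" "J < n" "in_block a b" "p = translate I J (a, b, w)"
      unfolding p' by blast
    have oc: "occupied (ty I J) (bump a b) a b w" using p(1) region_translate[OF r(3)] unfolding r(4) by blast
    have w: "0 \<le> w" "w \<le> 6" using occupied_bound[OF r(3) oc] by simp_all
    have ab: "0 \<le> a" "a < 14" "0 \<le> b" "b < 14" using r(3) by (simp_all add: in_block_def)
    have Qm: "(I, J, nat a, nat b, nat w) \<in> set ?Q" unfolding Q using r(1,2) w ab by (simp add: nat_less_iff)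
    have "nat a < 14" "nat b < 14" "nat w < 7" using ab w by (simp_all add: nat_less_iff)
    from occupied_code[OF this, of "ty I J"] oc ab w
    have "occupied_code (ty I J) (7 * (14 * nat a + nat b) + nat w)" by simp
    moreover have "c = ?g (I, J, nat a, nat b, nat w)" unfolding g p(2) r(4) using ab w by simp
    ultimately show "c \<in> set (region_list n ty)" unfolding region_list_def set_map set_filter
      by (intro image_eqI[of _ _ "(I, J, nat a, nat b, nat w)"]) (use Qm in simp_all)
  qed
qed

lemma length_binary: "k < 2 ^ j \<Longrightarrow> length (binary k) \<le> j"
proof (induction j arbitrary: k)
  case 0
  then show ?case by (simp add: binary.simps)
next
  case (Suc j)
  then have "length (binary (k div 2)) \<le> j" by (intro Suc.IH) simp
  then show ?case by (subst binary.simps) simp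
qed

text \<open>All queries are contractible regions, so the same reduction serves every set of
  instances that includes these, in particular both sets of the theorem.\<close>

theorem num_tilings_hard:
  assumes inj: "inj_on encode_region I" and sub: "{cs. distinct cs \<and> contractible_region (set cs)} \<subseteq> I"
  shows "sharp_P_hard I encode_region (\<lambda>cs. num_tilings slab (set cs))"
  unfolding sharp_P_hard_def
proof
  fix h assume "h \<in> sharp_P"
  from sharp_P_as_constraints[OF this] obtain p r :: "nat poly" and M vals where vals: "2 \<le> length vals"
    and h: "\<And>x. h x \<le> 2 ^ poly p (length x) \<and>
      h x = card {U \<in> {..<(poly r (length x) + 1) * (2 * poly r (length x) + 1)} \<rightarrow>\<^sub>E {..<length vals}.
      \<forall>g<(poly r (length x) + 1) * (2 * poly r (length x) + 1). \<forall>g'<(poly r (length x) + 1) * (2 * poly r (length x) + 1).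
        compatible M vals x (poly p (length x)) (poly r (length x)) g (U g) g' (U g')}" by blast
  define D where "D = length vals"
  define Tx where "Tx = Poly_ex (coeffs r) Len"
  define Gx where "Gx = Mul (Add Tx (C 1)) (Add (Mul (C 2) Tx) (C 1))"
  define K where "K = Compatible_ex M vals (Poly_ex (coeffs p) Len) Tx"
  define c where "c = Region_oc occupied_code (Add (Mul Gx (C D)) (C 2)) (Type_ex D Gx K)"
  show "poly_time (problem_oracle I encode_region (\<lambda>cs. num_tilings slab (set cs))) (\<lambda>x. binary (h x))"
  \<comment> \<open>A number of at most 2^p has at most p + 1 binary digits.\<close>
  proof (rule poly_time_query[where c = c and r = "p + 1"])
    fix w :: "bool list"
    have "h w \<le> 2 ^ poly p (length w)" using h[of w] by blast
    also have "\<dots> < 2 ^ (poly p (length w) + 1)" by simp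
    finally have "h w < 2 ^ (poly p (length w) + 1)" .
    from length_binary[OF this] show "length (binary (h w)) \<le> poly (p + 1) (length w)" by simp
    define T m G where "T = poly r (length w)" and "m = poly p (length w)" and "G = (T + 1) * (2 * T + 1)"
    define k where "k = compatible M vals w m T"
    define n where "n = G * D + 2"
    define ty where "ty = block_type (G * D) D (conflict k)"
    have D: "2 \<le> D" "0 < D" using vals unfolding D_def by linarith+
    have G0: "0 < G" by (simp add: G_def)
    have N0: "0 < G * D" using D G0 by simp
    have eG: "eval w s Gx = G" for s by (simp add: Gx_def Tx_def eval_Poly_ex G_def T_def)
    have eK: "eval w s K = of_bool (k (s 0) (s 1) (s 2) (s 3))" if "s 1 < D" "s 3 < D" for s
      using eval_Compatible_ex[of s vals w M "Poly_ex (coeffs p) Len" Tx] that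
      by (simp add: K_def k_def Tx_def eval_Poly_ex T_def m_def D_def)
    have vt: "valid_types n ty" unfolding n_def ty_def by (rule valid_block_type[OF N0])
    have ow: "ow w (\<lambda>_. 0) c = encode_region (region_list n ty)"
      unfolding c_def region_list_def
    proof (rule ow_Region_oc)
      show "eval w s (Add (Mul Gx (C D)) (C 2)) = n" for s by (simp add: eG n_def)
      show "eval w s (Type_ex D Gx K) = ty (s 4) (s 5)" if "s 4 < n" "s 5 < n" for s
        unfolding ty_def by (rule eval_Type_ex[OF eG D(2) eK]) (use that in \<open>simp_all add: n_def\<close>)
      show "ty I J < 15" if "I < n" "J < n" for I J by (rule valid_types_less[OF vt that])
    qed
    have in_I: "region_list n ty \<in> I"
      using sub region_list[of n ty] contractible_region_cubes[of n ty] by (auto simp: n_def)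
    have "num_tilings slab (set (region_list n ty)) = card (tilings is_slab (region n ty))"
      unfolding region_list(2) by (rule num_tilings_cube)
    also have "\<dots> = card {Z. Z \<subseteq> edges n \<and> (\<forall>I<n. \<forall>J<n. block_ok (ty I J) (bits Z I J))}"
      by (rule card_tilings_region[OF vt]) (simp add: n_def)
    also have "\<dots> = card {U \<in> {..<G} \<rightarrow>\<^sub>E {..<D}. \<forall>g<G. \<forall>g'<G. \<not> conflict k g (U g) g' (U g')}"
      unfolding n_def ty_def by (rule card_wirings[OF D(1) G0]) (simp add: conflict_def)
    \<comment> \<open>An assignment gives each variable one value, so the conflicts between values
      of the same variable never apply to it.\<close>
    also have "{U \<in> {..<G} \<rightarrow>\<^sub>E {..<D}. \<forall>g<G. \<forall>g'<G. \<not> conflict k g (U g) g' (U g')} =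
        {U \<in> {..<G} \<rightarrow>\<^sub>E {..<D}. \<forall>g<G. \<forall>g'<G. k g (U g) g' (U g')}"
      unfolding conflict_def by (intro Collect_cong) blast
    also have "card \<dots> = h w" using h[of w] by (simp only: k_def m_def T_def G_def D_def)
    finally have "num_tilings slab (set (region_list n ty)) = h w" .
    then show "problem_oracle I encode_region (\<lambda>cs. num_tilings slab (set cs)) (ow w (\<lambda>_. 0) c) = Some (binary (h w))"
      unfolding ow problem_oracle_def using in_I inv_into_f_f[OF inj in_I] by simp
  qed
qed

theorem theorem1p5:
  "sharp_P_complete {cs :: (int ^ 3) list. distinct cs}
     encode_region (\<lambda>cs. num_tilings slab (set cs)) \<and>
   sharp_P_complete {cs :: (int ^ 3) list. distinct cs \<and> contractible_region (set cs)}
     encode_region (\<lambda>cs. num_tilings slab (set cs))"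
proof -
  have inj: "inj_on encode_region I" for I using inj_on_subset[OF inj_encode_region subset_UNIV] .
  obtain f where f: "f \<in> sharp_P" "\<And>cs. f (encode_region cs) = card (tile_relations cs)"
    using certificates_in_sharp_P by blast
  then have "f (encode_region cs) = num_tilings slab (set cs)" if "distinct cs" for cs using card_tile_relations[OF that] by simp
  then have mem: "sharp_P_member I encode_region (\<lambda>cs. num_tilings slab (set cs))" if "I \<subseteq> {cs. distinct cs}" for I
    unfolding sharp_P_member_def using f(1) that by blast
  show ?thesis unfolding sharp_P_complete_def by (intro conjI inj mem num_tilings_hard) auto
qed

end
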